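(* Let $(X_n)_{n\in\mathbb{N}}$ be vertex-reinforced random walk on $\mathbb{Z}$ started at $v_0\in\mathbb{Z}$, and let $R'=\{v\in\mathbb{Z} : X_n=v \text{ for infinitely many } n\}$. Then almost surely there exist (random) $k\in\mathbb{Z}$, $\alpha\in(0,1)$ and $C_1,C_2\in(0,\infty)$ such that all of the following hold: (1) $R'=\{k-2,k-1,k,k+1,k+2\}$; (2) $Z_n(k-2)/n^{\alpha}\to C_1$ as $n\to\infty$; (3) $Z_n(k+2)/n^{1-\alpha}\to C_2$ as $n\to\infty$; (4) $Z_n(k-1)/n\to \alpha/2$ as $n\to\infty$; (5) $Z_n(k+1)/n\to(1-\alpha)/2$ as $n\to\infty$; (6) $Z_n(k)/n\to 1/2$ as $n\to\infty$.
   Context: Vertex-reinforced random walk (VRRW) on $\mathbb{Z}$ started at $v_0\in\mathbb{Z}$: a $\mathbb{Z}$-valued process $(X_n)_{n\in\mathbb{N}}$ on a probability space $(\Omega,\mathcal{F},\mathbb{P})$, with $\mathcal{F}_n=\sigma(X_0,\dots,X_n)$ and $Z_n(v)=1+\sum_{i=0}^n \mathbf{1}_{\{X_i=v\}}$ for $v\in\mathbb{Z}$, such that $X_0=v_0$ and for all $n\in\mathbb{N}$ $$\mathbb{P}(X_{n+1}=X_n\pm1\mid\mathcal{F}_n)=\frac{Z_n(X_n\pm1)}{Z_n(X_n-1)+Z_n(X_n+1)}.$$ *)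

theory Defs
  imports "HOL-Probability.Probability"
begin

definition local_time :: "(nat \<Rightarrow> 'a \<Rightarrow> int) \<Rightarrow> nat \<Rightarrow> int \<Rightarrow> 'a \<Rightarrow> nat" where
  "local_time X n v \<omega> = 1 + (\<Sum>i\<le>n. of_bool (X i \<omega> = v))"

definition history :: "'a measure \<Rightarrow> (nat \<Rightarrow> 'a \<Rightarrow> int) \<Rightarrow> nat \<Rightarrow> 'a measure" where
  "history M X n = sigma (space M) {X i -` A \<inter> space M | i A. i \<le> n}"

definition infinitely_visited :: "(nat \<Rightarrow> 'a \<Rightarrow> int) \<Rightarrow> 'a \<Rightarrow> int set" where
  "infinitely_visited X \<omega> = {v. \<exists>\<^sub>\<infinity>n. X n \<omega> = v}"

text \<open>The conditional probability of an event is the conditional expectation of its indicator,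
  so identities between conditional probabilities hold almost everywhere; the initial
  condition is likewise an almost sure identity between random variables.\<close>

locale vrrw = prob_space M for M :: "'a measure" +
  fixes X :: "nat \<Rightarrow> 'a \<Rightarrow> int" and v0 :: int
  assumes random_variable_X: "\<And>n. X n \<in> measurable M (count_space UNIV)"
    and start: "AE \<omega> in M. X 0 \<omega> = v0"
    and step: "\<And>n d. d \<in> {-1, 1} \<Longrightarrow>
      AE \<omega> in M.
        real_cond_exp M (history M X n) (indicator {\<omega> \<in> space M. X (Suc n) \<omega> = X n \<omega> + d}) \<omega> =
        real (local_time X n (X n \<omega> + d) \<omega>) /
        (real (local_time X n (X n \<omega> - 1) \<omega>) + real (local_time X n (X n \<omega> + 1) \<omega>))"

lemma (in vrrw) subalgebra_history: "subalgebra M (history M X n)"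
  unfolding subalgebra_def history_def
  using random_variable_X
  by (auto simp: space_measure_of_conv intro!: sets.sigma_sets_subset measurable_sets
      simp: sets_measure_of_conv)

end

theory Submission
  imports Defs "HOL-Library.Landau_Symbols"
begin

text \<open>Cylinder probabilities of the walk are explicit, so it may be replaced by Rubin's construction, in
  which every site carries independent exponential alarms towards its left and its right neighbour,
  with the current local time of the neighbour as their rate. For suitable weights \<open>H\<close> the sums of
  \<open>H / Z(i + 1)\<close> over the jumps \<open>i \<rightarrow> i + 1\<close> and of \<open>H / Z(i - 1)\<close> over the jumps \<open>i \<rightarrow> i - 1\<close> differ by a
  convergent martingale, and the logarithm of a local time is a sum of such sums with \<open>H = 1\<close>.

  A supermartingale shows that each newly visited site stops the walk with probability bounded below,
  so the range is finite. Call \<open>0\<close> the left end of the set of infinitely visited sites. The martingales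
  yield that \<open>0, \<dots>, 4\<close> are infinitely visited and that \<open>Z(0)/Z(2)\<close> tends to \<open>0\<close>.
  If \<open>5\<close> were infinitely visited as well, then the sum of \<open>1 / Z(5)\<close> over the jumps \<open>4 \<rightarrow> 5\<close> would
  either be bounded or not. In the first case the two alarm processes at \<open>4\<close> explode at the same time.
  In the second case \<open>Z(1)/Z(3)\<close> is asymptotic, along the visits to \<open>3\<close>, to a functional \<open>\<Theta>\<close> of the
  future jumps to the right of \<open>3\<close>. Delaying a single left alarm (at \<open>4\<close>, respectively at \<open>2\<close>) pushes the
  whole walk to the right: it destroys the coincidence of the explosion times, and it increases
  \<open>\<Theta>\<close> while it decreases \<open>Z(1)/Z(3)\<close> by a fixed factor. Hence, given all other alarms, at most one value
  of the delayed alarm is exceptional, and Fubini's theorem excludes both cases.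

  With five sites, \<open>Z(1)/Z(3)\<close> converges to some \<open>r > 0\<close> at a polynomial rate, which makes
  \<open>ln Z(0) - \<alpha> ln Z(2)\<close> converge for \<open>\<alpha> = r / (1 + r)\<close>; the right end is the mirror image.\<close>

section \<open>Path weights and one-step conditioning\<close>

text \<open>The coupling yields inequalities only, so each exclusion needs a quantity on which the
  two coupled walks must agree. If the sum at \<open>4\<close> is bounded, it is the explosion time
  shared by the two alarm processes. If not, neither explodes, and \<Theta> takes over. Its origin
  is a flow balance. Put y = Z(1)/Z(3) and w = Z(4)/Z(3), and give each crossing of the edge between
  \<open>2\<close> and \<open>3\<close> the weight y w / Z(2). The future crossings to the left add
  up to y, as its future losses; those to the right add up to w plus its future gains, which occur
  on jumps \<open>4 -> 5\<close>. At visits to \<open>3\<close> both totals agree asymptotically,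
  and this links the two sides of \<open>3\<close>. The balance needs w to be negligible, which is
  the content of the bootstrap estimate. All coupling arguments are deterministic: of the
  exponential law they use positivity and the law of large numbers for the alarms, and Fubini's
  theorem uses the absence of atoms. In the five-site case convergence of Z(1)/Z(3) alone would
  leave an uncontrolled sum in the logarithms; the rate comes from one further martingale whose
  weight grows.\<close>

definition loc :: "(nat \<Rightarrow> int) \<Rightarrow> nat \<Rightarrow> int \<Rightarrow> nat" where
  "loc p n v = 1 + (\<Sum>i\<le>n. of_bool (p i = v))"

definition unit_steps :: "(nat \<Rightarrow> int) \<Rightarrow> bool" where
  "unit_steps p \<longleftrightarrow> (\<forall>n. p (Suc n) = p n + 1 \<or> p (Suc n) = p n - 1)"

text \<open>The additive functionals of the walk below are sums over the jumps across one oriented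
  edge; \<open>f\<close> is read at departure, before the jump changes a local time.\<close>

definition wsum :: "(nat \<Rightarrow> int) \<Rightarrow> int \<Rightarrow> int \<Rightarrow> (nat \<Rightarrow> real) \<Rightarrow> nat \<Rightarrow> real" where
  "wsum p i d f n = (\<Sum>m<n. if p m = i \<and> p (Suc m) = i + d then f m else 0)"

definition step_prob :: "(nat \<Rightarrow> int) \<Rightarrow> nat \<Rightarrow> int \<Rightarrow> real" where
  "step_prob p n y = (if y = p n + 1 \<or> y = p n - 1
     then real (loc p n y) / (real (loc p n (p n - 1)) + real (loc p n (p n + 1))) else 0)"

fun path_weight :: "int \<Rightarrow> nat \<Rightarrow> (nat \<Rightarrow> int) \<Rightarrow> real" where
  "path_weight v 0 p = of_bool (p 0 = v)"
| "path_weight v (Suc n) p = path_weight v n p * step_prob p n (p (Suc n))"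

text \<open>Measurability with respect to the past, expressed on deterministic paths. Expectations
  of such functionals become finite sums.\<close>

definition adapted :: "nat \<Rightarrow> ((nat \<Rightarrow> int) \<Rightarrow> 'b) \<Rightarrow> bool" where
  "adapted n F \<longleftrightarrow> (\<forall>p q. (\<forall>i\<le>n. p i = q i) \<longrightarrow> F p = F q)"

lemma loc_ge_1: "1 \<le> loc p n v" and loc_pos [simp]: "0 < loc p n v"
  by (auto simp: loc_def)

lemma loc_nonzero [simp]: "loc p n v \<noteq> 0"
  by (simp add: loc_def)

lemma real_loc_ge_1: "1 \<le> real (loc p n v)"
  by (simp add: loc_def)

lemma loc_Suc: "loc p (Suc n) v = loc p n v + of_bool (p (Suc n) = v)"
  by (simp add: loc_def)

lemma loc_0: "loc p 0 v = 1 + of_bool (p 0 = v)"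
  by (simp add: loc_def)

lemma loc_mono: "m \<le> n \<Longrightarrow> loc p m v \<le> loc p n v"
  by (induction n rule: dec_induct) (auto simp: loc_Suc)

lemma loc_cong: "(\<And>i. i \<le> n \<Longrightarrow> p i = q i) \<Longrightarrow> loc p n v = loc q n v"
  by (simp add: loc_def)

lemma wsum_0 [simp]: "wsum p i d f 0 = 0"
  by (simp add: wsum_def)

lemma wsum_Suc: "wsum p i d f (Suc n) = wsum p i d f n + (if p n = i \<and> p (Suc n) = i + d then f n else 0)"
  by (simp add: wsum_def)

lemma wsum_mono: "(\<And>m. 0 \<le> f m) \<Longrightarrow> m \<le> n \<Longrightarrow> wsum p i d f m \<le> wsum p i d f n"
  by (rule lift_Suc_mono_le[of "wsum p i d f"]) (auto simp: wsum_Suc)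

lemma wsum_nonneg: "(\<And>m. 0 \<le> f m) \<Longrightarrow> 0 \<le> wsum p i d f n"
  using wsum_mono[of f 0 n p i d] by simp

lemma wsum_le: "(\<And>m. f m \<le> g m) \<Longrightarrow> wsum p i d f n \<le> wsum p i d g n"
  unfolding wsum_def by (intro sum_mono) auto

lemma unit_steps_cases: "unit_steps p \<Longrightarrow> p (Suc n) = p n + 1 \<or> p (Suc n) = p n - 1"
  by (auto simp: unit_steps_def)

lemma step_prob_nonneg [simp]: "0 \<le> step_prob p n y"
  by (simp add: step_prob_def)

lemma step_prob_cong: "(\<And>i. i \<le> n \<Longrightarrow> p i = q i) \<Longrightarrow> step_prob p n y = step_prob q n y"
  unfolding step_prob_def using loc_cong[of n p q] by simp

lemma step_prob_sum: "step_prob p n (p n + 1) + step_prob p n (p n - 1) = 1"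
proof -
  let ?a = "real (loc p n (p n - 1))" and ?b = "real (loc p n (p n + 1))"
  have "?a + ?b \<noteq> 0" using real_loc_ge_1[of p n "p n + 1"] real_loc_ge_1[of p n "p n - 1"] by linarith
  then show ?thesis by (simp add: step_prob_def add_divide_distrib[symmetric] add.commute)
qed

lemma path_weight_nonneg [simp]: "0 \<le> path_weight v n p"
  by (induction n) auto

lemma path_weight_cong: "(\<And>i. i \<le> n \<Longrightarrow> p i = q i) \<Longrightarrow> path_weight v n p = path_weight v n q"
proof (induction n)
  case (Suc n)
  then show ?case using step_prob_cong[of n p q "q (Suc n)"] by auto
qed simp

lemma adaptedD: "adapted n F \<Longrightarrow> (\<And>i. i \<le> n \<Longrightarrow> p i = q i) \<Longrightarrow> F p = F q"
  unfolding adapted_def by blast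

lemma adaptedI: "(\<And>p q. (\<And>i. i \<le> n \<Longrightarrow> p i = q i) \<Longrightarrow> F p = F q) \<Longrightarrow> adapted n F"
  unfolding adapted_def by blast

section \<open>Finite prefixes and one-step averaging\<close>

fun walk_prefixes :: "int \<Rightarrow> nat \<Rightarrow> (nat \<Rightarrow> int) set" where
  "walk_prefixes v 0 = {(\<lambda>_. 0)(0 := v)}"
| "walk_prefixes v (Suc n) = (\<lambda>q. q(Suc n := q n + 1)) ` walk_prefixes v n \<union> (\<lambda>q. q(Suc n := q n - 1)) ` walk_prefixes v n"

lemma finite_prefixes: "finite (walk_prefixes v n)"
  by (induction n) auto

text \<open>Padding by \<open>0\<close> makes a prefix a whole path determined by its first
  \<open>n + 1\<close> values, so that distinct prefixes have disjoint cylinders.\<close>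

lemma prefixes_zero: "q \<in> walk_prefixes v n \<Longrightarrow> i > n \<Longrightarrow> q i = 0"
  by (induction n arbitrary: q) auto

lemma sum_prefixes_Suc:
  fixes f :: "(nat \<Rightarrow> int) \<Rightarrow> real"
  shows "(\<Sum>q\<in>walk_prefixes v (Suc n). f q) =
    (\<Sum>q\<in>walk_prefixes v n. f (q(Suc n := q n + 1)) + f (q(Suc n := q n - 1)))"
proof -
  have inj: "inj_on (\<lambda>q. q(Suc n := q n + d)) (walk_prefixes v n)" for d :: int
  proof (rule inj_onI)
    fix q r assume *: "q \<in> walk_prefixes v n" "r \<in> walk_prefixes v n" "q(Suc n := q n + d) = r(Suc n := r n + d)"
    show "q = r"
    proof
      fix i
      show "q i = r i"
        using fun_cong[OF *(3), of i] *(1,2) prefixes_zero[of q v n i] prefixes_zero[of r v n i]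
        by (cases "i = Suc n") auto
    qed
  qed
  have disj: "(\<lambda>q. q(Suc n := q n + 1)) ` walk_prefixes v n \<inter> (\<lambda>q. q(Suc n := q n - 1)) ` walk_prefixes v n = {}"
  proof -
    have False if "q(Suc n := q n + 1) = r(Suc n := r n - 1)" for q r :: "nat \<Rightarrow> int"
      using fun_cong[OF that, of n] fun_cong[OF that, of "Suc n"] by simp
    then show ?thesis by blast
  qed
  show ?thesis
    using inj[of 1] inj[of "-1"] disj
    by (simp add: sum.union_disjoint finite_prefixes sum.reindex sum.distrib o_def del: fun_upd_apply)
qed

lemma path_weight_upd:
  "path_weight v (Suc n) (q(Suc n := y)) = path_weight v n q * step_prob q n y"
proof -
  have "path_weight v n (q(Suc n := y)) = path_weight v n q" by (rule path_weight_cong) auto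
  moreover have "step_prob (q(Suc n := y)) n y = step_prob q n y" by (rule step_prob_cong) auto
  ultimately show ?thesis by simp
qed

text \<open>Splitting off the last step averages over it; this finite identity takes the place of
  the tower property.\<close>

lemma sum_wt_prefixes_Suc:
  "(\<Sum>q\<in>walk_prefixes v (Suc n). path_weight v (Suc n) q * F q) =
   (\<Sum>q\<in>walk_prefixes v n. path_weight v n q * (step_prob q n (q n + 1) * F (q(Suc n := q n + 1)) +
      step_prob q n (q n - 1) * F (q(Suc n := q n - 1))))"
  unfolding sum_prefixes_Suc path_weight_upd by (simp add: algebra_simps)

lemma sum_wt_prefixes: "(\<Sum>q\<in>walk_prefixes v n. path_weight v n q) = 1"
proof (induction n)
  case (Suc n)
  have "(\<Sum>q\<in>walk_prefixes v (Suc n). path_weight v (Suc n) q) = (\<Sum>q\<in>walk_prefixes v n. path_weight v n q)"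
    using sum_wt_prefixes_Suc[of v n "\<lambda>_. 1"] by (simp only: mult_1_right step_prob_sum)
  with Suc show ?case by simp
qed simp

text \<open>The functional factors through the list of the first \<open>n + 1\<close> positions,
  which lives in a countable discrete space.\<close>

lemma measurable_adapted_process:
  fixes F :: "(nat \<Rightarrow> int) \<Rightarrow> 'b"
  assumes [measurable]: "\<And>n. X n \<in> measurable M (count_space UNIV)"
    and F: "adapted n F" "\<And>x. F x \<in> space N"
  shows "(\<lambda>\<omega>. F (\<lambda>n. X n \<omega>)) \<in> measurable M N"
proof -
  let ?l = "\<lambda>\<omega>. map (\<lambda>i. X i \<omega>) [0..<Suc n]"
  have l: "?l \<in> measurable M (count_space UNIV)"
  proof (rule measurable_count_space_eq_countable[THEN iffD2])
    show "countable (UNIV :: int list set)" by simp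
    show "?l \<in> space M \<rightarrow> UNIV \<and> (\<forall>a\<in>UNIV. ?l -` {a} \<inter> space M \<in> sets M)"
    proof (intro conjI ballI)
      fix a :: "int list"
      have "?l -` {a} \<inter> space M = {\<omega>\<in>space M. length a = Suc n \<and> (\<forall>i\<in>{..n}. X i \<omega> = a ! i)}"
        by (force simp: list_eq_iff_nth_eq nth_append less_Suc_eq_le simp del: upt_Suc)
      also have "\<dots> \<in> sets M" by measurable
      finally show "?l -` {a} \<inter> space M \<in> sets M" .
    qed auto
  qed
  have "(\<lambda>\<omega>. F (\<lambda>n. X n \<omega>)) = (\<lambda>xs. F (\<lambda>i. if i \<le> n then xs ! i else 0)) \<circ> ?l"
    by (rule ext, simp add: o_def del: upt_Suc, rule adaptedD[OF F(1)]) (auto simp del: upt_Suc)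
  also have "\<dots> \<in> measurable M N"
    using F(2) by (intro measurable_comp[OF l]) auto
  finally show ?thesis .
qed

text \<open>Only the cylinder probabilities are kept, so that the same results also apply to the
  reflected walk and to the walk driven by exponential clocks.\<close>

locale vrrw_law = prob_space M for M :: "'a measure" +
  fixes X :: "nat \<Rightarrow> 'a \<Rightarrow> int" and v0 :: int
  assumes X_measurable [measurable]: "\<And>n. X n \<in> measurable M (count_space UNIV)"
    and law: "\<And>n p. prob {\<omega> \<in> space M. \<forall>i\<le>n. X i \<omega> = p i} = path_weight v0 n p"
begin

definition path :: "'a \<Rightarrow> nat \<Rightarrow> int" where "path \<omega> = (\<lambda>n. X n \<omega>)"

lemma path_eq: "path \<omega> n = X n \<omega>"
  by (simp add: path_def)

lemma measurable_adapted:
  fixes F :: "(nat \<Rightarrow> int) \<Rightarrow> 'b"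
  assumes "adapted n F" "\<And>x. F x \<in> space N"
  shows "(\<lambda>\<omega>. F (path \<omega>)) \<in> measurable M N"
  unfolding path_def by (rule measurable_adapted_process[OF X_measurable assms])

lemma borel_measurable_adapted:
  fixes F :: "(nat \<Rightarrow> int) \<Rightarrow> real"
  shows "adapted n F \<Longrightarrow> (\<lambda>\<omega>. F (path \<omega>)) \<in> borel_measurable M"
  by (rule measurable_adapted) auto

lemma sets_adapted:
  "adapted n F \<Longrightarrow> {\<omega> \<in> space M. F (path \<omega>)} \<in> sets M"
  using measurable_adapted[of n F "count_space UNIV"] by (simp add: pred_def)

text \<open>The cylinders of distinct prefixes are disjoint and their weights add up to
  \<open>1\<close>.\<close>

lemma AE_prefix: "AE \<omega> in M. \<exists>q\<in>walk_prefixes v0 n. \<forall>i\<le>n. X i \<omega> = q i"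
proof -
  let ?A = "\<lambda>q. {\<omega> \<in> space M. \<forall>i\<in>{..n}. X i \<omega> = q i}"
  have m: "?A q \<in> sets M" for q :: "nat \<Rightarrow> int" by measurable
  have "disjoint_family_on ?A (walk_prefixes v0 n)"
  proof (unfold disjoint_family_on_def, intro ballI impI)
    fix q r assume *: "q \<in> walk_prefixes v0 n" "r \<in> walk_prefixes v0 n" "q \<noteq> r"
    then obtain i where "q i \<noteq> r i" by (auto simp: fun_eq_iff)
    with * have "i \<le> n" using prefixes_zero[of q v0 n i] prefixes_zero[of r v0 n i] by (metis not_le)
    with \<open>q i \<noteq> r i\<close> show "?A q \<inter> ?A r = {}" by auto
  qed
  then have "prob (\<Union>q\<in>walk_prefixes v0 n. ?A q) = (\<Sum>q\<in>walk_prefixes v0 n. prob (?A q))"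
    using m by (intro finite_measure_finite_Union) (auto simp: finite_prefixes)
  also have "\<dots> = 1" using law[of n] sum_wt_prefixes[of v0 n] by (simp add: Ball_def)
  finally have "AE \<omega> in M. \<omega> \<in> (\<Union>q\<in>walk_prefixes v0 n. ?A q)"
    using m by (intro AE_prob_1) auto
  then show ?thesis by eventually_elim auto
qed

lemma expectation_adapted:
  fixes F :: "(nat \<Rightarrow> int) \<Rightarrow> real"
  assumes "adapted n F"
  shows "integrable M (\<lambda>\<omega>. F (path \<omega>))"
    and "expectation (\<lambda>\<omega>. F (path \<omega>)) = (\<Sum>q\<in>walk_prefixes v0 n. path_weight v0 n q * F q)"
proof -
  let ?A = "\<lambda>q. {\<omega> \<in> space M. \<forall>i\<in>{..n}. X i \<omega> = q i}"
  have m [measurable]: "?A q \<in> sets M" for q :: "nat \<Rightarrow> int" by measurable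
  let ?G = "\<lambda>\<omega>. \<Sum>q\<in>walk_prefixes v0 n. indicator (?A q) \<omega> * F q"
  have AE: "AE \<omega> in M. F (path \<omega>) = ?G \<omega>"
    using AE_prefix[of n] AE_space
  proof eventually_elim
    case (elim \<omega>)
    then obtain q where q: "q \<in> walk_prefixes v0 n" "\<And>i. i \<le> n \<Longrightarrow> X i \<omega> = q i" by auto
    have "indicator (?A r) \<omega> * F r = (if r = q then F q else 0)" if r: "r \<in> walk_prefixes v0 n" for r
    proof (cases "r = q")
      case False
      then have "q \<noteq> r" by simp
      then obtain i where "q i \<noteq> r i" by (auto simp: fun_eq_iff)
      with r q(1) have "i \<le> n" using prefixes_zero[of q v0 n i] prefixes_zero[of r v0 n i] by (metis not_le)
      with \<open>q i \<noteq> r i\<close> have "\<omega> \<notin> ?A r" using q(2)[of i] by (auto intro!: bexI[of _ i])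
      with False show ?thesis by simp
    qed (use q elim in auto)
    then have "?G \<omega> = (\<Sum>r\<in>walk_prefixes v0 n. if r = q then F q else 0)" by (intro sum.cong) auto
    also have "\<dots> = F q" using q(1) by (simp add: finite_prefixes)
    finally have "?G \<omega> = F q" .
    moreover have "F (path \<omega>) = F q" by (rule adaptedD[OF assms]) (use q in \<open>auto simp: path_eq\<close>)
    ultimately show ?case by simp
  qed
  have int: "integrable M ?G" by (intro Bochner_Integration.integrable_sum integrable_mult_left integrable_real_indicator)
      (auto simp: emeasure_eq_measure m)
  show "integrable M (\<lambda>\<omega>. F (path \<omega>))"
    using int AE borel_measurable_adapted[OF assms]
    by (subst integrable_cong_AE[of _ _ ?G]) auto
  have "expectation (\<lambda>\<omega>. F (path \<omega>)) = expectation ?G"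
    using AE borel_measurable_adapted[OF assms] int by (intro integral_cong_AE) auto
  also have "\<dots> = (\<Sum>q\<in>walk_prefixes v0 n. prob (?A q) * F q)"
    by (subst Bochner_Integration.integral_sum) (auto simp: emeasure_eq_measure)
  finally show "expectation (\<lambda>\<omega>. F (path \<omega>)) = (\<Sum>q\<in>walk_prefixes v0 n. path_weight v0 n q * F q)"
    using law[of n] by (simp add: Ball_def)
qed

lemma expectation_step:
  fixes F :: "(nat \<Rightarrow> int) \<Rightarrow> real"
  assumes "adapted (Suc n) F"
  defines "G \<equiv> \<lambda>p. step_prob p n (p n + 1) * F (p(Suc n := p n + 1)) + step_prob p n (p n - 1) * F (p(Suc n := p n - 1))"
  shows "adapted n G" and "expectation (\<lambda>\<omega>. F (path \<omega>)) = expectation (\<lambda>\<omega>. G (path \<omega>))"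
proof -
  show G: "adapted n G"
  proof (rule adaptedI)
    fix p q :: "nat \<Rightarrow> int" assume *: "\<And>i. i \<le> n \<Longrightarrow> p i = q i"
    have "F (p(Suc n := y)) = F (q(Suc n := y))" for y
      by (rule adaptedD[OF assms(1)]) (auto simp: * le_Suc_eq)
    moreover have "step_prob p n y = step_prob q n y" for y by (rule step_prob_cong) (rule *)
    ultimately show "G p = G q" using *[of n] by (simp add: G_def)
  qed
  show "expectation (\<lambda>\<omega>. F (path \<omega>)) = expectation (\<lambda>\<omega>. G (path \<omega>))"
    unfolding expectation_adapted(2)[OF assms(1)] expectation_adapted(2)[OF G] sum_wt_prefixes_Suc
    by (simp add: G_def)
qed

lemma AE_unit_steps: "AE \<omega> in M. unit_steps (path \<omega>)"
proof -
  have "AE \<omega> in M. X (Suc n) \<omega> = X n \<omega> + 1 \<or> X (Suc n) \<omega> = X n \<omega> - 1" for n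
    using AE_prefix[of "Suc n"]
  proof eventually_elim
    case (elim \<omega>)
    then show ?case by auto
  qed
  then show ?thesis unfolding unit_steps_def path_eq by (simp add: AE_all_countable)
qed

lemma AE_start: "AE \<omega> in M. X 0 \<omega> = v0"
  using AE_prefix[of 0] by eventually_elim auto

end

section \<open>Martingale convergence\<close>

lemma local_time_eq_loc: "local_time X n v \<omega> = loc (\<lambda>n. X n \<omega>) n v"
  by (simp add: local_time_def loc_def)

text \<open>The cylinder \<open>A\<close> belongs to the history at time \<open>n\<close>, so
  integrating the conditional expectation over it gives the wanted probability, and on
  \<open>A\<close> the right-hand side of \<open>step\<close> is constant.\<close>

lemma (in vrrw) prob_step:
  fixes p :: "nat \<Rightarrow> int" and n :: nat
  defines "A \<equiv> {\<omega> \<in> space M. \<forall>i\<le>n. X i \<omega> = p i}"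
  shows "prob {\<omega> \<in> A. X (Suc n) \<omega> = y} = step_prob p n y * prob A"
proof -
  note random_variable_X [measurable]
  interpret finite_measure_subalgebra M "history M X n"
    by unfold_locales (rule subalgebra_history)
  have sets_hist: "sets (history M X n) = sigma_sets (space M) {X i -` A \<inter> space M | i A. i \<le> n}"
    unfolding history_def by (subst sets_measure_of) auto
  have "A = (\<Inter>i\<in>{..n}. X i -` {p i} \<inter> space M)" by (auto simp: A_def)
  also have "\<dots> \<in> sets (history M X n)"
    by (rule sets.finite_INT) (auto simp: sets_hist intro!: sigma_sets.Basic)
  finally have A_hist: "A \<in> sets (history M X n)" .
  then have A [measurable]: "A \<in> sets M"
    using subalgebra_history[of n] by (auto simp: subalgebra_def)
  have eq: "prob {\<omega> \<in> A. X (Suc n) \<omega> = p n + d} = step_prob p n (p n + d) * prob A" if d: "d \<in> {-1, 1}" for d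
  proof -
    let ?B = "{\<omega> \<in> space M. X (Suc n) \<omega> = X n \<omega> + d}"
    let ?c = "real_cond_exp M (history M X n) (indicator ?B)"
    have [measurable]: "?B \<in> sets M" by measurable
    have "prob {\<omega> \<in> A. X (Suc n) \<omega> = p n + d} = prob (A \<inter> ?B)"
      by (rule arg_cong[of _ _ prob]) (auto simp: A_def)
    also have "\<dots> = (\<integral>\<omega>. indicator (A \<inter> ?B) \<omega> \<partial>M)" by simp
    also have "\<dots> = set_lebesgue_integral M A (indicator ?B)"
      by (simp add: set_lebesgue_integral_def indicator_inter_arith)
    also have "\<dots> = set_lebesgue_integral M A ?c"
      by (rule real_cond_exp_intA[OF _ A_hist]) (simp add: emeasure_eq_measure)
    also have "\<dots> = (\<integral>\<omega>. indicator A \<omega> * step_prob p n (p n + d) \<partial>M)"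
      unfolding set_lebesgue_integral_def
    proof (rule integral_cong_AE)
      show "AE \<omega> in M. indicator A \<omega> *\<^sub>R ?c \<omega> = indicator A \<omega> * step_prob p n (p n + d)"
        using step[OF d, of n]
      proof eventually_elim
        case (elim \<omega>)
        have "loc (\<lambda>n. X n \<omega>) n v = loc p n v" if "\<omega> \<in> A" for v
          by (rule loc_cong) (use that in \<open>auto simp: A_def\<close>)
        then show ?case
          using elim d by (auto simp: indicator_def step_prob_def local_time_eq_loc A_def)
      qed
    qed (auto intro!: borel_measurable_indicator)
    also have "\<dots> = step_prob p n (p n + d) * prob A" by simp
    finally show ?thesis .
  qed
  show ?thesis
  proof (cases "y = p n + 1 \<or> y = p n - 1")
    case True
    then show ?thesis using eq[of 1] eq[of "-1"] by auto
  next
    case False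
    \<comment> \<open>The assumption \<open>step\<close> is silent about other targets; they are
      excluded because the two neighbours already carry the whole mass of \<open>A\<close>.\<close>
    have "prob {\<omega> \<in> A. X (Suc n) \<omega> = p n + 1} + prob {\<omega> \<in> A. X (Suc n) \<omega> = p n - 1}
       + prob {\<omega> \<in> A. X (Suc n) \<omega> = y} =
      prob (({\<omega> \<in> A. X (Suc n) \<omega> = p n + 1} \<union> {\<omega> \<in> A. X (Suc n) \<omega> = p n - 1}) \<union> {\<omega> \<in> A. X (Suc n) \<omega> = y})"
      using False by (subst finite_measure_Union finite_measure_Union; auto)+
    also have "\<dots> \<le> prob A" by (rule finite_measure_mono) auto
    finally have "prob {\<omega> \<in> A. X (Suc n) \<omega> = y} \<le> 0"
      using eq[of 1] eq[of "-1"] step_prob_sum[of p n] by (simp flip: distrib_right)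
    then show ?thesis using False by (simp add: step_prob_def measure_le_0_iff)
  qed
qed

lemma vrrw_imp_vrrw_law:
  assumes "vrrw M X v0"
  shows "vrrw_law M X v0"
proof -
  interpret vrrw M X v0 by fact
  note random_variable_X [measurable]
  show ?thesis
  proof
    fix n p
    show "prob {\<omega> \<in> space M. \<forall>i\<le>n. X i \<omega> = p i} = path_weight v0 n p"
    proof (induction n)
      case 0
      have m: "{\<omega> \<in> space M. X 0 \<omega> = p 0} \<in> sets M" by measurable
      show ?case
      proof (cases "p 0 = v0")
        case True
        with start m have "prob {\<omega> \<in> space M. X 0 \<omega> = p 0} = 1"
          by (subst prob_Collect_eq_1) auto
        with True show ?thesis by simp
      next
        case False
        with start m have "prob {\<omega> \<in> space M. X 0 \<omega> = p 0} = 0"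
          by (subst prob_Collect_eq_0) (auto elim: eventually_mono)
        with False show ?thesis by simp
      qed
    next
      case (Suc n)
      have "{\<omega> \<in> space M. \<forall>i\<le>Suc n. X i \<omega> = p i} =
          {\<omega> \<in> {\<omega> \<in> space M. \<forall>i\<le>n. X i \<omega> = p i}. X (Suc n) \<omega> = p (Suc n)}"
        by (auto simp: le_Suc_eq)
      then show ?case using prob_step[where n = n and p = p and y = "p (Suc n)"] Suc by simp
    qed
  qed (rule random_variable_X)
qed

lemma loc_uminus: "loc (\<lambda>n. - p n) n v = loc p n (- v)"
proof -
  have "(- p i = v) = (p i = - v)" for i by auto
  then show ?thesis by (simp add: loc_def)
qed

lemma path_weight_uminus: "path_weight (- v) n (\<lambda>n. - p n) = path_weight v n p"
proof (induction n)
  case (Suc n)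
  have "step_prob (\<lambda>n. - p n) n (- p (Suc n)) = step_prob p n (p (Suc n))"
    unfolding step_prob_def by (auto simp: loc_uminus algebra_simps)
  with Suc show ?case by simp
qed simp

section \<open>Orthogonal increments and almost sure convergence\<close>

context vrrw_law
begin

lemma uminus: "vrrw_law M (\<lambda>n \<omega>. - X n \<omega>) (- v0)"
proof
  fix n :: nat and p :: "nat \<Rightarrow> int"
  have "{\<omega> \<in> space M. \<forall>i\<le>n. - X i \<omega> = p i} = {\<omega> \<in> space M. \<forall>i\<le>n. X i \<omega> = - p i}"
    by (auto simp: minus_equation_iff)
  moreover have "path_weight v0 n (\<lambda>i. - p i) = path_weight (- v0) n p" using path_weight_uminus[of v0 n "\<lambda>i. - p i"] by simp
  ultimately show "prob {\<omega> \<in> space M. \<forall>i\<le>n. - X i \<omega> = p i} = path_weight (- v0) n p" by (simp add: law)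
qed (measurable)

text \<open>The partial sum up to \<open>b\<close> ignores position \<open>b + 1\<close>, so
  one-step averaging kills its product with the next increment, and only squares survive.\<close>

lemma orthogonal_sum:
  fixes \<xi> :: "nat \<Rightarrow> (nat \<Rightarrow> int) \<Rightarrow> real"
  assumes ad: "\<And>m. adapted (Suc m) (\<xi> m)"
    and mart: "\<And>m p. step_prob p m (p m + 1) * \<xi> m (p(Suc m := p m + 1)) + step_prob p m (p m - 1) * \<xi> m (p(Suc m := p m - 1)) = 0"
  shows "expectation (\<lambda>\<omega>. (\<Sum>m=a..<b. \<xi> m (path \<omega>))\<^sup>2) = (\<Sum>m=a..<b. expectation (\<lambda>\<omega>. (\<xi> m (path \<omega>))\<^sup>2))"
proof (induction b)
  case (Suc b)
  let ?S = "\<lambda>b p. \<Sum>m=a..<b. \<xi> m p"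
  have adS: "adapted b (?S b)"
  proof (rule adaptedI)
    fix p q :: "nat \<Rightarrow> int" assume *: "\<And>i. i \<le> b \<Longrightarrow> p i = q i"
    show "?S b p = ?S b q"
      by (rule sum.cong) (use * in \<open>auto intro!: adaptedD[OF ad]\<close>)
  qed
  have up: "?S b (p(Suc b := y)) = ?S b p" for p y by (rule adaptedD[OF adS]) auto
  show ?case
  proof (cases "a \<le> b")
    case True
    let ?F = "\<lambda>p. ?S b p * \<xi> b p"
    have adF: "adapted (Suc b) ?F"
      by (rule adaptedI, intro arg_cong2[of _ _ _ _ "(*)"] adaptedD[OF ad] adaptedD[OF adS]) auto
    have "expectation (\<lambda>\<omega>. ?F (path \<omega>)) = expectation (\<lambda>\<omega>. ?S b (path \<omega>) *
        (step_prob (path \<omega>) b (path \<omega> b + 1) * \<xi> b ((path \<omega>)(Suc b := path \<omega> b + 1)) +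
         step_prob (path \<omega>) b (path \<omega> b - 1) * \<xi> b ((path \<omega>)(Suc b := path \<omega> b - 1))))"
      unfolding expectation_step(2)[OF adF] up by (simp add: algebra_simps)
    then have 0: "expectation (\<lambda>\<omega>. ?F (path \<omega>)) = 0" unfolding mart by simp
    have ad1: "adapted b (\<lambda>p. (?S b p)\<^sup>2)"
      by (rule adaptedI, intro arg_cong[of _ _ "\<lambda>x. x\<^sup>2"] adaptedD[OF adS]) auto
    have ad2: "adapted (Suc b) (\<lambda>p. (\<xi> b p)\<^sup>2)"
      by (rule adaptedI, intro arg_cong[of _ _ "\<lambda>x. x\<^sup>2"] adaptedD[OF ad]) auto
    note int = expectation_adapted(1)[OF adF] expectation_adapted(1)[OF ad1] expectation_adapted(1)[OF ad2]
    have "expectation (\<lambda>\<omega>. (?S (Suc b) (path \<omega>))\<^sup>2) =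
      expectation (\<lambda>\<omega>. (?S b (path \<omega>))\<^sup>2 + 2 * ?F (path \<omega>) + (\<xi> b (path \<omega>))\<^sup>2)"
      using True by (intro Bochner_Integration.integral_cong) (auto simp: power2_eq_square algebra_simps)
    also have "\<dots> = expectation (\<lambda>\<omega>. (?S b (path \<omega>))\<^sup>2) + expectation (\<lambda>\<omega>. (\<xi> b (path \<omega>))\<^sup>2)"
      using int 0 by (subst Bochner_Integration.integral_add Bochner_Integration.integral_add; simp)+
    finally show ?thesis using Suc True by (simp add: sum.atLeastLessThan_Suc)
  qed simp
qed simp

text \<open>Kolmogorov's inequality: the stopped sum stays put once it has moved by \<open>\<epsilon>\<close>, so that
  Chebyshev's inequality at the final time is enough.\<close>

lemma maximal_inequality:
  fixes \<xi> :: "nat \<Rightarrow> (nat \<Rightarrow> int) \<Rightarrow> real"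
  assumes ad: "\<And>m. adapted (Suc m) (\<xi> m)"
    and mart: "\<And>m p. step_prob p m (p m + 1) * \<xi> m (p(Suc m := p m + 1)) + step_prob p m (p m - 1) * \<xi> m (p(Suc m := p m - 1)) = 0"
    and \<epsilon>: "\<epsilon> > 0"
  shows "prob {\<omega>\<in>space M. \<exists>k\<in>{a..b}. \<epsilon> \<le> \<bar>\<Sum>m=a..<k. \<xi> m (path \<omega>)\<bar>}
     \<le> (\<Sum>m=a..<b. expectation (\<lambda>\<omega>. (\<xi> m (path \<omega>))\<^sup>2)) / \<epsilon>\<^sup>2"
proof -
  define alive where "alive m p \<longleftrightarrow> (\<forall>k\<in>{a..m}. \<bar>\<Sum>j=a..<k. \<xi> j p\<bar> < \<epsilon>)" for m p
  define \<eta> where "\<eta> m p = (if alive m p then \<xi> m p else 0)" for m p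
  have alive_ad: "alive m p = alive m q" if "\<And>i. i \<le> m \<Longrightarrow> p i = q i" for m p q
  proof -
    have "\<xi> j p = \<xi> j q" if "j < m" for j
      by (rule adaptedD[OF ad]) (use that \<open>\<And>i. i \<le> m \<Longrightarrow> p i = q i\<close> in auto)
    then have "(\<Sum>j=a..<k. \<xi> j p) = (\<Sum>j=a..<k. \<xi> j q)" if "k \<le> m" for k
      using that by (intro sum.cong) auto
    then show ?thesis by (auto simp: alive_def)
  qed
  have ad_\<eta>: "adapted (Suc m) (\<eta> m)" for m
  proof (rule adaptedI)
    fix p q :: "nat \<Rightarrow> int" assume *: "\<And>i. i \<le> Suc m \<Longrightarrow> p i = q i"
    show "\<eta> m p = \<eta> m q"
      using alive_ad[of m p q] adaptedD[OF ad[of m], of p q] * by (simp add: \<eta>_def)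
  qed
  have up: "alive m (p(Suc m := y)) = alive m p" for m p y by (rule alive_ad) auto
  have mart_\<eta>: "step_prob p m (p m + 1) * \<eta> m (p(Suc m := p m + 1)) + step_prob p m (p m - 1) * \<eta> m (p(Suc m := p m - 1)) = 0" for m p
    using mart[of p m] by (simp add: \<eta>_def up)
  have stop: "\<epsilon> \<le> \<bar>\<Sum>m=a..<b. \<eta> m p\<bar>" if bad: "\<exists>k\<in>{a..b}. \<epsilon> \<le> \<bar>\<Sum>m=a..<k. \<xi> m p\<bar>" for p
  proof -
    let ?P = "\<lambda>k. a \<le> k \<and> k \<le> b \<and> \<epsilon> \<le> \<bar>\<Sum>m=a..<k. \<xi> m p\<bar>"
    define k where "k = (LEAST k. ?P k)"
    have k: "?P k" unfolding k_def by (rule LeastI_ex) (use bad in auto)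
    have before: "\<eta> m p = \<xi> m p" if "m \<in> {a..<k}" for m
      using that not_less_Least[of _ ?P] k unfolding \<eta>_def alive_def k_def[symmetric]
      by (auto simp: not_less[symmetric]) (metis le_less_trans less_imp_le not_less order_trans)
    have after: "\<eta> m p = 0" if "m \<in> {k..<b}" for m
      using that k unfolding \<eta>_def alive_def by (auto simp: not_less[symmetric])
    have "(\<Sum>m=a..<b. \<eta> m p) = (\<Sum>m=a..<k. \<eta> m p) + (\<Sum>m=k..<b. \<eta> m p)"
      using k by (simp add: sum.atLeastLessThan_concat)
    also have "\<dots> = (\<Sum>m=a..<k. \<xi> m p)" using before after by simp
    finally show ?thesis using k by simp
  qed
  let ?T = "\<lambda>p. (\<Sum>m=a..<b. \<eta> m p)\<^sup>2"
  have adT: "adapted b ?T"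
  proof (rule adaptedI)
    fix p q :: "nat \<Rightarrow> int" assume *: "\<And>i. i \<le> b \<Longrightarrow> p i = q i"
    have "(\<Sum>m=a..<b. \<eta> m p) = (\<Sum>m=a..<b. \<eta> m q)"
      by (rule sum.cong) (use * in \<open>auto intro!: adaptedD[OF ad_\<eta>]\<close>)
    then show "?T p = ?T q" by simp
  qed
  have int: "integrable M (\<lambda>\<omega>. ?T (path \<omega>))" by (rule expectation_adapted(1)[OF adT])
  have "prob {\<omega>\<in>space M. \<exists>k\<in>{a..b}. \<epsilon> \<le> \<bar>\<Sum>m=a..<k. \<xi> m (path \<omega>)\<bar>}
      \<le> prob {\<omega>\<in>space M. ?T (path \<omega>) \<ge> \<epsilon>\<^sup>2}"
  proof (rule finite_measure_mono)
    show "{\<omega> \<in> space M. \<exists>k\<in>{a..b}. \<epsilon> \<le> \<bar>\<Sum>m=a..<k. \<xi> m (path \<omega>)\<bar>} \<subseteq> {\<omega> \<in> space M. ?T (path \<omega>) \<ge> \<epsilon>\<^sup>2}"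
    proof safe
      fix \<omega> k assume "\<omega> \<in> space M" "k \<in> {a..b}" "\<epsilon> \<le> \<bar>\<Sum>m=a..<k. \<xi> m (path \<omega>)\<bar>"
      then have "\<epsilon> \<le> \<bar>\<Sum>m=a..<b. \<eta> m (path \<omega>)\<bar>" by (intro stop) auto
      then show "?T (path \<omega>) \<ge> \<epsilon>\<^sup>2" using \<epsilon> by (metis abs_le_square_iff abs_of_pos)
    qed
    show "{\<omega> \<in> space M. ?T (path \<omega>) \<ge> \<epsilon>\<^sup>2} \<in> events"
      using borel_measurable_adapted[OF adT] by measurable
  qed
  also have "\<dots> \<le> expectation (\<lambda>\<omega>. ?T (path \<omega>)) / \<epsilon>\<^sup>2"
    using integral_Markov_inequality_measure[OF int, of "{}" "\<epsilon>\<^sup>2"] \<epsilon> by simp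
  also have "expectation (\<lambda>\<omega>. ?T (path \<omega>)) = (\<Sum>m=a..<b. expectation (\<lambda>\<omega>. (\<eta> m (path \<omega>))\<^sup>2))"
    by (rule orthogonal_sum[OF ad_\<eta> mart_\<eta>])
  also have "\<dots> \<le> (\<Sum>m=a..<b. expectation (\<lambda>\<omega>. (\<xi> m (path \<omega>))\<^sup>2))"
  proof (intro sum_mono integral_mono)
    fix m
    show "integrable M (\<lambda>\<omega>. (\<eta> m (path \<omega>))\<^sup>2)" "integrable M (\<lambda>\<omega>. (\<xi> m (path \<omega>))\<^sup>2)"
      by (rule expectation_adapted(1)[of "Suc m"], rule adaptedI,
          intro arg_cong[of _ _ "\<lambda>x. x\<^sup>2"], rule adaptedD[OF ad_\<eta>] adaptedD[OF ad], blast)+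
  qed (auto simp: \<eta>_def)
  finally show ?thesis using \<epsilon> by (simp add: divide_right_mono)
qed

text \<open>The pathwise bound makes the second moments summable; the maximal inequality on blocks
  starting at \<open>a\<close> bounds the oscillation after \<open>a\<close> by a tail of this
  series, so almost every path of sums is Cauchy.\<close>

lemma AE_convergent_martingale:
  fixes \<xi> :: "nat \<Rightarrow> (nat \<Rightarrow> int) \<Rightarrow> real"
  assumes ad: "\<And>m. adapted (Suc m) (\<xi> m)"
    and mart: "\<And>m p. step_prob p m (p m + 1) * \<xi> m (p(Suc m := p m + 1)) + step_prob p m (p m - 1) * \<xi> m (p(Suc m := p m - 1)) = 0"
    and bound: "\<And>p n. unit_steps p \<Longrightarrow> (\<Sum>m<n. (\<xi> m p)\<^sup>2) \<le> C"
  shows "AE \<omega> in M. convergent (\<lambda>n. \<Sum>m<n. \<xi> m (path \<omega>))"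
proof -
  define e where "e m = expectation (\<lambda>\<omega>. (\<xi> m (path \<omega>))\<^sup>2)" for m
  have ad2: "adapted (Suc m) (\<lambda>p. (\<xi> m p)\<^sup>2)" for m
    by (rule adaptedI, intro arg_cong[of _ _ "\<lambda>x. x\<^sup>2"], rule adaptedD[OF ad]) auto
  note int = expectation_adapted(1)[OF ad2]
  have e0: "0 \<le> e m" for m by (simp add: e_def)
  have "(\<Sum>m<n. e m) \<le> C" for n
  proof -
    have "(\<Sum>m<n. e m) = expectation (\<lambda>\<omega>. \<Sum>m<n. (\<xi> m (path \<omega>))\<^sup>2)"
      unfolding e_def using int by (subst Bochner_Integration.integral_sum) auto
    also have "\<dots> \<le> expectation (\<lambda>_. C)"
      using AE_unit_steps int by (intro integral_mono_AE) (auto intro!: bound)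
    finally show ?thesis by (simp add: prob_space)
  qed
  then have sm: "summable e" using e0 by (intro bounded_imp_summable[of e C]) (auto simp only: lessThan_Suc_atMost[symmetric])
  let ?S = "\<lambda>\<omega> n. \<Sum>m<n. \<xi> m (path \<omega>)"
  let ?bad = "\<lambda>\<epsilon> a b. {\<omega>\<in>space M. \<exists>k\<in>{a..b}. \<epsilon> \<le> \<bar>\<Sum>m=a..<k. \<xi> m (path \<omega>)\<bar>}"
  have adS: "(\<lambda>\<omega>. \<Sum>m=a..<k. \<xi> m (path \<omega>)) \<in> borel_measurable M" for a k
    by (intro borel_measurable_sum borel_measurable_adapted[OF ad])
  have bad_sets [measurable]: "?bad \<epsilon> a b \<in> sets M" for \<epsilon> a b using adS by measurable
  let ?Bad = "\<lambda>\<epsilon> a. \<Union>b. ?bad \<epsilon> a b"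
  have Bad_le: "prob (?Bad \<epsilon> a) \<le> (\<Sum>m. e (m + a)) / \<epsilon>\<^sup>2" if "\<epsilon> > 0" for \<epsilon> a
  proof (rule LIMSEQ_le_const2)
    show "(\<lambda>b. prob (?bad \<epsilon> a b)) \<longlonglongrightarrow> prob (?Bad \<epsilon> a)"
      by (rule finite_Lim_measure_incseq) (auto simp: incseq_def)
    have "prob (?bad \<epsilon> a b) \<le> (\<Sum>m. e (m + a)) / \<epsilon>\<^sup>2" for b
    proof -
      have "prob (?bad \<epsilon> a b) \<le> (\<Sum>m=a..<b. e m) / \<epsilon>\<^sup>2"
        unfolding e_def by (rule maximal_inequality[OF ad mart that])
      also have "(\<Sum>m=a..<b. e m) = (\<Sum>m<b-a. e (m + a))"
        by (rule sum.reindex_bij_witness[of _ "\<lambda>m. m + a" "\<lambda>m. m - a"]) auto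
      also have "\<dots> \<le> (\<Sum>m. e (m + a))"
        using sm e0 by (intro sum_le_suminf) (auto simp: summable_iff_shift)
      finally show ?thesis by (simp add: divide_right_mono)
    qed
    then show "\<exists>N. \<forall>n\<ge>N. prob (?bad \<epsilon> a n) \<le> (\<Sum>m. e (m + a)) / \<epsilon>\<^sup>2" by blast
  qed
  have null: "prob (\<Inter>a. ?Bad \<epsilon> a) = 0" if "\<epsilon> > 0" for \<epsilon>
  proof -
    have "prob (\<Inter>a. ?Bad \<epsilon> a) \<le> (\<Sum>m. e (m + a)) / \<epsilon>\<^sup>2" for a
      by (rule order_trans[OF finite_measure_mono Bad_le[OF that]]) auto
    moreover have "(\<lambda>a. (\<Sum>m. e (m + a)) / \<epsilon>\<^sup>2) \<longlonglongrightarrow> 0 / \<epsilon>\<^sup>2"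
      using suminf_exist_split2[OF sm] by (intro tendsto_divide tendsto_const) (use that in auto)
    ultimately have "prob (\<Inter>a. ?Bad \<epsilon> a) \<le> 0" by (intro LIMSEQ_le_const) auto
    then show ?thesis by (simp add: measure_le_0_iff)
  qed
  have "AE \<omega> in M. \<forall>k::nat. \<omega> \<notin> (\<Inter>a. ?Bad (1 / Suc k) a)"
  proof (subst AE_all_countable, intro allI)
    fix k :: nat
    have "(\<Inter>a. ?Bad (1 / Suc k) a) \<in> null_sets M"
      using null[of "1 / Suc k"] by (auto simp: null_sets_def emeasure_eq_measure)
    then show "AE \<omega> in M. \<omega> \<notin> (\<Inter>a. ?Bad (1 / Suc k) a)" by (rule AE_not_in)
  qed
  with AE_space show ?thesis
  proof eventually_elim
    case (elim \<omega>)
    have "Cauchy (?S \<omega>)"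
    proof (rule metric_CauchyI)
      fix \<epsilon> :: real assume "\<epsilon> > 0"
      then obtain k :: nat where k: "1 / Suc k < \<epsilon> / 2" using nat_approx_posE[of "\<epsilon>/2"] by auto
      have "\<not> (\<forall>a. \<omega> \<in> ?Bad (1 / Suc k) a)" using elim(2)[rule_format, of k] by (simp only: INT_iff) simp
      then obtain a where "\<omega> \<notin> ?Bad (1 / Suc k) a" by (elim not_all[THEN iffD1, THEN exE])
      then have a: "\<omega> \<notin> ?bad (1 / Suc k) a b" for b by (meson UN_I UNIV_I)
      have *: "\<bar>?S \<omega> n - ?S \<omega> a\<bar> < \<epsilon> / 2" if "a \<le> n" for n
      proof -
        have "\<bar>\<Sum>m=a..<n. \<xi> m (path \<omega>)\<bar> < 1 / Suc k" using a[of n] elim(1) that by (auto simp: not_le)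
        moreover have "(\<Sum>m=a..<n. \<xi> m (path \<omega>)) = ?S \<omega> n - ?S \<omega> a"
          using sum.atLeastLessThan_concat[of 0 a n "\<lambda>m. \<xi> m (path \<omega>)"] that
          by (simp add: lessThan_atLeast0)
        ultimately show ?thesis using k by simp
      qed
      have "\<bar>?S \<omega> m - ?S \<omega> n\<bar> < \<epsilon>" if "a \<le> m" "a \<le> n" for m n
        using *[OF that(1)] *[OF that(2)] by linarith
      then show "\<exists>N. \<forall>m\<ge>N. \<forall>n\<ge>N. dist (?S \<omega> m) (?S \<omega> n) < \<epsilon>"
        unfolding dist_real_def by blast
    qed
    then show ?case by (rule Cauchy_convergent)
  qed
qed

end

section \<open>Compensated jump sums\<close>

lemma wsum_cmult: "wsum p i d (\<lambda>m. c * f m) n = c * wsum p i d f n"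
  by (induction n) (auto simp: wsum_Suc algebra_simps)

text \<open>While the walk is on the far side of \<open>i\<close>, the local time at \<open>i\<close> is frozen.\<close>

lemma wsum_crossings:
  assumes "unit_steps p" "d = 1 \<or> d = -1"
  shows "wsum p i d (\<lambda>m. g (loc p m i)) n - wsum p (i + d) (- d) (\<lambda>m. g (loc p m i)) n =
    (if (p n - i) * d > 0 then g (loc p n i) else 0) - (if (p 0 - i) * d > 0 then g (loc p 0 i) else 0)"
proof (induction n)
  case (Suc n)
  from unit_steps_cases[OF assms(1), of n] assms(2) Suc show ?case
    by (elim disjE; cases "p n = i"; cases "p n = i + d"; cases "p (Suc n) = i") (auto simp: wsum_Suc loc_Suc)
qed simp

text \<open>Each arrival at \<open>j\<close> comes from one of its neighbours and raises the local
  time by one, so each value \<open>k\<close> is used exactly once.\<close>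

lemma wsum_arrivals:
  assumes "unit_steps p"
  shows "wsum p (j - 1) 1 (\<lambda>m. g (loc p m j)) n + wsum p (j + 1) (-1) (\<lambda>m. g (loc p m j)) n =
    (\<Sum>k=loc p 0 j..<loc p n j. g k)"
proof (induction n)
  case (Suc n)
  have "loc p 0 j \<le> loc p n j" by (rule loc_mono) simp
  then show ?case using unit_steps_cases[OF assms, of n] Suc by (auto simp: wsum_Suc loc_Suc)
qed simp

text \<open>Jump probabilities from \<open>i\<close> are proportional to the local times of the
  targets; dividing by them gives both directions the same conditional mean, whatever weight
  \<open>H\<close> is read off from the past.\<close>

definition mart :: "(nat \<Rightarrow> int) \<Rightarrow> int \<Rightarrow> (nat \<Rightarrow> real) \<Rightarrow> nat \<Rightarrow> real" where
  "mart p i H n = wsum p i 1 (\<lambda>m. H m / loc p m (i + 1)) n - wsum p i (-1) (\<lambda>m. H m / loc p m (i - 1)) n"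

lemma sum_powr_bounded: "1 < \<gamma> \<Longrightarrow> \<exists>C. \<forall>a b. (\<Sum>k=a..<b. real k powr (- \<gamma>)) \<le> C"
proof -
  assume "1 < \<gamma>"
  then have s: "summable (\<lambda>k. real k powr (- \<gamma>))" by (simp add: summable_real_powr_iff)
  have "(\<Sum>k=a..<b. real k powr (- \<gamma>)) \<le> (\<Sum>k. real k powr (- \<gamma>))" for a b
    by (rule sum_le_suminf[OF s]) auto
  then show ?thesis by blast
qed

text \<open>A squared increment is at most the local time of the target to the power
  \<open>-3/2\<close>, twice the exponent \<open>1/4 - 1\<close>. By \<open>wsum_arrivals\<close>
  each value of that local time occurs at most once, so the squares have a bounded sum along every
  path.\<close>

lemma (in vrrw_law) AE_convergent_mart:
  fixes H :: "(nat \<Rightarrow> int) \<Rightarrow> nat \<Rightarrow> real"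
  assumes ad: "\<And>m. adapted m (\<lambda>p. H p m)" and nonneg: "\<And>p m. 0 \<le> H p m"
    and le: "\<And>p m. H p m \<le> real (loc p m (i + 1)) powr (1/4)" "\<And>p m. H p m \<le> real (loc p m (i - 1)) powr (1/4)"
  shows "AE \<omega> in M. convergent (mart (path \<omega>) i (H (path \<omega>)))"
proof -
  define \<xi> where "\<xi> m p = (if p m = i \<and> p (Suc m) = i + 1 then H p m / loc p m (i + 1) else 0) -
    (if p m = i \<and> p (Suc m) = i - 1 then H p m / loc p m (i - 1) else 0)" for m p
  obtain C where C: "\<And>a b. (\<Sum>k=a..<b. real k powr (-3/2)) \<le> C" using sum_powr_bounded[of "3 / 2", unfolded minus_divide_left] by force
  have mart_eq: "mart p i (H p) n = (\<Sum>m<n. \<xi> m p)" for p n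
    unfolding mart_def wsum_def \<xi>_def by (simp add: sum_subtractf)
  have H_up: "H (p(Suc m := y)) m = H p m" and l_up: "loc (p(Suc m := y)) m v = loc p m v" for p m y v
    by (rule adaptedD[OF ad], simp) (rule loc_cong, simp)
  have "AE \<omega> in M. convergent (\<lambda>n. \<Sum>m<n. \<xi> m (path \<omega>))"
  proof (rule AE_convergent_martingale[where C = "2 * C"])
    fix m show "adapted (Suc m) (\<xi> m)"
    proof (rule adaptedI)
      fix p q :: "nat \<Rightarrow> int" assume *: "\<And>i. i \<le> Suc m \<Longrightarrow> p i = q i"
      have "H p m = H q m" by (rule adaptedD[OF ad]) (use * in auto)
      moreover have "loc p m v = loc q m v" for v by (rule loc_cong) (use * in auto)
      ultimately show "\<xi> m p = \<xi> m q" using *[of m] *[of "Suc m"] by (simp add: \<xi>_def)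
    qed
  next
    fix m p
    have pos: "real (loc p m (i - 1)) + real (loc p m (i + 1)) > 0"
      using real_loc_ge_1[of p m "i - 1"] real_loc_ge_1[of p m "i + 1"] by linarith
    show "step_prob p m (p m + 1) * \<xi> m (p(Suc m := p m + 1)) + step_prob p m (p m - 1) * \<xi> m (p(Suc m := p m - 1)) = 0"
      using pos by (auto simp: \<xi>_def H_up l_up step_prob_def)
  next
    fix p :: "nat \<Rightarrow> int" and n :: nat assume unit_steps: "unit_steps p"
    have sq: "(H p m / loc p m v)\<^sup>2 \<le> real (loc p m v) powr (-3/2)" if "H p m \<le> real (loc p m v) powr (1/4)" for m v
    proof -
      have z: "real (loc p m v) > 0" by simp
      have "(H p m / loc p m v)\<^sup>2 \<le> (real (loc p m v) powr (1/4) / real (loc p m v) powr 1)\<^sup>2"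
        using that nonneg[of p m] z by (intro power_mono divide_right_mono) (auto simp: less_imp_le intro: divide_right_mono)
      also have "\<dots> = real (loc p m v) powr (-3/2)"
        unfolding powr_diff[symmetric] power2_eq_square powr_add[symmetric] by simp
      finally show ?thesis .
    qed
    let ?g = "\<lambda>k::nat. real k powr (-3/2)"
    have "(\<xi> m p)\<^sup>2 \<le> (if p m = i \<and> p (Suc m) = i + 1 then ?g (loc p m (i + 1)) else 0)
       + (if p m = i \<and> p (Suc m) = i + (-1) then ?g (loc p m (i - 1)) else 0)" for m
      using sq[OF le(1)[of p m]] sq[OF le(2)[of p m]] by (auto simp: \<xi>_def)
    then have "(\<Sum>m<n. (\<xi> m p)\<^sup>2) \<le> wsum p i 1 (\<lambda>m. ?g (loc p m (i + 1))) n + wsum p i (-1) (\<lambda>m. ?g (loc p m (i - 1))) n"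
      unfolding wsum_def sum.distrib[symmetric] by (rule sum_mono)
    also have "wsum p i 1 (\<lambda>m. ?g (loc p m (i + 1))) n \<le> C"
      using wsum_arrivals[OF unit_steps, of "i + 1" ?g n] wsum_nonneg[of "\<lambda>m. ?g (loc p m (i + 1))" p "i + 1 + 1" "-1" n]
        C[of "loc p 0 (i + 1)" "loc p n (i + 1)"] by simp
    also have "wsum p i (-1) (\<lambda>m. ?g (loc p m (i - 1))) n \<le> C"
      using wsum_arrivals[OF unit_steps, of "i - 1" ?g n] wsum_nonneg[of "\<lambda>m. ?g (loc p m (i - 1))" p "i - 1 - 1" "1" n]
        C[of "loc p 0 (i - 1)" "loc p n (i - 1)"] by simp
    finally show "(\<Sum>m<n. (\<xi> m p)\<^sup>2) \<le> 2 * C" by simp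
  qed
  then show ?thesis unfolding mart_eq .
qed

text \<open>The weights are those of the four compensations needed later; they are all dominated by the
  fourth root of the smaller neighbouring local time, which makes the martingales bounded in \<open>L\<^sup>2\<close>.\<close>

definition regular :: "(nat \<Rightarrow> int) \<Rightarrow> bool" where
  "regular p \<longleftrightarrow> unit_steps p \<and> (\<forall>i. convergent (mart p i (\<lambda>_. 1)) \<and>
     convergent (mart p i (\<lambda>m. min 1 (real (loc p m (i - 1)) / (2 * real (loc p m i))))) \<and>
     convergent (mart p i (\<lambda>m. min 1 (real (loc p m (i + 1)) / real (loc p m i)))) \<and>
     convergent (mart p i (\<lambda>m. min (real (loc p m (i - 1))) (real (loc p m (i + 1))) powr (1/4))))"

lemma adapted_loc2: "adapted m (\<lambda>p. h (loc p m u) (loc p m v))"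
proof (rule adaptedI)
  fix p q :: "nat \<Rightarrow> int" assume "\<And>i. i \<le> m \<Longrightarrow> p i = q i"
  then have "loc p m v = loc q m v" for v by (rule loc_cong)
  then show "h (loc p m u) (loc p m v) = h (loc q m u) (loc q m v)" by simp
qed

lemma (in vrrw_law) AE_regular: "AE \<omega> in M. regular (path \<omega>)"
proof -
  have one: "(1::real) \<le> real (loc p m v) powr (1/4)" for p m v
    using real_loc_ge_1[of p m v] by (intro ge_one_powr_ge_zero) auto
  have "AE \<omega> in M. convergent (mart (path \<omega>) i (\<lambda>_. 1))" for i
    by (rule AE_convergent_mart[where H = "\<lambda>_ _. 1"]) (auto simp: one intro: adaptedI)
  moreover have "AE \<omega> in M. convergent (mart (path \<omega>) i (\<lambda>m. min 1 (real (loc (path \<omega>) m (i - 1)) / (2 * real (loc (path \<omega>) m i)))))" for i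
    by (rule AE_convergent_mart[where H = "\<lambda>p m. min 1 (real (loc p m (i - 1)) / (2 * real (loc p m i)))"])
      (auto simp: one min.coboundedI1 intro: adapted_loc2[where h = "\<lambda>x y. min 1 (real x / (2 * real y))"])
  moreover have "AE \<omega> in M. convergent (mart (path \<omega>) i (\<lambda>m. min 1 (real (loc (path \<omega>) m (i + 1)) / real (loc (path \<omega>) m i))))" for i
    by (rule AE_convergent_mart[where H = "\<lambda>p m. min 1 (real (loc p m (i + 1)) / real (loc p m i))"])
      (auto simp: one min.coboundedI1 intro: adapted_loc2[where h = "\<lambda>x y. min 1 (real x / real y)"])
  moreover have "AE \<omega> in M. convergent (mart (path \<omega>) i (\<lambda>m. min (real (loc (path \<omega>) m (i - 1))) (real (loc (path \<omega>) m (i + 1))) powr (1/4)))" for i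
    by (rule AE_convergent_mart[where H = "\<lambda>p m. min (real (loc p m (i - 1))) (real (loc p m (i + 1))) powr (1/4)"])
      (auto intro!: powr_mono2 intro: adapted_loc2[where h = "\<lambda>x y. min (real x) (real y) powr (1/4)"])
  ultimately show ?thesis
    unfolding regular_def using AE_unit_steps by (simp add: AE_all_countable)
qed

section \<open>Finite range\<close>

text \<open>The trapping potential of a freshly visited vertex \<open>x\<close>: here \<open>a, b, c\<close> are the local times at
  \<open>x - 1, x + 1, x + 2\<close>, \<open>m\<close> is the local time at \<open>x\<close> (counting in advance the next return when the
  walk is to the left of \<open>x\<close>), and \<open>d\<close> is the position relative to \<open>x\<close>. It bounds from above the
  probability of ever reaching \<open>x + 3\<close>. As long as \<open>x + 1\<close> is unvisited, the walk gets up to \<open>50\<close>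
  chances to step to the left, each of which costs a factor at least \<open>2/3\<close>.\<close>

definition trap0 :: "nat \<Rightarrow> nat \<Rightarrow> nat \<Rightarrow> nat \<Rightarrow> int \<Rightarrow> real" where
  "trap0 a b c m d = 2 * b / (real a + real b) + 24 * c / m + (if d = 2 then 4 / b else 0) +
     (if d = 1 then 12 * c / (real m * real b) else 0)"

definition trap :: "nat \<Rightarrow> nat \<Rightarrow> nat \<Rightarrow> nat \<Rightarrow> int \<Rightarrow> real" where
  "trap a b c m d = (if b = 1 \<and> m < 52 then 1 - (2/3) ^ (52 - m) / 2 else min 1 (trap0 a b c m d))"

section \<open>Supermartingale inequalities for the potential, one position of the walk at a
  time\<close>

lemma trap_le_1: "trap a b c m d \<le> 1"
  by (simp add: trap_def)

lemma trap0_nonneg: "0 \<le> trap0 a b c m d"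
  by (auto simp: trap0_def intro!: add_nonneg_nonneg)

lemma trap_nonneg: "0 \<le> trap a b c m d"
proof -
  have "(2/3) ^ k / 2 \<le> (1::real)" for k using power_le_one[of "2/3::real" k] by simp
  then show ?thesis using trap0_nonneg by (auto simp: trap_def)
qed

text \<open>Covers the walk to the left of \<open>x\<close>: there only the local time at
  \<open>x - 1\<close> can still change the potential, because the return to \<open>x\<close> is
  already counted in \<open>m\<close>.\<close>

lemma trap_mono_a: "a > 0 \<Longrightarrow> trap (Suc a) b c m d \<le> trap a b c m d"
proof -
  assume "a > 0"
  then have "2 * b / (real (Suc a) + real b) \<le> 2 * b / (real a + real b)" by (intro frac_le) auto
  then have "trap0 (Suc a) b c m d \<le> trap0 a b c m d" unfolding trap0_def by linarith
  then show ?thesis by (simp add: trap_def min.coboundedI2)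
qed

lemma convex_le_1: "s + t = 1 \<Longrightarrow> 0 \<le> s \<Longrightarrow> 0 \<le> t \<Longrightarrow> x \<le> 1 \<Longrightarrow> y \<le> 1 \<Longrightarrow> s * x + t * y \<le> (1::real)"
  by (metis convex_bound_le)

text \<open>The walk is at \<open>x\<close>. While \<open>x + 1\<close> is unvisited, a step to the
  left has probability \<open>a / (a + 1) \<ge> 2/3\<close> and removes one factor
  \<open>2/3\<close>. Afterwards \<open>2 b / (a + b)\<close> is the martingale of an urn, and the
  drop of \<open>24 c / m\<close> on a step to the left pays for the term
  \<open>12 c / (m b)\<close> that a step to the right switches on.\<close>

lemma trap_step_0:
  assumes "2 \<le> a" "1 \<le> b" "2 \<le> m" "m + 1 \<le> a + b" "b = 1 \<Longrightarrow> m \<le> a \<and> c = 1" "d < 0"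
  shows "a / (real a + real b) * trap (Suc a) b c (Suc m) d + b / (real a + real b) * trap a (Suc b) c m 1 \<le> trap a b c m 0"
    (is "?s * _ + ?t * _ \<le> _")
proof (cases "b = 1 \<and> m < 52")
  case True
  have ab: "real a + real b > 0" using assms by simp
  have *: "trap (Suc a) b c (Suc m) d \<le> 1 - (2/3) ^ (51 - m) / 2"
  proof (cases "m = 51")
    case True
    \<comment> \<open>The bound \<open>52\<close> comes from here: at the last chance
      \<open>trap0\<close> is at most \<open>24 / 52 + 2 / 53\<close>, just below the value
      \<open>1 / 2\<close> at which the first branch ends.\<close>
    have "51 \<le> a" using assms \<open>b = 1 \<and> m < 52\<close> True by auto
    then have "2 / (1 + real a + 1) \<le> 2 / (53::real)" by (intro divide_left_mono) auto
    then show ?thesis using \<open>b = 1 \<and> m < 52\<close> assms(5) True \<open>d < 0\<close> by (auto simp: trap_def trap0_def)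
  next
    case False
    then have "Suc m < 52" "52 - Suc m = 51 - m" using True by auto
    then show ?thesis using True by (simp add: trap_def)
  qed
  have "?s * trap (Suc a) b c (Suc m) d + ?t * trap a (Suc b) c m 1 \<le> ?s * (1 - (2/3) ^ (51 - m) / 2) + ?t * 1"
    using * trap_le_1 by (intro add_mono mult_left_mono) auto
  also have "\<dots> = 1 - ?s * ((2/3) ^ (51 - m) / 2)"
  proof -
    have "s * (1 - E) + t * 1 = 1 - s * E" if "s + t = 1" for s t E :: real using that by (simp add: algebra_simps)
    from this[of ?s ?t] show ?thesis using ab by (simp add: add_divide_distrib[symmetric])
  qed
  also have "\<dots> \<le> 1 - 2/3 * ((2/3) ^ (51 - m) / 2)"
  proof -
    have "2/3 \<le> ?s" using True assms(1) by (simp add: field_simps)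
    then have "2/3 * ((2/3) ^ (51 - m) / 2) \<le> ?s * ((2/3) ^ (51 - m) / 2 :: real)" by (intro mult_right_mono) auto
    then show ?thesis by linarith
  qed
  also have "\<dots> = 1 - (2/3) ^ (52 - m) / 2"
  proof -
    have "52 - m = Suc (51 - m)" using True by auto
    then show ?thesis by simp
  qed
  finally show ?thesis using True by (simp add: trap_def)
next
  case False
  have ab: "real a + real b > 0" using assms by simp
  have sum1: "?s + ?t = 1" using ab by (simp add: add_divide_distrib[symmetric])
  show ?thesis
  proof (cases "trap0 a b c m 0 < 1")
    case F2: False
    have "?s * trap (Suc a) b c (Suc m) d + ?t * trap a (Suc b) c m 1 \<le> 1"
      by (rule convex_le_1[OF sum1]) (auto intro: trap_le_1)
    moreover have "trap a b c m 0 = 1" using F2 False by (auto simp: trap_def)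
    ultimately show ?thesis by simp
  next
    case True
    \<comment> \<open>A potential below \<open>1\<close> forces \<open>b < a\<close>, which sharpens
      \<open>m + 1 \<le> a + b\<close> to \<open>m + 1 \<le> 2 a\<close>. This lets the gain on the
      left outweigh the loss on the right in \<open>e2\<close>.\<close>
    have "2 * b / (real a + real b) < 1"
    proof -
      have "2 * b / (real a + real b) \<le> trap0 a b c m 0" by (simp add: trap0_def)
      with True show ?thesis by simp
    qed
    then have "b < a" using ab by (simp add: field_simps)
    then have m2a: "m + 1 \<le> 2 * a" using assms by simp
    have le0: "trap a b c m d \<le> trap0 a b c m d" if "\<not> (b = 1 \<and> m < 52)" for a b c m d
      using that by (auto simp: trap_def)
    have "?s * trap (Suc a) b c (Suc m) d + ?t * trap a (Suc b) c m 1
       \<le> ?s * trap0 (Suc a) b c (Suc m) d + ?t * trap0 a (Suc b) c m 1"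
      using False assms(2) by (intro add_mono mult_left_mono le0) auto
    also have "\<dots> \<le> trap0 a b c m 0"
    proof -
      define A B C N where "A = real a" and "B = real b" and "C = real c" and "N = real m"
      have pos: "A > 0" "B > 0" "C \<ge> 0" "N > 0" using assms by (auto simp: A_def B_def C_def N_def)
      have N2A: "N + 1 \<le> 2 * A" using m2a unfolding A_def N_def by linarith
      have e1: "A / (A + B) * (2 * B / (A + 1 + B)) + B / (A + B) * (2 * (B + 1) / (A + (B + 1))) = 2 * B / (A + B)"
      proof -
        have "A + B \<noteq> 0" "A + 1 + B \<noteq> 0" "A + (B + 1) = A + 1 + B" using pos by auto
        then show ?thesis by (simp add: divide_simps) algebra
      qed
      have e2: "A / (A + B) * (24 * C / (N + 1)) + B / (A + B) * (24 * C / N + 12 * C / (N * (B + 1))) \<le> 24 * C / N"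
      proof -
        have "24 * C / N - (A / (A + B) * (24 * C / (N + 1)) + B / (A + B) * (24 * C / N + 12 * C / (N * (B + 1))))
          = 12 * C / (N * (A + B)) * (2 * A / (N + 1) - B / (B + 1))"
        proof -
          have c1: "24 * C / N = A / (A + B) * (24 * C / N) + B / (A + B) * (24 * C / N)"
            using pos by (simp flip: distrib_right add_divide_distrib)
          have c2: "24 * C / N - 24 * C / (N + 1) = 24 * C / (N * (N + 1))"
            using pos by (simp add: field_simps)
          have "24 * C / N - (A / (A + B) * (24 * C / (N + 1)) + B / (A + B) * (24 * C / N + 12 * C / (N * (B + 1)))) =
            A / (A + B) * (24 * C / (N * (N + 1))) - B / (A + B) * (12 * C / (N * (B + 1)))"
          proof -
            have "P - (s * Q + t * (P + R)) = s * W - t * R" if "P = s * P + t * P" "P - Q = W" for s t P Q R W :: real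
            proof -
              have "P - (s * Q + t * (P + R)) = (s * P + t * P) - (s * Q + t * (P + R))" using that(1) by simp
              also have "\<dots> = s * (P - Q) - t * R" by (simp add: algebra_simps)
              finally show ?thesis using that(2) by simp
            qed
            from this[OF c1 c2] show ?thesis .
          qed
          also have "\<dots> = 12 * C / (N * (A + B)) * (2 * A / (N + 1) - B / (B + 1))"
            unfolding right_diff_distrib times_divide_times_eq by (simp add: mult_ac)
          finally show ?thesis .
        qed
        moreover have "B / (B + 1) \<le> 2 * A / (N + 1)"
        proof -
          have "B / (B + 1) \<le> 1" "1 \<le> 2 * A / (N + 1)" using pos N2A by (auto simp: field_simps)
          then show ?thesis by linarith
        qed
        ultimately show ?thesis using pos
          by (smt (verit) mult_nonneg_nonneg divide_nonneg_pos mult_pos_pos add_pos_pos)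
      qed
      have "?s * trap0 (Suc a) b c (Suc m) d + ?t * trap0 a (Suc b) c m 1 =
        (A / (A + B) * (2 * B / (A + 1 + B)) + B / (A + B) * (2 * (B + 1) / (A + (B + 1)))) +
        (A / (A + B) * (24 * C / (N + 1)) + B / (A + B) * (24 * C / N + 12 * C / (N * (B + 1))))"
        using \<open>d < 0\<close> unfolding trap0_def A_def B_def C_def N_def by (simp add: algebra_simps)
      also have "\<dots> \<le> 2 * B / (A + B) + 24 * C / N" using e1 e2 by linarith
      also have "\<dots> = trap0 a b c m 0" by (simp add: trap0_def A_def B_def C_def N_def)
      finally show ?thesis .
    qed
    also have "\<dots> = trap a b c m 0" using True False by (auto simp: trap_def)
    finally show ?thesis .
  qed
qed

text \<open>The walk is at \<open>x + 1\<close>. The upward drift of the ratio \<open>c / m\<close>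
  and the term \<open>4 / b\<close> due at \<open>x + 2\<close> are paid for by
  \<open>12 c / (m b)\<close>; the hypothesis \<open>b + 1 \<le> m + c\<close> compares
  them.\<close>

lemma trap_step_1:
  assumes "2 \<le> b" "2 \<le> m" "1 \<le> c" "b + 1 \<le> m + c"
  shows "m / (real m + real c) * trap a b c (Suc m) 0 + c / (real m + real c) * trap a b (Suc c) m 2 \<le> trap a b c m 1"
    (is "?s * _ + ?t * _ \<le> _")
proof -
  define A B C N where "A = real a" and "B = real b" and "C = real c" and "N = real m"
  have pos: "A \<ge> 0" "B > 0" "C > 0" "N > 0" "N \<ge> 2" using assms by (auto simp: A_def B_def C_def N_def)
  have bn: "B + 1 \<le> N + C" using assms unfolding A_def B_def C_def N_def by linarith
  have sum1: "?s + ?t = 1" using pos by (simp add: add_divide_distrib[symmetric] C_def N_def)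
  have eq: "trap a b c m d = min 1 (trap0 a b c m d)" for c m d using assms by (simp add: trap_def)
  have "?s * trap0 a b c (Suc m) 0 + ?t * trap0 a b (Suc c) m 2 \<le> trap0 a b c m 1"
  proof -
    have k: "24 * N / (N + 1) + 24 * (C + 1) / N + 4 / B \<le> (N + C) * (24 / N + 12 / (N * B))"
    proof -
      have "8 / N * (3 / (N + 1)) \<le> 8 / N * 1" using pos by (intro mult_left_mono) auto
      then have "24 / (N * (N + 1)) \<le> 8 / N" by simp
      also have "\<dots> \<le> 8 * (N + C) / (N * B)" using pos bn by (simp add: field_simps)
      also have "\<dots> \<le> 8 / B + 12 * C / (N * B)" using pos by (simp add: field_simps)
      finally have "24 / (N * (N + 1)) \<le> 8 / B + 12 * C / (N * B)" .
      moreover have "24 * N / (N + 1) = 24 - 24 / N + 24 / (N * (N + 1))"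
      proof -
        have "N \<noteq> 0" "N + 1 \<noteq> 0" using pos by auto
        then show ?thesis by (simp add: divide_simps; algebra?)
      qed
      moreover have "24 * (C + 1) / N = 24 * C / N + 24 / N" by (simp add: add_divide_distrib algebra_simps)
      moreover have "(N + C) * (24 / N + 12 / (N * B)) = 24 + 24 * C / N + 12 / B + 12 * C / (N * B)"
        using pos by (simp add: field_simps)
      ultimately show ?thesis by simp
    qed
    have "N / (N + C) * (24 * C / (N + 1)) + C / (N + C) * (24 * (C + 1) / N + 4 / B) =
      C / (N + C) * (24 * N / (N + 1) + 24 * (C + 1) / N + 4 / B)"
      by (simp add: algebra_simps)
    also have "\<dots> \<le> C / (N + C) * ((N + C) * (24 / N + 12 / (N * B)))"
      using k pos by (intro mult_left_mono) auto
    also have "\<dots> = 24 * C / N + 12 * C / (N * B)"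
    proof -
      have "C / q * (q * K) = C * K" if "q \<noteq> 0" for q K using that by simp
      from this[of "N + C"] have "C / (N + C) * ((N + C) * (24 / N + 12 / (N * B))) = C * (24 / N + 12 / (N * B))" using pos by simp
      then show ?thesis by (simp add: distrib_left mult.commute)
    qed
    finally have k2: "N / (N + C) * (24 * C / (N + 1)) + C / (N + C) * (24 * (C + 1) / N + 4 / B) \<le> 24 * C / N + 12 * C / (N * B)" .
    have "?s * trap0 a b c (Suc m) 0 + ?t * trap0 a b (Suc c) m 2 =
      (?s + ?t) * (2 * B / (A + B)) + (N / (N + C) * (24 * C / (N + 1)) + C / (N + C) * (24 * (C + 1) / N + 4 / B))"
      unfolding trap0_def A_def B_def C_def N_def by (simp add: algebra_simps)
    also have "\<dots> \<le> trap0 a b c m 1"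
      using k2 unfolding sum1 trap0_def A_def B_def C_def N_def by (simp add: algebra_simps)
    finally show ?thesis .
  qed
  moreover have "?s * trap a b c (Suc m) 0 + ?t * trap a b (Suc c) m 2 \<le> ?s * trap0 a b c (Suc m) 0 + ?t * trap0 a b (Suc c) m 2"
    unfolding eq by (intro add_mono mult_left_mono) auto
  moreover have "?s * trap a b c (Suc m) 0 + ?t * trap a b (Suc c) m 2 \<le> 1"
    by (rule convex_le_1[OF sum1]) (auto intro: trap_le_1)
  ultimately show ?thesis unfolding eq[of c m 1] by simp
qed

text \<open>The walk is at \<open>x + 2\<close> and \<open>x + 3\<close> is unvisited, with local
  time \<open>1\<close>: the jump there has probability \<open>1 / (b + 1)\<close> and value
  \<open>1\<close>, which the term \<open>4 / b\<close> covers.\<close>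

lemma trap_step_2:
  assumes "2 \<le> b" "2 \<le> m" "1 \<le> a"
  shows "b / (real b + 1) * trap a (Suc b) c m 1 + 1 / (real b + 1) * 1 \<le> trap a b c m 2"
    (is "?s * _ + ?t * _ \<le> _")
proof -
  define A B C N where "A = real a" and "B = real b" and "C = real c" and "N = real m"
  have pos: "A > 0" "B > 0" "C \<ge> 0" "N > 0" "N \<ge> 2" using assms by (auto simp: A_def B_def C_def N_def)
  have sum1: "?s + ?t = 1" by (simp add: add_divide_distrib[symmetric])
  have eq: "trap a b c m d = min 1 (trap0 a b c m d)" if "2 \<le> b" for b d using that by (simp add: trap_def)
  have "?s * trap0 a (Suc b) c m 1 + ?t * 1 \<le> trap0 a b c m 2"
  proof -
    have "B / (B + 1) * (2 * (B + 1) / (A + (B + 1))) \<le> 2 * B / (A + B)"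
    proof -
      have "B / q * (2 * q / D) = 2 * B / D" if "q \<noteq> 0" for q D using that by simp
      from this[of "B + 1"] have "B / (B + 1) * (2 * (B + 1) / (A + (B + 1))) = 2 * B / (A + (B + 1))" using pos by simp
      also have "\<dots> \<le> 2 * B / (A + B)" using pos by (intro divide_left_mono) auto
      finally show ?thesis .
    qed
    moreover have "B / (B + 1) * (24 * C / N + 12 * C / (N * (B + 1))) \<le> 24 * C / N"
    proof -
      have "B / (B + 1) * (24 * C / N + 12 * C / (N * (B + 1))) = 24 * C / N * (B / (B + 1) + B / (B + 1) * (1 / (2 * (B + 1))))"
      proof -
        have "N \<noteq> 0" "B + 1 \<noteq> 0" using pos by auto
        then show ?thesis by (simp add: divide_simps; algebra?)
      qed
      also have "\<dots> \<le> 24 * C / N * 1"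
      proof (rule mult_left_mono)
        have "B / (B + 1) * (1 / (2 * (B + 1))) \<le> 1 * (1 / (2 * (B + 1)))" using pos by (intro mult_right_mono) auto
        also have "\<dots> \<le> 1 / (B + 1)" using pos by (simp add: field_simps)
        finally show "B / (B + 1) + B / (B + 1) * (1 / (2 * (B + 1))) \<le> 1"
          using pos by (simp add: field_simps)
      qed (use pos in auto)
      finally show ?thesis by simp
    qed
    moreover have "1 / (B + 1) \<le> 4 / B" using pos by (simp add: field_simps)
    ultimately have "B / (B + 1) * (2 * (B + 1) / (A + (B + 1))) + B / (B + 1) * (24 * C / N + 12 * C / (N * (B + 1))) + 1 / (B + 1)
       \<le> 2 * B / (A + B) + 24 * C / N + 4 / B" by linarith
    then show ?thesis unfolding trap0_def A_def B_def C_def N_def by (simp add: algebra_simps)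
  qed
  moreover have "?s * trap a (Suc b) c m 1 + ?t * 1 \<le> ?s * trap0 a (Suc b) c m 1 + ?t * 1"
  proof -
    have "trap a (Suc b) c m 1 \<le> trap0 a (Suc b) c m 1" using eq[of "Suc b" 1] assms(1) by simp
    then show ?thesis by (intro add_mono mult_left_mono) auto
  qed
  moreover have "?s * trap a (Suc b) c m 1 + ?t * 1 \<le> 1"
    by (rule convex_le_1[OF sum1]) (auto intro: trap_le_1)
  ultimately show ?thesis unfolding eq[OF assms(1)] by simp
qed

section \<open>Invariants of the local times around a visited site\<close>

definition visited :: "(nat \<Rightarrow> int) \<Rightarrow> nat \<Rightarrow> int \<Rightarrow> bool" where
  "visited p n x \<longleftrightarrow> (\<exists>k\<le>n. p k = x)"

lemma visited_Suc: "visited p (Suc n) x \<longleftrightarrow> visited p n x \<or> p (Suc n) = x"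
  by (auto simp: visited_def le_Suc_eq)

lemma visited_cong: "(\<And>i. i \<le> n \<Longrightarrow> p i = q i) \<Longrightarrow> visited p n x = visited q n x"
  by (auto simp: visited_def)

lemma loc_unvisited: "\<not> visited p n x \<Longrightarrow> loc p n x = 1"
  by (auto simp: visited_def loc_def)

lemma visited_below:
  assumes "unit_steps p" "p 0 < x" "x \<le> y" "visited p n y"
  shows "visited p n x"
  using assms(4)
proof (induction n)
  case 0 with assms(2,3) show ?case by (auto simp: visited_def)
next
  case (Suc n)
  have lt: "p n < x" if "\<not> visited p n x" for n
    using that
  proof (induction n)
    case (Suc n)
    then show ?case using unit_steps_cases[OF assms(1), of n] by (auto simp: visited_Suc)
  qed (use assms(2) in simp)
  show ?case
  proof (rule ccontr)
    assume "\<not> visited p (Suc n) x"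
    from lt[OF this] this Suc assms(3) show False by (auto simp: visited_Suc)
  qed
qed

definition pending :: "(nat \<Rightarrow> int) \<Rightarrow> nat \<Rightarrow> int \<Rightarrow> nat" where
  "pending p n x = loc p n x + of_bool (p n < x)"

lemma unvisited_less:
  assumes "unit_steps p" "p 0 < x" "\<not> visited p n x"
  shows "p n < x"
  using assms(3)
proof (induction n)
  case (Suc n)
  then show ?case using unit_steps_cases[OF assms(1), of n] by (auto simp: visited_Suc)
qed (use assms(2) in simp)

text \<open>The induction step for bare numbers, with \<open>q\<close> and \<open>r\<close> the old
  and new positions relative to \<open>x\<close>, so that six cases settle it by arithmetic.\<close>

lemma trap_invariant_step:
  fixes a b c z :: nat and q r :: int
  assumes "1 \<le> b" "r = q + 1 \<or> r = q - 1"
    and "2 \<le> a \<and> 2 \<le> z \<and> z + of_bool (q < 0) + 1 + of_bool (q > 0) \<le> a + b \<and>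
      (b = 1 \<longrightarrow> z + of_bool (q < 0) \<le> a \<and> c = 1 \<and> q \<le> 0) \<and>
      b + 2 \<le> z + of_bool (q < 0) + c + of_bool (q = 1)"
  shows "2 \<le> a + of_bool (r = -1) \<and> 2 \<le> z + of_bool (r = 0) \<and>
      z + of_bool (r = 0) + of_bool (r < 0) + 1 + of_bool (r > 0) \<le> a + of_bool (r = -1) + (b + of_bool (r = 1)) \<and>
      (b + of_bool (r = 1) = 1 \<longrightarrow> z + of_bool (r = 0) + of_bool (r < 0) \<le> a + of_bool (r = -1) \<and>
        c + of_bool (r = 2) = 1 \<and> r \<le> 0) \<and>
      b + of_bool (r = 1) + 2 \<le> z + of_bool (r = 0) + of_bool (r < 0) + (c + of_bool (r = 2)) + of_bool (r = 1)"
proof -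
  consider "q < -1" | "q = -1" | "q = 0" | "q = 1" | "q = 2" | "q > 2" by linarith
  then show ?thesis
    by (cases; insert assms; elim disjE; auto)
qed

text \<open>These are the side conditions of the \<open>trap_step\<close> lemmas; they hold because
  arrivals at a site are departures from its neighbours.\<close>

lemma trap_invariant:
  assumes unit_steps: "unit_steps p" and start: "p 0 < x" and "visited p n x"
  shows "2 \<le> loc p n (x - 1) \<and> 2 \<le> loc p n x \<and>
    pending p n x + 1 + of_bool (p n > x) \<le> loc p n (x - 1) + loc p n (x + 1) \<and>
    (loc p n (x + 1) = 1 \<longrightarrow> pending p n x \<le> loc p n (x - 1) \<and> loc p n (x + 2) = 1 \<and> p n \<le> x) \<and>
    loc p n (x + 1) + 2 \<le> pending p n x + loc p n (x + 2) + of_bool (p n = x + 1)"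
  using assms(3)
proof (induction n)
  case 0 with start show ?case by (simp add: visited_def)
next
  case (Suc n)
  show ?case
  proof (cases "visited p n x")
    case True
    define q r where "q = p n - x" and "r = p (Suc n) - x"
    have "r = q + 1 \<or> r = q - 1" using unit_steps_cases[OF unit_steps, of n] by (auto simp: q_def r_def)
    moreover have e: "p n < x \<longleftrightarrow> q < 0" "p n > x \<longleftrightarrow> q > 0" "p n = x + 1 \<longleftrightarrow> q = 1" "p n \<le> x \<longleftrightarrow> q \<le> 0"
      "p (Suc n) < x \<longleftrightarrow> r < 0" "p (Suc n) > x \<longleftrightarrow> r > 0" "p (Suc n) = x + 1 \<longleftrightarrow> r = 1" "p (Suc n) \<le> x \<longleftrightarrow> r \<le> 0"
      "p (Suc n) = x - 1 \<longleftrightarrow> r = -1" "p (Suc n) = x \<longleftrightarrow> r = 0" "p (Suc n) = x + 2 \<longleftrightarrow> r = 2"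
      by (auto simp: q_def r_def)
    moreover note Suc.IH[OF True]
    ultimately show ?thesis
      unfolding loc_Suc pending_def e by (intro trap_invariant_step[OF loc_ge_1])
  next
    case False
    have "loc p n y = 1" if "y \<ge> x" for y
      using False visited_below[OF unit_steps start that] by (intro loc_unvisited) auto
    note l = this[of x] this[of "x + 1"] this[of "x + 2"]
    have lt: "p n < x" by (rule unvisited_less[OF unit_steps start False])
    have "p (Suc n) = x" using Suc.prems False by (simp add: visited_Suc)
    then have pn: "p n = x - 1" using lt unit_steps_cases[OF unit_steps, of n] by auto
    have "2 \<le> loc p n (x - 1)"
    proof -
      have "p n = x - 1" by (rule pn)
      then have "1 \<le> (\<Sum>i\<le>n. of_bool (p i = x - 1) :: nat)"
        using member_le_sum[of n "{..n}" "\<lambda>i. of_bool (p i = x - 1) :: nat"] by auto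
      then show ?thesis by (simp add: loc_def)
    qed
    then show ?thesis using l \<open>p (Suc n) = x\<close> by (simp add: loc_Suc pending_def)
  qed
qed

text \<open>The subtracted constant is the potential at the first visit to \<open>x\<close>, where
  \<open>m = 2\<close>, so the process leaves \<open>0\<close> without a jump; reaching
  \<open>x + 3\<close> freezes it at \<open>1\<close> minus that constant.\<close>

definition escape :: "int \<Rightarrow> nat \<Rightarrow> (nat \<Rightarrow> int) \<Rightarrow> real" where
  "escape x n p = (if visited p n x then
     (if visited p n (x + 3) then 1
      else trap (loc p n (x - 1)) (loc p n (x + 1)) (loc p n (x + 2)) (pending p n x) (p n - x))
       - (1 - (2/3) ^ 50 / 2) else 0)"

lemma adapted_escape: "adapted n (escape x n)"
proof (rule adaptedI)
  fix p q :: "nat \<Rightarrow> int" assume *: "\<And>i. i \<le> n \<Longrightarrow> p i = q i"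
  have "visited p n y = visited q n y" "loc p n y = loc q n y" for y
    using * by (auto intro!: visited_cong loc_cong)
  then show "escape x n p = escape x n q" using *[of n] by (simp add: escape_def pending_def)
qed

text \<open>Below \<open>x\<close> monotonicity in \<open>a\<close> suffices; at \<open>x\<close>,
  \<open>x + 1\<close> and \<open>x + 2\<close> the matching \<open>trap_step\<close> applies;
  before \<open>x\<close> or after \<open>x + 3\<close> has been visited there is equality.\<close>

lemma escape_step:
  assumes unit_steps: "unit_steps p" and start: "p 0 < x"
  shows "step_prob p n (p n + 1) * escape x (Suc n) (p(Suc n := p n + 1)) +
    step_prob p n (p n - 1) * escape x (Suc n) (p(Suc n := p n - 1)) \<le> escape x n p"
proof -
  have l: "loc (p(Suc n := y)) (Suc n) v = loc p n v + of_bool (y = v)" for y v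
    using loc_cong[of n "p(Suc n := y)" p v] by (simp add: loc_Suc)
  have vis: "visited (p(Suc n := y)) (Suc n) v \<longleftrightarrow> visited p n v \<or> y = v" for y v
    using visited_cong[of n "p(Suc n := y)" p v] by (simp add: visited_Suc)
  note s1 = step_prob_sum[of p n]
  let ?k = "1 - (2/3) ^ 50 / 2 :: real"
  show ?thesis
  proof (cases "visited p n x")
    case False
    have le: "loc p n y = 1" if "y \<ge> x" for y
      using False visited_below[OF unit_steps start that] by (intro loc_unvisited) auto
    have nv: "\<not> visited p n (x + 3)" using False visited_below[OF unit_steps start, of "x + 3" n] by auto
    have lt: "p n < x" by (rule unvisited_less[OF unit_steps start False])
    have "escape x (Suc n) (p(Suc n := y)) = 0" if "y \<noteq> x" for y using that False by (simp add: escape_def vis)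
    moreover have "escape x (Suc n) (p(Suc n := x)) = 0"
      using nv le[of x] le[of "x + 1"] le[of "x + 2"] by (simp add: escape_def vis l pending_def trap_def)
    ultimately have "escape x (Suc n) (p(Suc n := y)) = 0" for y by metis
    then show ?thesis using False by (simp add: escape_def)
  next
    case vx: True
    show ?thesis
    proof (cases "visited p n (x + 3)")
      case True
      then show ?thesis using vx s1 by (simp add: escape_def vis flip: distrib_right)
    next
      case nv: False
      define a b c m where "a = loc p n (x - 1)" and "b = loc p n (x + 1)" and "c = loc p n (x + 2)" and "m = pending p n x"
      note abcm = a_def b_def c_def m_def
      have inv: "2 \<le> a" "2 \<le> loc p n x" "m + 1 + of_bool (p n > x) \<le> a + b"
        "b = 1 \<Longrightarrow> m \<le> a \<and> c = 1 \<and> p n \<le> x" "b + 2 \<le> m + c + of_bool (p n = x + 1)"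
        using trap_invariant[OF unit_steps start vx] by (auto simp: abcm)
      have m2: "2 \<le> m" using inv(2) by (simp add: m_def pending_def)
      have bc: "1 \<le> b" "1 \<le> c" by (simp_all add: abcm Suc_le_eq)
      have E0: "escape x n p = trap a b c m (p n - x) - ?k" using vx nv by (simp add: escape_def abcm)
      define T where "T y = (if y = x + 3 then 1 else trap (a + of_bool (y = x - 1)) (b + of_bool (y = x + 1))
        (c + of_bool (y = x + 2)) (loc p n x + of_bool (y = x) + of_bool (y < x)) (y - x))" for y
      have E1: "escape x (Suc n) (p(Suc n := y)) = T y - ?k" for y
        using vx nv by (auto simp: escape_def vis l abcm pending_def T_def)
      have goal: "step_prob p n (p n + 1) * T (p n + 1) + step_prob p n (p n - 1) * T (p n - 1) \<le> trap a b c m (p n - x)"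
      proof -
        have lt3: "p n < x + 3" using nv unvisited_less[OF unit_steps _ nv] start by simp
        have T_le: "step_prob p n (p n + 1) * T (p n + 1) + step_prob p n (p n - 1) * T (p n - 1) \<le> z"
          if "T (p n + 1) \<le> z" "T (p n - 1) \<le> z" for z
          using convex_bound_le[OF that _ _ s1] by simp
        have d: "trap a b c m d = trap a b c m e" if "d < 1" "e < 1" for a b c m and d e :: int
          using that by (simp add: trap_def trap0_def)
        consider "p n < x" | "p n = x" | "p n = x + 1" | "p n = x + 2" using lt3 by linarith
        then show ?thesis
        proof cases
          case 1
          have mm: "m = Suc (loc p n x)" using 1 by (simp add: m_def pending_def)
          have aa: "trap (a + of_bool q) b c m (e::int) \<le> trap a b c m e" for q e
            using trap_mono_a[of a b c m e] inv(1) by (cases q) auto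
          have "T y \<le> trap a b c m (p n - x)" if "y \<le> x" for y
          proof -
            have "T y = trap (a + of_bool (y = x - 1)) b c m (y - x)" using that mm by (auto simp: T_def)
            also have "\<dots> \<le> trap a b c m (y - x)" by (rule aa)
            also have "\<dots> = trap a b c m (p n - x)" by (rule d) (use 1 that in auto)
            finally show ?thesis .
          qed
          then show ?thesis using 1 by (intro T_le) auto
        next
          case 2
          have mm: "m = loc p n x" using 2 by (simp add: m_def pending_def)
          have "a / (real a + real b) * trap (Suc a) b c (Suc m) (-1) + b / (real a + real b) * trap a (Suc b) c m 1 \<le> trap a b c m 0"
            using inv m2 bc 2 by (intro trap_step_0) auto
          then show ?thesis using 2 mm by (simp add: T_def step_prob_def a_def b_def add.commute)
        next
          case 3
          have mm: "m = loc p n x" using 3 by (simp add: m_def pending_def)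
          have b2: "2 \<le> b" using inv(4) bc 3 by (cases "b = 1") auto
          have "m / (real m + real c) * trap a b c (Suc m) 0 + c / (real m + real c) * trap a b (Suc c) m 2 \<le> trap a b c m 1"
            using inv m2 bc 3 b2 by (intro trap_step_1) auto
          then show ?thesis using 3 mm by (simp add: T_def step_prob_def c_def add.commute)
        next
          case 4
          have mm: "m = loc p n x" using 4 by (simp add: m_def pending_def)
          have b2: "2 \<le> b" using inv(4) bc 4 by (cases "b = 1") auto
          have l3: "loc p n (x + 3) = 1" by (rule loc_unvisited[OF nv])
          have "b / (real b + 1) * trap a (Suc b) c m 1 + 1 / (real b + 1) * 1 \<le> trap a b c m 2"
            using inv m2 b2 by (intro trap_step_2) auto
          then show ?thesis using 4 mm l3 by (simp add: T_def step_prob_def b_def add.commute)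
        qed
      qed
      have "step_prob p n (p n + 1) * (T (p n + 1) - ?k) + step_prob p n (p n - 1) * (T (p n - 1) - ?k) =
        (step_prob p n (p n + 1) * T (p n + 1) + step_prob p n (p n - 1) * T (p n - 1)) - (step_prob p n (p n + 1) + step_prob p n (p n - 1)) * ?k"
        by (simp add: algebra_simps)
      also have "\<dots> \<le> trap a b c m (p n - x) - ?k" using goal unfolding s1 by simp
      finally show ?thesis unfolding E0 E1 .
    qed
  qed
qed

context vrrw_law
begin

text \<open>The mean of \<open>escape\<close> never exceeds \<open>0\<close>, while
  \<open>escape\<close> dominates the indicator of a visit to \<open>x + 3\<close> minus the
  constant times that of a visit to \<open>x\<close>.\<close>

lemma prob_visited_le:
  assumes "v0 < x"
  shows "prob {\<omega>\<in>space M. visited (path \<omega>) n (x + 3)} \<le> (1 - (2/3) ^ 50 / 2) * prob {\<omega>\<in>space M. visited (path \<omega>) n x}"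
proof -
  let ?k = "1 - (2/3) ^ 50 / 2 :: real"
  have AEg: "AE \<omega> in M. unit_steps (path \<omega>) \<and> path \<omega> 0 < x" 
    using AE_unit_steps AE_start by eventually_elim (use assms in \<open>simp add: path_eq\<close>)
  have E: "expectation (\<lambda>\<omega>. escape x n (path \<omega>)) \<le> 0"
  proof (induction n)
    case 0
    have "expectation (\<lambda>\<omega>. escape x 0 (path \<omega>)) = expectation (\<lambda>_. 0)"
    proof (rule integral_cong_AE)
      show "AE \<omega> in M. escape x 0 (path \<omega>) = 0"
        using AEg by eventually_elim (simp add: escape_def visited_def)
    qed (simp_all add: borel_measurable_adapted[OF adapted_escape])
    then show ?case by simp
  next
    case (Suc n)
    let ?G = "\<lambda>p. step_prob p n (p n + 1) * escape x (Suc n) (p(Suc n := p n + 1)) +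
      step_prob p n (p n - 1) * escape x (Suc n) (p(Suc n := p n - 1))"
    note ex = expectation_step[OF adapted_escape[of "Suc n" x]]
    have "expectation (\<lambda>\<omega>. escape x (Suc n) (path \<omega>)) = expectation (\<lambda>\<omega>. ?G (path \<omega>))" by (rule ex(2))
    also have "\<dots> \<le> expectation (\<lambda>\<omega>. escape x n (path \<omega>))"
    proof (rule integral_mono_AE)
      show "AE \<omega> in M. ?G (path \<omega>) \<le> escape x n (path \<omega>)"
        using AEg by eventually_elim (rule escape_step; simp)
    qed (rule expectation_adapted(1)[OF ex(1)] expectation_adapted(1)[OF adapted_escape])+
    finally show ?case using Suc by simp
  qed
  have ad: "adapted n (\<lambda>p. visited p n y)" for y by (rule adaptedI) (rule visited_cong)
  have m [measurable]: "{\<omega>\<in>space M. visited (path \<omega>) n y} \<in> sets M" for y by (rule sets_adapted[OF ad])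
  let ?A = "{\<omega>\<in>space M. visited (path \<omega>) n x}" and ?B = "{\<omega>\<in>space M. visited (path \<omega>) n (x + 3)}"
  have "prob ?B - ?k * prob ?A = expectation (\<lambda>\<omega>. indicator ?B \<omega> - ?k * indicator ?A \<omega>)"
    by (subst Bochner_Integration.integral_diff) (auto simp: emeasure_eq_measure intro!: integrable_real_indicator)
  also have "\<dots> \<le> expectation (\<lambda>\<omega>. escape x n (path \<omega>))"
  proof (rule integral_mono_AE)
    show "AE \<omega> in M. indicator ?B \<omega> - ?k * indicator ?A \<omega> \<le> escape x n (path \<omega>)"
      using AEg AE_space
    proof eventually_elim
      case (elim \<omega>)
      then have "visited (path \<omega>) n x" if "visited (path \<omega>) n (x + 3)"
        using visited_below[of "path \<omega>" x "x + 3" n] that by auto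
      then show ?case using elim(2) trap_nonneg by (auto simp: escape_def)
    qed
    show "integrable M (\<lambda>\<omega>. indicator ?B \<omega> - ?k * indicator ?A \<omega>)"
      by (intro Bochner_Integration.integrable_diff integrable_mult_right integrable_real_indicator)
        (auto simp: emeasure_eq_measure)
  qed (rule expectation_adapted(1)[OF adapted_escape])
  finally show ?thesis using E by linarith
qed

text \<open>Along the sites \<open>v0 + 1 + 3 j\<close> the probability of a visit decays
  geometrically in \<open>j\<close>, uniformly in time.\<close>

lemma AE_bounded_above: "AE \<omega> in M. \<exists>B. \<forall>n. X n \<omega> \<le> B"
proof -
  let ?k = "1 - (2/3) ^ 50 / 2 :: real"
  have "(2/3) ^ 50 \<le> (1::real)" by (rule power_le_one) auto
  then have k: "0 \<le> ?k" "?k < 1" by auto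
  let ?A = "\<lambda>n x. {\<omega>\<in>space M. visited (path \<omega>) n x}"
  have ad: "adapted n (\<lambda>p. visited p n y)" for n y by (rule adaptedI) (rule visited_cong)
  have m [measurable]: "?A n y \<in> sets M" for n y by (rule sets_adapted[OF ad])
  have le: "prob (?A n (v0 + 1 + 3 * int j)) \<le> ?k ^ j" for n j
  proof (induction j)
    case (Suc j)
    have "prob (?A n (v0 + 1 + 3 * int (Suc j))) \<le> ?k * prob (?A n (v0 + 1 + 3 * int j))"
      using prob_visited_le[of "v0 + 1 + 3 * int j" n] by (simp add: algebra_simps)
    also have "\<dots> \<le> ?k * ?k ^ j" using Suc k by (intro mult_left_mono) auto
    finally show ?case by simp
  qed simp
  let ?U = "\<lambda>j. \<Union>n. ?A n (v0 + 1 + 3 * int j)"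
  have U: "prob (?U j) \<le> ?k ^ j" for j
  proof (rule LIMSEQ_le_const2)
    show "(\<lambda>n. prob (?A n (v0 + 1 + 3 * int j))) \<longlonglongrightarrow> prob (?U j)"
      by (rule finite_Lim_measure_incseq) (auto simp: incseq_Suc_iff visited_Suc)
  qed (use le in auto)
  have "prob (\<Inter>j. ?U j) \<le> ?k ^ j" for j
    by (rule order_trans[OF finite_measure_mono U]) auto
  moreover have "(\<lambda>j. ?k ^ j) \<longlonglongrightarrow> 0" using k by (intro LIMSEQ_realpow_zero) auto
  ultimately have "prob (\<Inter>j. ?U j) \<le> 0" by (intro LIMSEQ_le_const) auto
  then have "(\<Inter>j. ?U j) \<in> null_sets M" by (auto simp: null_sets_def emeasure_eq_measure measure_le_0_iff)
  then have "AE \<omega> in M. \<omega> \<notin> (\<Inter>j. ?U j)" by (rule AE_not_in)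
  with AE_unit_steps AE_start AE_space show ?thesis
  proof eventually_elim
    case (elim \<omega>)
    have "\<not> (\<forall>j. \<omega> \<in> ?U j)" using elim(4) by (simp only: INT_iff) simp
    then obtain j where "\<omega> \<notin> ?U j" by (elim not_all[THEN iffD1, THEN exE])
    then have "\<omega> \<notin> ?A n (v0 + 1 + 3 * int j)" for n by (meson UN_I UNIV_I)
    then have j: "\<not> visited (path \<omega>) n (v0 + 1 + 3 * int j)" for n using elim(3) by simp
    have "X n \<omega> < v0 + 1 + 3 * int j" for n
      using unvisited_less[OF elim(1) _ j, of n] elim(2) by (simp add: path_eq)
    then show ?case by (meson less_imp_le)
  qed
qed

end

lemma (in vrrw_law) AE_bounded: "AE \<omega> in M. \<exists>A B. \<forall>n. A \<le> X n \<omega> \<and> X n \<omega> \<le> B"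
proof -
  interpret neg: vrrw_law M "\<lambda>n \<omega>. - X n \<omega>" "- v0" by (rule uminus)
  from AE_bounded_above neg.AE_bounded_above show ?thesis
  proof eventually_elim
    case (elim \<omega>)
    then obtain B C where "\<And>n. X n \<omega> \<le> B" "\<And>n. - X n \<omega> \<le> C" by auto
    then have "\<forall>n. - C \<le> X n \<omega> \<and> X n \<omega> \<le> B" by (metis minus_le_iff)
    then show ?case by blast
  qed
qed

section \<open>Rubin's construction\<close>

text \<open>Index of a clock: site, side (\<open>True\<close> is the right one), serial
  number.\<close>

type_synonym clocks = "int \<times> bool \<times> nat \<Rightarrow> real"

definition dir :: "bool \<Rightarrow> int" where "dir s = (if s then 1 else - 1)"

lemma dir_simps [simp]: "dir True = 1" "dir False = - 1" "dir (\<not> s) = - dir s"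
  by (auto simp: dir_def)

abbreviation Exp1 :: "real measure" where "Exp1 \<equiv> density lborel (exponential_density 1)"

definition Clocks :: "clocks measure" where "Clocks = (\<Pi>\<^sub>M j\<in>UNIV. Exp1)"

lemma prob_space_Exp1: "prob_space Exp1"
  by (rule prob_space_exponential_density) simp

lemma prob_space_Clocks: "prob_space Clocks"
  unfolding Clocks_def by (intro prob_space_PiM prob_space_Exp1)

lemma space_Clocks [simp]: "space Clocks = UNIV"
  by (simp add: Clocks_def space_PiM)

lemma measurable_Clocks_component [measurable]: "(\<lambda>e. e j) \<in> borel_measurable Clocks"
proof -
  have "(\<lambda>e. e j) \<in> measurable Clocks Exp1" unfolding Clocks_def by (rule measurable_component_singleton) simp
  then show ?thesis by (simp cong: measurable_cong_sets)
qed

lemma measurable_ClocksI: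
  assumes "\<And>j. (\<lambda>x. f x j) \<in> borel_measurable N"
  shows "f \<in> measurable N Clocks"
  unfolding Clocks_def
proof (rule measurable_PiM_single')
  show "(\<lambda>x. f x j) \<in> measurable N Exp1" for j
    using assms[of j] by (simp cong: measurable_cong_sets)
qed (simp add: space_PiM)

lemma sigma_finite_Clocks: "sigma_finite_measure Clocks"
proof -
  interpret prob_space Clocks by (rule prob_space_Clocks)
  show ?thesis by unfold_locales
qed

lemma measurable_Clocks_upd: "(\<lambda>(x, e). e(j := x)) \<in> measurable (borel \<Otimes>\<^sub>M Clocks) Clocks"
proof (rule measurable_ClocksI)
  fix i show "(\<lambda>x. (case x of (x, e) \<Rightarrow> e(j := x)) i) \<in> borel_measurable (borel \<Otimes>\<^sub>M Clocks)"
    by (cases "i = j") (auto simp: case_prod_beta)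
qed

lemma measurable_Clocks_upd_const: "(\<lambda>e. e(j := x)) \<in> measurable Clocks Clocks"
proof (rule measurable_ClocksI)
  fix i show "(\<lambda>e. (e(j := x)) i) \<in> borel_measurable Clocks"
    by (cases "i = j") auto
qed

text \<open>Redrawing one clock leaves the product law unchanged. Fubini's theorem is applied below
  in this form.\<close>

lemma nn_integral_Clocks_upd:
  assumes [measurable]: "g \<in> borel_measurable Clocks"
  shows "(\<integral>\<^sup>+e. g e \<partial>Clocks) = (\<integral>\<^sup>+x. (\<integral>\<^sup>+e. g (e(j := x)) \<partial>Clocks) \<partial>Exp1)"
proof -
  interpret C: sigma_finite_measure Clocks by (rule sigma_finite_Clocks)
  have [measurable]: "(\<lambda>(x, e). e(j := x)) \<in> measurable (Exp1 \<Otimes>\<^sub>M Clocks) Clocks"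
    using measurable_Clocks_upd[of j] by (simp cong: measurable_cong_sets)
  have "(\<integral>\<^sup>+e. g e \<partial>Clocks) = (\<integral>\<^sup>+e. g e \<partial>distr (Exp1 \<Otimes>\<^sub>M Clocks) Clocks (\<lambda>(x, e). e(j := x)))"
    using distr_pair_PiM_eq_PiM[of UNIV "\<lambda>_. Exp1" j] prob_space_Exp1 by (simp add: Clocks_def)
  also have "\<dots> = (\<integral>\<^sup>+y. g ((snd y)(j := fst y)) \<partial>(Exp1 \<Otimes>\<^sub>M Clocks))"
    by (subst nn_integral_distr) (auto simp: case_prod_beta)
  also have "\<dots> = (\<integral>\<^sup>+x. (\<integral>\<^sup>+e. g (e(j := x)) \<partial>Clocks) \<partial>Exp1)"
    using measurable_compose[OF \<open>(\<lambda>(x, e). e(j := x)) \<in> measurable (Exp1 \<Otimes>\<^sub>M Clocks) Clocks\<close> assms]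
    by (subst C.nn_integral_fst[symmetric]) (auto simp: case_prod_beta')
  finally show ?thesis .
qed

text \<open>When the first clock at \<open>i\<close> on side \<open>s\<close> rings, it is discarded and the elapsed time is subtracted
  from the clock on the other side, in the units of that clock: \<open>c\<close> is the ratio of the two rates.\<close>

definition shift :: "int \<Rightarrow> bool \<Rightarrow> real \<Rightarrow> clocks \<Rightarrow> clocks" where
  "shift i s c e = (\<lambda>(j, t, k). if j = i \<and> t = s then e (j, t, Suc k)
     else if j = i \<and> k = 0 then e (j, t, 0) - c * e (i, s, 0) else e (j, t, k))"

lemma measurable_shift [measurable]: "shift i s c \<in> measurable Clocks Clocks"
proof (rule measurable_ClocksI)
  fix j show "(\<lambda>x. shift i s c x j) \<in> borel_measurable Clocks"
    by (cases j) (auto simp: shift_def)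
qed

text \<open>Substituting \<open>y = c x + z\<close> splits off the factor
  \<open>exp (- c x)\<close>: the overshoot is again standard exponential, and the factor integrates
  to the winning probability \<open>1 / (1 + c)\<close>.\<close>

lemma nn_integral_exponential_race:
  fixes h :: "real \<Rightarrow> ennreal"
  assumes c: "c > 0" and [measurable]: "h \<in> borel_measurable borel"
  shows "(\<integral>\<^sup>+x. (\<integral>\<^sup>+y. indicator {c * x<..} y * h (y - c * x) \<partial>Exp1) \<partial>Exp1) = ennreal (1 / (1 + c)) * (\<integral>\<^sup>+z. h z \<partial>Exp1)"
proof -
  let ?f = "\<lambda>x. ennreal (exponential_density 1 x)"
  have inner: "(\<integral>\<^sup>+y. indicator {c * x<..} y * h (y - c * x) \<partial>Exp1) = ennreal (exp (- (c * x))) * (\<integral>\<^sup>+z. h z \<partial>Exp1)" if "0 \<le> x" for x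
  proof -
    have "(\<integral>\<^sup>+y. indicator {c * x<..} y * h (y - c * x) \<partial>Exp1) =
      (\<integral>\<^sup>+y. ?f y * (indicator {c * x<..} y * h (y - c * x)) \<partial>lborel)"
      by (subst nn_integral_density) auto
    also have "\<dots> = (\<integral>\<^sup>+z. ?f (c * x + 1 * z) * (indicator {c * x<..} (c * x + 1 * z) * h (c * x + 1 * z - c * x)) \<partial>lborel)"
      by (subst nn_integral_real_affine[where c = 1 and t = "c * x"]) auto
    also have "\<dots> = (\<integral>\<^sup>+z. ennreal (exp (- (c * x))) * (?f z * h z) \<partial>lborel)"
    proof (rule nn_integral_cong_AE)
      have "AE z in lborel. z \<noteq> (0::real)" by (rule AE_lborel_singleton)
      then show "AE z in lborel. ?f (c * x + 1 * z) * (indicator {c * x<..} (c * x + 1 * z) * h (c * x + 1 * z - c * x)) =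
        ennreal (exp (- (c * x))) * (?f z * h z)"
      proof eventually_elim
        case (elim z)
        have "0 \<le> c * x" using c that by simp
        show ?case
        proof (cases "z < 0")
          case False
          then have "?f (c * x + z) = ennreal (exp (- (c * x))) * ?f z"
            using \<open>0 \<le> c * x\<close> by (simp add: exponential_density_def ennreal_mult[symmetric] exp_add[symmetric] add.commute)
          then show ?thesis using False elim by (simp add: mult.assoc)
        qed (simp add: exponential_density_def)
      qed
    qed
    also have "\<dots> = ennreal (exp (- (c * x))) * (\<integral>\<^sup>+z. h z \<partial>Exp1)"
      by (subst nn_integral_cmult) (auto simp: nn_integral_density)
    finally show ?thesis .
  qed
  have "(\<integral>\<^sup>+x. (\<integral>\<^sup>+y. indicator {c * x<..} y * h (y - c * x) \<partial>Exp1) \<partial>Exp1) =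
    (\<integral>\<^sup>+x. ennreal (exp (- (c * x))) * (\<integral>\<^sup>+z. h z \<partial>Exp1) \<partial>Exp1)"
  proof (rule nn_integral_cong_AE)
    have "AE x in Exp1. 0 \<le> x"
      by (subst AE_density) (auto simp: exponential_density_def)
    then show "AE x in Exp1. (\<integral>\<^sup>+y. indicator {c * x<..} y * h (y - c * x) \<partial>Exp1) =
       ennreal (exp (- (c * x))) * (\<integral>\<^sup>+z. h z \<partial>Exp1)"
      by eventually_elim (rule inner)
  qed
  also have "\<dots> = (\<integral>\<^sup>+x. ennreal (exp (- (c * x))) \<partial>Exp1) * (\<integral>\<^sup>+z. h z \<partial>Exp1)"
    by (rule nn_integral_multc) auto
  also have "(\<integral>\<^sup>+x. ennreal (exp (- (c * x))) \<partial>Exp1) = ennreal (1 / (1 + c))"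
  proof -
    have "(\<integral>\<^sup>+x. ennreal (exp (- (c * x))) \<partial>Exp1) = (\<integral>\<^sup>+x. ennreal (1 / (1 + c)) * ennreal (exponential_density (1 + c) x) \<partial>lborel)"
    proof -
      have E: "1 / (1 + c) * ((1 + c) * E) = E" for E using c by simp
      have "exp (- x) * exp (- (c * x)) = 1 / (1 + c) * ((1 + c) * exp (- x * (1 + c)))" for x
        unfolding E exp_add[symmetric] by (simp add: algebra_simps)
      then show ?thesis using c
        by (subst nn_integral_density) (auto simp: exponential_density_def ennreal_mult[symmetric] intro!: nn_integral_cong)
    qed
    also have "\<dots> = ennreal (1 / (1 + c)) * emeasure (density lborel (exponential_density (1 + c))) UNIV"
      by (subst nn_integral_cmult) (auto simp: emeasure_density)
    also have "emeasure (density lborel (exponential_density (1 + c))) UNIV = 1"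
      using prob_space.emeasure_space_1[OF prob_space_exponential_density[of "1 + c"]] c by simp
    finally show ?thesis by simp
  qed
  finally show ?thesis .
qed

lemma nn_integral_Clocks_reindex:
  assumes "inj f" and [measurable]: "g \<in> borel_measurable Clocks"
  shows "(\<integral>\<^sup>+e. g (\<lambda>j. e (f j)) \<partial>Clocks) = (\<integral>\<^sup>+e. g e \<partial>Clocks)"
proof -
  have [measurable]: "(\<lambda>e j. e (f j)) \<in> measurable Clocks Clocks" by (rule measurable_ClocksI) simp
  have "Clocks = distr Clocks Clocks (\<lambda>e j. e (f j))"
    using distr_PiM_reindex[of UNIV "\<lambda>_. Exp1" f UNIV] assms(1) prob_space_Exp1 by (simp add: Clocks_def restrict_def)
  then have "(\<integral>\<^sup>+e. g e \<partial>Clocks) = (\<integral>\<^sup>+e. g e \<partial>distr Clocks Clocks (\<lambda>e j. e (f j)))" by simp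
  also have "\<dots> = (\<integral>\<^sup>+e. g (\<lambda>j. e (f j)) \<partial>Clocks)" by (subst nn_integral_distr) auto
  finally show ?thesis by simp
qed

text \<open>Memorylessness: given which of the two clocks at \<open>i\<close> rings first, the remaining clocks are again
  independent standard exponentials.\<close>

lemma nn_integral_shift:
  assumes c: "c > 0" and [measurable]: "g \<in> borel_measurable Clocks"
  shows "(\<integral>\<^sup>+e. indicator {e. c * e (i, s, 0) < e (i, \<not> s, 0)} e * g (shift i s c e) \<partial>Clocks) =
    ennreal (1 / (1 + c)) * (\<integral>\<^sup>+e. g e \<partial>Clocks)"
proof -
  interpret C: sigma_finite_measure Clocks by (rule sigma_finite_Clocks)
  let ?a = "(i, s, 0::nat)" and ?b = "(i, \<not> s, 0::nat)"
  \<comment> \<open>The map \<open>\<sigma>\<close> skips the clock that has rung, so that apart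
    from the two competitors the shifted clocks are an injective relabelling of the old
    ones.\<close>
  define \<sigma> where "\<sigma> = (\<lambda>(j, t, k). (j, t, if j = i \<and> t = s then Suc k else k))"
  have inj: "inj \<sigma>"
  proof (rule injI)
    fix x y assume "\<sigma> x = \<sigma> y"
    then show "x = y" by (cases x; cases y) (auto simp: \<sigma>_def split: if_split_asm)
  qed
  define h where "h z = (\<integral>\<^sup>+e. g (e(?b := z)) \<partial>Clocks)" for z
  have "(\<lambda>(z, e). g (e(?b := z))) \<in> borel_measurable (borel \<Otimes>\<^sub>M Clocks)"
    using measurable_compose[OF measurable_Clocks_upd[of ?b] assms(2)] by (simp add: case_prod_beta')
  then have [measurable]: "h \<in> borel_measurable borel"
    unfolding h_def by (rule C.borel_measurable_nn_integral)
  have [measurable]: "Measurable.pred Clocks (\<lambda>e. c * e (i, s, 0) < e (i, \<not> s, 0))" by measurable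
  let ?G = "\<lambda>e. indicator {e. c * e ?a < e ?b} e * g (shift i s c e)"
  have G: "?G \<in> borel_measurable Clocks"
  proof -
    have [measurable]: "(\<lambda>e. indicator {e. c * e ?a < e ?b} e :: ennreal) \<in> borel_measurable Clocks"
      by (rule borel_measurable_indicator') measurable
    have [measurable]: "(\<lambda>e. g (shift i s c e)) \<in> borel_measurable Clocks"
      by (rule measurable_compose[OF measurable_shift assms(2)])
    show ?thesis by measurable
  qed
  have "(\<integral>\<^sup>+e. ?G e \<partial>Clocks) = (\<integral>\<^sup>+x. (\<integral>\<^sup>+e. ?G (e(?a := x)) \<partial>Clocks) \<partial>Exp1)"
    by (rule nn_integral_Clocks_upd[OF G])
  also have "\<dots> = (\<integral>\<^sup>+x. (\<integral>\<^sup>+y. (\<integral>\<^sup>+e. ?G (e(?b := y, ?a := x)) \<partial>Clocks) \<partial>Exp1) \<partial>Exp1)"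
    by (intro nn_integral_cong nn_integral_Clocks_upd measurable_compose[OF measurable_Clocks_upd_const G])
  also have "\<dots> = (\<integral>\<^sup>+x. (\<integral>\<^sup>+y. indicator {c * x<..} y * h (y - c * x) \<partial>Exp1) \<partial>Exp1)"
  proof (intro nn_integral_cong)
    fix x y
    have "shift i s c (e(?b := y, ?a := x)) = (\<lambda>j. e (\<sigma> j))(?b := y - c * x)" for e
      by (rule ext) (auto simp: shift_def \<sigma>_def split: if_splits)
    then have "(\<integral>\<^sup>+e. ?G (e(?b := y, ?a := x)) \<partial>Clocks) =
        (\<integral>\<^sup>+e. indicator {c * x<..} y * g ((\<lambda>j. e (\<sigma> j))(?b := y - c * x)) \<partial>Clocks)"
      by (intro nn_integral_cong) (auto simp: indicator_def)
    also have "\<dots> = indicator {c * x<..} y * (\<integral>\<^sup>+e. g ((\<lambda>j. e (\<sigma> j))(?b := y - c * x)) \<partial>Clocks)"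
    proof (rule nn_integral_cmult)
      have "(\<lambda>e j. e (\<sigma> j)) \<in> measurable Clocks Clocks" by (rule measurable_ClocksI) simp
      then show "(\<lambda>e. g ((\<lambda>j. e (\<sigma> j))(?b := y - c * x))) \<in> borel_measurable Clocks"
        by (intro measurable_compose[OF measurable_compose[OF _ measurable_Clocks_upd_const] assms(2)])
    qed
    also have "(\<integral>\<^sup>+e. g ((\<lambda>j. e (\<sigma> j))(?b := y - c * x)) \<partial>Clocks) = h (y - c * x)"
      unfolding h_def
      by (rule nn_integral_Clocks_reindex[OF inj, of "\<lambda>e. g (e(?b := y - c * x))"])
        (rule measurable_compose[OF measurable_Clocks_upd_const assms(2)])
    finally show "(\<integral>\<^sup>+e. ?G (e(?b := y, ?a := x)) \<partial>Clocks) = indicator {c * x<..} y * h (y - c * x)" .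
  qed
  also have "\<dots> = ennreal (1 / (1 + c)) * (\<integral>\<^sup>+z. h z \<partial>Exp1)"
    by (rule nn_integral_exponential_race[OF c]) measurable
  also have "(\<integral>\<^sup>+z. h z \<partial>Exp1) = (\<integral>\<^sup>+e. g e \<partial>Clocks)"
    unfolding h_def by (rule nn_integral_Clocks_upd[symmetric]) (rule assms(2))
  finally show ?thesis .
qed

text \<open>With the other clocks fixed, a tie pins one exponential variable to a single
  value.\<close>

lemma AE_Clocks_no_tie: "AE e in Clocks. c * e (i, s, 0) \<noteq> e (i, \<not> s, 0)"
proof -
  let ?a = "(i, s, 0::nat)" and ?b = "(i, \<not> s, 0::nat)"
  have "{e \<in> space Clocks. c * e ?a = e ?b} \<in> sets Clocks" by (rule borel_measurable_eq) measurable
  then have "Measurable.pred Clocks (\<lambda>e. c * e ?a = e ?b)" by (simp add: pred_def)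
  then have meas: "(\<lambda>e. indicator {e. c * e ?a = e ?b} e :: ennreal) \<in> borel_measurable Clocks" by measurable
  have "emeasure Clocks {e. c * e ?a = e ?b} = (\<integral>\<^sup>+e. indicator {e. c * e ?a = e ?b} e \<partial>Clocks)"
  proof (rule nn_integral_indicator[symmetric])
    have "{e \<in> space Clocks. c * e ?a = e ?b} \<in> sets Clocks" by measurable
    then show "{e. c * e ?a = e ?b} \<in> sets Clocks" by simp
  qed
  also have "\<dots> = (\<integral>\<^sup>+x. (\<integral>\<^sup>+e. indicator {e. c * e ?a = e ?b} (e(?b := x)) \<partial>Clocks) \<partial>Exp1)"
    by (rule nn_integral_Clocks_upd) (rule meas)
  also have "\<dots> = (\<integral>\<^sup>+e. (\<integral>\<^sup>+x. indicator {e. c * e ?a = e ?b} (e(?b := x)) \<partial>Exp1) \<partial>Clocks)"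
  proof -
    interpret E: prob_space Exp1 by (rule prob_space_Exp1)
    interpret C: prob_space Clocks by (rule prob_space_Clocks)
    interpret P: pair_sigma_finite Exp1 Clocks by unfold_locales
    have "(\<lambda>(x, e). e(?b := x)) \<in> measurable (Exp1 \<Otimes>\<^sub>M Clocks) Clocks"
      using measurable_Clocks_upd[of ?b] by (simp cong: measurable_cong_sets)
    from measurable_compose[OF this meas] show ?thesis by (intro P.Fubini'[symmetric]) (simp add: case_prod_beta')
  qed
  also have "\<dots> = (\<integral>\<^sup>+e. 0 \<partial>Clocks)"
  proof (intro nn_integral_cong)
    fix e :: clocks
    have "(\<integral>\<^sup>+x. indicator {e. c * e ?a = e ?b} (e(?b := x)) \<partial>Exp1) = (\<integral>\<^sup>+x. indicator {c * e ?a} x \<partial>Exp1)"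
      by (intro nn_integral_cong) (auto simp: indicator_def)
    also have "\<dots> = emeasure Exp1 {c * e ?a}" by simp
    also have "\<dots> = 0"
      by (subst emeasure_density) (auto intro!: nn_integral_0_iff_AE[THEN iffD2] AE_I'[where N = "{c * e ?a}"] simp: indicator_def)
    finally show "(\<integral>\<^sup>+x. indicator {e. c * e ?a = e ?b} (e(?b := x)) \<partial>Exp1) = 0" .
  qed
  finally have "emeasure Clocks {e. c * e ?a = e ?b} = 0" by simp
  then show ?thesis
    by (intro AE_I[where N = "{e. c * e ?a = e ?b}"])
      (use borel_measurable_eq[of "\<lambda>e. c * e ?a" Clocks "\<lambda>e. e ?b"] in auto)
qed

section \<open>The walk driven by the clocks\<close>

definition ring_ratio :: "(nat \<Rightarrow> int) \<Rightarrow> bool \<Rightarrow> nat \<Rightarrow> real" where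
  "ring_ratio q s n = real (loc q n (q n - dir s)) / real (loc q n (q n + dir s))"

text \<open>The path is a separate argument, not the walk itself, so that it can be held fixed while
  the clocks are integrated out.\<close>

fun residual :: "(nat \<Rightarrow> int) \<Rightarrow> clocks \<Rightarrow> nat \<Rightarrow> clocks" where
  "residual q e 0 = e"
| "residual q e (Suc n) = shift (q n) (q (Suc n) = q n + 1) (ring_ratio q (q (Suc n) = q n + 1) n) (residual q e n)"

definition goes_right :: "(nat \<Rightarrow> int) \<Rightarrow> nat \<Rightarrow> clocks \<Rightarrow> bool" where
  "goes_right q n f \<longleftrightarrow> f (q n, True, 0) / loc q n (q n + 1) < f (q n, False, 0) / loc q n (q n - 1)"

definition follows :: "int \<Rightarrow> (nat \<Rightarrow> int) \<Rightarrow> nat \<Rightarrow> clocks \<Rightarrow> bool" where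
  "follows v q n e \<longleftrightarrow> q 0 = v \<and>
     (\<forall>m<n. q (Suc m) = (if goes_right q m (residual q e m) then q m + 1 else q m - 1))"

text \<open>The rule for the next step consults the whole past, hence the recursion builds paths;
  \<open>walk\<close> reads off the diagonal.\<close>

fun run :: "int \<Rightarrow> clocks \<Rightarrow> nat \<Rightarrow> (nat \<Rightarrow> int)" where
  "run v e 0 = (\<lambda>_. v)"
| "run v e (Suc n) = (run v e n)(Suc n :=
     (if goes_right (run v e n) n (residual (run v e n) e n) then run v e n n + 1 else run v e n n - 1))"

definition walk :: "int \<Rightarrow> clocks \<Rightarrow> nat \<Rightarrow> int" where "walk v e n = run v e n n"

lemma ring_ratio_cong: "(\<And>i. i \<le> n \<Longrightarrow> p i = q i) \<Longrightarrow> ring_ratio p s n = ring_ratio q s n"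
  using loc_cong[of n p q] by (simp add: ring_ratio_def)

lemma residual_cong: "(\<And>i. i \<le> n \<Longrightarrow> p i = q i) \<Longrightarrow> residual p e n = residual q e n"
proof (induction n)
  case (Suc n)
  then show ?case using ring_ratio_cong[of n p q] by auto
qed simp

lemma goes_right_cong: "(\<And>i. i \<le> n \<Longrightarrow> p i = q i) \<Longrightarrow> goes_right p n f = goes_right q n f"
  using loc_cong[of n p q] by (simp add: goes_right_def)

lemma run_eq: "i \<le> n \<Longrightarrow> run v e n i = walk v e i"
proof (induction n)
  case (Suc n)
  then show ?case by (cases "i = Suc n") (auto simp: walk_def)
qed (simp add: walk_def)

lemma walk_0 [simp]: "walk v e 0 = v"
  by (simp add: walk_def)

lemma walk_Suc: "walk v e (Suc n) = (if goes_right (walk v e) n (residual (walk v e) e n) then walk v e n + 1 else walk v e n - 1)"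
proof -
  have "goes_right (run v e n) n f = goes_right (walk v e) n f" for f by (rule goes_right_cong) (rule run_eq)
  moreover have "residual (run v e n) e n = residual (walk v e) e n" by (rule residual_cong) (rule run_eq)
  ultimately show ?thesis by (simp add: walk_def)
qed

lemma nn_walk: "unit_steps (walk v e)"
  by (auto simp: unit_steps_def walk_Suc)

lemma follows_iff: "follows v q n e \<longleftrightarrow> (\<forall>i\<le>n. walk v e i = q i)"
proof (induction n)
  case 0 then show ?case by (auto simp: follows_def)
next
  case (Suc n)
  have *: "follows v q (Suc n) e \<longleftrightarrow> follows v q n e \<and>
      q (Suc n) = (if goes_right q n (residual q e n) then q n + 1 else q n - 1)"
    by (auto simp: follows_def less_Suc_eq)
  show ?case
  proof (cases "follows v q n e")
    case True
    with Suc have eq: "\<And>i. i \<le> n \<Longrightarrow> walk v e i = q i" by simp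
    have "goes_right (walk v e) n f = goes_right q n f" for f by (rule goes_right_cong) (rule eq)
    moreover have "residual (walk v e) e n = residual q e n" by (rule residual_cong) (rule eq)
    ultimately show ?thesis using * eq True by (auto simp: walk_Suc le_Suc_eq)
  qed (use * Suc in auto)
qed

lemma measurable_residual [measurable]: "(\<lambda>e. residual q e n) \<in> measurable Clocks Clocks"
proof (induction n)
  case 0
  have "(\<lambda>e. e) \<in> measurable Clocks Clocks" by simp
  then show ?case by simp
next
  case (Suc n)
  show ?case using measurable_compose[OF Suc measurable_shift] by simp
qed

lemma sets_goes_right [measurable]: "Measurable.pred Clocks (goes_right q n)"
  unfolding goes_right_def by measurable

lemma sets_follows [measurable]: "Measurable.pred Clocks (follows v q n)"
  unfolding follows_def
  by (intro pred_intros_logic pred_intros_finite pred_intros_countable)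
    (use measurable_compose[OF measurable_residual sets_goes_right] in \<open>auto split: if_splits simp: measurable_If\<close>)

text \<open>Memorylessness at each step: the race between the two front clocks at \<open>q n\<close>
  has the prescribed winner with the step probability and leaves fresh clocks. The test function
  \<open>g\<close> of the residual clocks encodes their independence of the past.\<close>

lemma nn_integral_follows:
  assumes [measurable]: "g \<in> borel_measurable Clocks"
  shows "(\<integral>\<^sup>+e. indicator {e. follows v q n e} e * g (residual q e n) \<partial>Clocks) = ennreal (path_weight v n q) * (\<integral>\<^sup>+e. g e \<partial>Clocks)"
  using assms
proof (induction n arbitrary: g)
  case 0
  show ?case by (cases "q 0 = v") (auto simp: follows_def)
next
  case (Suc n)
  note [measurable] = Suc.prems
  have fol: "follows v q (Suc n) e \<longleftrightarrow> follows v q n e \<and>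
      q (Suc n) = (if goes_right q n (residual q e n) then q n + 1 else q n - 1)" for e
    by (auto simp: follows_def less_Suc_eq)
  show ?case
  proof (cases "q (Suc n) = q n + 1 \<or> q (Suc n) = q n - 1")
    case False
    then have "{e. follows v q (Suc n) e} = {}" using fol by auto
    with False show ?thesis by (simp add: step_prob_def)
  next
    case True
    define s where "s = (q (Suc n) = q n + 1)"
    have qs: "q (Suc n) = q n + dir s" using True by (auto simp: s_def dir_def)
    define c where "c = ring_ratio q s n"
    have c: "c > 0" by (simp add: c_def ring_ratio_def)
    define D where "D f \<longleftrightarrow> c * f (q n, s, 0) < f (q n, \<not> s, 0)" for f :: clocks
    have [measurable]: "Measurable.pred Clocks D" unfolding D_def by measurable
    define h where "h f = indicator {f. D f} f * g (shift (q n) s c f)" for f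
    have [measurable]: "h \<in> borel_measurable Clocks" unfolding h_def by measurable
    have posl: "0 < real (loc q n v)" for v by simp
    have Dr: "D f \<longleftrightarrow> (s \<longleftrightarrow> goes_right q n f)" if "c * f (q n, s, 0) \<noteq> f (q n, \<not> s, 0)" for f
    proof (cases s)
      case True
      then show ?thesis using posl
        by (simp add: D_def goes_right_def c_def ring_ratio_def field_simps)
    next
      case False
      have "(f (q n, True, 0) / loc q n (q n + 1) < f (q n, False, 0) / loc q n (q n - 1)) \<longleftrightarrow>
        f (q n, True, 0) < c * f (q n, False, 0)"
        using False posl by (simp add: c_def ring_ratio_def field_simps)
      then show ?thesis using False that by (auto simp: D_def goes_right_def)
    qed
    \<comment> \<open>Ties go to the left in \<open>goes_right\<close>, while \<open>D\<close> is
      strict for both sides; the two descriptions differ on a null set.\<close>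
    have AEh: "AE e in Clocks. indicator {e. follows v q n e} e * (indicator {f. s \<longleftrightarrow> goes_right q n f} (residual q e n) * g (shift (q n) s c (residual q e n)))
       = indicator {e. follows v q n e} e * h (residual q e n)"
    proof -
      let ?T = "{f. c * f (q n, s, 0) = f (q n, \<not> s, 0)}"
      have T [measurable]: "?T \<in> sets Clocks"
        using borel_measurable_eq[of "\<lambda>f. c * f (q n, s, 0)" Clocks "\<lambda>f. f (q n, \<not> s, 0)"] by auto
      have "(\<integral>\<^sup>+e. indicator {e. follows v q n e} e * indicator ?T (residual q e n) \<partial>Clocks) = ennreal (path_weight v n q) * (\<integral>\<^sup>+e. indicator ?T e \<partial>Clocks)"
        by (rule Suc.IH) measurable
      also have "(\<integral>\<^sup>+e. indicator ?T e \<partial>Clocks) = 0"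
        using AE_Clocks_no_tie[of c "q n" s] by (subst nn_integral_0_iff_AE) (auto elim!: eventually_mono)
      finally have "AE e in Clocks. indicator {e. follows v q n e} e * indicator ?T (residual q e n) = (0::ennreal)"
        by (subst (asm) mult_zero_right, subst (asm) nn_integral_0_iff_AE) auto
      then show ?thesis
      proof eventually_elim
        case (elim e)
        then show ?case using Dr[of "residual q e n"] by (auto simp: indicator_def h_def)
      qed
    qed
    have "(\<integral>\<^sup>+e. indicator {e. follows v q (Suc n) e} e * g (residual q e (Suc n)) \<partial>Clocks) =
      (\<integral>\<^sup>+e. indicator {e. follows v q n e} e * (indicator {f. s \<longleftrightarrow> goes_right q n f} (residual q e n) * g (shift (q n) s c (residual q e n))) \<partial>Clocks)"
      using qs by (intro nn_integral_cong) (auto simp: fol indicator_def s_def c_def dir_def)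
    also have "\<dots> = (\<integral>\<^sup>+e. indicator {e. follows v q n e} e * h (residual q e n) \<partial>Clocks)"
      by (rule nn_integral_cong_AE) (rule AEh)
    also have "\<dots> = ennreal (path_weight v n q) * (\<integral>\<^sup>+e. h e \<partial>Clocks)" by (rule Suc.IH) measurable
    also have "(\<integral>\<^sup>+e. h e \<partial>Clocks) = ennreal (1 / (1 + c)) * (\<integral>\<^sup>+e. g e \<partial>Clocks)"
      unfolding h_def D_def by (rule nn_integral_shift[OF c]) measurable
    also have "1 / (1 + c) = step_prob q n (q (Suc n))"
      unfolding qs using posl by (cases s) (simp_all add: c_def ring_ratio_def step_prob_def field_simps)
    finally show ?thesis by (simp add: ennreal_mult mult.assoc)
  qed
qed

lemma walk_in_prefixes: "\<exists>q\<in>walk_prefixes v n. \<forall>i\<le>n. walk v e i = q i"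
proof (induction n)
  case (Suc n)
  then obtain q where q: "q \<in> walk_prefixes v n" "\<And>i. i \<le> n \<Longrightarrow> walk v e i = q i" by auto
  let ?q = "q(Suc n := walk v e (Suc n))"
  have "?q \<in> walk_prefixes v (Suc n)" using q by (auto simp: walk_Suc)
  moreover have "\<forall>i\<le>Suc n. walk v e i = ?q i" using q by (auto simp: le_Suc_eq)
  ultimately show ?case by blast
qed simp

lemma vrrw_law_walk: "vrrw_law Clocks (\<lambda>n e. walk v e n) v"
proof -
  interpret C: prob_space Clocks by (rule prob_space_Clocks)
  have fol: "{e. \<forall>i\<le>n. walk v e i = q i} \<in> sets Clocks" for n q
    using sets_follows[of v q n] by (simp add: follows_iff[symmetric] pred_def)
  show ?thesis
  proof
    fix n
    show "(\<lambda>e. walk v e n) \<in> measurable Clocks (count_space UNIV)"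
    proof (rule measurable_count_space_eq_countable[THEN iffD2])
      have "(\<lambda>e. walk v e n) -` {y} \<inter> space Clocks =
         (\<Union>q\<in>{q\<in>walk_prefixes v n. q n = y}. {e. \<forall>i\<le>n. walk v e i = q i})" for y
      proof -
        have "walk v e n = y \<longleftrightarrow> (\<exists>q\<in>walk_prefixes v n. q n = y \<and> (\<forall>i\<le>n. walk v e i = q i))" for e
          using walk_in_prefixes[of v n e] by (metis order_refl)
        then show ?thesis by auto
      qed
      moreover have "\<dots> y \<in> sets Clocks" for y
        using fol finite_prefixes by (intro sets.finite_UN) auto
      ultimately show "(\<lambda>e. walk v e n) \<in> space Clocks \<rightarrow> UNIV \<and> (\<forall>a\<in>UNIV. (\<lambda>e. walk v e n) -` {a} \<inter> space Clocks \<in> sets Clocks)"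
        by simp
    qed simp
  next
    fix n and p :: "nat \<Rightarrow> int"
    have "emeasure Clocks {e. follows v p n e} = (\<integral>\<^sup>+e. indicator {e. follows v p n e} e * 1 \<partial>Clocks)"
      using fol[of n p] by (simp add: follows_iff)
    also have "\<dots> = ennreal (path_weight v n p)"
      using nn_integral_follows[of "\<lambda>_. 1" v p n] C.emeasure_space_1 by simp
    finally show "C.prob {e \<in> space Clocks. \<forall>i\<le>n. walk v e i = p i} = path_weight v n p"
      by (simp add: C.emeasure_eq_measure follows_iff)
  qed
qed

section \<open>Coupling by a delayed alarm\<close>

definition cnt :: "(nat \<Rightarrow> int) \<Rightarrow> int \<Rightarrow> bool \<Rightarrow> nat \<Rightarrow> nat" where
  "cnt q i s n = (\<Sum>m<n. of_bool (q m = i \<and> q (Suc m) = i + dir s))"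

lemma cnt_0 [simp]: "cnt q i s 0 = 0"
  by (simp add: cnt_def)

lemma cnt_Suc: "cnt q i s (Suc n) = cnt q i s n + of_bool (q n = i \<and> q (Suc n) = i + dir s)"
  by (simp add: cnt_def)

lemma cnt_mono: "m \<le> n \<Longrightarrow> cnt q i s m \<le> cnt q i s n"
  by (rule lift_Suc_mono_le[of "cnt q i s"]) (auto simp: cnt_Suc)

lemma cnt_jump:
  assumes "j < cnt q i s n"
  shows "\<exists>t<n. q t = i \<and> q (Suc t) = i + dir s \<and> cnt q i s t = j"
  using assms
proof (induction n)
  case (Suc n)
  show ?case
  proof (cases "j < cnt q i s n")
    case True
    with Suc.IH show ?thesis using less_Suc_eq by auto
  next
    case False
    with Suc.prems have "q n = i \<and> q (Suc n) = i + dir s \<and> cnt q i s n = j"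
      by (cases "q n = i \<and> q (Suc n) = i + dir s") (auto simp: cnt_Suc)
    then show ?thesis by blast
  qed
qed simp

lemma loc_eq_cnt: "unit_steps q \<Longrightarrow> loc q n j = 1 + cnt q j True n + cnt q j False n + of_bool (q n = j)"
proof (induction n)
  case 0 then show ?case by (simp add: loc_0)
next
  case (Suc n)
  then show ?case using unit_steps_cases[OF Suc.prems, of n] by (auto simp: loc_Suc cnt_Suc)
qed

text \<open>Crossings of an edge alternate in direction, so the two counts differ only by the change
  of side.\<close>

lemma cnt_crossing:
  "unit_steps q \<Longrightarrow> cnt q i True n + of_bool (i < q 0) = cnt q (i + 1) False n + of_bool (i < q n)"
proof (induction n)
  case (Suc n)
  then show ?case using unit_steps_cases[OF Suc.prems, of n] by (auto simp: cnt_Suc split: if_splits)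
qed simp

text \<open>Without a jump from \<open>i\<close> to that side the walk cannot get there. This is why
  the rate of a pending alarm stays constant.\<close>

lemma loc_frozen:
  assumes unit_steps: "unit_steps q" and at: "(q m - i) * dir s \<le> 0" and "m \<le> n" "cnt q i s m = cnt q i s n"
  shows "loc q n (i + dir s) = loc q m (i + dir s) \<and> (q n - i) * dir s \<le> 0"
  using assms(3,4)
proof (induction n rule: dec_induct)
  case base show ?case using at by simp
next
  case (step n)
  have c: "cnt q i s m \<le> cnt q i s n" "cnt q i s n \<le> cnt q i s (Suc n)"
    using step.hyps by (auto intro: cnt_mono)
  with step.prems have eq: "cnt q i s m = cnt q i s n" "\<not> (q n = i \<and> q (Suc n) = i + dir s)"
    by (auto simp: cnt_Suc)
  from step.IH[OF eq(1)] have IH: "loc q n (i + dir s) = loc q m (i + dir s)" "(q n - i) * dir s \<le> 0" by auto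
  have "q (Suc n) \<noteq> i + dir s \<and> (q (Suc n) - i) * dir s \<le> 0"
    using unit_steps_cases[OF unit_steps, of n] IH(2) eq(2) by (cases s) auto
  then show ?case using IH(1) by (simp add: loc_Suc)
qed

text \<open>The local time at the neighbour of \<open>i\<close> on side \<open>s\<close> while the alarm number \<open>k\<close> on that side is
  pending; meaningless if that alarm is never reached.\<close>

definition zeta :: "(nat \<Rightarrow> int) \<Rightarrow> int \<Rightarrow> bool \<Rightarrow> nat \<Rightarrow> nat" where
  "zeta q i s k = loc q (LEAST n. q n = i \<and> cnt q i s n = k) (i + dir s)"

lemma zeta_eq:
  assumes "unit_steps q" "q n = i"
  shows "zeta q i s (cnt q i s n) = loc q n (i + dir s)"
proof -
  let ?P = "\<lambda>m. q m = i \<and> cnt q i s m = cnt q i s n"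
  define m where "m = (LEAST m. ?P m)"
  have m: "?P m" unfolding m_def by (rule LeastI[of ?P n]) (use assms in simp)
  have "m \<le> n" unfolding m_def by (rule Least_le) (use assms in simp)
  then have "loc q n (i + dir s) = loc q m (i + dir s)"
    using loc_frozen[OF assms(1), of m i s n] m by simp
  then show ?thesis by (simp add: zeta_def m_def)
qed

lemma zeta_Suc_le:
  assumes "unit_steps p" "Suc j \<le> cnt p i s n" "p m = i" "cnt p i s m = Suc j"
  shows "zeta p i s j + 1 \<le> zeta p i s (Suc j)"
proof -
  obtain t where t: "t < n" "p t = i" "p (Suc t) = i + dir s" "cnt p i s t = j"
    using cnt_jump[of j p i s n] assms(2) by auto
  have "Suc t \<le> m"
  proof (rule ccontr)
    assume "\<not> Suc t \<le> m"
    then have "cnt p i s m \<le> cnt p i s t" by (intro cnt_mono) simp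
    then show False using t assms by simp
  qed
  then have "loc p t (i + dir s) + 1 \<le> loc p m (i + dir s)"
    using loc_mono[of "Suc t" m p "i + dir s"] t by (simp add: loc_Suc)
  then show ?thesis using zeta_eq[OF assms(1) t(2), of s] zeta_eq[OF assms(1,3), of s] t assms by simp
qed

text \<open>The reading of the local clock of \<open>i\<close> when the \<open>k\<close>-th alarm on
  side \<open>s\<close> rings, each waiting time being \<open>e\<close> divided by the rate.\<close>

definition alarm :: "clocks \<Rightarrow> (nat \<Rightarrow> int) \<Rightarrow> int \<Rightarrow> bool \<Rightarrow> nat \<Rightarrow> real" where
  "alarm e q i s k = (\<Sum>j<k. e (i, s, j) / zeta q i s j)"

text \<open>The walk takes its next step from \<open>i\<close> to the side whose alarm rings first, on a clock that
  runs only while the walk is at \<open>i\<close>.\<close>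

definition rubin :: "clocks \<Rightarrow> (nat \<Rightarrow> int) \<Rightarrow> bool" where
  "rubin e q \<longleftrightarrow> unit_steps q \<and> (\<forall>n. q (Suc n) = q n + 1 \<longleftrightarrow>
     alarm e q (q n) True (Suc (cnt q (q n) True n)) < alarm e q (q n) False (Suc (cnt q (q n) False n)))"

lemma alarm_Suc_cnt:
  assumes "unit_steps q" "q n = i"
  shows "alarm e q i s (Suc (cnt q i s n)) = alarm e q i s (cnt q i s n) + e (i, s, cnt q i s n) / loc q n (i + dir s)"
  by (simp add: alarm_def zeta_eq[OF assms])

text \<open>Links the memoryless description to the alarms: \<open>clk i\<close> is the reading of
  the local clock of \<open>i\<close>. By the last clause it equals the latest alarm on side
  \<open>s\<close> while the walk is on that side, so the next alarm there has no elapsed time to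
  convert when its rate changes.\<close>

lemma residual_walk:
  fixes v :: int and e :: clocks
  defines "q \<equiv> walk v e"
  shows "\<exists>clk. \<forall>i s. (\<forall>k. residual q e n (i, s, Suc k) = e (i, s, Suc (cnt q i s n + k))) \<and>
     residual q e n (i, s, 0) = e (i, s, cnt q i s n) - (clk i - alarm e q i s (cnt q i s n)) * loc q n (i + dir s) \<and>
     ((q n - i) * dir s > 0 \<longrightarrow> clk i = alarm e q i s (cnt q i s n))"
proof (induction n)
  case 0
  show ?case by (intro exI[of _ "\<lambda>_. 0"]) (simp add: alarm_def)
next
  case (Suc n)
  have unit_steps: "unit_steps q" unfolding q_def by (rule nn_walk)
  from Suc obtain clk where
    tail: "\<And>i s k. residual q e n (i, s, Suc k) = e (i, s, Suc (cnt q i s n + k))" and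
    head: "\<And>i s. residual q e n (i, s, 0) = e (i, s, cnt q i s n) - (clk i - alarm e q i s (cnt q i s n)) * loc q n (i + dir s)" and
    clk: "\<And>i s. (q n - i) * dir s > 0 \<Longrightarrow> clk i = alarm e q i s (cnt q i s n)" by metis
  define i where "i = q n"
  define s where "s = (q (Suc n) = i + 1)"
  have qs: "q (Suc n) = i + dir s" using unit_steps_cases[OF unit_steps, of n] by (auto simp: s_def i_def dir_def)
  have cs: "cnt q i s (Suc n) = Suc (cnt q i s n)" "cnt q i (\<not> s) (Suc n) = cnt q i (\<not> s) n"
    using qs by (auto simp: cnt_Suc i_def dir_def)
  have cj: "cnt q j t (Suc n) = cnt q j t n" if "j \<noteq> i" for j t using that by (simp add: cnt_Suc i_def)
  have res: "residual q e (Suc n) = shift i s (ring_ratio q s n) (residual q e n)"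
    by (simp add: i_def s_def)
  note residual.simps [simp del]
  define A where "A = alarm e q i s (Suc (cnt q i s n))"
  have pos: "real (loc q n v) > 0" for v by simp
  have A: "residual q e n (i, s, 0) = (A - clk i) * loc q n (i + dir s)"
    unfolding head A_def alarm_Suc_cnt[OF unit_steps i_def[symmetric]] using pos by (simp add: field_simps)
  show ?case
  proof (intro exI[of _ "clk(i := A)"] allI conjI impI)
    fix j t k
    show "residual q e (Suc n) (j, t, Suc k) = e (j, t, Suc (cnt q j t (Suc n) + k))"
      using cs cj[of j t] tail by (cases "j = i"; cases s; cases t) (auto simp: res shift_def)
    show "residual q e (Suc n) (j, t, 0) = e (j, t, cnt q j t (Suc n)) -
      ((clk(i := A)) j - alarm e q j t (cnt q j t (Suc n))) * loc q (Suc n) (j + dir t)"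
    proof (cases "j = i")
      case True
      show ?thesis
      proof (cases "t = s")
        case True
        with \<open>j = i\<close> show ?thesis using cs tail[of i s 0] by (simp add: res shift_def A_def)
      next
        case False
        then have t: "t = (\<not> s)" by auto
        have l: "loc q (Suc n) (i + dir t) = loc q n (i + dir t)" using qs t by (cases s) (auto simp: loc_Suc)
        have r: "ring_ratio q s n = loc q n (i + dir t) / loc q n (i + dir s)"
          by (simp add: ring_ratio_def i_def t)
        have "residual q e (Suc n) (i, t, 0) = residual q e n (i, t, 0) - ring_ratio q s n * residual q e n (i, s, 0)"
          using False by (simp add: res shift_def)
        also have "\<dots> = residual q e n (i, t, 0) - (A - clk i) * loc q n (i + dir t)"
          unfolding A r using pos[of "i + dir s"] by simp
        also have "\<dots> = e (i, t, cnt q i t n) - (A - alarm e q i t (cnt q i t n)) * loc q n (i + dir t)"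
          unfolding head by (simp add: algebra_simps)
        finally show ?thesis using \<open>j = i\<close> cs t l by simp
      qed
    next
      case False
      have r: "residual q e (Suc n) (j, t, 0) = residual q e n (j, t, 0)" using False by (simp add: res shift_def)
      show ?thesis
      proof (cases "q (Suc n) = j + dir t")
        case True
        have "(q n - j) * dir t > 0"
          using True qs False by (cases s; cases t) (auto simp: i_def)
        from clk[OF this] show ?thesis using False r cj[OF False] head by simp
      next
        case False2: False
        then have "loc q (Suc n) (j + dir t) = loc q n (j + dir t)" by (simp add: loc_Suc)
        then show ?thesis using False r cj[OF False] head by simp
      qed
    qed
    show "(clk(i := A)) j = alarm e q j t (cnt q j t (Suc n))" if "(q (Suc n) - j) * dir t > 0"
    proof (cases "j = i")
      case True
      then have "t = s" using that qs by (cases s; cases t) auto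
      with True show ?thesis using cs by (simp add: A_def)
    next
      case False
      then have "(q n - j) * dir t > 0"
        using that qs by (cases s; cases t) (auto simp: i_def)
      with clk False cj[OF False] show ?thesis by simp
    qed
  qed
qed

lemma rubin_walk: "rubin e (walk v e)"
proof -
  let ?q = "walk v e"
  have unit_steps: "unit_steps ?q" by (rule nn_walk)
  have "?q (Suc n) = ?q n + 1 \<longleftrightarrow>
     alarm e ?q (?q n) True (Suc (cnt ?q (?q n) True n)) < alarm e ?q (?q n) False (Suc (cnt ?q (?q n) False n))" for n
  proof -
    define i where "i = ?q n"
    obtain clk where head: "\<And>i s. residual ?q e n (i, s, 0) = e (i, s, cnt ?q i s n) - (clk i - alarm e ?q i s (cnt ?q i s n)) * loc ?q n (i + dir s)"
      using residual_walk[of v e n] by metis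
    have *: "residual ?q e n (i, s, 0) / loc ?q n (i + dir s) = alarm e ?q i s (Suc (cnt ?q i s n)) - clk i" for s
      unfolding head alarm_Suc_cnt[OF unit_steps i_def[symmetric]] by (simp add: diff_divide_distrib)
    have "?q (Suc n) = ?q n + 1 \<longleftrightarrow> goes_right ?q n (residual ?q e n)" by (simp add: walk_Suc)
    also have "\<dots> \<longleftrightarrow> alarm e ?q i True (Suc (cnt ?q i True n)) - clk i < alarm e ?q i False (Suc (cnt ?q i False n)) - clk i"
      using *[of True] *[of False] by (simp add: goes_right_def i_def)
    finally show ?thesis by (simp add: i_def)
  qed
  with unit_steps show ?thesis by (simp add: rubin_def)
qed

lemma alarm_mono: "(\<And>j. 0 \<le> e j) \<Longrightarrow> k \<le> l \<Longrightarrow> alarm e q i s k \<le> alarm e q i s l"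
  unfolding alarm_def by (intro sum_mono2) auto

text \<open>This and its left counterpart turn an observed jump into an inequality between the two
  alarm sequences of the site. Ties go to the left: strict here, weak there.\<close>

lemma rubin_right:
  assumes "rubin e q" "\<And>j. 0 \<le> e j" "q t = i" "q (Suc t) = i + 1" "cnt q i False t < k"
  shows "alarm e q i True (Suc (cnt q i True t)) < alarm e q i False k"
proof -
  have "alarm e q i True (Suc (cnt q i True t)) < alarm e q i False (Suc (cnt q i False t))"
    using assms(1,3,4) by (auto simp: rubin_def)
  also have "\<dots> \<le> alarm e q i False k" using assms(2,5) by (intro alarm_mono) auto
  finally show ?thesis .
qed

lemma rubin_left:
  assumes "rubin e q" "\<And>j. 0 \<le> e j" "q t = i" "q (Suc t) = i - 1" "cnt q i True t < k"
  shows "alarm e q i False (Suc (cnt q i False t)) \<le> alarm e q i True k"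
proof -
  have "q (Suc t) \<noteq> q t + 1" using assms(3,4) by simp
  then have "alarm e q i False (Suc (cnt q i False t)) \<le> alarm e q i True (Suc (cnt q i True t))"
    using assms(1,3) unfolding rubin_def by (metis not_less)
  also have "\<dots> \<le> alarm e q i True k" using assms(2,5) by (intro alarm_mono) auto
  finally show ?thesis .
qed

text \<open>Delaying the first left alarm at \<open>x\<close> makes the walk more inclined to go to the right everywhere:
  at equal numbers of jumps across an edge to the right, the local time on the right is larger, and
  symmetrically on the left. The induction is on the sum of the two running times.\<close>

locale coupling =
  fixes e e' :: clocks and q q' :: "nat \<Rightarrow> int" and x :: int and \<delta> :: real
  assumes rubin: "rubin e q" and rubin': "rubin e' q'" and start: "q 0 = q' 0"
    and pos: "\<And>j. 0 < e j" and \<delta>: "0 < \<delta>"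
    and e': "e' = e((x, False, 0) := e (x, False, 0) + \<delta>)"
begin

lemma unit_steps: "unit_steps q" and unit_steps': "unit_steps q'"
  using rubin rubin' by (auto simp: rubin_def)

lemma e_nonneg: "0 \<le> e j" and e'_nonneg: "0 \<le> e' j" and e_le: "e j \<le> e' j"
  using pos[of j] pos[of "(x, False, 0)"] \<delta> by (auto simp: e')

lemma e'_True: "e' (i, True, k) = e (i, True, k)"
  by (simp add: e')

definition ordered :: "nat \<Rightarrow> nat \<Rightarrow> bool" where
  "ordered n n' \<longleftrightarrow> (\<forall>i m m'. m \<le> n \<longrightarrow> m' \<le> n' \<longrightarrow> q m = i \<longrightarrow> q' m' = i \<longrightarrow>
     (cnt q i True m = cnt q' i True m' \<longrightarrow> loc q m (i + 1) \<le> loc q' m' (i + 1)) \<and>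
     (cnt q i False m = cnt q' i False m' \<longrightarrow> loc q' m' (i - 1) \<le> loc q m (i - 1)))"

text \<open>Values of \<open>zeta\<close> are meaningful only for alarms that become pending, so the
  comparisons carry this side condition up to the time considered.\<close>

definition reached :: "(nat \<Rightarrow> int) \<Rightarrow> int \<Rightarrow> bool \<Rightarrow> nat \<Rightarrow> nat \<Rightarrow> bool" where
  "reached p i s n k \<longleftrightarrow> (\<exists>t\<le>n. p t = i \<and> cnt p i s t = k)"

lemma reached_less: "j < cnt p i s n \<Longrightarrow> reached p i s n j"
  using cnt_jump[of j p i s n] by (auto simp: reached_def intro: less_imp_le)

lemma reached_at: "p m = i \<Longrightarrow> m \<le> n \<Longrightarrow> j \<le> cnt p i s m \<Longrightarrow> reached p i s n j"
  using reached_less[of j p i s m] by (cases "j = cnt p i s m") (auto simp: reached_def intro: order_trans)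

lemma reached_atI: "p m = i \<Longrightarrow> cnt p i s m = c \<Longrightarrow> m \<le> n \<Longrightarrow> j \<le> c \<Longrightarrow> reached p i s n j"
  using reached_at by blast

lemma zeta_ordered:
  assumes "ordered n n'" "reached q i s n k" "reached q' i s n' k"
  shows "if s then zeta q i s k \<le> zeta q' i s k else zeta q' i s k \<le> zeta q i s k"
proof -
  obtain t t' where t: "t \<le> n" "q t = i" "cnt q i s t = k" "t' \<le> n'" "q' t' = i" "cnt q' i s t' = k"
    using assms(2,3) by (auto simp: reached_def)
  have z: "zeta q i s k = loc q t (i + dir s)" "zeta q' i s k = loc q' t' (i + dir s)"
    using zeta_eq[OF unit_steps t(2), of s] zeta_eq[OF unit_steps' t(5), of s] t by auto
  show ?thesis using assms(1) t unfolding z ordered_def by (cases s) auto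
qed

text \<open>The right clocks are common to both walks, and the rates on the right are larger in the
  second.\<close>

lemma alarm_True_ordered:
  assumes "ordered n n'" "\<And>j. j < k \<Longrightarrow> reached q i True n j" "\<And>j. j < k \<Longrightarrow> reached q' i True n' j"
  shows "alarm e' q' i True k \<le> alarm e q i True k"
  unfolding alarm_def
proof (rule sum_mono)
  fix j assume "j \<in> {..<k}"
  then have "zeta q i True j \<le> zeta q' i True j" using zeta_ordered[OF assms(1), of i True j] assms(2,3) by simp
  then show "e' (i, True, j) / zeta q' i True j \<le> e (i, True, j) / zeta q i True j"
    unfolding e'_True using e_nonneg by (intro divide_left_mono) (auto simp: zeta_def)
qed

text \<open>The rates on the left are smaller in the second walk, and the delayed alarm adds
  \<open>\<delta>\<close> divided by a rate of at most \<open>zeta q x False 0\<close>.\<close>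

lemma alarm_False_ordered:
  assumes "ordered n n'" "\<And>j. j < k \<Longrightarrow> reached q i False n j" "\<And>j. j < k \<Longrightarrow> reached q' i False n' j"
  shows "alarm e q i False k \<le> alarm e' q' i False k"
    and "i = x \<Longrightarrow> 0 < k \<Longrightarrow> alarm e q i False k + \<delta> / zeta q i False 0 \<le> alarm e' q' i False k"
proof -
  have z: "zeta q' i False j \<le> zeta q i False j" if "j < k" for j
    using zeta_ordered[OF assms(1), of i False j] assms(2,3) that by simp
  have le: "e (i, False, j) / zeta q i False j \<le> e' (i, False, j) / zeta q' i False j" if "j < k" for j
    using z[OF that] e'_nonneg e_le by (intro frac_le) (auto simp: zeta_def)
  then show "alarm e q i False k \<le> alarm e' q' i False k" unfolding alarm_def by (intro sum_mono) auto
  assume x: "i = x" "0 < k"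
  have "e (i, False, 0) / zeta q i False 0 + \<delta> / zeta q i False 0 = e' (i, False, 0) / zeta q i False 0"
    using x by (simp add: e' add_divide_distrib)
  also have "\<dots> \<le> e' (i, False, 0) / zeta q' i False 0"
    using z[OF x(2)] e'_nonneg by (intro divide_left_mono) (auto simp: zeta_def)
  finally have le0: "e (i, False, 0) / zeta q i False 0 + \<delta> / zeta q i False 0 \<le> e' (i, False, 0) / zeta q' i False 0" .
  have split: "(\<Sum>j<k. f j) = f 0 + (\<Sum>j\<in>{..<k} - {0}. f j)" for f :: "nat \<Rightarrow> real"
    using x(2) by (intro sum.remove) auto
  have "(\<Sum>j\<in>{..<k} - {0}. e (i, False, j) / zeta q i False j) \<le> (\<Sum>j\<in>{..<k} - {0}. e' (i, False, j) / zeta q' i False j)"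
    using le by (intro sum_mono) auto
  with le0 show "alarm e q i False k + \<delta> / zeta q i False 0 \<le> alarm e' q' i False k"
    unfolding alarm_def split by linarith
qed

lemma ordered: "ordered n n'"
proof -
  have "(cnt q i True n = cnt q' i True n' \<longrightarrow> loc q n (i + 1) \<le> loc q' n' (i + 1)) \<and>
     (cnt q i False n = cnt q' i False n' \<longrightarrow> loc q' n' (i - 1) \<le> loc q n (i - 1))"
    if "q n = i" "q' n' = i" for i n n'
    using that
  proof (induction "n + n'" arbitrary: n n' i rule: less_induct)
    case less
    have ord: "ordered m m'" if "m + m' < n + n'" for m m'
      unfolding ordered_def using less.hyps that by (meson add_mono le_less_trans)
    show ?case
    proof (intro conjI impI)
      assume eq: "cnt q i True n = cnt q' i True n'"
      \<comment> \<open>At equal numbers of jumps from \<open>i\<close> to the right, the left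
        departures from \<open>i + 1\<close> agree, so the local times there differ exactly by the
        right departures \<open>\<rho>\<close> and \<open>\<rho>'\<close>.\<close>
      define f where "f = cnt q (i + 1) False n"
      define \<rho> where "\<rho> = cnt q (i + 1) True n"
      define \<rho>' where "\<rho>' = cnt q' (i + 1) True n'"
      have f': "cnt q' (i + 1) False n' = f"
        using cnt_crossing[OF unit_steps, of i n] cnt_crossing[OF unit_steps', of i n'] eq less.prems start by (simp add: f_def)
      have "\<rho> \<le> \<rho>'"
      proof (rule ccontr)
        assume "\<not> \<rho> \<le> \<rho>'"
        have fr: "cnt q (i + 1) False r < f" if "q r = i + 1" "r < n" for r
          using cnt_crossing[OF unit_steps, of i r] cnt_crossing[OF unit_steps, of i n] cnt_mono[of r n q i True] that less.prems
          by (auto simp: f_def split: if_splits)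
        obtain r0 where "r0 < n" "q r0 = i + 1"
          using cnt_jump[of \<rho>' q "i + 1" True n] \<open>\<not> \<rho> \<le> \<rho>'\<close> by (auto simp: \<rho>_def)
        from fr[OF this(2,1)] have "f - 1 < cnt q' (i + 1) False n'" "f > 0" using f' by auto
        \<comment> \<open>This is the last left departure of \<open>q'\<close> from
          \<open>i + 1\<close>. By then \<open>q'\<close> has made \<open>\<rho>''\<close> right
          departures, fewer than \<open>q\<close> makes before its own \<open>f\<close>-th left
          departure; so the walks see the left alarm \<open>f\<close> and the right alarm
          \<open>\<rho>'' + 1\<close> in opposite orders.\<close>
        then obtain m' where m': "m' < n'" "q' m' = i + 1" "q' (Suc m') = i + 1 - 1" "cnt q' (i + 1) False m' = f - 1"
          using cnt_jump[of "f - 1" q' "i + 1" False n'] by auto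
        define \<rho>'' where "\<rho>'' = cnt q' (i + 1) True m'"
        have "\<rho>'' \<le> \<rho>'" using m'(1) by (auto simp: \<rho>''_def \<rho>'_def intro: cnt_mono)
        then have "\<rho>'' < cnt q (i + 1) True n" using \<open>\<not> \<rho> \<le> \<rho>'\<close> by (simp add: \<rho>_def)
        then obtain r where r: "r < n" "q r = i + 1" "q (Suc r) = i + 1 + 1" "cnt q (i + 1) True r = \<rho>''"
          using cnt_jump[of \<rho>'' q "i + 1" True n] by auto
        have o: "ordered r m'" "ordered (n - 1) m'" using r(1) m'(1) by (auto intro!: ord)
        have "alarm e' q' (i + 1) False f \<le> alarm e' q' (i + 1) True (Suc \<rho>'')"
          using rubin_left[OF rubin' e'_nonneg m'(2,3), of "Suc \<rho>''"] m'(4) \<open>f > 0\<close> by (simp add: \<rho>''_def)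
        also have "\<dots> \<le> alarm e q (i + 1) True (Suc \<rho>'')"
        proof (rule alarm_True_ordered[OF o(1)])
          fix j assume j: "j < Suc \<rho>''"
          show "reached q (i + 1) True r j" by (rule reached_atI[where p = q, OF r(2) r(4)]) (use j in auto)
          show "reached q' (i + 1) True m' j" by (rule reached_atI[where p = q', OF m'(2) \<rho>''_def[symmetric]]) (use j in auto)
        qed
        also have "\<dots> < alarm e q (i + 1) False f"
          using rubin_right[OF rubin e_nonneg r(2,3) fr[OF r(2,1)]] r(4) by simp
        also have "\<dots> \<le> alarm e' q' (i + 1) False f"
        proof (rule alarm_False_ordered(1)[OF o(2)])
          fix j assume j: "j < f"
          then obtain t where "t < n" "q t = i + 1" "cnt q (i + 1) False t = j"
            using cnt_jump[of j q "i + 1" False n] by (auto simp: f_def)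
          then show "reached q (i + 1) False (n - 1) j" by (auto simp: reached_def intro!: exI[of _ t])
          show "reached q' (i + 1) False m' j" by (rule reached_atI[where p = q', OF m'(2) m'(4)]) (use j in auto)
        qed
        finally show False by simp
      qed
      then show "loc q n (i + 1) \<le> loc q' n' (i + 1)"
        using less.prems by (simp add: loc_eq_cnt[OF unit_steps] loc_eq_cnt[OF unit_steps'] f' f_def \<rho>_def \<rho>'_def)
    next
      assume eq: "cnt q i False n = cnt q' i False n'"
      define j0 where "j0 = i - 1"
      have i: "i = j0 + 1" by (simp add: j0_def)
      define f where "f = cnt q j0 True n"
      define \<rho> where "\<rho> = cnt q j0 False n"
      define \<rho>' where "\<rho>' = cnt q' j0 False n'"
      have f': "cnt q' j0 True n' = f"
        using cnt_crossing[OF unit_steps, of j0 n] cnt_crossing[OF unit_steps', of j0 n'] eq less.prems start by (simp add: f_def i)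
      \<comment> \<open>The mirror argument at \<open>i - 1\<close>, with the roles of the two walks
        exchanged.\<close>
      have "\<rho>' \<le> \<rho>"
      proof (rule ccontr)
        assume "\<not> \<rho>' \<le> \<rho>"
        have fr: "cnt q' j0 True r < f" if "q' r = j0" "r < n'" for r
          using cnt_crossing[OF unit_steps', of j0 r] cnt_crossing[OF unit_steps', of j0 n'] cnt_mono[of r n' q' "j0 + 1" False] that less.prems f'
          by (auto simp: i split: if_splits)
        obtain r0 where "r0 < n'" "q' r0 = j0"
          using cnt_jump[of \<rho> q' j0 False n'] \<open>\<not> \<rho>' \<le> \<rho>\<close> by (auto simp: \<rho>'_def)
        from fr[OF this(2,1)] have "f - 1 < cnt q j0 True n" "f > 0" by (auto simp: f_def)
        then obtain m where m: "m < n" "q m = j0" "q (Suc m) = j0 + 1" "cnt q j0 True m = f - 1"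
          using cnt_jump[of "f - 1" q j0 True n] by auto
        define \<rho>'' where "\<rho>'' = cnt q j0 False m"
        have "\<rho>'' \<le> \<rho>" using m(1) by (auto simp: \<rho>''_def \<rho>_def intro: cnt_mono)
        then have "\<rho>'' < cnt q' j0 False n'" using \<open>\<not> \<rho>' \<le> \<rho>\<close> by (simp add: \<rho>'_def)
        then obtain r where r: "r < n'" "q' r = j0" "q' (Suc r) = j0 - 1" "cnt q' j0 False r = \<rho>''"
          using cnt_jump[of \<rho>'' q' j0 False n'] by auto
        have o: "ordered m r" "ordered m (n' - 1)" using r(1) m(1) by (auto intro!: ord)
        have "alarm e q j0 True f < alarm e q j0 False (Suc \<rho>'')"
          using rubin_right[OF rubin e_nonneg m(2,3), of "Suc \<rho>''"] m(4) \<open>f > 0\<close> by (simp add: \<rho>''_def)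
        also have "\<dots> \<le> alarm e' q' j0 False (Suc \<rho>'')"
        proof (rule alarm_False_ordered(1)[OF o(1)])
          fix j assume j: "j < Suc \<rho>''"
          show "reached q' j0 False r j" by (rule reached_atI[where p = q', OF r(2) r(4)]) (use j in auto)
          show "reached q j0 False m j" by (rule reached_atI[where p = q, OF m(2) \<rho>''_def[symmetric]]) (use j in auto)
        qed
        also have "\<dots> \<le> alarm e' q' j0 True f"
          using rubin_left[OF rubin' e'_nonneg r(2,3) fr[OF r(2,1)]] r(4) by simp
        also have "\<dots> \<le> alarm e q j0 True f"
        proof (rule alarm_True_ordered[OF o(2)])
          fix j assume j: "j < f"
          then obtain t where "t < n'" "q' t = j0" "cnt q' j0 True t = j"
            using cnt_jump[of j q' j0 True n'] by (auto simp: f')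
          then show "reached q' j0 True (n' - 1) j" by (auto simp: reached_def intro!: exI[of _ t])
          show "reached q j0 True m j" by (rule reached_atI[where p = q, OF m(2) m(4)]) (use j in auto)
        qed
        finally show False by simp
      qed
      then have "loc q' n' j0 \<le> loc q n j0"
        using less.prems by (simp add: loc_eq_cnt[OF unit_steps] loc_eq_cnt[OF unit_steps'] f' f_def[symmetric] \<rho>_def \<rho>'_def i)
      then show "loc q' n' (i - 1) \<le> loc q n (i - 1)" by (simp add: j0_def)
    qed
  qed
  then show ?thesis unfolding ordered_def by blast
qed

text \<open>If both local clocks at \<open>x\<close> were to explode in both walks, then the explosion times of the left
  and of the right alarms would agree, which is incompatible with the delay.\<close>

lemma no_common_explosion:
  assumes inf: "\<And>s k. \<exists>n. k < cnt q x s n" "\<And>s k. \<exists>n. k < cnt q' x s n"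
    and bound: "\<And>k. alarm e q x False k \<le> C"
  shows False
proof -
  have al: "alarm e q x False k + \<delta> / zeta q x False 0 \<le> alarm e' q' x False k" if "0 < k" for k
  proof -
    obtain n n' where "k < cnt q x False n" "k < cnt q' x False n'" using inf by blast
    then show ?thesis
      using that by (intro alarm_False_ordered(2)[OF ordered[of n n']] reached_less) auto
  qed
  have ar: "alarm e' q' x True k \<le> alarm e q x True k" for k
  proof -
    obtain n n' where "k < cnt q x True n" "k < cnt q' x True n'" using inf by blast
    then show ?thesis by (intro alarm_True_ordered[OF ordered[of n n']] reached_less) auto
  qed
  have il: "\<exists>l. alarm e' q' x False (Suc k) \<le> alarm e' q' x True l" for k
  proof -
    obtain n where "k < cnt q' x False n" using inf by blast
    from cnt_jump[OF this] obtain t where t: "q' t = x" "q' (Suc t) = x - 1" "cnt q' x False t = k" by auto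
    from rubin_left[OF rubin' e'_nonneg t(1,2) lessI] t(3) show ?thesis by auto
  qed
  have ir: "\<exists>l. alarm e q x True (Suc k) \<le> alarm e q x False l" for k
  proof -
    obtain n where "k < cnt q x True n" using inf by blast
    from cnt_jump[OF this] obtain t where t: "q t = x" "q (Suc t) = x + 1" "cnt q x True t = k" by auto
    from rubin_right[OF rubin e_nonneg t(1,2) lessI] t(3) show ?thesis by (auto intro: less_imp_le)
  qed
  define S where "S = (SUP k. alarm e q x False k)"
  have bdd: "bdd_above (range (\<lambda>k. alarm e q x False k))" using bound by (auto intro!: bdd_aboveI)
  have S: "alarm e q x False k \<le> S" for k unfolding S_def using bdd by (intro cSUP_upper) auto
  \<comment> \<open>A cycle of comparisons: a left alarm of \<open>q\<close> plus the delay lies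
    below a left alarm of \<open>q'\<close>, then a right alarm of \<open>q'\<close>, a right alarm
    of \<open>q\<close>, and again a left alarm of \<open>q\<close>, hence below the
    supremum.\<close>
  have "alarm e q x False k + \<delta> / zeta q x False 0 \<le> S" for k
  proof -
    have "alarm e q x False k + \<delta> / zeta q x False 0 \<le> alarm e q x False (Suc k) + \<delta> / zeta q x False 0"
      using alarm_mono[where e = e and k = k and l = "Suc k" and q = q and i = x and s = False] e_nonneg by simp
    also have "\<dots> \<le> alarm e' q' x False (Suc k)" by (rule al) simp
    also obtain l where "\<dots> \<le> alarm e' q' x True l" using il by blast
    also have "\<dots> \<le> alarm e' q' x True (Suc l)" by (rule alarm_mono[OF e'_nonneg]) simp
    also have "\<dots> \<le> alarm e q x True (Suc l)" by (rule ar)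
    also obtain l' where "\<dots> \<le> alarm e q x False l'" using ir by blast
    also have "\<dots> \<le> S" by (rule S)
    finally show ?thesis .
  qed
  then have "S \<le> S - \<delta> / zeta q x False 0"
    unfolding S_def[symmetric] by (subst S_def) (intro cSUP_least, auto simp: le_diff_eq)
  moreover have "0 < \<delta> / zeta q x False 0" using \<delta> by (intro divide_pos_pos) (auto simp: zeta_def)
  ultimately show False by simp
qed

text \<open>Equal numbers of visits mean equal numbers of departures, so more right jumps in
  \<open>q\<close> would force more left jumps in \<open>q'\<close>, and the alarms at
  \<open>i\<close> would ring in opposite orders.\<close>

lemma cnt_True_common_visit:
  assumes at: "q n = i" "q' n' = i" and eq: "loc q n i = loc q' n' i"
  shows "cnt q i True n \<le> cnt q' i True n'"
proof (rule ccontr)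
  assume less: "\<not> ?thesis"
  then have less2: "cnt q i False n < cnt q' i False n'"
    using eq at by (simp add: loc_eq_cnt[OF unit_steps] loc_eq_cnt[OF unit_steps'])
  obtain t where t: "t < n" "q t = i" "q (Suc t) = i + 1" "cnt q i True t = cnt q' i True n'"
    using cnt_jump[of "cnt q' i True n'" q i True n] less by auto
  obtain t' where t': "t' < n'" "q' t' = i" "q' (Suc t') = i - 1" "cnt q' i False t' = cnt q i False n"
    using cnt_jump[of "cnt q i False n" q' i False n'] less2 by auto
  have ct: "cnt q i False t \<le> cnt q i False n" "cnt q' i True t' \<le> cnt q' i True n'"
    using t(1) t'(1) by (auto intro: cnt_mono)
  have "alarm e q i True (Suc (cnt q' i True n')) < alarm e q i False (Suc (cnt q i False n))"
    using rubin_right[OF rubin e_nonneg t(2,3), of "Suc (cnt q i False n)"] t(4) ct by simp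
  also have "\<dots> \<le> alarm e' q' i False (Suc (cnt q i False n))"
  proof (rule alarm_False_ordered(1)[OF ordered[of n n']])
    fix j assume j: "j < Suc (cnt q i False n)"
    show "reached q i False n j" by (rule reached_at[where m = n]) (use at j in auto)
    show "reached q' i False n' j" by (rule reached_atI[where p = q', OF t'(2) t'(4)]) (use j t'(1) in auto)
  qed
  also have "\<dots> \<le> alarm e' q' i True (Suc (cnt q' i True n'))"
    using rubin_left[OF rubin' e'_nonneg t'(2,3), of "Suc (cnt q' i True n')"] t'(4) ct by simp
  also have "\<dots> \<le> alarm e q i True (Suc (cnt q' i True n'))"
  proof (rule alarm_True_ordered[OF ordered[of n n']])
    fix j assume j: "j < Suc (cnt q' i True n')"
    show "reached q' i True n' j" by (rule reached_at[where m = n']) (use at j in auto)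
    show "reached q i True n j" by (rule reached_atI[where p = q, OF t(2) t(4)]) (use j t(1) in auto)
  qed
  finally show False by simp
qed

text \<open>Having crossed from \<open>i\<close> at least as often, \<open>q'\<close> has also left
  \<open>i + 1\<close> to the left at least as often; a surplus of right jumps of \<open>q\<close>
  at \<open>i + 1\<close> would then reverse the order of two alarms there.\<close>

lemma cnt_True_next_common_visit:
  assumes at: "q n = i" "q' n' = i" and eq: "loc q n i = loc q' n' i"
  shows "cnt q (i + 1) True n \<le> cnt q' (i + 1) True n'"
proof (rule ccontr)
  assume less: "\<not> ?thesis"
  define k where "k = cnt q (i + 1) False n"
  have k': "k \<le> cnt q' (i + 1) False n'"
    using cnt_True_common_visit[OF assms] cnt_crossing[OF unit_steps, of i n] cnt_crossing[OF unit_steps', of i n'] at start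
    by (simp add: k_def)
  have kr: "cnt q (i + 1) False r < k" if "r < n" "q r = i + 1" for r
    using cnt_crossing[OF unit_steps, of i r] cnt_crossing[OF unit_steps, of i n] cnt_mono[of r n q i True] that at
    by (auto simp: k_def split: if_splits)
  obtain r0 where "r0 < n" "q r0 = i + 1"
    using cnt_jump[of "cnt q' (i + 1) True n'" q "i + 1" True n] less by auto
  from kr[OF this] have "0 < k" by simp
  then have "k - 1 < cnt q' (i + 1) False n'" using k' by simp
  from cnt_jump[OF this] obtain t' where t': "t' < n'" "q' t' = i + 1" "q' (Suc t') = i + 1 - 1" "cnt q' (i + 1) False t' = k - 1"
    by auto
  define \<rho> where "\<rho> = cnt q' (i + 1) True t'"
  have "\<rho> \<le> cnt q' (i + 1) True n'" using t'(1) by (auto simp: \<rho>_def intro: cnt_mono)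
  then obtain r where r: "r < n" "q r = i + 1" "q (Suc r) = i + 1 + 1" "cnt q (i + 1) True r = \<rho>"
    using cnt_jump[of \<rho> q "i + 1" True n] less by auto
  have "alarm e q (i + 1) True (Suc \<rho>) < alarm e q (i + 1) False k"
    using rubin_right[OF rubin e_nonneg r(2,3) kr[OF r(1,2)]] r(4) by simp
  also have "\<dots> \<le> alarm e' q' (i + 1) False k"
    using k' by (intro alarm_False_ordered(1)[OF ordered[of n n']] reached_less) (auto simp: k_def)
  also have "\<dots> \<le> alarm e' q' (i + 1) True (Suc \<rho>)"
    using rubin_left[OF rubin' e'_nonneg t'(2,3), of "Suc \<rho>"] t'(4) \<open>0 < k\<close> by (simp add: \<rho>_def)
  also have "\<dots> \<le> alarm e q (i + 1) True (Suc \<rho>)"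
  proof (rule alarm_True_ordered[OF ordered[of n n']])
    fix j assume j: "j < Suc \<rho>"
    show "reached q (i + 1) True n j" by (rule reached_atI[where p = q, OF r(2) r(4)]) (use j r(1) in auto)
    show "reached q' (i + 1) True n' j" by (rule reached_atI[where p = q', OF t'(2) \<rho>_def[symmetric]]) (use j t'(1) in auto)
  qed
  finally show False by simp
qed

text \<open>After its last jump from \<open>i\<close> to \<open>i + 1\<close> the walk stays above
  \<open>i\<close>, so the local time at \<open>i - 1\<close> is still the rate of the left alarm
  that was pending at that jump.\<close>

lemma last_right_jump:
  assumes unit_steps: "unit_steps p" and at: "p n = i + 1" and pos: "0 < cnt p i True n"
  shows "\<exists>r<n. p r = i \<and> p (Suc r) = i + 1 \<and> Suc (cnt p i True r) = cnt p i True n \<and>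
    cnt p i False r = cnt p i False n \<and> loc p n (i - 1) = zeta p i False (cnt p i False n)"
proof -
  obtain r where r: "r < n" "p r = i" "p (Suc r) = i + 1" "cnt p i True r = cnt p i True n - 1"
    using cnt_jump[of "cnt p i True n - 1" p i True n] pos by auto
  have "\<not> cnt p i False r < cnt p i False n"
  proof
    assume "cnt p i False r < cnt p i False n"
    then obtain t where t: "t < n" "p t = i" "p (Suc t) = i - 1" "cnt p i False t = cnt p i False r"
      using cnt_jump[of "cnt p i False r" p i False n] by auto
    have "\<not> t < r"
    proof
      assume "t < r"
      then have "cnt p i False (Suc t) \<le> cnt p i False r" by (intro cnt_mono) simp
      then show False using t by (simp add: cnt_Suc)
    qed
    moreover have "t \<noteq> r" using t(3) r(3) by auto
    ultimately have "cnt p i True (Suc r) \<le> cnt p i True t" by (intro cnt_mono) simp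
    then have "cnt p i True n \<le> cnt p i True t" using r pos by (simp add: cnt_Suc)
    then show False
      using cnt_crossing[OF unit_steps, of i t] cnt_crossing[OF unit_steps, of i n] cnt_mono[of t n p "i + 1" False] t(1,2) at
      by (auto split: if_splits)
  qed
  then have eq: "cnt p i False r = cnt p i False n"
    using cnt_mono[of r n p i False] r(1) by simp
  have "loc p n (i - 1) = loc p r (i - 1)"
    using loc_frozen[OF unit_steps, of r i False n] r eq by simp
  also have "\<dots> = zeta p i False (cnt p i False r)" using zeta_eq[OF unit_steps r(2), of False] by simp
  finally show ?thesis using r eq pos by auto
qed

text \<open>The quantitative effect of the delay, for the critical case. Here \<open>l\<close> and
  \<open>l'\<close> number the left alarms at \<open>x\<close> pending in the two walks; the waiting
  times of alarms \<open>l'\<close> to \<open>l\<close> of the undelayed walk must together exceed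
  the delay.\<close>

lemma left_alarms_common_visit:
  assumes at: "q n = x + 1" "q' n' = x + 1" and eq: "loc q n (x + 1) = loc q' n' (x + 1)"
    and pos': "0 < cnt q' x False n'"
  defines "l \<equiv> cnt q x False n" and "l' \<equiv> cnt q' x False n'"
  shows "l' \<le> l" and "alarm e q x False l' + \<delta> / zeta q x False 0 < alarm e q x False (Suc l)"
    and "loc q' n' (x - 1) \<le> zeta q x False l'" and "loc q n (x - 1) = zeta q x False l"
proof -
  define k where "k = cnt q x True n"
  define k' where "k' = cnt q' x True n'"
  have "cnt q' (x + 1) False n' \<le> cnt q (x + 1) False n"
    using cnt_True_common_visit[OF at eq] eq at by (simp add: loc_eq_cnt[OF unit_steps] loc_eq_cnt[OF unit_steps'])
  then have kk: "k' \<le> k"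
    using cnt_crossing[OF unit_steps, of x n] cnt_crossing[OF unit_steps', of x n'] at start by (simp add: k_def k'_def)
  have l'pos: "0 < l'" using pos' by (simp add: l'_def)
  then obtain t' where t': "t' < n'" "q' t' = x" "q' (Suc t') = x - 1" "cnt q' x False t' = l' - 1"
    using cnt_jump[of "l' - 1" q' x False n'] by (auto simp: l'_def)
  have ct': "cnt q' x True t' < k'"
    using cnt_crossing[OF unit_steps', of x t'] cnt_crossing[OF unit_steps', of x n'] cnt_mono[of t' n' q' "x + 1" False] t'(1,2) at
    by (auto simp: k'_def split: if_splits)
  then have "0 < cnt q x True n" "0 < cnt q' x True n'" using kk by (auto simp: k_def k'_def)
  then obtain r r' where r: "r < n" "q r = x" "q (Suc r) = x + 1" "Suc (cnt q x True r) = k" "cnt q x False r = l"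
      "loc q n (x - 1) = zeta q x False l"
    and r': "r' < n'" "q' r' = x" "cnt q' x False r' = l'" "loc q' n' (x - 1) = zeta q' x False l'"
    using last_right_jump[OF unit_steps at(1)] last_right_jump[OF unit_steps' at(2)] unfolding k_def l_def l'_def by metis
  show "loc q n (x - 1) = zeta q x False l" by (rule r(6))
  have right: "alarm e q x True k < alarm e q x False (Suc l)"
    using rubin_right[OF rubin e_nonneg r(2,3), of "Suc l"] r(4,5) by simp
  have left': "alarm e' q' x False l' \<le> alarm e' q' x True k'"
    using rubin_left[OF rubin' e'_nonneg t'(2,3) ct'] t'(4) l'pos by simp
  have "alarm e' q' x True k' \<le> alarm e q x True k'"
    using kk by (intro alarm_True_ordered[OF ordered[of n n']] reached_less) (auto simp: k_def k'_def)
  also have "\<dots> \<le> alarm e q x True k" by (rule alarm_mono[OF e_nonneg kk])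
  finally have chain: "alarm e' q' x False l' < alarm e q x False (Suc l)" using left' right by simp
  show le: "l' \<le> l"
  proof (rule ccontr)
    assume "\<not> l' \<le> l"
    have "alarm e q x False (Suc l) \<le> alarm e' q' x False (Suc l)"
    proof (rule alarm_False_ordered(1)[OF ordered[of n n']])
      fix j assume j: "j < Suc l"
      show "reached q x False n j" by (rule reached_atI[where p = q, OF r(2) r(5)]) (use j r(1) in auto)
      show "reached q' x False n' j" by (rule reached_atI[where p = q', OF r'(2) r'(3)]) (use j r'(1) \<open>\<not> l' \<le> l\<close> in auto)
    qed
    also have "\<dots> \<le> alarm e' q' x False l'" using \<open>\<not> l' \<le> l\<close> by (intro alarm_mono e'_nonneg) simp
    finally show False using chain by simp
  qed
  have reach: "reached q x False n j" "reached q' x False n' j" if "j \<le> l'" for j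
    by (rule reached_atI[where p = q, OF r(2) r(5)], use that le r(1) in auto)
      (rule reached_atI[where p = q', OF r'(2) r'(3)], use that r'(1) in auto)
  have "alarm e q x False l' + \<delta> / zeta q x False 0 \<le> alarm e' q' x False l'"
    using l'pos reach by (intro alarm_False_ordered(2)[OF ordered[of n n']]) auto
  then show "alarm e q x False l' + \<delta> / zeta q x False 0 < alarm e q x False (Suc l)" using chain by simp
  show "loc q' n' (x - 1) \<le> zeta q x False l'"
    using zeta_ordered[OF ordered[of n n'] reach, of l'] r'(4) by simp
qed

end

section \<open>Exclusion of explosions\<close>

lemma nn_integral_prod_clocks:
  fixes f :: "real \<Rightarrow> ennreal"
  assumes [measurable]: "f \<in> borel_measurable borel"
  shows "(\<integral>\<^sup>+e. (\<Prod>j<k. f (e (i, s, j))) \<partial>Clocks) = (\<integral>\<^sup>+x. f x \<partial>Exp1) ^ k"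
proof (induction k)
  case 0
  then show ?case using prob_space.emeasure_space_1[OF prob_space_Clocks] by simp
next
  case (Suc k)
  have "(\<integral>\<^sup>+e. (\<Prod>j<Suc k. f (e (i, s, j))) \<partial>Clocks) =
     (\<integral>\<^sup>+x. (\<integral>\<^sup>+e. (\<Prod>j<Suc k. f ((e((i, s, k) := x)) (i, s, j))) \<partial>Clocks) \<partial>Exp1)"
    by (rule nn_integral_Clocks_upd) measurable
  also have "\<dots> = (\<integral>\<^sup>+x. (\<integral>\<^sup>+e. (\<Prod>j<k. f (e (i, s, j))) * f x \<partial>Clocks) \<partial>Exp1)"
    by (intro nn_integral_cong) (auto intro!: prod.cong)
  also have "\<dots> = (\<integral>\<^sup>+x. (\<integral>\<^sup>+x. f x \<partial>Exp1) ^ k * f x \<partial>Exp1)"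
    by (subst nn_integral_multc) (auto simp: Suc)
  also have "\<dots> = (\<integral>\<^sup>+x. f x \<partial>Exp1) ^ Suc k"
    by (subst nn_integral_cmult) (auto simp: mult.commute)
  finally show ?case .
qed

lemma nn_integral_exp_Exp1:
  assumes "t < 1"
  shows "(\<integral>\<^sup>+x. ennreal (exp (t * x)) \<partial>Exp1) = ennreal (1 / (1 - t))"
proof -
  have E: "1 / (1 - t) * ((1 - t) * E) = E" for E using assms by simp
  have *: "exp (- x) * exp (t * x) = 1 / (1 - t) * ((1 - t) * exp (- x * (1 - t)))" for x
    unfolding E exp_add[symmetric] by (simp add: algebra_simps)
  have "(\<integral>\<^sup>+x. ennreal (exp (t * x)) \<partial>Exp1) = (\<integral>\<^sup>+x. ennreal (1 / (1 - t)) * ennreal (exponential_density (1 - t) x) \<partial>lborel)"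
    using assms * by (subst nn_integral_density)
      (auto simp: exponential_density_def ennreal_mult[symmetric] intro!: nn_integral_cong)
  also have "\<dots> = ennreal (1 / (1 - t)) * emeasure (density lborel (exponential_density (1 - t))) UNIV"
    by (subst nn_integral_cmult) (auto simp: emeasure_density)
  also have "emeasure (density lborel (exponential_density (1 - t))) UNIV = 1"
    using prob_space.emeasure_space_1[OF prob_space_exponential_density[of "1 - t"]] assms by simp
  finally show ?thesis by simp
qed

lemma chernoff_clocks:
  assumes "t < 1"
  shows "emeasure Clocks {e. c * k \<le> t * (\<Sum>j<k. e (i, s, j))} \<le> ennreal ((exp (- c) / (1 - t)) ^ k)"
proof -
  have "{e \<in> space Clocks. 1 \<le> ennreal (exp (- (c * k))) * ennreal (exp (t * (\<Sum>j<k. e (i, s, j))))} =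
      {e. c * k \<le> t * (\<Sum>j<k. e (i, s, j))}"
    by (auto simp: ennreal_mult[symmetric] exp_add[symmetric] simp flip: ennreal_1)
  then have "emeasure Clocks {e. c * k \<le> t * (\<Sum>j<k. e (i, s, j))} \<le>
      ennreal (exp (- (c * k))) * (\<integral>\<^sup>+e. ennreal (exp (t * (\<Sum>j<k. e (i, s, j)))) * indicator (space Clocks) e \<partial>Clocks)"
    using nn_integral_Markov_inequality[where u = "\<lambda>e. ennreal (exp (t * (\<Sum>j<k. e (i, s, j))))"
        and M = Clocks and A = "space Clocks" and c = "ennreal (exp (- (c * k)))"]
    using sets.top[of Clocks] by simp
  also have "(\<integral>\<^sup>+e. ennreal (exp (t * (\<Sum>j<k. e (i, s, j)))) * indicator (space Clocks) e \<partial>Clocks) =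
      (\<integral>\<^sup>+e. (\<Prod>j<k. ennreal (exp (t * e (i, s, j)))) \<partial>Clocks)"
    by (simp add: sum_distrib_left exp_sum prod_ennreal)
  also have "\<dots> = ennreal (1 / (1 - t)) ^ k"
    using nn_integral_prod_clocks[of "\<lambda>x. ennreal (exp (t * x))"] nn_integral_exp_Exp1[OF assms] by simp
  also have "ennreal (exp (- (c * k))) * ennreal (1 / (1 - t)) ^ k = ennreal ((exp (- c) / (1 - t)) ^ k)"
    using assms by (simp add: ennreal_power ennreal_mult[symmetric] power_divide exp_of_nat_mult[symmetric] mult.commute)
  finally show ?thesis .
qed

lemma exp_gt_one_plus_self:
  fixes x :: real
  assumes "x \<noteq> 0" "- 2 < x"
  shows "1 + x < exp x"
proof -
  have "0 < (x / 2)\<^sup>2" using assms by simp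
  then have "1 + x < (1 + x / 2)\<^sup>2" unfolding power2_sum by simp
  also have "\<dots> \<le> (exp (x / 2))\<^sup>2"
    using assms exp_ge_add_one_self[of "x / 2"] by (intro power_mono) auto
  also have "\<dots> = exp x" by (simp add: power2_eq_square exp_add[symmetric])
  finally show ?thesis .
qed

text \<open>Chernoff bounds at the optimal exponents \<open>\<kappa> / (1 + \<kappa>)\<close> and
  \<open>- \<kappa> / (1 - \<kappa>)\<close> have the ratios
  \<open>(1 + \<kappa>) exp (- \<kappa>)\<close> and \<open>(1 - \<kappa>) exp \<kappa>\<close>,
  both below \<open>1\<close>; Borel-Cantelli does the rest.\<close>

lemma AE_clocks_deviation:
  assumes \<kappa>: "0 < \<kappa>" "\<kappa> < 1"
  shows "AE e in Clocks. eventually (\<lambda>k. \<bar>(\<Sum>j<k. e (i, s, j)) - real k\<bar> < \<kappa> * real k) sequentially"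
proof -
  interpret C: prob_space Clocks by (rule prob_space_Clocks)
  let ?S = "\<lambda>e k. \<Sum>j<k. e (i, s, j)"
  have bc: "AE e in Clocks. eventually (\<lambda>k. \<not> c * real k \<le> t * ?S e k) sequentially"
    if t: "t < 1" and r: "exp (- c) / (1 - t) < 1" for t c
  proof -
    have [measurable]: "{e. c * real k \<le> t * ?S e k} \<in> sets Clocks" for k
    proof -
      have "{e \<in> space Clocks. c * real k \<le> t * ?S e k} \<in> sets Clocks" by measurable
      then show ?thesis by simp
    qed
    have le: "C.prob {e. c * real k \<le> t * ?S e k} \<le> (exp (- c) / (1 - t)) ^ k" for k
    proof -
      have "ennreal (C.prob {e. c * real k \<le> t * ?S e k}) \<le> ennreal ((exp (- c) / (1 - t)) ^ k)"
        using chernoff_clocks[OF t, of c k i s] unfolding C.emeasure_eq_measure .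
      then show ?thesis using t by (subst (asm) ennreal_le_iff) auto
    qed
    have sm: "summable (\<lambda>k. (exp (- c) / (1 - t)) ^ k)" using t r by (intro summable_geometric) auto
    have "summable (\<lambda>k. C.prob {e. c * real k \<le> t * ?S e k})"
    proof (rule summable_comparison_test'[OF sm, of 0])
      fix k show "norm (C.prob {e. c * real k \<le> t * ?S e k}) \<le> (exp (- c) / (1 - t)) ^ k"
        using le[of k] by (simp only: real_norm_def abs_of_nonneg measure_nonneg)
    qed
    then have "AE e in Clocks. eventually (\<lambda>k. e \<in> space Clocks - {e. c * real k \<le> t * ?S e k}) sequentially"
      by (intro borel_cantelli_AE1) (auto simp: C.emeasure_eq_measure)
    then show ?thesis by eventually_elim (auto elim: eventually_mono)
  qed
  have "AE e in Clocks. eventually (\<lambda>k. \<not> \<kappa> * real k \<le> \<kappa> / (1 + \<kappa>) * ?S e k) sequentially"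
  proof (rule bc)
    show "\<kappa> / (1 + \<kappa>) < 1" using \<kappa> by (simp add: field_simps)
    have "1 - \<kappa> / (1 + \<kappa>) = 1 / (1 + \<kappa>)" using \<kappa> by (simp add: field_simps)
    then have "exp (- \<kappa>) / (1 - \<kappa> / (1 + \<kappa>)) = (1 + \<kappa>) / exp \<kappa>" by (simp add: exp_minus divide_inverse mult.commute)
    moreover have "1 + \<kappa> < exp \<kappa>" using \<kappa> by (intro exp_gt_one_plus_self) auto
    ultimately show "exp (- \<kappa>) / (1 - \<kappa> / (1 + \<kappa>)) < 1" by simp
  qed
  moreover have "AE e in Clocks. eventually (\<lambda>k. \<not> (- \<kappa>) * real k \<le> (- (\<kappa> / (1 - \<kappa>))) * ?S e k) sequentially"
  proof (rule bc)
    have "0 < \<kappa> / (1 - \<kappa>)" using \<kappa> by simp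
    then show "- (\<kappa> / (1 - \<kappa>)) < 1" by linarith
    have "1 - - (\<kappa> / (1 - \<kappa>)) = 1 / (1 - \<kappa>)" using \<kappa> by (simp add: divide_simps)
    then have "exp (- (- \<kappa>)) / (1 - - (\<kappa> / (1 - \<kappa>))) = (1 - \<kappa>) / exp (- \<kappa>)" by (simp add: exp_minus divide_inverse mult.commute)
    moreover have "1 + (- \<kappa>) < exp (- \<kappa>)" using \<kappa> by (intro exp_gt_one_plus_self) auto
    ultimately show "exp (- (- \<kappa>)) / (1 - - (\<kappa> / (1 - \<kappa>))) < 1" by simp
  qed
  ultimately show ?thesis
  proof eventually_elim
    case (elim e)
    from elim show ?case
    proof eventually_elim
      case (elim k)
      have "?S e k < (1 + \<kappa>) * k"
      proof -
        have "\<kappa> / (1 + \<kappa>) * ?S e k < \<kappa> * k" using elim(1) by simp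
        then have "\<kappa> * ?S e k < \<kappa> * ((1 + \<kappa>) * k)" using \<kappa> by (simp add: divide_less_eq algebra_simps)
        then show ?thesis using \<kappa>(1) by (simp only: mult_less_cancel_left_pos)
      qed
      moreover have "(1 - \<kappa>) * k < ?S e k"
      proof -
        have "\<kappa> * k < \<kappa> / (1 - \<kappa>) * ?S e k" using elim(2) by simp
        then have "\<kappa> * ((1 - \<kappa>) * k) < \<kappa> * ?S e k" using \<kappa> by (simp add: less_divide_eq algebra_simps)
        then show ?thesis using \<kappa>(1) by (simp only: mult_less_cancel_left_pos)
      qed
      ultimately show ?case by (simp add: algebra_simps abs_less_iff)
    qed
  qed
qed

text \<open>What the coupling arguments use of the exponential law. The tolerances
  \<open>1 / (m + 2)\<close> are countably many, tend to \<open>0\<close> and stay below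
  \<open>1\<close>, as the deviation bound requires.\<close>

definition good_clocks :: "clocks \<Rightarrow> bool" where
  "good_clocks e \<longleftrightarrow> (\<forall>j. 0 < e j) \<and>
     (\<forall>i s m. eventually (\<lambda>k. \<bar>(\<Sum>j<k. e (i, s, j)) - real k\<bar> < 1 / Suc (Suc m) * real k) sequentially)"

lemma AE_good_clocks: "AE e in Clocks. good_clocks e"
proof -
  have "AE e in Clocks. 0 < e j" for j
  proof -
    have "AE x in Exp1. 0 < x"
      by (subst AE_density)
        (auto simp: exponential_density_def intro: eventually_mono[OF AE_lborel_singleton[of 0]])
    then have "AE e in PiM UNIV (\<lambda>_. Exp1). 0 < e j"
      by (intro product_prob_space.AE_component)
        (auto simp: product_prob_space_def product_prob_space_axioms_def product_sigma_finite_def prob_space_Exp1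
          intro: prob_space_imp_sigma_finite)
    then show ?thesis unfolding Clocks_def .
  qed
  moreover have "AE e in Clocks. eventually (\<lambda>k. \<bar>(\<Sum>j<k. e (i, s, j)) - real k\<bar> < 1 / Suc (Suc m) * real k) sequentially" for i s m
    by (rule AE_clocks_deviation) auto
  ultimately show ?thesis unfolding good_clocks_def by (simp add: AE_all_countable)
qed

text \<open>Each fibre in direction \<open>j\<close> contains at most one exceptional point, and the
  exponential law has no atoms.\<close>

lemma AE_Clocks_not:
  assumes [measurable]: "Measurable.pred Clocks P"
    and AEG: "AE e in Clocks. G e"
    and excl: "\<And>e \<delta>. 0 < \<delta> \<Longrightarrow> G e \<Longrightarrow> P e \<Longrightarrow> G (e(j := e j + \<delta>)) \<Longrightarrow> P (e(j := e j + \<delta>)) \<Longrightarrow> False"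
  shows "AE e in Clocks. \<not> P e"
proof -
  obtain N where N: "{e \<in> space Clocks. \<not> G e} \<subseteq> N" "emeasure Clocks N = 0" "N \<in> sets Clocks"
    using AEG by (rule AE_E)
  \<comment> \<open>The set \<open>G\<close> is not assumed measurable; removing a measurable null
    set outside which it holds keeps the integrand measurable.\<close>
  define Q where "Q e \<longleftrightarrow> P e \<and> e \<notin> N" for e
  have QG: "G e \<and> P e" if "Q e" for e using that N(1) by (auto simp: Q_def)
  have meas: "(\<lambda>e. indicator {e. Q e} e :: ennreal) \<in> borel_measurable Clocks"
  proof (rule borel_measurable_indicator')
    have "{e \<in> space Clocks. P e} - N \<in> sets Clocks" using N(3) assms(1) by (intro sets.Diff) (auto simp: pred_def)
    moreover have "{x \<in> space Clocks. x \<in> {e. Q e}} = {e \<in> space Clocks. P e} - N" by (auto simp: Q_def)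
    ultimately show "{x \<in> space Clocks. x \<in> {e. Q e}} \<in> sets Clocks" by (simp only:)
  qed
  have "(\<integral>\<^sup>+e. indicator {e. Q e} e \<partial>Clocks) = (\<integral>\<^sup>+x. (\<integral>\<^sup>+e. indicator {e. Q e} (e(j := x)) \<partial>Clocks) \<partial>Exp1)"
    by (rule nn_integral_Clocks_upd[OF meas])
  also have "\<dots> = (\<integral>\<^sup>+e. (\<integral>\<^sup>+x. indicator {e. Q e} (e(j := x)) \<partial>Exp1) \<partial>Clocks)"
  proof -
    interpret E: prob_space Exp1 by (rule prob_space_Exp1)
    interpret C: prob_space Clocks by (rule prob_space_Clocks)
    interpret P: pair_sigma_finite Exp1 Clocks by unfold_locales
    have "(\<lambda>(x, e). e(j := x)) \<in> measurable (Exp1 \<Otimes>\<^sub>M Clocks) Clocks"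
      using measurable_Clocks_upd[of j] by (simp cong: measurable_cong_sets)
    from measurable_compose[OF this meas] show ?thesis by (intro P.Fubini'[symmetric]) (simp add: case_prod_beta')
  qed
  also have "\<dots> = (\<integral>\<^sup>+e. 0 \<partial>Clocks)"
  proof (intro nn_integral_cong)
    fix e :: clocks
    have one: "x = y" if "Q (e(j := x))" "Q (e(j := y))" for x y
    proof -
      have False if "x < y" "Q (e(j := x))" "Q (e(j := y))" for x y
        using excl[of "y - x" "e(j := x)"] QG[OF that(2)] QG[OF that(3)] that(1) by simp
      then show ?thesis using that by (metis linorder_neqE)
    qed
    obtain x0 where "\<And>x. Q (e(j := x)) \<Longrightarrow> x = x0" using one by metis
    then have "(\<integral>\<^sup>+x. indicator {e. Q e} (e(j := x)) \<partial>Exp1) \<le> (\<integral>\<^sup>+x. indicator {x0} x \<partial>Exp1)"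
      by (intro nn_integral_mono) (auto simp: indicator_def)
    also have "\<dots> = emeasure Exp1 {x0}" by simp
    also have "\<dots> = 0"
      by (subst emeasure_density) (auto intro!: nn_integral_0_iff_AE[THEN iffD2] AE_I'[where N = "{x0}"] simp: indicator_def)
    finally show "(\<integral>\<^sup>+x. indicator {e. Q e} (e(j := x)) \<partial>Exp1) = 0" by simp
  qed
  finally have "(\<integral>\<^sup>+e. indicator {e. Q e} e \<partial>Clocks) = 0" by simp
  then have "AE e in Clocks. \<not> Q e"
    by (subst (asm) nn_integral_0_iff_AE[OF meas]) (auto simp: indicator_def)
  with AEG AE_not_in[of N Clocks] N show ?thesis
    by (auto simp: Q_def null_sets_def elim: eventually_elim2)
qed

section \<open>Transfer between path space and clock space\<close>

abbreviation Paths :: "(nat \<Rightarrow> int) measure" where "Paths \<equiv> PiM UNIV (\<lambda>_. count_space UNIV)"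

lemma measurable_Paths_adapted:
  fixes F :: "(nat \<Rightarrow> int) \<Rightarrow> 'b"
  assumes "adapted n F" "\<And>x. F x \<in> space N"
  shows "F \<in> measurable Paths N"
  using measurable_adapted_process[of "\<lambda>n p. p n" Paths n F N] assms by simp

text \<open>The two laws on path space agree on cylinders, because expectations of adapted
  functionals depend on \<open>path_weight\<close> alone.\<close>

lemma (in vrrw_law) AE_path_iff_AE_walk:
  assumes "Measurable.pred Paths Q"
  shows "(AE \<omega> in M. Q (path \<omega>)) \<longleftrightarrow> (AE e in Clocks. Q (walk v0 e))"
proof -
  interpret W: vrrw_law Clocks "\<lambda>n e. walk v0 e n" v0 by (rule vrrw_law_walk)
  have mp: "path \<in> measurable M Paths" "W.path \<in> measurable Clocks Paths"
    unfolding path_def W.path_def by (auto intro!: measurable_PiM_single' simp: space_PiM)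
  have "distr M Paths path = distr Clocks Paths W.path"
  proof (rule measure_eqI_PiM_infinite)
    show "finite_measure (distr M Paths path)"
      using prob_space_distr[OF mp(1)] by (rule prob_space.finite_measure)
  next
    fix A :: "nat \<Rightarrow> int set" and J :: "nat set" assume J: "finite J"
    let ?X = "prod_emb UNIV (\<lambda>_. count_space UNIV) J (Pi\<^sub>E J A)"
    obtain n where n: "\<And>j. j \<in> J \<Longrightarrow> j \<le> n" using J by (meson Max_ge)
    define F where "F p = (of_bool (\<forall>j\<in>J. p j \<in> A j) :: real)" for p
    have F: "adapted n F" by (rule adaptedI) (use n in \<open>auto simp: F_def\<close>)
    have X: "?X \<in> sets Paths" using J by (intro sets_PiM_I) auto
    have "emeasure (distr M Paths path) ?X = emeasure M {\<omega>\<in>space M. \<forall>j\<in>J. path \<omega> j \<in> A j}"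
      using X mp(1) by (subst emeasure_distr) (auto simp: prod_emb_def space_PiM Pi_iff intro!: arg_cong2[where f = emeasure])
    also have "\<dots> = ennreal (expectation (\<lambda>\<omega>. indicator {\<omega>\<in>space M. \<forall>j\<in>J. path \<omega> j \<in> A j} \<omega>))"
      by (simp add: emeasure_eq_measure Int_absorb2 subset_eq)
    also have "expectation (\<lambda>\<omega>. indicator {\<omega>\<in>space M. \<forall>j\<in>J. path \<omega> j \<in> A j} \<omega>) = expectation (\<lambda>\<omega>. F (path \<omega>))"
      by (intro Bochner_Integration.integral_cong) (auto simp: F_def)
    also have "\<dots> = W.expectation (\<lambda>\<omega>. F (W.path \<omega>))"
      unfolding expectation_adapted(2)[OF F] W.expectation_adapted(2)[OF F] by simp
    also have "\<dots> = W.expectation (\<lambda>\<omega>. indicator {\<omega>\<in>space Clocks. \<forall>j\<in>J. W.path \<omega> j \<in> A j} \<omega>)"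
      by (intro Bochner_Integration.integral_cong) (auto simp: F_def)
    also have "ennreal \<dots> = emeasure Clocks {\<omega>\<in>space Clocks. \<forall>j\<in>J. W.path \<omega> j \<in> A j}"
      by (simp add: W.emeasure_eq_measure)
    also have "\<dots> = emeasure (distr Clocks Paths W.path) ?X"
      using X mp(2) by (subst emeasure_distr) (auto simp: prod_emb_def space_PiM Pi_iff intro!: arg_cong2[where f = emeasure])
    finally show "emeasure (distr M Paths path) ?X = emeasure (distr Clocks Paths W.path) ?X" .
  qed auto
  then have "(AE p in distr M Paths path. Q p) \<longleftrightarrow> (AE p in distr Clocks Paths W.path. Q p)" by (simp only:)
  then show ?thesis
    using assms by (simp add: AE_distr_iff[OF mp(1)] AE_distr_iff[OF mp(2)] pred_def W.path_def)
qed

lemma adapted_cnt: "adapted n (\<lambda>p. cnt p i s n)"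
  by (rule adaptedI) (auto simp: cnt_def intro!: sum.cong)

lemma adapted_inverse_wsum: "adapted n (\<lambda>p. wsum p i d (\<lambda>m. 1 / loc p m v) n)"
proof (rule adaptedI)
  fix p q :: "nat \<Rightarrow> int" assume *: "\<And>i. i \<le> n \<Longrightarrow> p i = q i"
  have "loc p m v = loc q m v" if "m < n" for m by (rule loc_cong) (use * that in auto)
  then show "wsum p i d (\<lambda>m. 1 / loc p m v) n = wsum q i d (\<lambda>m. 1 / loc q m v) n"
    unfolding wsum_def by (intro sum.cong) (use * in auto)
qed

text \<open>The bound is a natural number, so that the quantifier is countable and the set
  measurable.\<close>

definition explosive :: "int \<Rightarrow> (nat \<Rightarrow> int) \<Rightarrow> bool" where
  "explosive x p \<longleftrightarrow> (\<forall>s k. \<exists>n. k < cnt p x s n) \<and>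
     (\<exists>C::nat. \<forall>n. wsum p x (-1) (\<lambda>m. 1 / loc p m (x - 1)) n \<le> C)"

lemma pred_explosive: "Measurable.pred Paths (explosive x)"
proof -
  have [measurable]: "(\<lambda>p. cnt p x s n) \<in> measurable Paths (count_space UNIV)" for s n
    by (rule measurable_Paths_adapted[OF adapted_cnt]) simp
  have [measurable]: "(\<lambda>p. wsum p x (-1) (\<lambda>m. 1 / loc p m (x - 1)) n) \<in> borel_measurable Paths" for n
    by (rule measurable_Paths_adapted[OF adapted_inverse_wsum]) simp
  show ?thesis unfolding explosive_def by measurable
qed

lemma sum_inverse_zeta:
  assumes "unit_steps q"
  shows "(\<Sum>j<cnt q i s n. 1 / zeta q i s j) = wsum q i (dir s) (\<lambda>m. 1 / loc q m (i + dir s)) n"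
proof (induction n)
  case (Suc n)
  show ?case
    using Suc zeta_eq[OF assms, of n i s] by (auto simp: cnt_Suc wsum_Suc)
qed simp

lemma cnt_le_zeta:
  assumes "unit_steps q" "j < cnt q i s n"
  shows "j + 1 \<le> zeta q i s j"
proof -
  obtain t where t: "q t = i" "cnt q i s t = j" using cnt_jump[OF assms(2)] by auto
  have "cnt q i s t + 1 \<le> loc q t (i + dir s)"
  proof -
    have "1 + cnt q i s t \<le> loc q t (i + dir s)" for t
    proof (induction t)
      case (Suc t)
      then show ?case by (auto simp: cnt_Suc loc_Suc)
    qed (simp add: Suc_le_eq)
    then show ?thesis by simp
  qed
  then show ?thesis using zeta_eq[OF assms(1) t(1), of s] t by simp
qed

lemma zeta_strict:
  assumes "unit_steps q" "Suc j < cnt q i s n"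
  shows "zeta q i s j + 1 \<le> zeta q i s (Suc j)"
proof -
  obtain t where "q t = i" "cnt q i s t = Suc j" using cnt_jump[OF assms(2)] by auto
  then show ?thesis using zeta_Suc_le[OF assms(1), of j i s n t] assms(2) by simp
qed

text \<open>Summation by parts against the weights \<open>1 / \<zeta>\<close>, using the law of large numbers for the clocks.\<close>

lemma alarm_bounded:
  assumes q: "unit_steps q" and inf: "\<And>k. \<exists>n. k < cnt q i s n" and e: "good_clocks e"
    and C: "\<And>n. wsum q i (dir s) (\<lambda>m. 1 / loc q m (i + dir s)) n \<le> C"
  shows "\<exists>B. \<forall>k. alarm e q i s k \<le> B"
proof -
  define z where "z j = 1 / real (zeta q i s j)" for j
  define S where "S k = (\<Sum>j<k. e (i, s, j))" for k
  have z: "0 \<le> z j" "z (Suc j) \<le> z j" "z j \<le> 1" for j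
  proof -
    obtain n where n: "Suc j < cnt q i s n" using inf by blast
    show "0 \<le> z j" by (simp add: z_def)
    show "z (Suc j) \<le> z j" "z j \<le> 1"
      using zeta_strict[OF q n] cnt_le_zeta[OF q, of j i s n] n unfolding z_def by (auto intro!: divide_left_mono)
  qed
  have sumz: "(\<Sum>j<k. z j) \<le> C" for k
  proof -
    obtain n where n: "k < cnt q i s n" using inf by blast
    have "(\<Sum>j<k. z j) \<le> (\<Sum>j<cnt q i s n. z j)" using n z(1) by (intro sum_mono2) auto
    also have "\<dots> \<le> C" using sum_inverse_zeta[OF q, of i s n] C[of n] by (simp add: z_def)
    finally show ?thesis .
  qed
  have "eventually (\<lambda>k. \<bar>S k - real k\<bar> < 1 / Suc (Suc 0) * real k) sequentially"
    using e[unfolded good_clocks_def, THEN conjunct2, rule_format, of i s 0] by (simp only: S_def)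
  then obtain K where K: "\<And>k. K \<le> k \<Longrightarrow> \<bar>S k - k\<bar> < 1 / Suc (Suc 0) * k" by (auto simp: eventually_sequentially)
  have Smono: "S k \<le> S l" if "k \<le> l" for k l
    unfolding S_def using e that by (intro sum_mono2) (auto simp: good_clocks_def less_imp_le)
  have S: "S k \<le> 2 * k + S K" for k
  proof (cases "K \<le> k")
    case True
    have "0 \<le> S K" using Smono[of 0 K] by (simp add: S_def)
    moreover have "\<bar>S k - real k\<bar> < real k" using K[OF True] by (auto intro: le_less_trans)
    ultimately show ?thesis by linarith
  next
    case False
    then have "S k \<le> S K" by (intro Smono) simp
    then show ?thesis by simp
  qed
  \<comment> \<open>Abel summation against the decreasing weights \<open>z\<close>: the partial sums
    \<open>S\<close> are at most \<open>2 k\<close> plus a constant, and undoing the summation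
    leaves twice the sum of \<open>z\<close>.\<close>
  have abel: "(\<Sum>j<k. e (i, s, j) * z j) = S k * z k + (\<Sum>j<k. S (Suc j) * (z j - z (Suc j)))" for k
    by (induction k) (auto simp: S_def algebra_simps)
  have abel2: "(\<Sum>j<k. z j) = k * z k + (\<Sum>j<k. real (Suc j) * (z j - z (Suc j)))" for k
    by (induction k) (auto simp: algebra_simps)
  have tele: "(\<Sum>j<k. z j - z (Suc j)) = z 0 - z k" for k
    by (induction k) auto
  have "alarm e q i s k \<le> 2 * C + S K" for k
  proof -
    have "alarm e q i s k = (\<Sum>j<k. e (i, s, j) * z j)" by (simp add: alarm_def z_def)
    also have "\<dots> \<le> (2 * k + S K) * z k + (\<Sum>j<k. (2 * real (Suc j) + S K) * (z j - z (Suc j)))"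
      unfolding abel using S[of k] z S[of "Suc _"] by (intro add_mono mult_right_mono sum_mono) auto
    also have "\<dots> = 2 * (k * z k + (\<Sum>j<k. real (Suc j) * (z j - z (Suc j)))) + S K * (z k + (\<Sum>j<k. z j - z (Suc j)))"
      by (simp add: algebra_simps sum.distrib sum_distrib_left sum_subtractf)
    also have "\<dots> = 2 * (\<Sum>j<k. z j) + S K * z 0" unfolding abel2[symmetric] tele by simp
    also have "\<dots> \<le> 2 * C + S K * 1"
      using sumz z(3)[of 0] Smono[of 0 K] by (intro add_mono mult_left_mono) (auto simp: S_def)
    finally show ?thesis by simp
  qed
  then show ?thesis by blast
qed

lemma AE_walk_not_explosive: "AE e in Clocks. \<not> explosive x (walk v e)"
proof (rule AE_Clocks_not[where G = good_clocks and j = "(x, False, 0)"])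
  interpret W: vrrw_law Clocks "\<lambda>n e. walk v e n" v by (rule vrrw_law_walk)
  have "(\<lambda>e. walk v e) \<in> measurable Clocks Paths"
    by (auto intro!: measurable_PiM_single' simp: space_PiM)
  from measurable_compose[OF this pred_explosive[of x]] show "Measurable.pred Clocks (\<lambda>e. explosive x (walk v e))" .
next
  fix e :: clocks and \<delta> :: real
  let ?e' = "e((x, False, 0) := e (x, False, 0) + \<delta>)"
  assume \<delta>: "0 < \<delta>" and e: "good_clocks e" "explosive x (walk v e)" "explosive x (walk v ?e')"
  interpret coupling e ?e' "walk v e" "walk v ?e'" x \<delta>
    by standard (use e \<delta> in \<open>auto simp: rubin_walk good_clocks_def\<close>)
  obtain C :: nat where "\<And>n. wsum (walk v e) x (dir False) (\<lambda>m. 1 / loc (walk v e) m (x + dir False)) n \<le> C"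
    using e(2) by (auto simp: explosive_def)
  then obtain B where "\<And>k. alarm e (walk v e) x False k \<le> B"
    using alarm_bounded[OF unit_steps _ e(1), of x False "real C"] e(2) by (auto simp: explosive_def)
  then show False using e(2,3) by (intro no_common_explosion[of B]) (auto simp: explosive_def)
qed (rule AE_good_clocks)

lemma (in vrrw_law) AE_not_explosive: "AE \<omega> in M. \<forall>x. \<not> explosive x (path \<omega>)"
proof -
  have "AE \<omega> in M. \<not> explosive x (path \<omega>)" for x
    using AE_path_iff_AE_walk[of "\<lambda>p. \<not> explosive x p"] pred_explosive[of x] AE_walk_not_explosive
    by (simp add: pred_def) measurable
  then show ?thesis by (simp add: AE_all_countable)
qed

section \<open>The left end of the set of infinitely visited sites\<close>

text \<open>Martingale corrections are convergent, so the analysis of local times becomes a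
  calculation modulo this equivalence.\<close>

definition eqc :: "(nat \<Rightarrow> real) \<Rightarrow> (nat \<Rightarrow> real) \<Rightarrow> bool" where
  "eqc f g \<longleftrightarrow> convergent (\<lambda>n. f n - g n)"

lemma eqc_refl [simp]: "eqc f f"
  by (simp add: eqc_def convergent_const)

lemma eqc_sym: "eqc f g \<Longrightarrow> eqc g f"
  unfolding eqc_def using convergent_minus_iff[of "\<lambda>n. f n - g n"] by simp

lemma eqc_trans: "eqc f g \<Longrightarrow> eqc g h \<Longrightarrow> eqc f h"
  unfolding eqc_def using convergent_add[of "\<lambda>n. f n - g n" "\<lambda>n. g n - h n"] by simp

lemma eqc_add: "eqc f g \<Longrightarrow> eqc f' g' \<Longrightarrow> eqc (\<lambda>n. f n + f' n) (\<lambda>n. g n + g' n)"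
  unfolding eqc_def using convergent_add[of "\<lambda>n. f n - g n" "\<lambda>n. f' n - g' n"] by (simp add: algebra_simps)

lemma eqc_diff: "eqc f g \<Longrightarrow> eqc f' g' \<Longrightarrow> eqc (\<lambda>n. f n - f' n) (\<lambda>n. g n - g' n)"
  unfolding eqc_def using convergent_diff[of "\<lambda>n. f n - g n" "\<lambda>n. f' n - g' n"] by (simp add: algebra_simps)

lemma eqc_cmult: "eqc f g \<Longrightarrow> eqc (\<lambda>n. c * f n) (\<lambda>n. c * g n)"
  unfolding eqc_def using convergent_mult[OF convergent_const[of c], of "\<lambda>n. f n - g n"] by (simp add: algebra_simps)

lemma eqc_0_iff: "eqc f (\<lambda>_. 0) \<longleftrightarrow> convergent f"
  by (simp add: eqc_def)

lemma eqc_at_top: "eqc f g \<Longrightarrow> filterlim f at_top sequentially \<Longrightarrow> filterlim g at_top sequentially"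
  unfolding eqc_def convergent_def
proof (elim exE)
  fix L assume "filterlim f at_top sequentially" "(\<lambda>n. f n - g n) \<longlonglongrightarrow> L"
  then have "filterlim (\<lambda>n. - (f n - g n) + f n) at_top sequentially"
    by (intro filterlim_tendsto_add_at_top[OF tendsto_minus])
  then show ?thesis by simp
qed

lemma eqc_small:
  assumes "eqc f g" "0 < \<epsilon>"
  shows "\<exists>N. \<forall>m\<ge>N. \<forall>n\<ge>N. \<bar>(f m - f n) - (g m - g n)\<bar> < \<epsilon>"
proof -
  have "Cauchy (\<lambda>n. f n - g n)" using assms(1) unfolding eqc_def by (rule convergent_Cauchy)
  then obtain N where "\<forall>m\<ge>N. \<forall>n\<ge>N. norm ((f m - g m) - (f n - g n)) < \<epsilon>"
    using assms(2) unfolding Cauchy_iff by blast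
  then show ?thesis by (auto intro!: exI[of _ N] simp: algebra_simps)
qed

lemma eqc_eventually:
  assumes "\<And>n. n \<ge> N \<Longrightarrow> f (Suc n) - f n = g (Suc n) - g n"
  shows "eqc f g"
proof -
  have "f n - g n = f N - g N" if "n \<ge> N" for n
    using that
  proof (induction n rule: dec_induct)
    case (step n)
    then show ?case using assms[of n] by simp
  qed simp
  then have "(\<lambda>n. f n - g n) \<longlonglongrightarrow> f N - g N"
    by (intro tendsto_eventually eventually_sequentiallyI[of N])
  then show ?thesis by (auto simp: eqc_def convergent_def)
qed

lemma wsum_eqc:
  assumes "\<And>n. n \<ge> N \<Longrightarrow> p n = i \<Longrightarrow> p (Suc n) = i + d \<Longrightarrow> f n = g n"
  shows "eqc (wsum p i d f) (wsum p i d g)"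
  by (rule eqc_eventually[of N]) (use assms in \<open>auto simp: wsum_Suc\<close>)

lemma mono_unbounded_at_top:
  fixes f :: "nat \<Rightarrow> real"
  assumes "incseq f" "\<not> convergent f"
  shows "filterlim f at_top sequentially"
proof -
  have "\<exists>n. C < f n" for C
  proof (rule ccontr)
    assume "\<not> (\<exists>n. C < f n)"
    then have "\<And>n. f n \<le> C" by (auto simp: not_less)
    with assms(1) have "convergent f" by (meson incseq_convergent convergentI)
    with assms(2) show False by simp
  qed
  then show ?thesis
    unfolding filterlim_at_top_gt[where c = 0] eventually_sequentially
    using assms(1) by (meson incseqD less_imp_le order_trans)
qed

text \<open>A bounded \<open>f\<close> is covered too: it is eventually constant, like the local
  time of a site visited finitely often.\<close>

lemma convergent_comp_incseq:
  fixes f :: "nat \<Rightarrow> nat" and g :: "nat \<Rightarrow> real"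
  assumes "incseq f" "convergent g"
  shows "convergent (\<lambda>n. g (f n))"
proof (cases "\<exists>B. \<forall>n. f n \<le> B")
  case True
  then obtain B where B: "\<And>n. f n \<le> B" by auto
  define M where "M = Max (range f)"
  have fin: "finite (range f)" by (meson B atMost_iff finite_atMost finite_subset image_subsetI)
  obtain N where N: "f N = M" using Max_in[OF fin] by (auto simp: M_def)
  have "f n = M" if "n \<ge> N" for n
    using incseqD[OF assms(1) that] N Max_ge[OF fin, of "f n"] by (simp add: M_def)
  then have "(\<lambda>n. g (f n)) \<longlonglongrightarrow> g M"
    by (intro tendsto_eventually eventually_sequentiallyI[of N]) simp
  then show ?thesis by (auto simp: convergent_def)
next
  case False
  then have "filterlim f at_top sequentially"
    unfolding filterlim_at_top eventually_sequentially using assms(1) by (meson incseqD nat_le_linear order_trans)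
  with assms(2) show ?thesis
    unfolding convergent_def by (auto intro: filterlim_compose)
qed

lemma convergent_sum_inverse: "convergent (\<lambda>k. (\<Sum>i=c..<k. 1 / real i) - ln (real k))"
proof -
  have "(\<lambda>k. harm k - ln (real k)) \<longlonglongrightarrow> (euler_mascheroni :: real)" by (rule euler_mascheroni_LIMSEQ)
  then have "(\<lambda>k. harm k - ln (real k) - 1 / real k - (\<Sum>i=1..<c. 1 / real i)) \<longlonglongrightarrow>
      euler_mascheroni - 0 - (\<Sum>i=1..<c. 1 / real i)"
    by (intro tendsto_diff tendsto_const lim_const_over_n)
  moreover have "harm k - ln (real k) - 1 / real k - (\<Sum>i=1..<c. 1 / real i) = (\<Sum>i=c..<k. 1 / real i) - ln (real k)"
    if "k \<ge> c + 1" for k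
  proof -
    have "harm k = (\<Sum>i=1..<k. 1 / real i) + 1 / real k"
    proof -
      have "{1..k} = insert k {1..<k}" using that by auto
      then show ?thesis by (simp add: harm_def inverse_eq_divide)
    qed
    moreover have "(\<Sum>i=1..<k. 1 / real i) = (\<Sum>i=1..<c. 1 / real i) + (\<Sum>i=c..<k. 1 / real i)"
    proof (cases "c = 0")
      case True
      have "{0..<k} = insert 0 {1..<k}" using that by auto
      then show ?thesis using True by simp
    qed (use that in \<open>simp add: sum.atLeastLessThan_concat\<close>)
    ultimately show ?thesis by simp
  qed
  ultimately have "(\<lambda>k. (\<Sum>i=c..<k. 1 / real i) - ln (real k)) \<longlonglongrightarrow>
      euler_mascheroni - 0 - (\<Sum>i=1..<c. 1 / real i)"
    by (elim Lim_transform_eventually) (auto simp: eventually_sequentially intro!: exI[of _ "c + 1"])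
  then show ?thesis by (rule convergentI)
qed

lemma cnt_less_loc: "cnt q i s n < loc q n (i + dir s)"
  by (induction n) (auto simp: cnt_Suc loc_Suc)

lemma loc_le_neighbours: "unit_steps q \<Longrightarrow> loc q n j \<le> loc q n (j - 1) + loc q n (j + 1)"
  using loc_eq_cnt[of q n j] cnt_less_loc[of q j True n] cnt_less_loc[of q j False n] by simp

lemma cnt_wsum: "real (cnt q i s n) = wsum q i (dir s) (\<lambda>_. 1) n"
  by (induction n) (auto simp: cnt_Suc wsum_Suc)

text \<open>With \<open>H = 1\<close>, the two jump sums in \<open>mart\<close> are the basic
  unknowns of the analysis.\<close>

definition Asum :: "(nat \<Rightarrow> int) \<Rightarrow> int \<Rightarrow> nat \<Rightarrow> real" where
  "Asum p j = wsum p j 1 (\<lambda>m. 1 / loc p m (j + 1))"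

definition Bsum :: "(nat \<Rightarrow> int) \<Rightarrow> int \<Rightarrow> nat \<Rightarrow> real" where
  "Bsum p j = wsum p j (-1) (\<lambda>m. 1 / loc p m (j - 1))"

lemma incseq_wsum: "(\<And>m. 0 \<le> f m) \<Longrightarrow> incseq (wsum p i d f)"
  by (auto simp: incseq_def intro: wsum_mono)

lemma incseq_Asum: "incseq (Asum p j)" and incseq_Bsum: "incseq (Bsum p j)"
  unfolding Asum_def Bsum_def by (rule incseq_wsum, simp)+

lemma Asum_nonneg: "0 \<le> Asum p j n" and Bsum_nonneg: "0 \<le> Bsum p j n"
  unfolding Asum_def Bsum_def by (rule wsum_nonneg, simp)+

lemma incseq_loc: "incseq (\<lambda>n. loc p n j)"
  by (auto simp: incseq_def intro: loc_mono)

section \<open>Local times along a regular path\<close>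

locale regular_path =
  fixes p :: "nat \<Rightarrow> int"
  assumes reg: "regular p"
begin

abbreviation z :: "int \<Rightarrow> nat \<Rightarrow> real" where "z j n \<equiv> real (loc p n j)"

lemma unit_steps: "unit_steps p"
  using reg by (simp add: regular_def)

lemma z_pos [simp]: "0 < z j n"
  by simp

lemma z_mono: "m \<le> n \<Longrightarrow> z j m \<le> z j n"
  by (simp add: loc_mono)

lemma AB: "eqc (Asum p j) (Bsum p j)"
proof -
  have "convergent (mart p j (\<lambda>_. 1))" using reg by (simp add: regular_def)
  moreover have "mart p j (\<lambda>_. 1) = (\<lambda>n. Asum p j n - Bsum p j n)"
    by (rule ext) (simp add: mart_def Asum_def Bsum_def)
  ultimately show ?thesis by (simp add: eqc_def)
qed

text \<open>The harmonic sum over arrivals at \<open>j\<close> is \<open>Asum\<close> at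
  \<open>j - 1\<close> plus \<open>Bsum\<close> at \<open>j + 1\<close>; the martingale at
  \<open>j + 1\<close> trades the latter for \<open>Asum\<close>.\<close>

lemma ln_z: "eqc (\<lambda>n. ln (z j n)) (\<lambda>n. Asum p (j - 1) n + Asum p (j + 1) n)"
proof -
  have "Asum p (j - 1) n + Bsum p (j + 1) n = (\<Sum>k=loc p 0 j..<loc p n j. 1 / real k)" for n
    using wsum_arrivals[OF unit_steps, of j "\<lambda>k. 1 / real k" n] by (simp add: Asum_def Bsum_def)
  moreover have "convergent (\<lambda>n. (\<Sum>k=loc p 0 j..<loc p n j. 1 / real k) - ln (real (loc p n j)))"
    by (rule convergent_comp_incseq[OF incseq_loc convergent_sum_inverse])
  ultimately have "eqc (\<lambda>n. Asum p (j - 1) n + Bsum p (j + 1) n) (\<lambda>n. ln (z j n))" by (simp add: eqc_def)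
  from eqc_trans[OF eqc_sym[OF this] eqc_add[OF eqc_refl eqc_sym[OF AB]]] show ?thesis .
qed

lemma ln_ratio:
  "eqc (\<lambda>n. ln (z i n / z j n)) (\<lambda>n. (Asum p (i - 1) n + Asum p (i + 1) n) - (Asum p (j - 1) n + Asum p (j + 1) n))"
proof -
  have "(\<lambda>n. ln (z i n / z j n)) = (\<lambda>n. ln (z i n) - ln (z j n))" by (rule ext) (simp add: ln_div)
  then show ?thesis using eqc_diff[OF ln_z[of i] ln_z[of j]] by simp
qed

lemma z_at_top_iff: "filterlim (z j) at_top sequentially \<longleftrightarrow> (\<forall>N. \<exists>n\<ge>N. p n = j)"
proof
  assume lim: "filterlim (z j) at_top sequentially"
  show "\<forall>N. \<exists>n\<ge>N. p n = j"
  proof (rule ccontr)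
    assume "\<not> (\<forall>N. \<exists>n\<ge>N. p n = j)"
    then obtain N where N: "\<And>n. n \<ge> N \<Longrightarrow> p n \<noteq> j" by auto
    have const: "loc p n j = loc p N j" if "n \<ge> N" for n
      using that by (induction n rule: dec_induct) (auto simp: loc_Suc N)
    have "eventually (\<lambda>n. z j n > z j N) sequentially"
      using lim[unfolded filterlim_at_top_dense, rule_format, of "z j N"] .
    then obtain M where "\<And>n. n \<ge> M \<Longrightarrow> z j n > z j N" unfolding eventually_sequentially by blast
    from this[of "max M N"] const[of "max M N"] show False by simp
  qed
next
  assume inf: "\<forall>N. \<exists>n\<ge>N. p n = j"
  have "\<exists>n. k \<le> loc p n j" for k
  proof (induction k)
    case (Suc k)
    then obtain n where n: "k \<le> loc p n j" by auto
    obtain m where m: "m \<ge> Suc n" "p m = j" using inf by blast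
    then obtain m' where "m = Suc m'" by (cases m) auto
    then have "Suc k \<le> loc p m j" using m n loc_mono[of n m' p j] by (simp add: loc_Suc)
    then show ?case by blast
  qed simp
  then have "filterlim (\<lambda>n. loc p n j) at_top sequentially"
    unfolding filterlim_at_top eventually_sequentially by (meson loc_mono order_trans)
  then show "filterlim (z j) at_top sequentially"
    by (rule filterlim_compose[OF filterlim_real_sequentially])
qed

lemma wsum_unbounded_visits:
  assumes "filterlim (wsum p j d f) at_top sequentially"
  shows "filterlim (z j) at_top sequentially"
  unfolding z_at_top_iff
proof (rule ccontr)
  assume "\<not> (\<forall>N. \<exists>n\<ge>N. p n = j)"
  then obtain N where N: "\<And>n. n \<ge> N \<Longrightarrow> p n \<noteq> j" by auto
  have const: "wsum p j d f n = wsum p j d f N" if "n \<ge> N" for n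
    using that by (induction n rule: dec_induct) (auto simp: wsum_Suc N)
  have "eventually (\<lambda>n. wsum p j d f n > wsum p j d f N) sequentially" using assms by (simp add: filterlim_at_top_dense)
  then obtain M where "\<And>n. n \<ge> M \<Longrightarrow> wsum p j d f n > wsum p j d f N" unfolding eventually_sequentially by blast
  from this[of "max M N"] const[of "max M N"] show False by simp
qed

text \<open>A jump away from \<open>i\<close> and the return see the same local time at
  \<open>i\<close>; the boundary term at time \<open>n\<close> vanishes since that local time
  diverges.\<close>

lemma crossings_eqc:
  assumes lim: "filterlim (z i) at_top sequentially" and d: "d = 1 \<or> d = -1"
  shows "eqc (wsum p i d (\<lambda>m. 1 / z i m)) (wsum p (i + d) (- d) (\<lambda>m. 1 / z i m))"
proof -
  have inv: "(\<lambda>n. 1 / z i n) \<longlonglongrightarrow> 0"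
    using tendsto_inverse_0_at_top[OF lim] by (simp add: inverse_eq_divide)
  have "(\<lambda>n. if (p n - i) * d > 0 then 1 / z i n else 0) \<longlonglongrightarrow> 0"
    by (rule real_tendsto_sandwich[OF _ _ tendsto_const inv]) (auto intro!: always_eventually)
  then have "(\<lambda>n. (if (p n - i) * d > 0 then 1 / z i n else 0) - (if (p 0 - i) * d > 0 then 1 / z i 0 else 0))
     \<longlonglongrightarrow> 0 - (if (p 0 - i) * d > 0 then 1 / z i 0 else 0)"
    by (intro tendsto_diff tendsto_const)
  then have "(\<lambda>n. wsum p i d (\<lambda>m. 1 / z i m) n - wsum p (i + d) (- d) (\<lambda>m. 1 / z i m) n)
     \<longlonglongrightarrow> 0 - (if (p 0 - i) * d > 0 then 1 / z i 0 else 0)"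
    using wsum_crossings[OF unit_steps d, of i "\<lambda>k. 1 / real k"] by simp
  then show ?thesis by (auto simp: eqc_def convergent_def)
qed

end

locale left_end = regular_path +
  assumes fin: "\<exists>N. \<forall>n\<ge>N. p n \<noteq> -1" and inf: "\<forall>N. \<exists>n\<ge>N. p n = 0"
begin

lemma z0: "filterlim (z 0) at_top sequentially"
  using inf by (simp add: z_at_top_iff)

lemma A_minus_1: "convergent (Asum p (-1))"
proof -
  obtain N where "\<And>n. n \<ge> N \<Longrightarrow> p n \<noteq> -1" using fin by blast
  then have "eqc (Asum p (-1)) (\<lambda>_. 0)"
    unfolding Asum_def by (intro eqc_eventually[of N]) (simp add: wsum_Suc)
  then show ?thesis by (simp add: eqc_0_iff)
qed

text \<open>Jumps \<open>0 -> -1\<close> come to an end, so \<open>Bsum\<close> at \<open>0\<close>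
  is eventually constant, and the martingale transfers this to the jumps
  \<open>0 -> 1\<close>.\<close>

lemma A0: "convergent (Asum p 0)"
proof -
  obtain N where N: "\<And>n. n \<ge> N \<Longrightarrow> p n \<noteq> -1" using fin by blast
  have "eqc (Bsum p 0) (\<lambda>_. 0)"
    unfolding Bsum_def
  proof (rule eqc_eventually[of N])
    fix n assume "n \<ge> N"
    then have "p (Suc n) \<noteq> -1" by (intro N) simp
    then show "wsum p 0 (- 1) (\<lambda>m. 1 / z (0 - 1) m) (Suc n) - wsum p 0 (- 1) (\<lambda>m. 1 / z (0 - 1) m) n = 0 - 0"
      by (simp add: wsum_Suc)
  qed
  from eqc_trans[OF AB this] show ?thesis by (simp add: eqc_0_iff)
qed

lemma A1: "filterlim (Asum p 1) at_top sequentially"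
proof -
  have "eqc (\<lambda>n. ln (z 0 n)) (\<lambda>n. Asum p (-1) n + Asum p 1 n)" using ln_z[of 0] by simp
  also have "eqc (\<lambda>n. Asum p (-1) n + Asum p 1 n) (\<lambda>n. 0 + Asum p 1 n)"
    using A_minus_1 by (intro eqc_add) (auto simp: eqc_0_iff)
  finally (eqc_trans) have "eqc (\<lambda>n. ln (z 0 n)) (Asum p 1)" by simp
  from eqc_at_top[OF this] show ?thesis
    using filterlim_compose[OF ln_at_top z0] by simp
qed

lemma z1: "filterlim (z 1) at_top sequentially"
  using A1 unfolding Asum_def by (rule wsum_unbounded_visits)

lemma ln_z1: "eqc (\<lambda>n. ln (z 1 n)) (Asum p 2)"
proof -
  have "eqc (\<lambda>n. ln (z 1 n)) (\<lambda>n. Asum p 0 n + Asum p 2 n)" using ln_z[of 1] by simp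
  also have "eqc (\<lambda>n. Asum p 0 n + Asum p 2 n) (\<lambda>n. 0 + Asum p 2 n)"
    using A0 by (intro eqc_add) (auto simp: eqc_0_iff)
  finally (eqc_trans) show ?thesis by simp
qed

lemma A2: "filterlim (Asum p 2) at_top sequentially"
  using eqc_at_top[OF ln_z1] filterlim_compose[OF ln_at_top z1] by simp

lemma z2: "filterlim (z 2) at_top sequentially"
  using A2 unfolding Asum_def by (rule wsum_unbounded_visits)

lemma ln_z0_z2: "eqc (\<lambda>n. ln (z 0 n / z 2 n)) (\<lambda>n. - Asum p 3 n)"
proof -
  have "eqc (\<lambda>n. ln (z 0 n / z 2 n)) (\<lambda>n. (Asum p (-1) n + Asum p 1 n) - (Asum p 1 n + Asum p 3 n))"
    using ln_ratio[of 0 2] by simp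
  also have "eqc (\<lambda>n. (Asum p (-1) n + Asum p 1 n) - (Asum p 1 n + Asum p 3 n)) (\<lambda>n. (0 + Asum p 1 n) - (Asum p 1 n + Asum p 3 n))"
    using A_minus_1 by (intro eqc_add eqc_diff) (auto simp: eqc_0_iff)
  finally (eqc_trans) show ?thesis by simp
qed

text \<open>Otherwise \<open>z 0\<close> and \<open>z 2\<close> are comparable, hence
  \<open>z 1\<close> is at most a multiple of \<open>z 0\<close>. The sum of \<open>1 / z 1\<close>
  over jumps \<open>0 -> 1\<close> then dominates a multiple of the sum of \<open>1 / z 0\<close>,
  which grows like \<open>ln (z 0)\<close>, contrary to \<open>A0\<close>.\<close>

lemma A3: "filterlim (Asum p 3) at_top sequentially"
proof (rule mono_unbounded_at_top[OF incseq_Asum], rule notI)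
  assume "convergent (Asum p 3)"
  then have "eqc (\<lambda>n. - Asum p 3 n) (\<lambda>_. 0)" by (simp add: eqc_0_iff convergent_minus_iff[symmetric])
  from eqc_trans[OF ln_z0_z2 this] have "convergent (\<lambda>n. ln (z 0 n / z 2 n))" by (simp add: eqc_0_iff)
  then have "Bseq (\<lambda>n. ln (z 0 n / z 2 n))" by (rule convergent_imp_Bseq)
  then obtain K where K: "\<And>n. \<bar>ln (z 0 n / z 2 n)\<bar> \<le> K" by (auto simp: Bseq_def)
  define c where "c = exp (- K)"
  have c: "0 < c" "c * z 2 n \<le> z 0 n" for n
  proof -
    have "- K \<le> ln (z 0 n / z 2 n)" using K[of n] by simp
    then have "exp (- K) \<le> z 0 n / z 2 n" by (metis exp_le_cancel_iff exp_ln divide_pos_pos z_pos)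
    then show "0 < c" "c * z 2 n \<le> z 0 n" by (auto simp: c_def field_simps)
  qed
  have z1_le: "z 1 n \<le> (1 + 1 / c) * z 0 n" for n
  proof -
    have "z 1 n \<le> z 0 n + z 2 n" using loc_le_neighbours[OF unit_steps, where n = n and j = 1] by simp
    moreover have "z 2 n \<le> 1 / c * z 0 n" using c(1) c(2)[of n] by (simp add: field_simps)
    ultimately show ?thesis by (simp add: algebra_simps)
  qed
  let ?W = "wsum p 0 1 (\<lambda>m. 1 / z 0 m)"
  have W: "eqc ?W (wsum p 1 (-1) (\<lambda>m. 1 / z 0 m))" using crossings_eqc[OF z0, where d = 1] by simp
  obtain N where "\<And>n. n \<ge> N \<Longrightarrow> p n \<noteq> -1" using fin by blast
  then have "eqc (wsum p (-1) 1 (\<lambda>m. 1 / z 0 m)) (\<lambda>_. 0)"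
    by (intro eqc_eventually[of N]) (simp add: wsum_Suc)
  from eqc_add[OF this eqc_sym[OF W]]
  have 1: "eqc (\<lambda>n. wsum p (-1) 1 (\<lambda>m. 1 / z 0 m) n + wsum p 1 (-1) (\<lambda>m. 1 / z 0 m) n) ?W"
    by simp
  have 2: "(\<lambda>n. wsum p (-1) 1 (\<lambda>m. 1 / z 0 m) n + wsum p 1 (-1) (\<lambda>m. 1 / z 0 m) n) = (\<lambda>n. \<Sum>k=loc p 0 0..<loc p n 0. 1 / real k)"
    using wsum_arrivals[OF unit_steps, of 0 "\<lambda>k. 1 / real k"] by (intro ext) simp
  have 3: "eqc (\<lambda>n. \<Sum>k=loc p 0 0..<loc p n 0. 1 / real k) (\<lambda>n. ln (z 0 n))"
    unfolding eqc_def by (rule convergent_comp_incseq[OF incseq_loc convergent_sum_inverse])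
  have "eqc (\<lambda>n. ln (z 0 n)) ?W" by (rule eqc_trans[OF eqc_sym[OF 3] 1[unfolded 2]])
  from eqc_at_top[OF this] have "filterlim ?W at_top sequentially"
    using filterlim_compose[OF ln_at_top z0] by simp
  then have "filterlim (\<lambda>n. (1 / (1 + 1 / c)) * ?W n) at_top sequentially"
    using c(1) by (intro filterlim_tendsto_pos_mult_at_top[OF tendsto_const]) (auto intro!: divide_pos_pos add_pos_pos)
  moreover have "(1 / (1 + 1 / c)) * ?W n \<le> Asum p 0 n" for n
    unfolding wsum_cmult[symmetric] Asum_def
  proof (rule wsum_le)
    fix m
    have "1 / (1 + 1 / c) * (1 / z 0 m) = 1 / ((1 + 1 / c) * z 0 m)" by simp
    also have "\<dots> \<le> 1 / z 1 m" using z1_le[of m] c(1) by (intro divide_left_mono mult_pos_pos add_pos_pos) auto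
    finally show "1 / (1 + 1 / c) * (1 / z 0 m) \<le> 1 / real (loc p m (0 + 1))" by simp
  qed
  ultimately have "filterlim (Asum p 0) at_top sequentially"
    by (elim filterlim_at_top_mono) (auto intro: always_eventually)
  moreover have "Bseq (Asum p 0)" using A0 by (rule convergent_imp_Bseq)
  ultimately show False by (meson filterlim_at_top_imp_at_infinity not_tendsto_and_filterlim_at_infinity A0 convergent_LIMSEQ_iff trivial_limit_sequentially)
qed

lemma z3: "filterlim (z 3) at_top sequentially"
  using A3 unfolding Asum_def by (rule wsum_unbounded_visits)

lemma z4: "filterlim (z 4) at_top sequentially"
proof -
  have "eqc (\<lambda>n. Asum p 3 n + Asum p 5 n) (\<lambda>n. ln (z 4 n))" using eqc_sym[OF ln_z[of 4]] by simp
  moreover have "filterlim (\<lambda>n. Asum p 3 n + Asum p 5 n) at_top sequentially"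
    by (rule filterlim_at_top_mono[OF A3]) (auto intro: always_eventually simp: Asum_nonneg)
  ultimately have "filterlim (\<lambda>n. ln (z 4 n)) at_top sequentially" by (rule eqc_at_top)
  then have "filterlim (\<lambda>n. exp (ln (z 4 n))) at_top sequentially" by (rule filterlim_compose[OF exp_at_top])
  then show ?thesis by simp
qed

lemma z0_z2: "(\<lambda>n. z 0 n / z 2 n) \<longlonglongrightarrow> 0"
proof -
  have "eqc (\<lambda>n. - ln (z 0 n / z 2 n)) (Asum p 3)" using eqc_diff[OF eqc_refl[of "\<lambda>_. 0"] ln_z0_z2] by simp
  from eqc_at_top[OF eqc_sym[OF this] A3] have "filterlim (\<lambda>n. - ln (z 0 n / z 2 n)) at_top sequentially" .
  then have "filterlim (\<lambda>n. ln (z 0 n / z 2 n)) at_bot sequentially" by (simp add: filterlim_uminus_at_top)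
  then have "(\<lambda>n. exp (ln (z 0 n / z 2 n))) \<longlonglongrightarrow> 0" by (rule filterlim_compose[OF exp_at_bot])
  then show ?thesis by simp
qed

lemma z1_le_z2: "eventually (\<lambda>n. z 1 n \<le> 2 * z 2 n) sequentially"
proof -
  have "eventually (\<lambda>n. z 0 n / z 2 n < 1) sequentially" using z0_z2 by (rule order_tendstoD) simp
  then show ?thesis
  proof eventually_elim
    case (elim n)
    then have "z 0 n < z 2 n" by (simp add: divide_less_eq)
    moreover have "z 1 n \<le> z 0 n + z 2 n" using loc_le_neighbours[OF unit_steps, where n = n and j = 1] by simp
    ultimately show ?case by simp
  qed
qed

text \<open>Jumps \<open>1 \<rightarrow> 2\<close> are the returns of jumps \<open>2 \<rightarrow> 1\<close>, and the latter occur \<open>Z(1)/Z(3)\<close> times as often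
  as jumps \<open>2 \<rightarrow> 3\<close>.\<close>

lemma A1_eqc: "eqc (Asum p 1) (wsum p 2 1 (\<lambda>m. z 1 m / (z 2 m * z 3 m)))"
proof -
  let ?H = "\<lambda>m. min 1 (z 1 m / (2 * z 2 m))"
  have "convergent (mart p 2 ?H)"
    using reg[unfolded regular_def, THEN conjunct2, rule_format, of 2] by simp
  then have 1: "eqc (wsum p 2 1 (\<lambda>m. ?H m / z 3 m)) (wsum p 2 (-1) (\<lambda>m. ?H m / z 1 m))"
    by (simp add: eqc_def mart_def[abs_def])
  \<comment> \<open>The cap in \<open>?H\<close> keeps the weight bounded for the martingale;
    because of the factor \<open>2\<close> it is inactive at late times.\<close>
  obtain N where N: "\<And>n. n \<ge> N \<Longrightarrow> z 1 n \<le> 2 * z 2 n" using z1_le_z2 by (auto simp: eventually_sequentially)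
  have H: "?H n = z 1 n / (2 * z 2 n)" if "n \<ge> N" for n using N[OF that] by (simp add: min_def divide_le_eq)
  have 2: "eqc (wsum p 2 1 (\<lambda>m. ?H m / z 3 m)) (wsum p 2 1 (\<lambda>m. (1 / 2) * (z 1 m / (z 2 m * z 3 m))))"
    by (rule wsum_eqc[of N]) (simp add: H)
  have 3: "eqc (wsum p 2 (-1) (\<lambda>m. ?H m / z 1 m)) (wsum p 2 (-1) (\<lambda>m. (1 / 2) * (1 / z 2 m)))"
    by (rule wsum_eqc[of N]) (simp add: H)
  have "eqc (wsum p 2 1 (\<lambda>m. (1 / 2) * (z 1 m / (z 2 m * z 3 m)))) (wsum p 2 (-1) (\<lambda>m. (1 / 2) * (1 / z 2 m)))"
    by (rule eqc_trans[OF eqc_sym[OF 2] eqc_trans[OF 1 3]])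
  then have "eqc (\<lambda>n. (1 / 2) * wsum p 2 1 (\<lambda>m. z 1 m / (z 2 m * z 3 m)) n) (\<lambda>n. (1 / 2) * wsum p 2 (-1) (\<lambda>m. 1 / z 2 m) n)"
    unfolding wsum_cmult[abs_def] .
  from eqc_cmult[OF this, of 2] have "eqc (wsum p 2 1 (\<lambda>m. z 1 m / (z 2 m * z 3 m))) (wsum p 2 (-1) (\<lambda>m. 1 / z 2 m))"
    by simp
  also have "eqc (wsum p 2 (-1) (\<lambda>m. 1 / z 2 m)) (wsum p 1 1 (\<lambda>m. 1 / z 2 m))"
    using crossings_eqc[OF z2, where d = "-1"] by simp
  finally (eqc_trans) have "eqc (wsum p 2 1 (\<lambda>m. z 1 m / (z 2 m * z 3 m))) (wsum p 1 1 (\<lambda>m. 1 / z 2 m))" .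
  from eqc_sym[OF this] show ?thesis by (simp add: Asum_def)
qed

end

section \<open>Tail sums of exponentials\<close>

definition tail_sum :: "(nat \<Rightarrow> real) \<Rightarrow> nat \<Rightarrow> real" where
  "tail_sum f n = suminf f - sum f {..<n}"

lemma tail_sum_Suc: "tail_sum f (Suc n) = tail_sum f n - f n"
  by (simp add: tail_sum_def)

lemma tail_sum_tendsto_0: "summable f \<Longrightarrow> tail_sum f \<longlonglongrightarrow> 0"
  unfolding tail_sum_def using tendsto_diff[OF tendsto_const[of "suminf f"] summable_LIMSEQ[of f]] by simp

lemma antimono_limit_nonneg:
  fixes g :: "nat \<Rightarrow> real"
  assumes "\<And>n. n \<ge> N \<Longrightarrow> g (Suc n) \<le> g n" "g \<longlonglongrightarrow> 0" "n \<ge> N"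
  shows "0 \<le> g n"
proof (rule LIMSEQ_le_const2[OF assms(2)], intro exI[of _ n] allI impI)
  fix m assume "n \<le> m"
  then show "g m \<le> g n" using assms(1,3)
    by (induction m rule: dec_induct) (auto intro: order_trans[OF assms(1)])
qed

lemma tail_sum_nonneg: "summable f \<Longrightarrow> (\<And>m. 0 \<le> f m) \<Longrightarrow> 0 \<le> tail_sum f n"
  by (rule antimono_limit_nonneg[where N = 0]) (auto simp: tail_sum_Suc tail_sum_tendsto_0)

lemma tail_sum_mono:
  assumes "summable f" "summable g" "\<And>m. m \<ge> N \<Longrightarrow> f m \<le> g m" "n \<ge> N"
  shows "tail_sum f n \<le> tail_sum g n"
  using antimono_limit_nonneg[where N = N and n = n and g = "\<lambda>n. tail_sum g n - tail_sum f n"]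
    tendsto_diff[OF tail_sum_tendsto_0[OF assms(2)] tail_sum_tendsto_0[OF assms(1)]] assms(3,4)
  by (simp add: tail_sum_Suc)

lemma tail_sum_cmult: "summable f \<Longrightarrow> tail_sum (\<lambda>m. c * f m) n = c * tail_sum f n"
  by (simp add: tail_sum_def suminf_mult sum_distrib_left algebra_simps)

lemma asymp_equiv_iff_eps:
  assumes "\<And>n. 0 \<le> (g n :: real)"
  shows "f \<sim>[F] g \<longleftrightarrow> (\<forall>\<epsilon>>0. eventually (\<lambda>n. \<bar>f n - g n\<bar> \<le> \<epsilon> * g n) F)"
  unfolding asymp_equiv_altdef smallo_def using assms by simp

lemma asymp_equiv_add_nonneg:
  assumes "f \<sim>[F] g" "f' \<sim>[F] g'" "\<And>n. 0 \<le> (g n :: real)" "\<And>n. 0 \<le> (g' n :: real)"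
  shows "(\<lambda>n. f n + f' n) \<sim>[F] (\<lambda>n. g n + g' n)"
  unfolding asymp_equiv_iff_eps[OF add_nonneg_nonneg[OF assms(3,4)]]
proof (intro allI impI)
  fix \<epsilon> :: real assume "0 < \<epsilon>"
  then have "eventually (\<lambda>n. \<bar>f n - g n\<bar> \<le> \<epsilon> * g n) F" "eventually (\<lambda>n. \<bar>f' n - g' n\<bar> \<le> \<epsilon> * g' n) F"
    using assms(1,2) unfolding asymp_equiv_iff_eps[OF assms(3)] asymp_equiv_iff_eps[OF assms(4)] by blast+
  then show "eventually (\<lambda>n. \<bar>f n + f' n - (g n + g' n)\<bar> \<le> \<epsilon> * (g n + g' n)) F"
    by eventually_elim (simp add: algebra_simps)
qed

text \<open>From a late index on, \<open>f\<close> lies between \<open>(1 - \<epsilon>) g\<close>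
  and \<open>(1 + \<epsilon>) g\<close>, and tails are monotone.\<close>

lemma tail_sum_asymp_equiv:
  assumes eq: "f \<sim>[sequentially] g" and nonneg: "\<And>n. 0 \<le> g n" and g: "summable g"
  shows "summable f" "tail_sum f \<sim>[sequentially] tail_sum g"
proof -
  have ev: "eventually (\<lambda>n. \<bar>f n - g n\<bar> \<le> \<epsilon> * g n) sequentially" if "0 < \<epsilon>" for \<epsilon>
    using eq that unfolding asymp_equiv_iff_eps[OF nonneg] by blast
  have "eventually (\<lambda>n. norm (f n) \<le> 2 * g n) sequentially"
    using ev[of 1] by (rule eventually_mono) (use nonneg in \<open>auto simp: abs_le_iff\<close>)
  then show f: "summable f"
    by (rule summable_comparison_test_ev) (rule summable_mult[OF g])
  show "tail_sum f \<sim>[sequentially] tail_sum g"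
    unfolding asymp_equiv_iff_eps[OF tail_sum_nonneg[OF g nonneg]]
  proof (intro allI impI)
    fix \<epsilon> :: real assume "0 < \<epsilon>"
    from ev[OF this] obtain N where N: "\<And>n. n \<ge> N \<Longrightarrow> \<bar>f n - g n\<bar> \<le> \<epsilon> * g n" by (auto simp: eventually_sequentially)
    show "eventually (\<lambda>n. \<bar>tail_sum f n - tail_sum g n\<bar> \<le> \<epsilon> * tail_sum g n) sequentially"
    proof (rule eventually_sequentiallyI[of N])
      fix n assume n: "n \<ge> N"
      have "tail_sum f n \<le> tail_sum (\<lambda>m. (1 + \<epsilon>) * g m) n"
        by (rule tail_sum_mono[OF f summable_mult[OF g] _ n]) (use N in \<open>force simp: algebra_simps abs_le_iff\<close>)
      moreover have "tail_sum (\<lambda>m. (1 - \<epsilon>) * g m) n \<le> tail_sum f n"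
        by (rule tail_sum_mono[OF summable_mult[OF g] f _ n]) (use N in \<open>force simp: algebra_simps abs_le_iff\<close>)
      ultimately show "\<bar>tail_sum f n - tail_sum g n\<bar> \<le> \<epsilon> * tail_sum g n"
        unfolding tail_sum_cmult[OF g] by (simp add: algebra_simps abs_le_iff)
    qed
  qed
qed

lemma summable_bounded_partial:
  fixes f :: "nat \<Rightarrow> real"
  assumes "\<And>n. 0 \<le> f n" "\<And>n. (\<Sum>m<n. f m) \<le> C"
  shows "summable f"
  by (rule bounded_imp_summable[where B = C]) (use assms(1) assms(2)[of "Suc _"] in \<open>auto simp: lessThan_Suc_atMost\<close>)

text \<open>A sequence \<open>exp (v - u)\<close> that tends to \<open>0\<close> is the sum of its future decrements:
  the tails of \<open>exp (v - u) du\<close> pay for the current value and for the future increments \<open>exp (v - u) dv\<close>.\<close>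

lemma exp_tails:
  fixes u v :: "nat \<Rightarrow> real"
  defines "W \<equiv> \<lambda>n. exp (v n - u n)"
  defines "a \<equiv> \<lambda>n. W n * (u (Suc n) - u n)" and "b \<equiv> \<lambda>n. W n * (v (Suc n) - v n)"
  assumes u: "\<And>n. u n \<le> u (Suc n)" and v: "\<And>n. v n \<le> v (Suc n)" and uv: "\<And>n. u (Suc n) = u n \<or> v (Suc n) = v n"
    and du: "(\<lambda>n. u (Suc n) - u n) \<longlonglongrightarrow> 0" and dv: "(\<lambda>n. v (Suc n) - v n) \<longlonglongrightarrow> 0"
    and W: "W \<longlonglongrightarrow> 0" and a: "summable a"
  shows "summable b" "tail_sum a \<sim>[sequentially] (\<lambda>n. W n + tail_sum b n)"
proof -
  have W_pos: "0 < W n" for n by (simp add: W_def)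
  have W_Suc: "W (Suc n) = W n * exp ((v (Suc n) - v n) - (u (Suc n) - u n))" for n
    by (simp add: W_def exp_add[symmetric])
  \<comment> \<open>From \<open>1 + x \<le> exp x\<close>, valid at every step; it yields
    summability of \<open>b\<close> and one half of the asymptotics. The reverse bound
    \<open>upper\<close> uses small increments.\<close>
  have lower: "b n - a n \<le> W (Suc n) - W n" for n
  proof -
    have "W n * (1 + ((v (Suc n) - v n) - (u (Suc n) - u n))) \<le> W (Suc n)"
      unfolding W_Suc by (intro mult_left_mono exp_ge_add_one_self) (simp add: W_pos less_imp_le)
    then show ?thesis by (simp add: a_def b_def algebra_simps)
  qed
  have a_nonneg: "0 \<le> a n" and b_nonneg: "0 \<le> b n" for n
    using u[of n] v[of n] W_pos[of n] by (simp_all add: a_def b_def)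
  obtain K where K: "\<And>n. W n \<le> K"
    using convergent_imp_Bseq[OF convergentI[OF W]] by (auto simp: Bseq_def abs_le_iff)
  have part: "(\<Sum>m<n. b m) \<le> W n - W 0 + (\<Sum>m<n. a m)" for n
    by (induction n) (use lower in \<open>auto simp: algebra_simps intro: order_trans add_mono\<close>, smt (verit) lower)
  show b: "summable b"
  proof (rule summable_bounded_partial[OF b_nonneg])
    fix n
    have "(\<Sum>m<n. a m) \<le> suminf a" by (rule sum_le_suminf[OF a]) (auto simp: a_nonneg)
    then show "(\<Sum>m<n. b m) \<le> K + suminf a" using part[of n] K[of n] W_pos[of 0] by simp
  qed
  have tl0: "tail_sum a \<longlonglongrightarrow> 0" "tail_sum b \<longlonglongrightarrow> 0" using a b by (auto intro: tail_sum_tendsto_0)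
  have lim: "(\<lambda>n. c * W n + d * tail_sum b n + e * tail_sum a n) \<longlonglongrightarrow> 0" for c d e
    by (rule tendsto_eq_rhs[OF tendsto_add[OF tendsto_add[OF tendsto_mult[OF tendsto_const W] tendsto_mult[OF tendsto_const tl0(2)]] tendsto_mult[OF tendsto_const tl0(1)]]]) simp
  have le: "W n + tail_sum b n \<le> tail_sum a n" for n
  proof -
    have "0 \<le> (-1) * W n + (-1) * tail_sum b n + 1 * tail_sum a n"
      by (rule antimono_limit_nonneg[where N = 0, OF _ lim]) (use lower in \<open>simp_all add: tail_sum_Suc algebra_simps\<close>)
    then show ?thesis by simp
  qed
  have tlb: "0 \<le> tail_sum b n" for n by (rule tail_sum_nonneg[OF b b_nonneg])
  show "tail_sum a \<sim>[sequentially] (\<lambda>n. W n + tail_sum b n)"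
    unfolding asymp_equiv_iff_eps[OF add_nonneg_nonneg[OF less_imp_le[OF W_pos] tlb]]
  proof (intro allI impI)
    fix \<epsilon>' :: real assume "0 < \<epsilon>'"
    \<comment> \<open>Chosen so that \<open>(1 + \<epsilon>) / (1 - \<epsilon>) \<le> 1 + 4
      \<epsilon> \<le> 1 + \<epsilon>'\<close>.\<close>
    define \<epsilon> where "\<epsilon> = min (1 / 2) (\<epsilon>' / 4)"
    have \<epsilon>: "0 < \<epsilon>" "\<epsilon> \<le> 1 / 2" "4 * \<epsilon> \<le> \<epsilon>'" using \<open>0 < \<epsilon>'\<close> by (auto simp: \<epsilon>_def)
    have "eventually (\<lambda>n. u (Suc n) - u n < \<epsilon>) sequentially" "eventually (\<lambda>n. v (Suc n) - v n < \<epsilon>) sequentially"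
      using order_tendstoD(2)[OF du \<epsilon>(1)] order_tendstoD(2)[OF dv \<epsilon>(1)] by auto
    then have "eventually (\<lambda>n. u (Suc n) - u n < \<epsilon> \<and> v (Suc n) - v n < \<epsilon>) sequentially" by (rule eventually_conj)
    then obtain N where N: "\<And>n. n \<ge> N \<Longrightarrow> u (Suc n) - u n < \<epsilon> \<and> v (Suc n) - v n < \<epsilon>"
      by (auto simp: eventually_sequentially)
    have upper: "W (Suc n) - W n \<le> (1 + \<epsilon>) * b n - (1 - \<epsilon>) * a n" if n: "n \<ge> N" for n
    proof -
      define s t where "s = u (Suc n) - u n" and "t = v (Suc n) - v n"
      have st: "0 \<le> s" "s < \<epsilon>" "0 \<le> t" "t < \<epsilon>" "s = 0 \<or> t = 0"
        using N[OF n] u[of n] v[of n] uv[of n] by (auto simp: s_def t_def)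
      have "exp (t - s) - 1 \<le> (1 + \<epsilon>) * t - (1 - \<epsilon>) * s"
        using st(5)
      proof
        assume s0: "s = 0"
        have "exp t \<le> 1 + t + t\<^sup>2" using st \<epsilon> by (intro exp_bound) auto
        moreover have "t\<^sup>2 \<le> \<epsilon> * t" unfolding power2_eq_square using st by (intro mult_right_mono) auto
        ultimately show ?thesis using s0 by (simp add: algebra_simps)
      next
        assume t0: "t = 0"
        have "exp (- s) \<le> 1 / (1 + s)"
          using exp_ge_add_one_self[of s] st(1) by (simp add: exp_minus inverse_eq_divide frac_le)
        also have "\<dots> \<le> 1 - s + s\<^sup>2"
        proof -
          have "1 \<le> (1 - s + s\<^sup>2) * (1 + s)" using st(1) by (simp add: algebra_simps power2_eq_square power3_eq_cube)
          then show ?thesis using st(1) by (simp add: divide_le_eq)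
        qed
        also have "s\<^sup>2 \<le> \<epsilon> * s" unfolding power2_eq_square using st by (intro mult_right_mono) auto
        finally show ?thesis using t0 by (simp add: algebra_simps)
      qed
      then have "W n * (exp (t - s) - 1) \<le> W n * ((1 + \<epsilon>) * t - (1 - \<epsilon>) * s)"
        using W_pos[of n] by (intro mult_left_mono) auto
      then show ?thesis unfolding W_Suc a_def b_def s_def t_def by (simp add: algebra_simps)
    qed
    show "eventually (\<lambda>n. \<bar>tail_sum a n - (W n + tail_sum b n)\<bar> \<le> \<epsilon>' * (W n + tail_sum b n)) sequentially"
    proof (rule eventually_sequentiallyI[of N])
      fix n assume n: "n \<ge> N"
      have "0 \<le> 1 * W n + (1 + \<epsilon>) * tail_sum b n + (- (1 - \<epsilon>)) * tail_sum a n"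
        by (rule antimono_limit_nonneg[where N = N, OF _ lim n]) (use upper in \<open>fastforce simp: tail_sum_Suc algebra_simps\<close>)
      then have "(1 - \<epsilon>) * tail_sum a n \<le> (1 + \<epsilon>) * (W n + tail_sum b n)"
        using mult_nonneg_nonneg[OF less_imp_le[OF \<epsilon>(1)] less_imp_le[OF W_pos[of n]]] by (simp add: algebra_simps)
      also have "(1 + \<epsilon>) \<le> (1 - \<epsilon>) * (1 + 4 * \<epsilon>)"
        using mult_left_mono[OF \<epsilon>(2), of \<epsilon>] \<epsilon>(1) by (simp add: algebra_simps)
      then have "(1 + \<epsilon>) * (W n + tail_sum b n) \<le> (1 - \<epsilon>) * (1 + 4 * \<epsilon>) * (W n + tail_sum b n)"
        using W_pos[of n] tlb[of n] by (intro mult_right_mono) auto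
      finally have "(1 - \<epsilon>) * tail_sum a n \<le> (1 - \<epsilon>) * ((1 + 4 * \<epsilon>) * (W n + tail_sum b n))" by (simp only: mult.assoc)
      then have "tail_sum a n \<le> (1 + 4 * \<epsilon>) * (W n + tail_sum b n)" using \<epsilon>(2) by (simp add: mult_le_cancel_left)
      also have "\<dots> \<le> (1 + \<epsilon>') * (W n + tail_sum b n)"
        using W_pos[of n] tlb[of n] \<epsilon> by (intro mult_right_mono) auto
      finally show "\<bar>tail_sum a n - (W n + tail_sum b n)\<bar> \<le> \<epsilon>' * (W n + tail_sum b n)"
        using le[of n] by (simp add: algebra_simps)
    qed
  qed
qed

lemma eqc_ln_asymp_equiv:
  assumes "eqc (\<lambda>n. ln (w n)) g" "\<And>n. 0 < w n"
  obtains L where "w \<sim>[sequentially] (\<lambda>n. exp (L + g n))"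
proof -
  from assms(1) obtain L where L: "(\<lambda>n. ln (w n) - g n) \<longlonglongrightarrow> L" by (auto simp: eqc_def convergent_def)
  then have "(\<lambda>n. exp (ln (w n) - g n)) \<longlonglongrightarrow> exp L" by (rule tendsto_exp)
  then have "(\<lambda>n. exp (ln (w n) - g n) / exp L) \<longlonglongrightarrow> exp L / exp L" by (intro tendsto_divide) auto
  moreover have "exp (ln (w n) - g n) / exp L = w n / exp (L + g n)" for n
    using assms(2)[of n] by (simp add: exp_diff exp_add mult.commute)
  ultimately have "(\<lambda>n. w n / exp (L + g n)) \<longlonglongrightarrow> 1" by simp
  then have "w \<sim>[sequentially] (\<lambda>n. exp (L + g n))" by (intro asymp_equivI') simp
  then show ?thesis by (rule that)
qed

text \<open>The sequence \<open>w\<close> is asymptotic to \<open>exp (v - u)\<close> up to a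
  constant factor; the factor is absorbed in \<open>v'\<close>, and each tail passes through
  \<open>tail_sum_asymp_equiv\<close>.\<close>

lemma ratio_tails:
  fixes u v w :: "nat \<Rightarrow> real"
  assumes u: "\<And>n. u n \<le> u (Suc n)" and v: "\<And>n. v n \<le> v (Suc n)" and uv: "\<And>n. u (Suc n) = u n \<or> v (Suc n) = v n"
    and du: "(\<lambda>n. u (Suc n) - u n) \<longlonglongrightarrow> 0" and dv: "(\<lambda>n. v (Suc n) - v n) \<longlonglongrightarrow> 0"
    and w: "w \<longlonglongrightarrow> 0" "\<And>n. 0 < w n" "eqc (\<lambda>n. ln (w n)) (\<lambda>n. v n - u n)"
    and a: "summable (\<lambda>n. w n * (u (Suc n) - u n))"
  shows "summable (\<lambda>n. w n * (v (Suc n) - v n))"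
    "tail_sum (\<lambda>n. w n * (u (Suc n) - u n)) \<sim>[sequentially] (\<lambda>n. w n + tail_sum (\<lambda>n. w n * (v (Suc n) - v n)) n)"
proof -
  obtain L where L: "w \<sim>[sequentially] (\<lambda>n. exp (L + (v n - u n)))" using eqc_ln_asymp_equiv[OF w(3,2)] .
  define v' where "v' n = L + v n" for n
  have L: "w \<sim>[sequentially] (\<lambda>n. exp (v' n - u n))" using L by (simp add: v'_def add_diff_eq)
  have W: "(\<lambda>n. exp (v' n - u n)) \<longlonglongrightarrow> 0"
    using tendsto_asymp_equiv_cong[OF L, of 0] w(1) by simp
  have eqa: "(\<lambda>n. exp (v' n - u n) * (u (Suc n) - u n)) \<sim>[sequentially] (\<lambda>n. w n * (u (Suc n) - u n))"
    by (intro asymp_equiv_intros asymp_equiv_symI[OF L])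
  have eqb: "(\<lambda>n. w n * (v (Suc n) - v n)) \<sim>[sequentially] (\<lambda>n. exp (v' n - u n) * (v' (Suc n) - v' n))"
    unfolding v'_def using L by (intro asymp_equiv_intros) (simp_all add: v'_def)
  have nna: "0 \<le> w n * (u (Suc n) - u n)" for n using u[of n] w(2)[of n] by simp
  have nnb: "0 \<le> exp (v' n - u n) * (v' (Suc n) - v' n)" for n using v[of n] by (simp add: v'_def)
  note tla = tail_sum_asymp_equiv[OF eqa nna a]
  have "summable (\<lambda>n. exp (v' n - u n) * (v' (Suc n) - v' n)) \<and>
    tail_sum (\<lambda>n. exp (v' n - u n) * (u (Suc n) - u n)) \<sim>[sequentially] (\<lambda>n. exp (v' n - u n) + tail_sum (\<lambda>n. exp (v' n - u n) * (v' (Suc n) - v' n)) n)"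
    by (intro conjI exp_tails) (use u v uv du dv W tla(1) in \<open>auto simp: v'_def\<close>)
  note tlv = this[THEN conjunct1] this[THEN conjunct2]
  note tlb = tail_sum_asymp_equiv[OF eqb nnb tlv(1)]
  show "summable (\<lambda>n. w n * (v (Suc n) - v n))" by (rule tlb(1))
  have "tail_sum (\<lambda>n. w n * (u (Suc n) - u n)) \<sim>[sequentially] tail_sum (\<lambda>n. exp (v' n - u n) * (u (Suc n) - u n))"
    by (rule asymp_equiv_symI[OF tla(2)])
  also note tlv(2)
  also have "(\<lambda>n. exp (v' n - u n) + tail_sum (\<lambda>n. exp (v' n - u n) * (v' (Suc n) - v' n)) n) \<sim>[sequentially]
      (\<lambda>n. w n + tail_sum (\<lambda>n. w n * (v (Suc n) - v n)) n)"
    by (rule asymp_equiv_symI[OF asymp_equiv_add_nonneg[OF L tlb(2)]]) (auto intro: tail_sum_nonneg[OF tlv(1) nnb])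
  finally show "tail_sum (\<lambda>n. w n * (u (Suc n) - u n)) \<sim>[sequentially] (\<lambda>n. w n + tail_sum (\<lambda>n. w n * (v (Suc n) - v n)) n)" .
qed

lemma exp_minus_le: "0 \<le> s \<Longrightarrow> s \<le> 1 \<Longrightarrow> exp (- s) \<le> 1 - s / (2::real)"
proof -
  assume s: "0 \<le> s" "s \<le> 1"
  have "exp (- s) \<le> 1 / (1 + s)"
    using exp_ge_add_one_self[of s] s(1) by (simp add: exp_minus inverse_eq_divide frac_le)
  also have "\<dots> \<le> 1 - s / 2"
  proof -
    have "s * s \<le> 1 * s" using s by (intro mult_right_mono) auto
    then have "1 \<le> (1 - s / 2) * (1 + s)" by (simp add: algebra_simps)
    then show ?thesis using s(1) by (simp add: divide_le_eq)
  qed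
  finally show ?thesis .
qed

text \<open>Since \<open>1 - exp (- s) \<ge> s / 2\<close> for small \<open>s\<close>, the
  decrements of the decreasing sequence \<open>W\<close> dominate half of the summands, and they
  telescope.\<close>

lemma summable_ratio:
  fixes u w :: "nat \<Rightarrow> real"
  assumes u: "\<And>n. u n \<le> u (Suc n)" and du: "(\<lambda>n. u (Suc n) - u n) \<longlonglongrightarrow> 0"
    and w: "\<And>n. 0 < w n" "eqc (\<lambda>n. ln (w n)) (\<lambda>n. - u n)"
  shows "summable (\<lambda>n. w n * (u (Suc n) - u n))"
proof -
  obtain L where L: "w \<sim>[sequentially] (\<lambda>n. exp (L + - u n))" using eqc_ln_asymp_equiv[OF w(2,1)] .
  define W where "W n = exp (L - u n)" for n
  have L: "w \<sim>[sequentially] W" using L by (simp add: W_def[abs_def])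
  have W_pos: "0 < W n" for n by (simp add: W_def)
  have dec: "decseq W" by (rule decseq_SucI) (simp add: W_def u)
  obtain l where "W \<longlonglongrightarrow> l" using decseq_convergent[OF dec, of 0] less_imp_le[OF W_pos] by blast
  then have tele: "summable (\<lambda>n. 2 * (W n - W (Suc n)))" by (intro summable_mult telescope_summable')
  have "eventually (\<lambda>n. u (Suc n) - u n < 1 / 2) sequentially" by (rule order_tendstoD(2)[OF du]) simp
  then have "eventually (\<lambda>n. norm (W n * (u (Suc n) - u n)) \<le> 2 * (W n - W (Suc n))) sequentially"
  proof eventually_elim
    case (elim n)
    define s where "s = u (Suc n) - u n"
    have s: "0 \<le> s" "s < 1 / 2" using elim u[of n] by (auto simp: s_def)
    have "W n * exp (- s) \<le> W n * (1 - s / 2)"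
      using W_pos[of n] s by (intro mult_left_mono exp_minus_le) auto
    moreover have "W (Suc n) = W n * exp (- s)" by (simp add: W_def s_def exp_add[symmetric])
    ultimately show ?case using W_pos[of n] s(1) by (simp add: s_def[symmetric] algebra_simps)
  qed
  then have "summable (\<lambda>n. W n * (u (Suc n) - u n))" by (rule summable_comparison_test_ev[OF _ tele])
  moreover have "(\<lambda>n. w n * (u (Suc n) - u n)) \<sim>[sequentially] (\<lambda>n. W n * (u (Suc n) - u n))"
    by (intro asymp_equiv_intros L)
  moreover have "0 \<le> W n * (u (Suc n) - u n)" for n using u[of n] W_pos[of n] by simp
  ultimately show ?thesis by (metis (lifting) tail_sum_asymp_equiv(1))
qed

section \<open>The critical case\<close>

lemma wsum_increment: "wsum p i d f (Suc n) - wsum p i d f n = (if p n = i \<and> p (Suc n) = i + d then f n else 0)"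
  by (simp add: wsum_Suc)

lemma wsum_increment_tendsto_0:
  assumes "f \<longlonglongrightarrow> 0" "\<And>n. 0 \<le> f n"
  shows "(\<lambda>n. wsum p i d f (Suc n) - wsum p i d f n) \<longlonglongrightarrow> 0"
  unfolding wsum_increment
  by (rule real_tendsto_sandwich[OF _ _ tendsto_const assms(1)]) (auto intro!: always_eventually simp: assms(2))

lemma wsum_diff_le:
  assumes "\<And>m. n0 \<le> m \<Longrightarrow> p m = i \<Longrightarrow> p (Suc m) = i + d \<Longrightarrow> f m \<le> g m" "n0 \<le> n"
  shows "wsum p i d f n - wsum p i d f n0 \<le> wsum p i d g n - wsum p i d g n0"
  using assms(2)
proof (induction n rule: dec_induct)
  case (step n)
  then show ?case using assms(1)[of n] by (auto simp: wsum_Suc)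
qed simp

locale critical_end = left_end +
  assumes A4: "filterlim (Asum p 4) at_top sequentially"
begin

lemma ln_y: "eqc (\<lambda>n. ln (z 1 n / z 3 n)) (\<lambda>n. - Asum p 4 n)"
proof -
  have "eqc (\<lambda>n. ln (z 1 n / z 3 n)) (\<lambda>n. (Asum p 0 n + Asum p 2 n) - (Asum p 2 n + Asum p 4 n))"
    using ln_ratio[of 1 3] by simp
  also have "eqc (\<lambda>n. (Asum p 0 n + Asum p 2 n) - (Asum p 2 n + Asum p 4 n)) (\<lambda>n. (0 + Asum p 2 n) - (Asum p 2 n + Asum p 4 n))"
    by (intro eqc_diff eqc_add eqc_refl) (use A0 in \<open>simp add: eqc_0_iff\<close>)
  finally (eqc_trans) show ?thesis by simp
qed

lemma ln_x: "eqc (\<lambda>n. ln (z 4 n / z 2 n)) (\<lambda>n. Asum p 5 n - Asum p 1 n)"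
  using ln_ratio[of 4 2] by simp

lemma X_eqc: "eqc (wsum p 3 1 (\<lambda>m. 1 / z 3 m)) (Asum p 4)"
proof -
  have "eqc (wsum p 3 1 (\<lambda>m. 1 / z 3 m)) (Bsum p 4)"
    using crossings_eqc[OF z3, where d = 1] by (simp add: Bsum_def)
  from eqc_trans[OF this eqc_sym[OF AB]] show ?thesis .
qed

lemma V_eqc: "eqc (wsum p 4 1 (\<lambda>m. 1 / z 4 m)) (Asum p 5)"
proof -
  have "eqc (wsum p 4 1 (\<lambda>m. 1 / z 4 m)) (Bsum p 5)"
    using crossings_eqc[OF z4, where d = 1] by (simp add: Bsum_def)
  from eqc_trans[OF this eqc_sym[OF AB]] show ?thesis .
qed

lemma X_at_top: "filterlim (wsum p 3 1 (\<lambda>m. 1 / z 3 m)) at_top sequentially"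
  by (rule eqc_at_top[OF eqc_sym[OF X_eqc] A4])

lemma B_at_top: "filterlim (wsum p 2 1 (\<lambda>m. z 1 m / (z 2 m * z 3 m))) at_top sequentially"
  by (rule eqc_at_top[OF A1_eqc A1])

text \<open>The weight stays capped as long as smallness of \<open>z 4 / z 3\<close> is unknown;
  \<open>Y_eqc\<close> removes the cap after the bootstrap.\<close>

lemma Xh_eqc: "eqc (wsum p 3 1 (\<lambda>m. min 1 (z 4 m / z 3 m) / z 4 m)) (wsum p 3 (-1) (\<lambda>m. min 1 (z 4 m / z 3 m) / z 2 m))"
proof -
  have "convergent (mart p 3 (\<lambda>m. min 1 (z (3 + 1) m / z 3 m)))"
    using reg[unfolded regular_def] by blast
  then show ?thesis by (simp add: eqc_def mart_def[abs_def])
qed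

lemma y_le: "\<exists>K>0. \<forall>n. z 1 n / z 3 n \<le> K * exp (- wsum p 3 1 (\<lambda>m. 1 / z 3 m) n)"
proof -
  have "eqc (\<lambda>n. - Asum p 4 n) (\<lambda>n. - wsum p 3 1 (\<lambda>m. 1 / z 3 m) n)"
    using eqc_cmult[OF eqc_sym[OF X_eqc], of "-1"] by simp
  from eqc_trans[OF ln_y this] have "convergent (\<lambda>n. ln (z 1 n / z 3 n) + wsum p 3 1 (\<lambda>m. 1 / z 3 m) n)"
    by (simp add: eqc_def)
  then have "Bseq (\<lambda>n. ln (z 1 n / z 3 n) + wsum p 3 1 (\<lambda>m. 1 / z 3 m) n)" by (rule convergent_imp_Bseq)
  then obtain C where C: "\<And>n. \<bar>ln (z 1 n / z 3 n) + wsum p 3 1 (\<lambda>m. 1 / z 3 m) n\<bar> \<le> C"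
    by (auto simp: Bseq_def)
  have "z 1 n / z 3 n \<le> exp C * exp (- wsum p 3 1 (\<lambda>m. 1 / z 3 m) n)" for n
  proof -
    have "ln (z 1 n / z 3 n) \<le> C + - wsum p 3 1 (\<lambda>m. 1 / z 3 m) n" using C[of n] by simp
    then have "exp (ln (z 1 n / z 3 n)) \<le> exp (C + - wsum p 3 1 (\<lambda>m. 1 / z 3 m) n)" by (simp only: exp_le_cancel_iff)
    then show ?thesis unfolding exp_add by (subst (asm) exp_ln) auto
  qed
  then show ?thesis by (intro exI[of _ "exp C"]) auto
qed

text \<open>If \<open>Z(4)/Z(2)\<close> were large at a late time, it would stay bounded below: each jump \<open>2 \<rightarrow> 3\<close> then
  is followed by a return \<open>3 \<rightarrow> 2\<close> that makes \<open>Z(1)/Z(3)\<close> decrease by a fixed fraction of \<open>1/Z(2)\<close>.\<close>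

lemma bootstrap:
  assumes x0: "0 < x0" and n0: "4 * x0 \<le> z 4 n0 / z 2 n0"
    and K: "0 < K" "\<And>n. z 1 n / z 3 n \<le> K * exp (- wsum p 3 1 (\<lambda>m. 1 / z 3 m) n)"
    and small: "K * exp (1 - wsum p 3 1 (\<lambda>m. 1 / z 3 m) n0) * (1 + 2 * (1 + x0) / x0) \<le> 1 / 2"
    and lnx: "\<And>n. n \<ge> n0 \<Longrightarrow> \<bar>(ln (z 4 n / z 2 n) - ln (z 4 n0 / z 2 n0)) -
      ((Asum p 5 n - wsum p 2 1 (\<lambda>m. z 1 m / (z 2 m * z 3 m)) n) - (Asum p 5 n0 - wsum p 2 1 (\<lambda>m. z 1 m / (z 2 m * z 3 m)) n0))\<bar> \<le> 1 / 2"
    and Xh: "\<And>n. n \<ge> n0 \<Longrightarrow> \<bar>(wsum p 3 1 (\<lambda>m. min 1 (z 4 m / z 3 m) / z 4 m) n - wsum p 3 1 (\<lambda>m. min 1 (z 4 m / z 3 m) / z 4 m) n0) -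
       (wsum p 3 (-1) (\<lambda>m. min 1 (z 4 m / z 3 m) / z 2 m) n - wsum p 3 (-1) (\<lambda>m. min 1 (z 4 m / z 3 m) / z 2 m) n0)\<bar> \<le> 1"
    and n: "n0 \<le> n"
  shows "wsum p 2 1 (\<lambda>m. z 1 m / (z 2 m * z 3 m)) n - wsum p 2 1 (\<lambda>m. z 1 m / (z 2 m * z 3 m)) n0 \<le> 1 / 2"
proof -
  define X where "X = wsum p 3 1 (\<lambda>m. 1 / z 3 m)"
  define B where "B = wsum p 2 1 (\<lambda>m. z 1 m / (z 2 m * z 3 m))"
  define Y where "Y = wsum p 3 (-1) (\<lambda>m. min 1 (z 4 m / z 3 m) / z 2 m)"
  define Y1 where "Y1 = wsum p 3 1 (\<lambda>m. min 1 (z 4 m / z 3 m) / z 4 m)"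
  \<comment> \<open>Up to a constant, \<open>E\<close> bounds the decay of \<open>z 1 / z 3\<close>
    since time \<open>n0\<close>, driven by returns \<open>3 -> 2\<close>; \<open>G\<close> sums
    \<open>E / z 2\<close> over jumps \<open>2 -> 3\<close> and controls the growth of
    \<open>B\<close>.\<close>
  define E where "E n = exp (- (Y n - Y n0))" for n
  define G where "G n = wsum p 2 1 (\<lambda>m. E m / z 2 m) n - wsum p 2 1 (\<lambda>m. E m / z 2 m) n0" for n
  \<comment> \<open>A lower bound for \<open>z 4 / z 3\<close> as long as
    \<open>z 4 / z 2 \<ge> x0\<close>, from \<open>z 3 \<le> z 2 + z 4\<close>.\<close>
  define w0 where "w0 = x0 / (1 + x0)"
  have w0: "0 < w0" "w0 < 1" using x0 by (auto simp: w0_def)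
  have inv_w0: "1 / w0 = (1 + x0) / x0" by (simp add: w0_def)
  have E_pos: "0 < E n" for n by (simp add: E_def)
  have X_ge: "X n0 + (Y n - Y n0) - 1 \<le> X n" if "n \<ge> n0" for n
  proof -
    have "Y1 n - Y1 n0 \<le> X n - X n0" unfolding X_def Y1_def
    proof (rule wsum_diff_le[OF _ that])
      fix m
      have "min 1 (z 4 m / z 3 m) / z 4 m \<le> (z 4 m / z 3 m) / z 4 m" by (intro divide_right_mono) auto
      then show "min 1 (z 4 m / z 3 m) / z 4 m \<le> 1 / z 3 m" by simp
    qed
    moreover have "\<bar>(Y1 n - Y1 n0) - (Y n - Y n0)\<bar> \<le> 1" using Xh[OF that] by (simp add: Y_def Y1_def)
    ultimately show ?thesis by linarith
  qed
  have B_le: "B n - B n0 \<le> K * exp (1 - X n0) * G n" if "n \<ge> n0" for n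
    using that
  proof (induction n rule: dec_induct)
    case (step n)
    have "z 1 n / (z 2 n * z 3 n) \<le> K * exp (1 - X n0) * (E n / z 2 n)"
    proof -
      have "z 1 n / z 3 n \<le> K * exp (- X n)" using K(2)[of n] by (simp add: X_def)
      also have "\<dots> \<le> K * exp (1 - X n0 - (Y n - Y n0))" using X_ge[OF step(1)] K(1) by (intro mult_left_mono) auto
      also have "\<dots> = K * exp (1 - X n0) * E n" by (simp add: E_def exp_diff exp_minus divide_inverse)
      finally have "(z 1 n / z 3 n) / z 2 n \<le> (K * exp (1 - X n0) * E n) / z 2 n" by (intro divide_right_mono) auto
      then show ?thesis by (simp add: mult.commute)
    qed
    then show ?case using step.IH by (simp add: B_def G_def wsum_Suc algebra_simps)
  qed (simp add: G_def)
  \<comment> \<open>While \<open>B\<close> has grown by at most \<open>1 / 2\<close>, the logarithm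
    of the ratio has dropped by at most \<open>1\<close>; the initial factor \<open>4\<close>
    absorbs this because \<open>exp 1 < 4\<close>.\<close>
  have x_ge: "x0 \<le> z 4 n / z 2 n" if n: "n \<ge> n0" and B: "B n - B n0 \<le> 1 / 2" for n
  proof -
    have "0 \<le> Asum p 5 n - Asum p 5 n0" using incseqD[OF incseq_Asum n] by simp
    then have "-1 \<le> ln (z 4 n / z 2 n) - ln (z 4 n0 / z 2 n0)" using lnx[OF n, folded B_def] B by linarith
    then have "ln (z 4 n0 / z 2 n0) + (-1) \<le> ln (z 4 n / z 2 n)" by simp
    then have "exp (ln (z 4 n0 / z 2 n0) + (-1)) \<le> exp (ln (z 4 n / z 2 n))" by (simp only: exp_le_cancel_iff)
    then have "z 4 n0 / z 2 n0 * exp (- 1) \<le> z 4 n / z 2 n" unfolding exp_add by (subst (asm) (1 2) exp_ln) auto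
    moreover have "1 / 4 \<le> exp (- 1 :: real)" using exp_le by (simp add: exp_minus field_simps)
    then have "4 * x0 * (1 / 4) \<le> z 4 n0 / z 2 n0 * exp (- 1)" using n0 x0 by (intro mult_mono) auto
    ultimately show ?thesis by simp
  qed
  have G_imp_B: "B n - B n0 \<le> 1 / 2" if "n \<ge> n0" "G n \<le> 1 + 2 / w0" for n
  proof -
    have "B n - B n0 \<le> K * exp (1 - X n0) * (1 + 2 / w0)"
      by (rule order_trans[OF B_le[OF that(1)] mult_left_mono[OF that(2)]]) (use K(1) in simp)
    also have "\<dots> \<le> 1 / 2" using small inv_w0 by (simp add: X_def w0_def)
    finally show ?thesis .
  qed
  have bound: "1 + 2 / w0 * (1 - E n) - (if p n \<le> 2 then E n / z 2 n else 0) \<le> 1 + 2 / w0" for n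
  proof -
    have "2 / w0 * (1 - E n) \<le> 2 / w0 * 1" using w0 E_pos[of n] by (intro mult_left_mono) auto
    moreover have "0 \<le> E n / z 2 n" using E_pos[of n] by simp
    ultimately show ?thesis by (auto split: if_splits)
  qed
  \<comment> \<open>The last term is a reserve: at or below \<open>2\<close> the walk still owes one
    jump \<open>2 -> 3\<close>, worth \<open>E / z 2\<close>. Each return \<open>3 -> 2\<close>
    refills the reserve out of the drop of \<open>E\<close>; the initial \<open>1\<close> covers a
    start on that side.\<close>
  have G: "G n \<le> 1 + 2 / w0 * (1 - E n) - (if p n \<le> 2 then E n / z 2 n else 0)" if "n \<ge> n0" for n
    using that
  proof (induction n rule: dec_induct)
    case base
    have "1 / z 2 n0 \<le> 1" using real_loc_ge_1[of p n0 2] by simp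
    then show ?case by (simp add: G_def E_def)
  next
    case (step n)
    have x: "x0 \<le> z 4 n / z 2 n"
      by (rule x_ge[OF step(1) G_imp_B[OF step(1) order_trans[OF step.IH bound]]])
    have Y_Suc: "Y (Suc n) = Y n + (if p n = 3 \<and> p (Suc n) = 2 then min 1 (z 4 n / z 3 n) / z 2 n else 0)"
      by (simp add: Y_def wsum_Suc)
    have G_Suc: "G (Suc n) = G n + (if p n = 2 \<and> p (Suc n) = 3 then E n / z 2 n else 0)"
      by (simp add: G_def wsum_Suc)
    consider "p n = 2 \<and> p (Suc n) = 3" | "p n = 3 \<and> p (Suc n) = 2"
      | "\<not> (p n = 2 \<and> p (Suc n) = 3)" "\<not> (p n = 3 \<and> p (Suc n) = 2)" by blast
    then show ?case
    proof cases
      case 1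
      then have "E (Suc n) = E n" by (simp add: E_def Y_Suc)
      then show ?thesis using step.IH 1 by (simp add: G_Suc)
    next
      case 2
      define t where "t = min 1 (z 4 n / z 3 n) / z 2 n"
      have h: "w0 \<le> min 1 (z 4 n / z 3 n)"
      proof -
        have "z 3 n \<le> z 2 n + z 4 n" using loc_le_neighbours[OF unit_steps, where n = n and j = 3] by simp
        also have "z 2 n \<le> z 4 n / x0" using x x0 by (simp add: field_simps)
        finally have "z 3 n \<le> z 4 n / x0 + z 4 n" by simp
        then have "w0 * z 3 n \<le> w0 * (z 4 n / x0 + z 4 n)" using w0 by (intro mult_left_mono) auto
        also have "z 4 n / x0 + z 4 n = z 4 n * (1 + x0) / x0" using x0 by (simp add: field_simps)
        also have "w0 * \<dots> = z 4 n" using x0 by (simp add: w0_def add_pos_pos[THEN less_imp_neq, symmetric])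
        finally have "w0 \<le> z 4 n / z 3 n" by (simp add: field_simps)
        then show ?thesis using w0 by simp
      qed
      have t: "0 \<le> t" "t \<le> 1" "w0 / z 2 n \<le> t"
      proof -
        show "0 \<le> t" by (simp add: t_def)
        have "t \<le> 1 / z 2 n" unfolding t_def by (intro divide_right_mono) auto
        also have "\<dots> \<le> 1" using real_loc_ge_1[of p n 2] by simp
        finally show "t \<le> 1" .
        show "w0 / z 2 n \<le> t" unfolding t_def using h by (intro divide_right_mono) auto
      qed
      have E_Suc: "E (Suc n) = E n * exp (- t)" using 2 by (simp add: E_def Y_Suc t_def exp_add[symmetric])
      have "E (Suc n) / z 2 (Suc n) \<le> E n * 1 / z 2 n"
        unfolding E_Suc using E_pos[of n] t(1) z_mono[of n "Suc n" 2] by (intro frac_le mult_left_mono mult_nonneg_nonneg) auto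
      also have "1 / z 2 n \<le> 1 / w0 * t" using t(3) w0 by (simp add: field_simps)
      then have "E n * 1 / z 2 n \<le> E n * (1 / w0 * t)"
        using mult_left_mono[of "1 / z 2 n" "1 / w0 * t" "E n"] E_pos[of n] by simp
      also have "\<dots> = 2 / w0 * E n * (t / 2)" by simp
      also have "\<dots> \<le> 2 / w0 * E n * (1 - exp (- t))"
        using exp_minus_le[OF t(1,2)] w0 E_pos[of n] by (intro mult_left_mono) auto
      also have "\<dots> = 2 / w0 * (E n - E (Suc n))" unfolding E_Suc by (simp only: right_diff_distrib mult.assoc mult_1_right)
      finally have "E (Suc n) / z 2 (Suc n) \<le> 2 / w0 * (1 - E (Suc n)) - 2 / w0 * (1 - E n)"
        by (simp only: right_diff_distrib mult_1_right)
      then show ?thesis using step.IH 2 by (simp add: G_Suc)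
    next
      case 3
      then have E_Suc: "E (Suc n) = E n" by (simp only: E_def Y_Suc if_False add_0_right)
      have "(if p (Suc n) \<le> 2 then E n / z 2 (Suc n) else 0) \<le> (if p n \<le> 2 then E n / z 2 n else 0)"
      proof (cases "p (Suc n) \<le> 2")
        case True
        then have "p n \<le> 2" using 3 unit_steps_cases[OF unit_steps, of n] by auto
        moreover have "E n / z 2 (Suc n) \<le> E n / z 2 n" using E_pos[of n] z_mono[of n "Suc n" 2] by (intro divide_left_mono) auto
        ultimately show ?thesis using True by simp
      qed (use E_pos[of n] in simp)
      then show ?thesis using step.IH 3 by (simp only: G_Suc E_Suc if_False add_0_right)
    qed
  qed
  from G_imp_B[OF n order_trans[OF G[OF n] bound]] show ?thesis by (simp add: B_def)
qed

text \<open>Were the ratio bounded below infinitely often, the bootstrap could start arbitrarily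
  late and would cap a sum that diverges by \<open>B_at_top\<close>.\<close>

lemma x_tendsto_0: "(\<lambda>n. z 4 n / z 2 n) \<longlonglongrightarrow> 0"
proof (rule ccontr)
  assume "\<not> (\<lambda>n. z 4 n / z 2 n) \<longlonglongrightarrow> 0"
  then obtain c where c: "0 < c" "\<And>N. \<exists>n\<ge>N. c \<le> z 4 n / z 2 n"
    by (auto simp: lim_sequentially dist_real_def not_less)
  define x0 where "x0 = c / 4"
  have x0: "0 < x0" using c(1) by (simp add: x0_def)
  let ?X = "wsum p 3 1 (\<lambda>m. 1 / z 3 m)" and ?B = "wsum p 2 1 (\<lambda>m. z 1 m / (z 2 m * z 3 m))"
  obtain K where K: "0 < K" "\<And>n. z 1 n / z 3 n \<le> K * exp (- ?X n)" using y_le by blast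
  define D where "D = K * exp 1 * (1 + 2 * (1 + x0) / x0)"
  have D: "0 < D" using K(1) x0 by (auto simp: D_def intro!: mult_pos_pos add_pos_pos divide_pos_pos)
  have "eventually (\<lambda>n. ln (2 * D) \<le> ?X n) sequentially" using X_at_top by (simp add: filterlim_at_top)
  then obtain N1 where N1: "\<And>n. n \<ge> N1 \<Longrightarrow> ln (2 * D) \<le> ?X n" by (auto simp: eventually_sequentially)
  have "eqc (\<lambda>n. ln (z 4 n / z 2 n)) (\<lambda>n. Asum p 5 n - ?B n)"
    by (rule eqc_trans[OF ln_x eqc_diff[OF eqc_refl A1_eqc]])
  from eqc_small[OF this, of "1 / 2"] obtain N2 where N2: "\<And>m n. m \<ge> N2 \<Longrightarrow> n \<ge> N2 \<Longrightarrow>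
     \<bar>(ln (z 4 m / z 2 m) - ln (z 4 n / z 2 n)) - ((Asum p 5 m - ?B m) - (Asum p 5 n - ?B n))\<bar> < 1 / 2" by auto
  from eqc_small[OF Xh_eqc, of 1] obtain N3 where N3: "\<And>m n. m \<ge> N3 \<Longrightarrow> n \<ge> N3 \<Longrightarrow>
    \<bar>(wsum p 3 1 (\<lambda>m. min 1 (z 4 m / z 3 m) / z 4 m) m - wsum p 3 1 (\<lambda>m. min 1 (z 4 m / z 3 m) / z 4 m) n) -
       (wsum p 3 (-1) (\<lambda>m. min 1 (z 4 m / z 3 m) / z 2 m) m - wsum p 3 (-1) (\<lambda>m. min 1 (z 4 m / z 3 m) / z 2 m) n)\<bar> < 1" by auto
  obtain n0 where n0: "n0 \<ge> max N1 (max N2 N3)" "c \<le> z 4 n0 / z 2 n0" using c(2) by blast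
  have small: "K * exp (1 - ?X n0) * (1 + 2 * (1 + x0) / x0) \<le> 1 / 2"
  proof -
    have "2 * D \<le> exp (?X n0)" using N1[of n0] n0(1) D by (metis exp_le_cancel_iff exp_ln max.boundedE mult_pos_pos zero_less_numeral)
    then have "D / exp (?X n0) \<le> 1 / 2" by (simp add: divide_le_eq)
    then show ?thesis by (simp add: D_def exp_diff)
  qed
  have "?B n - ?B n0 \<le> 1 / 2" if "n \<ge> n0" for n
  proof (rule bootstrap[OF x0 _ K small _ _ that])
    show "4 * x0 \<le> z 4 n0 / z 2 n0" using n0(2) by (simp add: x0_def)
  next
    fix m assume m: "m \<ge> n0"
    then have ge: "m \<ge> N2" "n0 \<ge> N2" "m \<ge> N3" "n0 \<ge> N3" using n0(1) by auto
    show "\<bar>(ln (z 4 m / z 2 m) - ln (z 4 n0 / z 2 n0)) - ((Asum p 5 m - ?B m) - (Asum p 5 n0 - ?B n0))\<bar> \<le> 1 / 2"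
      using N2[OF ge(1,2)] by linarith
    show "\<bar>(wsum p 3 1 (\<lambda>m. min 1 (z 4 m / z 3 m) / z 4 m) m - wsum p 3 1 (\<lambda>m. min 1 (z 4 m / z 3 m) / z 4 m) n0) -
       (wsum p 3 (-1) (\<lambda>m. min 1 (z 4 m / z 3 m) / z 2 m) m - wsum p 3 (-1) (\<lambda>m. min 1 (z 4 m / z 3 m) / z 2 m) n0)\<bar> \<le> 1"
      using N3[OF ge(3,4)] by linarith
  qed
  moreover have "eventually (\<lambda>n. ?B n0 + 1 \<le> ?B n) sequentially" using B_at_top by (simp add: filterlim_at_top)
  then obtain M where "\<And>n. n \<ge> M \<Longrightarrow> ?B n0 + 1 \<le> ?B n" by (auto simp: eventually_sequentially)
  ultimately have "?B (max M n0) - ?B n0 \<le> 1 / 2" "?B n0 + 1 \<le> ?B (max M n0)" by auto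
  then show False by linarith
qed

end

lemma asymp_equiv_of_bool:
  fixes f g :: "nat \<Rightarrow> real"
  assumes "f \<sim>[F] g"
  shows "(\<lambda>n. if P n then f n else 0) \<sim>[F] (\<lambda>n. if P n then g n else 0)"
  using asymp_equiv_mult[OF asymp_equiv_refl[of "\<lambda>n. if P n then 1 else 0 :: real" F] assms]
  by (simp add: if_distrib[of "\<lambda>c. c * _"] cong: if_cong)

section \<open>The flow balance across the edge between 2 and 3\<close>

context critical_end
begin

lemma y_tendsto_0: "(\<lambda>n. z 1 n / z 3 n) \<longlonglongrightarrow> 0"
proof -
  have "eqc (\<lambda>n. - ln (z 1 n / z 3 n)) (Asum p 4)" using eqc_cmult[OF ln_y, of "-1"] by simp
  from eqc_at_top[OF eqc_sym[OF this] A4] have "filterlim (\<lambda>n. - ln (z 1 n / z 3 n)) at_top sequentially" .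
  then have "filterlim (\<lambda>n. ln (z 1 n / z 3 n)) at_bot sequentially" by (simp add: filterlim_uminus_at_top)
  then have "(\<lambda>n. exp (ln (z 1 n / z 3 n))) \<longlonglongrightarrow> 0" by (rule filterlim_compose[OF exp_at_bot])
  then show ?thesis by simp
qed

lemma z2_z3: "(\<lambda>n. z 2 n / z 3 n) \<longlonglongrightarrow> 1"
proof (rule tendsto_sandwich)
  show "(\<lambda>n. 1 / (1 + z 4 n / z 2 n)) \<longlonglongrightarrow> 1"
    by (rule tendsto_eq_rhs[OF tendsto_divide[OF tendsto_const tendsto_add[OF tendsto_const x_tendsto_0]]]) auto
  show "(\<lambda>n. z 1 n / z 3 n + 1) \<longlonglongrightarrow> 1"
    by (rule tendsto_eq_rhs[OF tendsto_add[OF y_tendsto_0 tendsto_const]]) simp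
  show "eventually (\<lambda>n. 1 / (1 + z 4 n / z 2 n) \<le> z 2 n / z 3 n) sequentially"
  proof (rule always_eventually, rule allI)
    fix n
    have "z 3 n \<le> z 2 n + z 4 n" using loc_le_neighbours[OF unit_steps, where n = n and j = 3] by simp
    moreover have "1 / (1 + z 4 n / z 2 n) = z 2 n / (z 2 n + z 4 n)" by (simp add: field_simps)
    ultimately show "1 / (1 + z 4 n / z 2 n) \<le> z 2 n / z 3 n" by (simp add: frac_le)
  qed
  show "eventually (\<lambda>n. z 2 n / z 3 n \<le> z 1 n / z 3 n + 1) sequentially"
  proof (rule always_eventually, rule allI)
    fix n
    have "z 2 n \<le> z 1 n + z 3 n" using loc_le_neighbours[OF unit_steps, where n = n and j = 2] by simp
    then show "z 2 n / z 3 n \<le> z 1 n / z 3 n + 1" by (simp add: field_simps)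
  qed
qed

lemma w_tendsto_0: "(\<lambda>n. z 4 n / z 3 n) \<longlonglongrightarrow> 0"
proof -
  have "(\<lambda>n. z 4 n / z 2 n * (z 2 n / z 3 n)) \<longlonglongrightarrow> 0 * 1" by (rule tendsto_mult[OF x_tendsto_0 z2_z3])
  then show ?thesis by simp
qed

lemma Y_eqc: "eqc (wsum p 3 (-1) (\<lambda>m. z 4 m / (z 2 m * z 3 m))) (Asum p 4)"
proof -
  have "eventually (\<lambda>n. z 4 n / z 3 n < 1) sequentially" by (rule order_tendstoD(2)[OF w_tendsto_0]) simp
  then obtain N where N: "\<And>n. n \<ge> N \<Longrightarrow> z 4 n / z 3 n < 1" by (auto simp: eventually_sequentially)
  have H: "min 1 (z 4 n / z 3 n) = z 4 n / z 3 n" if "n \<ge> N" for n using N[OF that] by (simp add: min_def)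
  have 1: "eqc (wsum p 3 (-1) (\<lambda>m. z 4 m / (z 2 m * z 3 m))) (wsum p 3 (-1) (\<lambda>m. min 1 (z 4 m / z 3 m) / z 2 m))"
    by (rule wsum_eqc[of N]) (simp add: H mult.commute)
  have 2: "eqc (wsum p 3 1 (\<lambda>m. min 1 (z 4 m / z 3 m) / z 4 m)) (wsum p 3 1 (\<lambda>m. 1 / z 3 m))"
    by (rule wsum_eqc[of N]) (simp add: H)
  show ?thesis by (rule eqc_trans[OF 1 eqc_trans[OF eqc_sym[OF Xh_eqc] eqc_trans[OF 2 X_eqc]]])
qed

lemma inverse_tendsto_0: "filterlim (z j) at_top sequentially \<Longrightarrow> (\<lambda>n. 1 / z j n) \<longlonglongrightarrow> 0"
  using tendsto_inverse_0_at_top[of "z j"] by (simp add: inverse_eq_divide)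

text \<open>With y = \<open>z 1 / z 3\<close> and w = \<open>z 4 / z 3\<close> this is y w /
  \<open>z 2\<close>: at once y times its relative loss on a jump \<open>3 -> 2\<close>, and w times
  its relative loss on a jump \<open>2 -> 3\<close>, in the compensated form. This coincidence makes
  the balance possible.\<close>

definition \<phi> :: "nat \<Rightarrow> real" where
  "\<phi> n = z 1 n * z 4 n / (z 2 n * z 3 n ^ 2)"

definition left_flow :: "nat \<Rightarrow> real" where
  "left_flow n = (if p n = 3 \<and> p (Suc n) = 2 then \<phi> n else 0)"

definition right_flow :: "nat \<Rightarrow> real" where
  "right_flow n = (if p n = 2 \<and> p (Suc n) = 3 then \<phi> n else 0)"

text \<open>This is \<open>ratio_tails\<close> with no increasing part: y is asymptotically the sum
  of its future losses.\<close>

lemma y_tails: "summable left_flow" "(\<lambda>n. z 1 n / z 3 n) \<sim>[sequentially] tail_sum left_flow"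
proof -
  let ?u = "wsum p 3 (-1) (\<lambda>m. z 4 m / (z 2 m * z 3 m))"
  have eq: "left_flow = (\<lambda>n. z 1 n / z 3 n * (?u (Suc n) - ?u n))"
    by (rule ext) (simp add: left_flow_def \<phi>_def wsum_increment power2_eq_square)
  have u: "?u n \<le> ?u (Suc n)" for n by (rule wsum_mono) auto
  have "(\<lambda>n. z 4 n / z 3 n * (1 / z 2 n)) \<longlonglongrightarrow> 0 * 0"
    by (rule tendsto_mult[OF w_tendsto_0 inverse_tendsto_0[OF z2]])
  then have "(\<lambda>n. z 4 n / (z 2 n * z 3 n)) \<longlonglongrightarrow> 0" by (simp add: mult.commute)
  then have du: "(\<lambda>n. ?u (Suc n) - ?u n) \<longlonglongrightarrow> 0" by (rule wsum_increment_tendsto_0) simp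
  have "eqc (\<lambda>n. - Asum p 4 n) (\<lambda>n. - ?u n)" using eqc_cmult[OF eqc_sym[OF Y_eqc], of "-1"] by simp
  from eqc_trans[OF ln_y this] have ln: "eqc (\<lambda>n. ln (z 1 n / z 3 n)) (\<lambda>n. - ?u n)" .
  have y_pos: "0 < z 1 n / z 3 n" for n by simp
  show "summable left_flow" unfolding eq by (rule summable_ratio[OF u du y_pos ln])
  then have sm: "summable (\<lambda>n. z 1 n / z 3 n * (?u (Suc n) - ?u n))" unfolding eq .
  have "tail_sum (\<lambda>n. z 1 n / z 3 n * (?u (Suc n) - ?u n)) \<sim>[sequentially]
     (\<lambda>n. z 1 n / z 3 n + tail_sum (\<lambda>n. z 1 n / z 3 n * ((\<lambda>_. 0) (Suc n) - (\<lambda>_. 0) n)) n)"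
    by (rule ratio_tails(2)) (use u du y_tendsto_0 y_pos ln sm in auto)
  moreover have "tail_sum (\<lambda>_. 0) n = 0" for n by (simp add: tail_sum_def)
  ultimately have "tail_sum left_flow \<sim>[sequentially] (\<lambda>n. z 1 n / z 3 n)" unfolding eq by simp
  then show "(\<lambda>n. z 1 n / z 3 n) \<sim>[sequentially] tail_sum left_flow" by (rule asymp_equiv_symI)
qed

lemma \<phi>_nonneg: "0 \<le> \<phi> n"
  by (simp add: \<phi>_def)

lemma \<phi>_tendsto_0: "\<phi> \<longlonglongrightarrow> 0"
proof -
  have "(\<lambda>n. z 1 n / z 3 n * (z 4 n / z 3 n) * (1 / z 2 n)) \<longlonglongrightarrow> 0 * 0 * 0"
    by (intro tendsto_mult y_tendsto_0 w_tendsto_0 inverse_tendsto_0 z2)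
  moreover have "z 1 n / z 3 n * (z 4 n / z 3 n) * (1 / z 2 n) = \<phi> n" for n
    by (simp add: \<phi>_def power2_eq_square mult.commute mult.left_commute)
  ultimately show ?thesis by simp
qed

text \<open>During an excursion to the left of \<open>3\<close> the factor \<open>\<phi>\<close> hardly changes, so the crossings
  \<open>3 \<rightarrow> 2\<close> and \<open>2 \<rightarrow> 3\<close> contribute the same future flow at visits to \<open>3\<close>.\<close>

lemma flows:
  shows "summable right_flow"
    and "tail_sum left_flow \<sim>[inf sequentially (principal {n. p n = 3})] tail_sum right_flow"
proof -
  obtain L where L: "z 1 \<sim>[sequentially] (\<lambda>n. exp (L + Asum p 2 n))"
    using eqc_ln_asymp_equiv[OF ln_z1 z_pos] .
  \<comment> \<open>Asymptotic to \<open>\<phi>\<close>, but exactly constant while the walk stays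
    at or below \<open>2\<close>: \<open>z 1\<close> is replaced by
    \<open>exp (L + Asum p 2)\<close> and \<open>z 2\<close> by \<open>z 3\<close>. Hence
    \<open>b\<close> balances the two flows step by step, and it vanishes at visits to
    \<open>3\<close>.\<close>
  define \<psi> where "\<psi> n = exp (L + Asum p 2 n) * z 4 n / z 3 n ^ 3" for n
  have \<psi>_nonneg: "0 \<le> \<psi> n" for n by (simp add: \<psi>_def)
  have z23: "z 2 \<sim>[sequentially] z 3" by (rule asymp_equivI'[OF z2_z3])
  have "\<phi> \<sim>[sequentially] (\<lambda>n. exp (L + Asum p 2 n) * z 4 n / (z 3 n * z 3 n ^ 2))"
    unfolding \<phi>_def[abs_def] by (intro asymp_equiv_intros L z23)
  then have \<phi>\<psi>: "\<phi> \<sim>[sequentially] \<psi>"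
    unfolding \<psi>_def[abs_def] by (simp add: power2_eq_square power3_eq_cube mult.assoc)
  have \<psi>0: "\<psi> \<longlonglongrightarrow> 0" using tendsto_asymp_equiv_cong[OF \<phi>\<psi>, of 0] \<phi>_tendsto_0 by simp
  define l where "l n = (if p n = 3 \<and> p (Suc n) = 2 then \<psi> n else 0)" for n
  define r where "r n = (if p n = 2 \<and> p (Suc n) = 3 then \<psi> n else 0)" for n
  define b where "b n = (if p n \<le> 2 then \<psi> n else 0)" for n
  have b_Suc: "b (Suc n) = b n + l n - r n" for n
  proof -
    have same: "\<psi> (Suc n) = \<psi> n" if "p (Suc n) \<le> 2"
    proof -
      have "Asum p 2 (Suc n) = Asum p 2 n" using that by (simp add: Asum_def wsum_Suc)
      moreover have "z 3 (Suc n) = z 3 n" "z 4 (Suc n) = z 4 n" using that by (simp_all add: loc_Suc)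
      ultimately show ?thesis by (simp add: \<psi>_def)
    qed
    consider "p n = 3 \<and> p (Suc n) = 2" | "p n = 2 \<and> p (Suc n) = 3" | "p n \<le> 2 \<and> p (Suc n) \<le> 2"
      | "p n > 2 \<and> p (Suc n) > 2" using unit_steps_cases[OF unit_steps, of n] by fastforce
    then show ?thesis by cases (auto simp: b_def l_def r_def same)
  qed
  have b_sum: "(\<Sum>m<n. l m) - (\<Sum>m<n. r m) = b n - b 0" for n
    by (induction n) (simp_all add: b_Suc)
  have b0: "b \<longlonglongrightarrow> 0"
    by (rule real_tendsto_sandwich[OF _ _ tendsto_const \<psi>0]) (auto simp: b_def \<psi>_nonneg intro!: always_eventually)
  have lf: "l \<sim>[sequentially] left_flow" "r \<sim>[sequentially] (\<lambda>n. right_flow n)"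
    unfolding l_def[abs_def] r_def[abs_def] left_flow_def[abs_def] right_flow_def[abs_def]
    by (rule asymp_equiv_of_bool, rule asymp_equiv_symI[OF \<phi>\<psi>])+
  have nonneg: "0 \<le> left_flow n" "0 \<le> r n" for n
    by (auto simp: left_flow_def r_def \<phi>_nonneg \<psi>_nonneg)
  note l = tail_sum_asymp_equiv[OF lf(1) nonneg(1) y_tails(1)]
  have "(\<lambda>n. (\<Sum>m<n. l m) - b n + b 0) \<longlonglongrightarrow> suminf l - 0 + b 0"
    by (intro tendsto_intros b0 summable_LIMSEQ l(1))
  moreover have "(\<Sum>m<n. l m) - b n + b 0 = (\<Sum>m<n. r m)" for n using b_sum[of n] by simp
  ultimately have "r sums (suminf l + b 0)" by (simp add: sums_def)
  then have r: "summable r" and "suminf r = suminf l + b 0" by (auto simp: sums_iff)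
  then have tl: "tail_sum r n = tail_sum l n + b n" for n using b_sum[of n] by (simp add: tail_sum_def)
  note rr = tail_sum_asymp_equiv[OF asymp_equiv_symI[OF lf(2)] nonneg(2) r]
  show "summable right_flow" using rr(1) by simp
  let ?F = "inf sequentially (principal {n. p n = 3})"
  have le: "?F \<le> sequentially" by simp
  have mono: "f \<sim>[?F] g" if "f \<sim>[sequentially] g" for f g :: "nat \<Rightarrow> real"
    using tendsto_mono[OF le asymp_equivD[OF that]] by (rule asymp_equivI)
  have "tail_sum left_flow \<sim>[?F] tail_sum l" by (rule asymp_equiv_symI[OF mono[OF l(2)]])
  also have "tail_sum l \<sim>[?F] tail_sum r"
    by (rule asymp_equiv_refl_ev) (auto simp: eventually_inf_principal tl b_def)
  also have "tail_sum r \<sim>[?F] tail_sum right_flow" by (rule asymp_equiv_symI[OF mono]) (use rr(2) in simp)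
  finally show "tail_sum left_flow \<sim>[?F] tail_sum right_flow" .
qed

definition escape_flow :: "nat \<Rightarrow> real" where
  "escape_flow n = (if p n = 4 \<and> p (Suc n) = 5 then 1 / z 3 n else 0)"

text \<open>This is \<open>ratio_tails\<close> for w, with losses on jumps \<open>2 -> 3\<close> and
  gains on jumps \<open>4 -> 5\<close>; a relative gain of \<open>1 / z 4\<close> is an absolute
  gain of \<open>1 / z 3\<close>.\<close>

lemma right_flow_tails: "summable escape_flow" "tail_sum right_flow \<sim>[sequentially] (\<lambda>n. z 4 n / z 3 n + tail_sum escape_flow n)"
proof -
  let ?u = "wsum p 2 1 (\<lambda>m. z 1 m / (z 2 m * z 3 m))"
  let ?v = "wsum p 4 1 (\<lambda>m. 1 / z 4 m)"
  have equ: "right_flow = (\<lambda>n. z 4 n / z 3 n * (?u (Suc n) - ?u n))"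
    by (rule ext) (simp add: right_flow_def \<phi>_def wsum_increment power2_eq_square mult.commute mult.left_commute)
  have eqv: "escape_flow = (\<lambda>n. z 4 n / z 3 n * (?v (Suc n) - ?v n))"
    by (rule ext) (simp add: escape_flow_def wsum_increment)
  have u: "?u n \<le> ?u (Suc n)" for n by (rule wsum_mono) auto
  have v: "?v n \<le> ?v (Suc n)" for n by (rule wsum_mono) auto
  have uv: "?u (Suc n) = ?u n \<or> ?v (Suc n) = ?v n" for n by (auto simp: wsum_Suc)
  have "(\<lambda>n. z 1 n / z 3 n * (1 / z 2 n)) \<longlonglongrightarrow> 0 * 0"
    by (rule tendsto_mult[OF y_tendsto_0 inverse_tendsto_0[OF z2]])
  then have "(\<lambda>n. z 1 n / (z 2 n * z 3 n)) \<longlonglongrightarrow> 0" by (simp add: mult.commute)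
  then have du: "(\<lambda>n. ?u (Suc n) - ?u n) \<longlonglongrightarrow> 0" by (rule wsum_increment_tendsto_0) simp
  have dv: "(\<lambda>n. ?v (Suc n) - ?v n) \<longlonglongrightarrow> 0" by (rule wsum_increment_tendsto_0[OF inverse_tendsto_0[OF z4]]) simp
  have "(\<lambda>n. ln (z 2 n / z 3 n)) \<longlonglongrightarrow> ln 1" by (rule tendsto_ln[OF z2_z3]) simp
  then have "eqc (\<lambda>n. ln (z 2 n / z 3 n)) (\<lambda>_. 0)" by (auto simp: eqc_0_iff convergent_def)
  from eqc_add[OF ln_x this] have "eqc (\<lambda>n. ln (z 4 n / z 2 n) + ln (z 2 n / z 3 n)) (\<lambda>n. Asum p 5 n - Asum p 1 n)" by simp
  moreover have "ln (z 4 n / z 2 n) + ln (z 2 n / z 3 n) = ln (z 4 n / z 3 n)" for n by (simp add: ln_div)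
  ultimately have "eqc (\<lambda>n. ln (z 4 n / z 3 n)) (\<lambda>n. Asum p 5 n - Asum p 1 n)" by simp
  from eqc_trans[OF this eqc_diff[OF eqc_sym[OF V_eqc] A1_eqc]] have ln: "eqc (\<lambda>n. ln (z 4 n / z 3 n)) (\<lambda>n. ?v n - ?u n)" .
  have w_pos: "0 < z 4 n / z 3 n" for n by simp
  have sm: "summable (\<lambda>n. z 4 n / z 3 n * (?u (Suc n) - ?u n))" using flows(1) unfolding equ .
  show "summable escape_flow" unfolding eqv by (rule ratio_tails(1)[OF u v uv du dv w_tendsto_0 w_pos ln sm])
  show "tail_sum right_flow \<sim>[sequentially] (\<lambda>n. z 4 n / z 3 n + tail_sum escape_flow n)"
    unfolding eqv equ by (rule ratio_tails(2)[OF u v uv du dv w_tendsto_0 w_pos ln sm])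
qed

text \<open>Current value plus future gains of w. At visits to \<open>3\<close> it is determined,
  given the start, by the visits to \<open>3\<close> and the jumps \<open>3 -> 4\<close> and
  \<open>4 -> 5\<close>, whose counts the coupling orders.\<close>

definition \<Theta> :: "nat \<Rightarrow> real" where
  "\<Theta> n = z 4 n / z 3 n + tail_sum escape_flow n"

lemma escape_flow_nonneg: "0 \<le> escape_flow n"
  by (simp add: escape_flow_def)

lemma \<Theta>_pos: "0 < \<Theta> n"
  unfolding \<Theta>_def using tail_sum_nonneg[OF right_flow_tails(1) escape_flow_nonneg, of n] by (intro add_pos_nonneg) auto

lemma y_\<Theta>:
  assumes "0 < \<epsilon>"
  shows "\<exists>N. \<forall>n\<ge>N. p n = 3 \<longrightarrow> \<bar>z 1 n / z 3 n - \<Theta> n\<bar> \<le> \<epsilon> * \<Theta> n"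
proof -
  let ?F = "inf sequentially (principal {n. p n = 3})"
  have le: "?F \<le> sequentially" by simp
  have mono: "f \<sim>[?F] g" if "f \<sim>[sequentially] g" for f g :: "nat \<Rightarrow> real"
    using tendsto_mono[OF le asymp_equivD[OF that]] by (rule asymp_equivI)
  have "(\<lambda>n. z 1 n / z 3 n) \<sim>[?F] tail_sum left_flow" by (rule mono[OF y_tails(2)])
  also note flows(2)
  also have "tail_sum right_flow \<sim>[?F] \<Theta>" unfolding \<Theta>_def[abs_def] by (rule mono[OF right_flow_tails(2)])
  finally have "(\<lambda>n. z 1 n / z 3 n) \<sim>[?F] \<Theta>" .
  then have "eventually (\<lambda>n. \<bar>z 1 n / z 3 n - \<Theta> n\<bar> \<le> \<epsilon> * \<Theta> n) ?F"
    using assms unfolding asymp_equiv_iff_eps[OF less_imp_le[OF \<Theta>_pos]] by blast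
  then show ?thesis unfolding eventually_inf_principal eventually_sequentially by simp
qed

end

section \<open>Exclusion of the critical case\<close>

text \<open>Local times start at \<open>1\<close>, so the first visit has value \<open>2\<close>,
  and each further visit raises it by one.\<close>

lemma visit_exists:
  assumes inf: "\<forall>N. \<exists>n\<ge>N. p n = i" and j: "2 \<le> j"
  shows "\<exists>n. p n = i \<and> loc p n i = j"
  using j
proof (induction j rule: dec_induct)
  case base
  define n where "n = (LEAST n. p n = i)"
  have n: "p n = i" unfolding n_def using inf by (meson LeastI)
  have "p m \<noteq> i" if "m < n" for m using not_less_Least[OF that[unfolded n_def]] .
  then have "(\<Sum>m<n. of_bool (p m = i)) = (0 :: nat)" by simp
  then have "loc p n i = 2" using n by (simp add: loc_def lessThan_Suc_atMost[symmetric])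
  with n show ?case by blast
next
  case (step j)
  then obtain n where n: "p n = i" "loc p n i = j" by blast
  define m where "m = (LEAST m. n < m \<and> p m = i)"
  obtain m0 where "m0 \<ge> Suc n" "p m0 = i" using inf by blast
  then have m: "n < m" "p m = i" unfolding m_def using LeastI[of "\<lambda>m. n < m \<and> p m = i" m0] by auto
  have between: "p l \<noteq> i" if "n < l" "l < m" for l
    using not_less_Least[OF that(2)[unfolded m_def]] that(1) by blast
  obtain m' where m': "m = Suc m'" using m(1) by (cases m) auto
  have const: "loc p l i = j" if "n \<le> l" "l \<le> m'" for l
    using that by (induction l rule: dec_induct) (use n between m' in \<open>auto simp: loc_Suc\<close>)
  have "loc p m i = Suc j" using const[of m'] m m' by (simp add: loc_Suc)
  then show ?case using m(2) by blast
qed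

lemma loc_between_visits:
  assumes "p a = i" "loc p a i = j" "p b = i" "loc p b i = Suc j"
  shows "a < b" and "a \<le> m \<Longrightarrow> m < b \<Longrightarrow> loc p m i = j"
proof -
  show ab: "a < b" using loc_mono[of b a p i] assms by (cases "a < b") auto
  then obtain b' where b': "b = Suc b'" by (cases b) auto
  assume "a \<le> m" "m < b"
  then show "loc p m i = j"
    using loc_mono[of a m p i] loc_mono[of m b' p i] assms b' by (simp add: loc_Suc)
qed

lemma escape_between_visits:
  assumes "p a = 3" "loc p a 3 = j" "p b = 3" "loc p b 3 = Suc j"
  shows "wsum p 4 1 (\<lambda>m. 1 / loc p m 3) b - wsum p 4 1 (\<lambda>m. 1 / loc p m 3) a =
    (real (cnt p 4 True b) - real (cnt p 4 True a)) / j"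
proof -
  note between = loc_between_visits[OF assms]
  have "wsum p 4 1 (\<lambda>m. 1 / loc p m 3) n - wsum p 4 1 (\<lambda>m. 1 / loc p m 3) a =
    (real (cnt p 4 True n) - real (cnt p 4 True a)) / j" if "a \<le> n" "n \<le> b" for n
    using that
  proof (induction n rule: dec_induct)
    case (step n)
    then show ?case using between(2)[of n]
      by (auto simp: wsum_Suc cnt_Suc add_divide_distrib diff_divide_distrib)
  qed simp
  then show ?thesis using between(1) by simp
qed

lemma loc_4_at_3:
  assumes "unit_steps p" "p n = 3"
  shows "loc p n 4 = 1 + cnt p 4 True n + cnt p 3 True n + of_bool (3 < p 0)"
  using loc_eq_cnt[OF assms(1), of n 4] cnt_crossing[OF assms(1), of 3 n] assms(2) by simp

text \<open>Summation by parts over the visits to \<open>3\<close> turns the future escape flow into a sum with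
  nonnegative weights of the counts of jumps \<open>4 \<rightarrow> 5\<close>, which are monotone in the coupling.\<close>

lemma escape_comparison:
  assumes unit_steps: "unit_steps p" "unit_steps p'" and start: "p 0 = p' 0"
    and cmp: "\<And>n n'. p n = 3 \<Longrightarrow> p' n' = 3 \<Longrightarrow> loc p n 3 = loc p' n' 3 \<Longrightarrow>
      cnt p 3 True n \<le> cnt p' 3 True n' \<and> cnt p 4 True n \<le> cnt p' 4 True n'"
    and inf: "\<forall>N. \<exists>n\<ge>N. p n = 3" "\<forall>N. \<exists>n\<ge>N. p' n = 3"
    and at: "p n0 = 3" "p' n0' = 3" "loc p n0 3 = J" "loc p' n0' 3 = J"
    and j: "J \<le> j"
  shows "p n = 3 \<Longrightarrow> p' n' = 3 \<Longrightarrow> loc p n 3 = j \<Longrightarrow> loc p' n' 3 = j \<Longrightarrow>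
    loc p n0 4 / J + (wsum p 4 1 (\<lambda>m. 1 / loc p m 3) n - wsum p 4 1 (\<lambda>m. 1 / loc p m 3) n0) - cnt p 4 True n / j \<le>
    loc p' n0' 4 / J + (wsum p' 4 1 (\<lambda>m. 1 / loc p' m 3) n' - wsum p' 4 1 (\<lambda>m. 1 / loc p' m 3) n0') - cnt p' 4 True n' / j"
  using j
proof (induction j arbitrary: n n' rule: dec_induct)
  case base
  have unique: "m = n" if "q m = 3" "q n = 3" "loc q m 3 = loc q n 3" for m n and q :: "nat \<Rightarrow> int"
  proof (rule ccontr)
    have less: False if h: "q m = 3" "q n = 3" "loc q m 3 = loc q n 3" "m < n" for m n
    proof -
      obtain n1 where n1: "n = Suc n1" using h(4) by (cases n) auto
      then show False using loc_mono[of m n1 q 3] h by (simp add: loc_Suc)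
    qed
    assume "m \<noteq> n"
    then show False using less[of m n] less[of n m] that by (cases "m < n") auto
  qed
  have "n = n0" "n' = n0'" using unique[of p n n0] unique[of p' n' n0'] base at by auto
  then show ?case
    using cmp[OF at(1,2)] at start
    by (simp add: loc_4_at_3[OF unit_steps(1) at(1)] loc_4_at_3[OF unit_steps(2) at(2)] add_divide_distrib divide_right_mono)
next
  case (step j)
  have J: "2 \<le> J"
  proof (cases n0)
    case 0
    then show ?thesis using at by (simp add: loc_0)
  next
    case (Suc k)
    then show ?thesis using at loc_ge_1[of p k 3] by (simp add: loc_Suc)
  qed
  then have j: "2 \<le> j" using step(1) by simp
  obtain m m' where m: "p m = 3" "loc p m 3 = j" "p' m' = 3" "loc p' m' 3 = j"
    using visit_exists[OF inf(1) j] visit_exists[OF inf(2) j] by blast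
  note IH = step.IH[OF m(1,3,2,4)]
  have c: "real (cnt p 4 True n) \<le> real (cnt p' 4 True n')" using cmp[of n n'] step.prems by simp
  \<comment> \<open>Summation by parts puts the nonnegative weight
    \<open>1 / j - 1 / (j + 1)\<close> on the count of jumps.\<close>
  have "1 / real (Suc j) \<le> 1 / real j" using j by (simp add: frac_le)
  then have "cnt p 4 True n * (1 / j - 1 / Suc j) \<le> cnt p' 4 True n' * (1 / j - 1 / Suc j)"
    using c by (intro mult_right_mono) auto
  then have "cnt p 4 True n / j - cnt p 4 True n / Suc j \<le> cnt p' 4 True n' / j - cnt p' 4 True n' / Suc j"
    by (simp add: right_diff_distrib)
  then show ?case
    using IH escape_between_visits[of p m j n] escape_between_visits[of p' m' j n'] m step.prems
    by (simp add: diff_divide_distrib)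
qed

lemma (in left_end) visits_3: "\<forall>N. \<exists>n\<ge>N. p n = 3"
  using z3 by (simp add: z_at_top_iff)

lemma (in critical_end) sum_escape_flow: "(\<Sum>m<n. escape_flow m) = wsum p 4 1 (\<lambda>m. 1 / z 3 m) n"
  unfolding wsum_def escape_flow_def by simp

lemma \<Theta>_mono:
  assumes "critical_end p" "critical_end p'" and start: "p 0 = p' 0"
    and cmp: "\<And>n n'. p n = 3 \<Longrightarrow> p' n' = 3 \<Longrightarrow> loc p n 3 = loc p' n' 3 \<Longrightarrow>
      cnt p 3 True n \<le> cnt p' 3 True n' \<and> cnt p 4 True n \<le> cnt p' 4 True n'"
    and at: "p n0 = 3" "p' n0' = 3" "loc p n0 3 = loc p' n0' 3"
  shows "critical_end.\<Theta> p n0 \<le> critical_end.\<Theta> p' n0'"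
proof -
  interpret P: critical_end p by fact
  interpret P': critical_end p' by fact
  let ?J = "loc p n0 3"
  let ?E = "wsum p 4 1 (\<lambda>m. 1 / loc p m 3)" and ?E' = "wsum p' 4 1 (\<lambda>m. 1 / loc p' m 3)"
  have le: "loc p n0 4 / ?J + (?E m - ?E n0) \<le> P'.\<Theta> n0'" for m
  proof -
    define j where "j = max 2 (max ?J (Suc (loc p m 3)))"
    obtain n n' where n: "p n = 3" "loc p n 3 = j" "p' n' = 3" "loc p' n' 3 = j"
      using visit_exists[OF P.visits_3, of j] visit_exists[OF P'.visits_3, of j] by (auto simp: j_def)
    have mn: "m \<le> n" using loc_mono[of n m p 3] n(2) unfolding j_def by (cases "m \<le> n") auto
    have "?E m \<le> ?E n" by (rule wsum_mono[OF _ mn]) simp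
    moreover have "loc p n0 4 / ?J + (?E n - ?E n0) - cnt p 4 True n / j \<le>
        loc p' n0' 4 / ?J + (?E' n' - ?E' n0') - cnt p' 4 True n' / j"
      by (rule escape_comparison[OF P.unit_steps P'.unit_steps start cmp P.visits_3 P'.visits_3])
        (use at n in \<open>auto simp: j_def\<close>)
    moreover have "cnt p 4 True n / j \<le> cnt p' 4 True n' / j"
      using cmp[OF n(1,3)] n(2,4) by (intro divide_right_mono) auto
    moreover have "?E' n' \<le> suminf P'.escape_flow"
      unfolding P'.sum_escape_flow[symmetric]
      by (rule sum_le_suminf[OF P'.right_flow_tails(1)]) (auto simp: P'.escape_flow_nonneg)
    ultimately show ?thesis using at(3) by (simp add: P'.\<Theta>_def tail_sum_def P'.sum_escape_flow)
  qed
  have "(\<lambda>m. ?E m) \<longlonglongrightarrow> suminf P.escape_flow"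
    using summable_LIMSEQ[OF P.right_flow_tails(1)] by (simp add: P.sum_escape_flow)
  then have "(\<lambda>m. loc p n0 4 / ?J + (?E m - ?E n0)) \<longlonglongrightarrow> loc p n0 4 / ?J + (suminf P.escape_flow - ?E n0)"
    by (intro tendsto_intros)
  from LIMSEQ_le_const2[OF this] le have "loc p n0 4 / ?J + (suminf P.escape_flow - ?E n0) \<le> P'.\<Theta> n0'" by blast
  then show ?thesis by (simp add: P.\<Theta>_def tail_sum_def P.sum_escape_flow)
qed

text \<open>Each jump \<open>1 -> 2\<close> adds at most \<open>1\<close> to the divergent
  \<open>Asum p 1\<close>, and such jumps alternate with jumps \<open>2 -> 1\<close>.\<close>

lemma (in left_end) left_jumps_unbounded: "\<exists>n. k < cnt p 2 False n"
proof -
  have "eventually (\<lambda>n. real (k + 2) \<le> Asum p 1 n) sequentially" using A1 by (simp add: filterlim_at_top)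
  then obtain n where n: "real (k + 2) \<le> Asum p 1 n" by (auto simp: eventually_sequentially)
  have "Asum p 1 n \<le> wsum p 1 1 (\<lambda>_. 1) n"
    unfolding Asum_def using real_loc_ge_1 by (intro wsum_le) simp
  also have "\<dots> = real (cnt p 1 True n)" using cnt_wsum[of p 1 True n] by simp
  finally have "real (k + 2) \<le> real (cnt p 1 True n)" using n by linarith
  then have "k + 2 \<le> cnt p 1 True n" by (simp only: of_nat_le_iff)
  then have "k < cnt p 2 False n" using cnt_crossing[OF unit_steps, of 1 n] by (simp add: of_bool_def split: if_splits)
  then show ?thesis by blast
qed

section \<open>Translation of paths and the critical event\<close>

definition shifted :: "int \<Rightarrow> (nat \<Rightarrow> int) \<Rightarrow> nat \<Rightarrow> int" where
  "shifted a p n = p n - a"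

lemma loc_shifted: "loc (shifted a p) n v = loc p n (v + a)"
  unfolding loc_def shifted_def by (simp add: diff_eq_eq)

lemma wsum_shifted: "wsum (shifted a p) i d f n = wsum p (i + a) d f n"
  unfolding wsum_def shifted_def by (intro sum.cong) (auto simp: diff_eq_eq)

lemma cnt_shifted: "cnt (shifted a p) i s n = cnt p (i + a) s n"
  unfolding cnt_def shifted_def by (intro sum.cong) (auto simp: diff_eq_eq)

lemma Asum_shifted: "Asum (shifted a p) j = Asum p (j + a)"
  by (rule ext) (simp add: Asum_def wsum_shifted loc_shifted add.commute add.left_commute)

lemma mart_shifted: "mart (shifted a p) i H = mart p (i + a) H"
  by (rule ext) (simp add: mart_def wsum_shifted loc_shifted algebra_simps)

lemma regular_shifted: "regular p \<Longrightarrow> regular (shifted a p)"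
  unfolding regular_def mart_shifted loc_shifted
proof (elim conjE, intro conjI allI)
  assume "unit_steps p"
  then show "unit_steps (shifted a p)" by (force simp: unit_steps_def shifted_def)
next
  fix i
  assume "\<forall>i. convergent (mart p i (\<lambda>_. 1)) \<and> convergent (mart p i (\<lambda>m. min 1 (real (loc p m (i - 1)) / (2 * real (loc p m i))))) \<and>
     convergent (mart p i (\<lambda>m. min 1 (real (loc p m (i + 1)) / real (loc p m i)))) \<and>
     convergent (mart p i (\<lambda>m. min (real (loc p m (i - 1))) (real (loc p m (i + 1))) powr (1/4)))"
  note this[rule_format, of "i + a"]
  then show "convergent (mart p (i + a) (\<lambda>_. 1))"
    "convergent (mart p (i + a) (\<lambda>m. min 1 (real (loc p m (i - 1 + a)) / (2 * real (loc p m (i + a))))))"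
    "convergent (mart p (i + a) (\<lambda>m. min 1 (real (loc p m (i + 1 + a)) / real (loc p m (i + a)))))"
    "convergent (mart p (i + a) (\<lambda>m. min (real (loc p m (i - 1 + a))) (real (loc p m (i + 1 + a))) powr (1/4)))"
    by (simp_all add: algebra_simps)
qed

definition critical :: "int \<Rightarrow> (nat \<Rightarrow> int) \<Rightarrow> bool" where
  "critical a p \<longleftrightarrow> (\<exists>N. \<forall>n\<ge>N. p n \<noteq> a - 1) \<and> (\<forall>N. \<exists>n\<ge>N. p n = a) \<and> (\<forall>k::nat. \<exists>n. k < Asum p (a + 4) n)"

lemma pred_critical: "Measurable.pred Paths (critical a)"
proof -
  have [measurable]: "(\<lambda>p. Asum p (a + 4) n) \<in> borel_measurable Paths" for n
    unfolding Asum_def by (rule measurable_Paths_adapted[OF adapted_inverse_wsum]) simp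
  have [measurable]: "(\<lambda>p. p n) \<in> measurable Paths (count_space UNIV)" for n :: nat
    by (rule measurable_component_singleton) simp
  show ?thesis unfolding critical_def by measurable
qed

lemma critical_end_shifted:
  assumes "regular p" "critical a p"
  shows "critical_end (shifted a p)"
proof
  show "regular (shifted a p)" by (rule regular_shifted[OF assms(1)])
  show "\<exists>N. \<forall>n\<ge>N. shifted a p n \<noteq> - 1" "\<forall>N. \<exists>n\<ge>N. shifted a p n = 0"
    using assms(2) by (auto simp: critical_def shifted_def algebra_simps)
  have un: "\<exists>n. real k < Asum p (a + 4) n" for k :: nat using assms(2) by (auto simp: critical_def)
  have "\<not> convergent (Asum p (a + 4))"
  proof
    assume "convergent (Asum p (a + 4))"
    then have "Bseq (Asum p (a + 4))" by (rule convergent_imp_Bseq)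
    then obtain C where C: "\<And>n. \<bar>Asum p (a + 4) n\<bar> \<le> C" by (auto simp: Bseq_def)
    obtain k :: nat where "C \<le> real k" using real_arch_simple by blast
    with un[of k] C show False by (meson abs_le_iff not_less order_trans)
  qed
  then show "filterlim (Asum (shifted a p) 4) at_top sequentially"
    unfolding Asum_shifted using mono_unbounded_at_top[OF incseq_Asum] by (simp add: add.commute)
qed

lemma zeta_add_le:
  assumes "unit_steps q" "\<And>k. \<exists>n. k < cnt q i s n" "k \<le> l"
  shows "zeta q i s k + (l - k) \<le> zeta q i s l"
  using assms(3)
proof (induction l rule: dec_induct)
  case (step l)
  obtain n where "Suc l < cnt q i s n" using assms(2) by blast
  from zeta_strict[OF assms(1) this] step show ?case by simp
qed simp

text \<open>At a late visit to \<open>x + 1\<close> with the same number in both walks, monotonicity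
  of \<open>\<Theta>\<close> makes the local time at \<open>x - 1\<close> in \<open>q\<close> at
  most \<open>1 + \<epsilon>\<close> times that in \<open>q'\<close>. So few left alarms lie between
  the pending ones, numbered \<open>l'\<close> and \<open>l\<close>; yet their waiting times must
  exceed the delay, against the law of large numbers.\<close>

lemma (in coupling) not_both_critical:
  assumes good: "good_clocks e" and x: "x = a + 2"
    and crit: "critical_end (shifted a q)" "critical_end (shifted a q')"
  shows False
proof -
  interpret P: critical_end "shifted a q" by (rule crit(1))
  interpret P': critical_end "shifted a q'" by (rule crit(2))
  have site: "3 + a = x + 1" "2 + a = x" "4 + a = (x + 1) + 1" "1 + a = x - 1" by (simp_all add: x)
  have at3: "shifted a p n = 3 \<longleftrightarrow> p n = x + 1" for p n by (auto simp: shifted_def x)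
  define \<kappa> where "\<kappa> = \<delta> / zeta q x False 0"
  have \<kappa>: "0 < \<kappa>" using \<delta> by (simp add: \<kappa>_def zeta_def)
  \<comment> \<open>Here \<open>\<epsilon> \<le> \<kappa> / 4\<close> and below
    \<open>\<eta> \<le> \<kappa> / 16\<close>, so that
    \<open>\<epsilon> + 4 \<eta> \<le> \<kappa> / 2\<close> in the final estimate.\<close>
  define \<epsilon> where "\<epsilon> = min 1 (\<kappa> / 4)"
  have \<epsilon>: "0 < \<epsilon>" "\<epsilon> \<le> 1" "\<epsilon> \<le> \<kappa> / 4" using \<kappa> by (auto simp: \<epsilon>_def)
  obtain m :: nat where m: "16 / \<kappa> \<le> real m" using real_arch_simple by blast
  define \<eta> where "\<eta> = 1 / real (Suc (Suc m))"
  have \<eta>: "0 < \<eta>" "\<eta> \<le> \<kappa> / 16"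
  proof -
    have "16 / \<kappa> \<le> real (Suc (Suc m))" using m by simp
    then have "16 \<le> \<kappa> * real (Suc (Suc m))" using \<kappa> by (simp add: divide_le_eq mult.commute)
    then show "0 < \<eta>" "\<eta> \<le> \<kappa> / 16" by (simp_all add: \<eta>_def divide_le_eq)
  qed
  have "eventually (\<lambda>k. \<bar>(\<Sum>j<k. e (x, False, j)) - real k\<bar> < \<eta> * real k) sequentially"
    using good unfolding good_clocks_def \<eta>_def by blast
  then obtain K where K: "\<And>k. k \<ge> K \<Longrightarrow> \<bar>(\<Sum>j<k. e (x, False, j)) - real k\<bar> < \<eta> * real k"
    by (auto simp: eventually_sequentially)
  obtain k0 :: nat where k0: "2 / \<kappa> < real k0" using reals_Archimedean2 by blast
  obtain N where N: "\<And>n. n \<ge> N \<Longrightarrow> q n = x + 1 \<Longrightarrow> \<bar>P.z 1 n / P.z 3 n - P.\<Theta> n\<bar> \<le> \<epsilon> / 4 * P.\<Theta> n"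
    using P.y_\<Theta>[of "\<epsilon> / 4"] \<epsilon> by (auto simp: at3)
  obtain N1 where N1: "\<And>n. n \<ge> N1 \<Longrightarrow> q' n = x + 1 \<Longrightarrow> \<bar>P'.z 1 n / P'.z 3 n - P'.\<Theta> n\<bar> \<le> \<epsilon> / 4 * P'.\<Theta> n"
    using P'.y_\<Theta>[of "\<epsilon> / 4"] \<epsilon> by (auto simp: at3)
  have unb: "\<exists>n. k < cnt q x False n" "\<exists>n. k < cnt q' x False n" for k
    using P.left_jumps_unbounded[of k] P'.left_jumps_unbounded[of k] by (auto simp: cnt_shifted site)
  obtain N2 where N2: "max K (Suc k0) < cnt q' x False N2" using unb(2) by blast
  \<comment> \<open>A visit number beyond all thresholds of both walks: the coupling compares
    visits, not times.\<close>
  define j where "j = max 2 (max (Suc (loc q N (x + 1))) (max (Suc (loc q' N1 (x + 1))) (Suc (loc q' N2 (x + 1)))))"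
  obtain n n' where n: "q n = x + 1" "loc q n (x + 1) = j" and n': "q' n' = x + 1" "loc q' n' (x + 1) = j"
    using visit_exists[OF P.visits_3, of j] visit_exists[OF P'.visits_3, of j] by (auto simp: j_def at3 loc_shifted site)
  have late: "N \<le> n" "N1 \<le> n'" "N2 \<le> n'"
    using loc_mono[of n N q "x + 1"] loc_mono[of n' N1 q' "x + 1"] loc_mono[of n' N2 q' "x + 1"] n n'
    unfolding j_def by (metis Suc_le_eq max.bounded_iff nat_le_linear not_less order_refl)+
  define l where "l = cnt q x False n"
  define l' where "l' = cnt q' x False n'"
  have l': "K \<le> l'" "k0 < l'" using N2 cnt_mono[OF late(3), of q' x False] by (auto simp: l'_def)
  have pos': "0 < cnt q' x False n'" using l' by (simp add: l'_def)
  note al = left_alarms_common_visit[OF n(1) n'(1) trans[OF n(2) n'(2)[symmetric]] pos', folded l_def l'_def]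
  have "P.\<Theta> n \<le> P'.\<Theta> n'"
  proof (rule \<Theta>_mono[OF crit])
    show "shifted a q 0 = shifted a q' 0" using start by (simp add: shifted_def)
  next
    fix r r' assume "shifted a q r = 3" "shifted a q' r' = 3" "loc (shifted a q) r 3 = loc (shifted a q') r' 3"
    then have r: "q r = x + 1" "q' r' = x + 1" "loc q r (x + 1) = loc q' r' (x + 1)" by (auto simp: at3 loc_shifted site)
    show "cnt (shifted a q) 3 True r \<le> cnt (shifted a q') 3 True r' \<and> cnt (shifted a q) 4 True r \<le> cnt (shifted a q') 4 True r'"
      using cnt_True_common_visit[OF r] cnt_True_next_common_visit[OF r] by (simp add: cnt_shifted site)
  qed (use n n' in \<open>auto simp: at3 loc_shifted site\<close>)
  then have "P.z 1 n / j \<le> (1 + \<epsilon> / 4) * P'.\<Theta> n'" "(1 - \<epsilon> / 4) * P'.\<Theta> n' \<le> P'.z 1 n' / j"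
  proof -
    assume le: "P.\<Theta> n \<le> P'.\<Theta> n'"
    have z3: "P.z 3 n = j" "P'.z 3 n' = j" using n(2) n'(2) by (simp_all add: loc_shifted site)
    have "P.z 1 n / j \<le> (1 + \<epsilon> / 4) * P.\<Theta> n" using N[OF late(1) n(1), unfolded z3] unfolding abs_le_iff by (simp only: algebra_simps) linarith
    also have "\<dots> \<le> (1 + \<epsilon> / 4) * P'.\<Theta> n'" using le \<epsilon> by (intro mult_left_mono) auto
    finally show "P.z 1 n / j \<le> (1 + \<epsilon> / 4) * P'.\<Theta> n'" .
    show "(1 - \<epsilon> / 4) * P'.\<Theta> n' \<le> P'.z 1 n' / j" using N1[OF late(2) n'(1), unfolded z3] unfolding abs_le_iff by (simp only: algebra_simps) linarith
  qed
  moreover have "(1 + \<epsilon> / 4) * P'.\<Theta> n' \<le> (1 + \<epsilon>) * ((1 - \<epsilon> / 4) * P'.\<Theta> n')"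
  proof -
    have "\<epsilon> * \<epsilon> \<le> 1 * \<epsilon>" using \<epsilon> by (intro mult_right_mono) auto
    moreover have "(1 + \<epsilon>) * (1 - \<epsilon> / 4) = 1 + 3 / 4 * \<epsilon> - \<epsilon> * \<epsilon> / 4" by (simp add: field_simps)
    ultimately have "1 + \<epsilon> / 4 \<le> (1 + \<epsilon>) * (1 - \<epsilon> / 4)" using \<epsilon>(1) by linarith
    then show ?thesis using P'.\<Theta>_pos[of n'] mult_right_mono[of "1 + \<epsilon> / 4" "(1 + \<epsilon>) * (1 - \<epsilon> / 4)" "P'.\<Theta> n'"]
      by (simp add: mult.assoc)
  qed
  moreover have "(1 + \<epsilon>) * ((1 - \<epsilon> / 4) * P'.\<Theta> n') \<le> (1 + \<epsilon>) * (P'.z 1 n' / j)" if "(1 - \<epsilon> / 4) * P'.\<Theta> n' \<le> P'.z 1 n' / j"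
    using that \<epsilon> by (intro mult_left_mono) auto
  ultimately have "P.z 1 n / j \<le> (1 + \<epsilon>) * P'.z 1 n' / j" by simp
  moreover have j: "0 < j" by (simp add: j_def)
  ultimately have z1: "P.z 1 n \<le> (1 + \<epsilon>) * P'.z 1 n'" by (simp add: divide_le_cancel)
  define \<zeta> where "\<zeta> = real (zeta q x False l')"
  have zl: "real (zeta q x False l) \<le> (1 + \<epsilon>) * \<zeta>"
  proof -
    have "real (zeta q x False l) \<le> (1 + \<epsilon>) * real (loc q' n' (x - 1))"
      using z1 al(4) by (simp add: loc_shifted site)
    also have "\<dots> \<le> (1 + \<epsilon>) * \<zeta>" using al(3) \<epsilon> by (intro mult_left_mono) (auto simp: \<zeta>_def)
    finally show ?thesis .
  qed
  \<comment> \<open>Each alarm raises \<open>zeta\<close> by at least one, so a small relative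
    growth of \<open>zeta\<close> bounds the number of alarms in between.\<close>
  have add: "\<zeta> + (real l - real l') \<le> real (zeta q x False l)"
    using zeta_add_le[OF unit_steps unb(1) al(1)] al(1) by (simp add: \<zeta>_def of_nat_diff[symmetric] of_nat_add[symmetric] del: of_nat_add of_nat_diff)
  obtain r where "l < cnt q x False r" using unb(1) by blast
  from cnt_le_zeta[OF unit_steps this] have l_le: "real l + 1 \<le> (1 + \<epsilon>) * \<zeta>" using zl by simp
  obtain r where "l' < cnt q x False r" using unb(1) by blast
  from cnt_le_zeta[OF unit_steps this] have l'_le: "real l' + 1 \<le> \<zeta>" by (simp add: \<zeta>_def)
  have \<zeta>_pos: "0 < \<zeta>" using l'_le by simp
  \<comment> \<open>All rates from alarm \<open>l'\<close> on are at least \<open>\<zeta>\<close>,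
    so the clocks between must add up to more than the delay times \<open>\<zeta>\<close>.\<close>
  have "\<kappa> * \<zeta> < (\<Sum>j=l'..<Suc l. e (x, False, j))"
  proof -
    have "alarm e q x False (Suc l) = alarm e q x False l' + (\<Sum>j=l'..<Suc l. e (x, False, j) / zeta q x False j)"
      unfolding alarm_def using al(1)
      by (simp add: sum.atLeastLessThan_concat lessThan_atLeast0 del: sum.op_ivl_Suc)
    then have "\<kappa> < (\<Sum>j=l'..<Suc l. e (x, False, j) / zeta q x False j)" using al(2) by (simp add: \<kappa>_def)
    also have "\<dots> \<le> (\<Sum>j=l'..<Suc l. e (x, False, j) / \<zeta>)"
    proof (rule sum_mono)
      fix j assume "j \<in> {l'..<Suc l}"
      then have "zeta q x False l' + (j - l') \<le> zeta q x False j" using zeta_add_le[OF unit_steps unb(1)] by simp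
      then have "\<zeta> \<le> real (zeta q x False j)" by (simp add: \<zeta>_def)
      then show "e (x, False, j) / real (zeta q x False j) \<le> e (x, False, j) / \<zeta>"
        using \<zeta>_pos e_nonneg by (intro divide_left_mono) auto
    qed
    also have "\<dots> = (\<Sum>j=l'..<Suc l. e (x, False, j)) / \<zeta>" by (simp only: sum_divide_distrib)
    finally show ?thesis using \<zeta>_pos by (simp only: less_divide_eq if_True)
  qed
  also have "(\<Sum>j=l'..<Suc l. e (x, False, j)) = (\<Sum>j<Suc l. e (x, False, j)) - (\<Sum>j<l'. e (x, False, j))"
    using al(1) sum.atLeastLessThan_concat[of 0 l' "Suc l" "\<lambda>j. e (x, False, j)"] by (simp add: lessThan_atLeast0 del: sum.op_ivl_Suc)
  also have "\<dots> \<le> (real (Suc l) + \<eta> * real (Suc l)) - (real l' - \<eta> * real l')"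
    using K[of "Suc l"] K[of l'] l'(1) al(1) by (simp add: abs_less_iff del: sum.lessThan_Suc)
  also have "\<dots> = (real l - real l') + 1 + \<eta> * ((real l + 1) + real l')" by (simp add: algebra_simps)
  also have "\<dots> \<le> \<epsilon> * \<zeta> + 1 + \<eta> * (4 * \<zeta>)"
  proof -
    have "\<epsilon> * \<zeta> \<le> 1 * \<zeta>" using \<epsilon> \<zeta>_pos by (intro mult_right_mono) auto
    moreover have "(1 + \<epsilon>) * \<zeta> = \<zeta> + \<epsilon> * \<zeta>" by (simp add: algebra_simps)
    ultimately have "(real l + 1) + real l' \<le> 4 * \<zeta>" using l_le l'_le \<zeta>_pos by linarith
    then have "\<eta> * ((real l + 1) + real l') \<le> \<eta> * (4 * \<zeta>)" using \<eta> by (intro mult_left_mono) auto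
    moreover have "real l - real l' \<le> \<epsilon> * \<zeta>" using add zl by (simp add: algebra_simps)
    ultimately show ?thesis by simp
  qed
  also have "\<epsilon> * \<zeta> + 1 + \<eta> * (4 * \<zeta>) \<le> \<kappa> / 4 * \<zeta> + 1 + \<kappa> / 16 * (4 * \<zeta>)"
    using \<epsilon> \<eta> \<zeta>_pos by (intro add_mono mult_right_mono) auto
  finally have "\<kappa> * \<zeta> < 2" by simp
  moreover have "2 < \<kappa> * \<zeta>"
  proof -
    have "2 < \<kappa> * real k0" using k0 \<kappa> by (simp add: divide_less_eq mult.commute)
    also have "\<dots> \<le> \<kappa> * \<zeta>" using l'_le l'(2) \<kappa> by (intro mult_left_mono) auto
    finally show ?thesis .
  qed
  ultimately show False by simp
qed

lemma AE_walk_not_critical: "AE e in Clocks. \<not> critical a (walk v e)"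
proof (rule AE_Clocks_not[where G = "\<lambda>e. good_clocks e \<and> regular (walk v e)" and j = "(a + 2, False, 0)"])
  interpret W: vrrw_law Clocks "\<lambda>n e. walk v e n" v by (rule vrrw_law_walk)
  have "(\<lambda>e. walk v e) \<in> measurable Clocks Paths"
    by (auto intro!: measurable_PiM_single' simp: space_PiM)
  from measurable_compose[OF this pred_critical[of a]] show "Measurable.pred Clocks (\<lambda>e. critical a (walk v e))" .
  show "AE e in Clocks. good_clocks e \<and> regular (walk v e)"
    using AE_good_clocks W.AE_regular by (simp add: W.path_def)
next
  fix e :: clocks and \<delta> :: real
  let ?e' = "e((a + 2, False, 0) := e (a + 2, False, 0) + \<delta>)"
  assume \<delta>: "0 < \<delta>" and e: "good_clocks e \<and> regular (walk v e)" "critical a (walk v e)"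
    "good_clocks ?e' \<and> regular (walk v ?e')" "critical a (walk v ?e')"
  interpret coupling e ?e' "walk v e" "walk v ?e'" "a + 2" \<delta>
    by standard (use e \<delta> in \<open>auto simp: rubin_walk good_clocks_def\<close>)
  show False
    by (rule not_both_critical[of a]) (use e in \<open>auto intro: critical_end_shifted\<close>)
qed

lemma (in vrrw_law) AE_not_critical: "AE \<omega> in M. \<forall>a. \<not> critical a (path \<omega>)"
proof -
  have "AE \<omega> in M. \<not> critical a (path \<omega>)" for a
    using AE_path_iff_AE_walk[of "\<lambda>p. \<not> critical a p"] pred_critical[of a] AE_walk_not_critical
    by (simp add: pred_def) measurable
  then show ?thesis by (simp add: AE_all_countable)
qed

section \<open>Five sites\<close>

text \<open>Reflection about \<open>2\<close>, which preserves the range from \<open>0\<close> to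
  \<open>4\<close>; a right end at \<open>4\<close> becomes a left end at \<open>0\<close>.\<close>

definition mirror :: "(nat \<Rightarrow> int) \<Rightarrow> nat \<Rightarrow> int" where
  "mirror p n = 4 - p n"

lemma loc_mirror: "loc (mirror p) n v = loc p n (4 - v)"
proof -
  have "(4 - p i = v) = (p i = 4 - v)" for i by auto
  then show ?thesis by (simp add: loc_def mirror_def)
qed

lemma wsum_mirror: "wsum (mirror p) i d f n = wsum p (4 - i) (- d) f n"
  unfolding wsum_def by (intro sum.cong) (auto simp: mirror_def)

lemma Asum_mirror: "Asum (mirror p) j = Bsum p (4 - j)"
  by (rule ext) (simp add: Asum_def Bsum_def wsum_mirror loc_mirror)

lemma mirror_mirror [simp]: "mirror (mirror p) = p"
  by (rule ext) (simp add: mirror_def)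

lemma eqc_bounded:
  assumes "eqc f g"
  obtains C where "\<And>n. \<bar>f n - g n\<bar> \<le> C"
proof -
  from assms have "Bseq (\<lambda>n. f n - g n)" unfolding eqc_def by (rule convergent_imp_Bseq)
  then show ?thesis using that by (auto simp: Bseq_def)
qed

text \<open>Jumps \<open>i -> i + 1\<close> are matched with the returns, and at arrivals the local
  time takes each value at most once; a convergent series remains.\<close>

lemma wsum_powr_bounded:
  assumes "unit_steps p" "1 < \<gamma>"
  shows "\<exists>C. \<forall>n. wsum p i 1 (\<lambda>m. real (loc p m i) powr (- \<gamma>)) n \<le> C"
proof -
  obtain C where C: "\<And>a b. (\<Sum>k=a..<b. real k powr (- \<gamma>)) \<le> C" using sum_powr_bounded[OF assms(2)] by blast
  have "wsum p i 1 (\<lambda>m. real (loc p m i) powr (- \<gamma>)) n \<le> C + 1" for n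
  proof -
    have "wsum p i 1 (\<lambda>m. real (loc p m i) powr (- \<gamma>)) n - wsum p (i + 1) (- 1) (\<lambda>m. real (loc p m i) powr (- \<gamma>)) n
      = (if 0 < (p n - i) * 1 then real (loc p n i) powr (- \<gamma>) else 0) - (if 0 < (p 0 - i) * 1 then real (loc p 0 i) powr (- \<gamma>) else 0)"
      by (rule wsum_crossings[OF assms(1), where g = "\<lambda>k. real k powr (- \<gamma>)"]) simp
    moreover have "real (loc p n i) powr (- \<gamma>) \<le> 1"
      using powr_mono[of "- \<gamma>" 0 "real (loc p n i)"] assms(2) real_loc_ge_1[of p n i] by simp
    then have "(if 0 < (p n - i) * 1 then real (loc p n i) powr (- \<gamma>) else 0) \<le> 1" by simp
    moreover have "wsum p (i - 1) 1 (\<lambda>m. real (loc p m i) powr (- \<gamma>)) n + wsum p (i + 1) (-1) (\<lambda>m. real (loc p m i) powr (- \<gamma>)) n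
      = (\<Sum>k=loc p 0 i..<loc p n i. real k powr (- \<gamma>))"
      by (rule wsum_arrivals[OF assms(1), where g = "\<lambda>k. real k powr (- \<gamma>)"])
    moreover have "0 \<le> wsum p (i - 1) 1 (\<lambda>m. real (loc p m i) powr (- \<gamma>)) n" by (rule wsum_nonneg) simp
    moreover have "0 \<le> (if 0 < (p 0 - i) * 1 then real (loc p 0 i) powr (- \<gamma>) else 0)" by simp
    ultimately show ?thesis using C[of "loc p 0 i" "loc p n i"] by linarith
  qed
  then show ?thesis by blast
qed

lemma harmonic_ln_error:
  assumes "0 < a" "a \<le> b"
  shows "\<bar>(\<Sum>k=a..<b. 1 / real k) - (ln (real b) - ln (real a))\<bar> \<le> 1 / real a"
proof -
  have "0 \<le> (\<Sum>k=a..<b. 1 / real k) - (ln (real b) - ln (real a)) \<and>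
    (\<Sum>k=a..<b. 1 / real k) - (ln (real b) - ln (real a)) \<le> 1 / real a - 1 / real b"
    using assms(2)
  proof (induction b rule: dec_induct)
    case (step b)
    have b: "0 < b" using step(1) assms(1) by simp
    have "ln (1 + 1 / real b) \<le> 1 / real b" by (rule ln_add_one_self_le_self) simp
    moreover have "1 + 1 / real b = real (Suc b) / real b" using b by (simp add: field_simps)
    ultimately have 1: "ln (real (Suc b)) - ln (real b) \<le> 1 / real b" using b by (simp add: ln_div)
    have "ln (real b / real (Suc b)) \<le> real b / real (Suc b) - 1" using b by (intro ln_le_minus_one) simp
    then have "ln (real b) - ln (real (Suc b)) \<le> - (1 / real (Suc b))" using b by (simp add: ln_div field_simps)
    with 1 step show ?case by simp
  qed simp
  moreover have "0 \<le> 1 / real b" by simp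
  ultimately show ?thesis unfolding abs_le_iff by linarith
qed

lemma abs_diff_le_ln:
  assumes "0 < a" "0 < (b::real)" "a \<le> K" "b \<le> K"
  shows "\<bar>a - b\<bar> \<le> K * \<bar>ln a - ln b\<bar>"
proof -
  have *: "a - b \<le> K * \<bar>ln a - ln b\<bar>" if "0 < a" "0 < b" "a \<le> K" for a b
  proof (cases "b \<le> a")
    case True
    have "ln (b / a) \<le> b / a - 1" using that by (intro ln_le_minus_one) simp
    then have "1 - b / a \<le> ln a - ln b" using that by (simp add: ln_div)
    then have "a * (1 - b / a) \<le> a * (ln a - ln b)" using that by (intro mult_left_mono) auto
    also have "\<dots> \<le> K * \<bar>ln a - ln b\<bar>" using that True by (intro mult_mono) auto
    also have "a * (1 - b / a) = a - b" using that by (simp add: field_simps)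
    finally show ?thesis .
  next
    case False
    moreover have "0 \<le> K * \<bar>ln a - ln b\<bar>" using that by (intro mult_nonneg_nonneg) auto
    ultimately show ?thesis by linarith
  qed
  show ?thesis using *[of a b] *[of b a] assms by (simp add: abs_le_iff abs_minus_commute)
qed

text \<open>Partial summation: bounded sums with a growing weight \<open>H\<close> leave unweighted
  increments of order \<open>1 / H n\<close> after time \<open>n\<close>. This turns the last
  compensation in \<open>regular\<close> into a rate.\<close>

lemma weighted_increments_rate:
  fixes M T H :: "nat \<Rightarrow> real"
  assumes inc: "\<And>n. T (Suc n) - T n = H n * (M (Suc n) - M n)"
    and H: "\<And>n. 0 < H n" "\<And>n. H n \<le> H (Suc n)" and T: "\<And>n. \<bar>T n\<bar> \<le> C" and n: "n \<le> N"
  shows "\<bar>M N - M n\<bar> \<le> 2 * C / H n"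
proof -
  have C: "\<bar>T k - T n\<bar> \<le> 2 * C" for k using T[of k] T[of n] by linarith
  have "\<bar>(M N - M n) - (T N - T n) / H N\<bar> \<le> 2 * C * (1 / H n - 1 / H N)"
    using n
  proof (induction N rule: dec_induct)
    case (step N)
    have HN: "H N \<noteq> 0" using H(1)[of N] by simp
    have "M (Suc N) - M N = (T (Suc N) - T N) / H N" using inc[of N] HN by (simp add: field_simps)
    then have "(M (Suc N) - M n) - (T (Suc N) - T n) / H (Suc N) =
      ((M N - M n) - (T N - T n) / H N) + (T (Suc N) - T n) * (1 / H N - 1 / H (Suc N))"
      by (simp add: diff_divide_distrib algebra_simps)
    also have "\<bar>\<dots>\<bar> \<le> 2 * C * (1 / H n - 1 / H N) + 2 * C * (1 / H N - 1 / H (Suc N))"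
    proof (rule order_trans[OF abs_triangle_ineq add_mono[OF step.IH]])
      have "0 \<le> 1 / H N - 1 / H (Suc N)" using H(1)[of N] H(2)[of N] by (simp add: frac_le)
      then show "\<bar>(T (Suc N) - T n) * (1 / H N - 1 / H (Suc N))\<bar> \<le> 2 * C * (1 / H N - 1 / H (Suc N))"
        unfolding abs_mult using C[of "Suc N"] by (intro mult_mono) auto
    qed
    finally show ?case by (simp add: algebra_simps)
  qed simp
  moreover have "\<bar>(T N - T n) / H N\<bar> \<le> 2 * C * (1 / H N)"
    using C[of N] H(1)[of N] by (simp add: divide_right_mono)
  ultimately have "\<bar>M N - M n\<bar> \<le> 2 * C * (1 / H n - 1 / H N) + 2 * C * (1 / H N)" by linarith
  then show ?thesis by (simp add: algebra_simps)
qed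

lemma convergent_pos_bounds:
  fixes f :: "nat \<Rightarrow> real"
  assumes "f \<longlonglongrightarrow> l" "\<And>n. 0 < f n" "0 < l"
  obtains K where "0 < K" "\<And>n. f n \<le> K" "\<And>n. 1 / f n \<le> K"
proof -
  obtain K1 where K1: "\<And>n. \<bar>f n\<bar> \<le> K1" using convergent_imp_Bseq[OF convergentI[OF assms(1)]] by (auto simp: Bseq_def)
  have "(\<lambda>n. 1 / f n) \<longlonglongrightarrow> 1 / l" using assms by (intro tendsto_divide) auto
  then obtain K2 where K2: "\<And>n. \<bar>1 / f n\<bar> \<le> K2" using convergent_imp_Bseq[OF convergentI] by (force simp: Bseq_def)
  have "f n \<le> K1" "1 / f n \<le> K2" for n using K1[of n] K2[of n] assms(2)[of n] by simp_all
  then show ?thesis by (intro that[of "max 1 (max K1 K2)"]) (auto intro: max.coboundedI1 max.coboundedI2)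
qed

locale five_sites = left_end +
  assumes mirror_end: "left_end (mirror p)"
begin

interpretation R: left_end "mirror p"
  by (rule mirror_end)

lemma A4_convergent: "convergent (Asum p 4)" and B4_convergent: "convergent (Bsum p 4)"
proof -
  show *: "convergent (Bsum p 4)" using R.A0 by (simp add: Asum_mirror)
  show "convergent (Asum p 4)" using eqc_trans[OF AB[of 4], of "\<lambda>_. 0"] * by (simp add: eqc_0_iff)
qed

lemma z4_z2: "(\<lambda>n. z 4 n / z 2 n) \<longlonglongrightarrow> 0"
  using R.z0_z2 by (simp add: loc_mirror)

lemma y_limit: "\<exists>r>0. (\<lambda>n. z 1 n / z 3 n) \<longlonglongrightarrow> r"
proof -
  have "eqc (\<lambda>n. ln (z 1 n / z 3 n)) (\<lambda>n. (Asum p 0 n + Asum p 2 n) - (Asum p 2 n + Asum p 4 n))"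
    using ln_ratio[of 1 3] by simp
  also have "eqc (\<lambda>n. (Asum p 0 n + Asum p 2 n) - (Asum p 2 n + Asum p 4 n)) (\<lambda>n. (0 + Asum p 2 n) - (Asum p 2 n + 0))"
    by (intro eqc_diff eqc_add eqc_refl) (use A0 A4_convergent in \<open>simp_all add: eqc_0_iff\<close>)
  finally (eqc_trans) have "convergent (\<lambda>n. ln (z 1 n / z 3 n))" by (simp add: eqc_0_iff)
  then obtain L where "(\<lambda>n. ln (z 1 n / z 3 n)) \<longlonglongrightarrow> L" by (auto simp: convergent_def)
  then have "(\<lambda>n. exp (ln (z 1 n / z 3 n))) \<longlonglongrightarrow> exp L" by (rule tendsto_exp)
  then show ?thesis by (intro exI[of _ "exp L"]) simp
qed

lemma A3_eqc: "eqc (Asum p 3) (wsum p 2 1 (\<lambda>m. 1 / z 2 m))"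
proof -
  have "eqc (wsum p 2 1 (\<lambda>m. 1 / z 2 m)) (Bsum p 3)"
    using crossings_eqc[OF z2, where d = 1] by (simp add: Bsum_def)
  from eqc_trans[OF AB eqc_sym[OF this]] show ?thesis .
qed

lemma z1_z3_compare: "\<exists>K>0. \<forall>n. z 2 n \<le> K * z 1 n \<and> z 2 n \<le> K * z 3 n \<and> z 1 n / z 3 n \<le> K"
proof -
  obtain r where r: "0 < r" "(\<lambda>n. z 1 n / z 3 n) \<longlonglongrightarrow> r" using y_limit by blast
  obtain K where K: "0 < K" "\<And>n. z 1 n / z 3 n \<le> K" "\<And>n. 1 / (z 1 n / z 3 n) \<le> K"
    using convergent_pos_bounds[OF r(2) _ r(1)] by auto
  have "z 2 n \<le> (1 + K) * z 1 n \<and> z 2 n \<le> (1 + K) * z 3 n \<and> z 1 n / z 3 n \<le> 1 + K" for n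
  proof -
    have "z 2 n \<le> z 1 n + z 3 n" using loc_le_neighbours[OF unit_steps, where n = n and j = 2] by simp
    moreover have "z 1 n \<le> K * z 3 n" "z 3 n \<le> K * z 1 n" using K(2,3)[of n] by (simp_all add: divide_le_eq)
    ultimately show ?thesis using K(2)[of n] by (simp add: algebra_simps)
  qed
  then show ?thesis using K(1) by (intro exI[of _ "1 + K"]) auto
qed

text \<open>Up to bounded terms \<open>Asum p 1 \<le> K * Asum p 3\<close>, where \<open>K\<close>
  bounds \<open>z 1 / z 3\<close>. As \<open>ln (z 2)\<close> is the sum of both and
  \<open>ln (z 0 / z 2)\<close> is minus the second, the exponent is
  \<open>1 - 1 / (K + 1)\<close>.\<close>

lemma z0_power: "\<exists>\<beta> C. 0 < \<beta> \<and> \<beta> < 1 \<and> 0 < C \<and> (\<forall>n. z 0 n \<le> C * z 2 n powr \<beta>)"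
proof -
  obtain K where K: "0 < K" "\<And>n. z 1 n / z 3 n \<le> K" using z1_z3_compare by blast
  obtain C1 where C1: "\<And>n. \<bar>Asum p 1 n - wsum p 2 1 (\<lambda>m. z 1 m / (z 2 m * z 3 m)) n\<bar> \<le> C1" using eqc_bounded[OF A1_eqc] by blast
  obtain C2 where C2: "\<And>n. \<bar>Asum p 3 n - wsum p 2 1 (\<lambda>m. 1 / z 2 m) n\<bar> \<le> C2" using eqc_bounded[OF A3_eqc] by blast
  obtain C3 where C3: "\<And>n. \<bar>ln (z 2 n) - (Asum p (2 - 1) n + Asum p (2 + 1) n)\<bar> \<le> C3" using eqc_bounded[OF ln_z[of 2]] by blast
  obtain C4 where C4: "\<And>n. \<bar>ln (z 0 n / z 2 n) - (- Asum p 3 n)\<bar> \<le> C4" using eqc_bounded[OF ln_z0_z2] by blast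
  define \<beta> where "\<beta> = 1 - 1 / (K + 1)"
  have \<beta>: "0 < \<beta>" "\<beta> < 1" using K(1) by (auto simp: \<beta>_def field_simps)
  define D where "D = (C1 + K * C2 + C3) / (K + 1) + C4"
  have "z 0 n \<le> exp D * z 2 n powr \<beta>" for n
  proof -
    have "wsum p 2 1 (\<lambda>m. z 1 m / (z 2 m * z 3 m)) n \<le> wsum p 2 1 (\<lambda>m. K * (1 / z 2 m)) n"
    proof (rule wsum_le)
      fix m
      have "(z 1 m / z 3 m) / z 2 m \<le> K / z 2 m" using K(2)[of m] by (intro divide_right_mono) auto
      then show "z 1 m / (z 2 m * z 3 m) \<le> K * (1 / z 2 m)" by (simp add: mult.commute)
    qed
    also have "\<dots> = K * wsum p 2 1 (\<lambda>m. 1 / z 2 m) n" by (rule wsum_cmult)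
    also have "\<dots> \<le> K * (Asum p 3 n + C2)" using C2[of n] K(1) by (intro mult_left_mono) auto
    finally have "Asum p 1 n \<le> K * Asum p 3 n + K * C2 + C1" using C1[of n] by (simp add: algebra_simps)
    then have "ln (z 2 n) \<le> (K + 1) * Asum p 3 n + (C1 + K * C2 + C3)" using C3[of n] by (simp add: algebra_simps)
    then have "ln (z 2 n) / (K + 1) \<le> ((K + 1) * Asum p 3 n + (C1 + K * C2 + C3)) / (K + 1)"
      using K(1) by (intro divide_right_mono) auto
    also have "\<dots> = Asum p 3 n + (C1 + K * C2 + C3) / (K + 1)" using K(1) by (simp add: add_divide_distrib)
    finally have "ln (z 2 n) / (K + 1) \<le> Asum p 3 n + (C1 + K * C2 + C3) / (K + 1)" .
    moreover have "ln (z 0 n / z 2 n) \<le> - Asum p 3 n + C4" using C4[of n] by (simp add: abs_le_iff)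
    ultimately have "ln (z 0 n) \<le> D + (ln (z 2 n) - ln (z 2 n) / (K + 1))" by (simp add: D_def ln_div)
    also have "ln (z 2 n) - ln (z 2 n) / (K + 1) = \<beta> * ln (z 2 n)" by (simp add: \<beta>_def algebra_simps)
    finally have "exp (ln (z 0 n)) \<le> exp (D + \<beta> * ln (z 2 n))" by (simp only: exp_le_cancel_iff)
    then show ?thesis by (simp add: exp_add powr_def)
  qed
  with \<beta> show ?thesis by (intro exI[of _ \<beta>] exI[of _ "exp D"]) auto
qed

lemma A0_rate: "\<exists>\<epsilon> C. 0 < \<epsilon> \<and> (\<forall>n N. n \<le> N \<longrightarrow> Asum p 0 N - Asum p 0 n \<le> C * z 2 n powr (- \<epsilon>))"
proof -
  obtain K where K: "0 < K" "\<And>n. z 2 n \<le> K * z 1 n" using z1_z3_compare by blast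
  obtain \<beta> C where \<beta>: "0 < \<beta>" "\<beta> < 1" "0 < C" "\<And>n. z 0 n \<le> C * z 2 n powr \<beta>" using z0_power by blast
  \<comment> \<open>Half of the gap \<open>1 - \<beta>\<close> becomes the rate; the other half
    leaves \<open>z 2 powr (- (1 - \<epsilon>))\<close>, at most a multiple of
    \<open>z 0 powr (- \<gamma>)\<close> with \<open>\<gamma> > 1\<close>, which is summable over
    jumps \<open>0 -> 1\<close>.\<close>
  define \<epsilon> where "\<epsilon> = (1 - \<beta>) / 2"
  define \<gamma> where "\<gamma> = (1 - \<epsilon>) / \<beta>"
  have \<epsilon>: "0 < \<epsilon>" "\<epsilon> < 1" using \<beta> by (auto simp: \<epsilon>_def)
  have "\<beta> < 1 - \<epsilon>" using \<beta> by (simp add: \<epsilon>_def field_simps)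
  then have \<gamma>: "1 < \<gamma>" using \<beta> by (simp add: \<gamma>_def)
  obtain S where S: "\<And>n. wsum p 0 1 (\<lambda>m. z 0 m powr (- \<gamma>)) n \<le> S" using wsum_powr_bounded[OF unit_steps \<gamma>] by blast
  define c where "c = K * C powr \<gamma>"
  have c: "0 < c" using K \<beta> by (simp add: c_def)
  have "Asum p 0 N - Asum p 0 n \<le> c * S * z 2 n powr (- \<epsilon>)" if "n \<le> N" for n N
  proof -
    have "Asum p 0 N - Asum p 0 n \<le>
      wsum p 0 1 (\<lambda>m. c * z 2 n powr (- \<epsilon>) * z 0 m powr (- \<gamma>)) N - wsum p 0 1 (\<lambda>m. c * z 2 n powr (- \<epsilon>) * z 0 m powr (- \<gamma>)) n"
      unfolding Asum_def
    proof (rule wsum_diff_le[OF _ that])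
      fix m assume m: "n \<le> m"
      have "1 / z 1 m \<le> K * (1 / z 2 m)" using K(2)[of m] by (simp add: field_simps)
      also have "1 / z 2 m = z 2 m powr (- \<epsilon>) * z 2 m powr (- (1 - \<epsilon>))"
      proof -
        have "- \<epsilon> + - (1 - \<epsilon>) = - 1" by simp
        then show ?thesis by (simp only: powr_add[symmetric]) (simp add: powr_minus inverse_eq_divide)
      qed
      also have "z 2 m powr (- \<epsilon>) \<le> z 2 n powr (- \<epsilon>)"
        using \<epsilon> z_mono[OF m, of 2] by (intro powr_mono2') auto
      also have "z 2 m powr (- (1 - \<epsilon>)) \<le> C powr \<gamma> * z 0 m powr (- \<gamma>)"
      proof -
        have "(C * z 2 m powr \<beta>) powr (- \<gamma>) \<le> z 0 m powr (- \<gamma>)"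
          using \<beta>(4)[of m] \<gamma> by (intro powr_mono2') auto
        moreover have "(C * z 2 m powr \<beta>) powr (- \<gamma>) = C powr (- \<gamma>) * z 2 m powr (- (1 - \<epsilon>))"
          using \<beta> by (simp add: powr_mult powr_powr \<gamma>_def)
        ultimately have "C powr \<gamma> * (C powr (- \<gamma>) * z 2 m powr (- (1 - \<epsilon>))) \<le> C powr \<gamma> * z 0 m powr (- \<gamma>)"
          by (intro mult_left_mono) auto
        moreover have "C powr \<gamma> * C powr (- \<gamma>) = 1" using \<beta>(3) by (simp add: powr_add[symmetric])
        ultimately show ?thesis by (simp add: mult.assoc[symmetric])
      qed
      finally show "1 / real (loc p m (0 + 1)) \<le> c * z 2 n powr (- \<epsilon>) * z 0 m powr (- \<gamma>)"
        using K(1) by (simp add: c_def mult_left_mono mult.commute mult.left_commute)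
    qed
    also have "\<dots> \<le> c * z 2 n powr (- \<epsilon>) * wsum p 0 1 (\<lambda>m. z 0 m powr (- \<gamma>)) N"
      unfolding wsum_cmult using c by (simp add: wsum_nonneg)
    also have "\<dots> \<le> c * z 2 n powr (- \<epsilon>) * S" using S[of N] c by (intro mult_left_mono) auto
    finally show ?thesis by (simp add: mult.commute mult.left_commute)
  qed
  with \<epsilon>(1) show ?thesis by blast
qed

lemma mart_rate: "\<exists>C. \<forall>n N. n \<le> N \<longrightarrow> \<bar>mart p 2 (\<lambda>_. 1) N - mart p 2 (\<lambda>_. 1) n\<bar> \<le> C * z 2 n powr (- (1/4))"
proof -
  let ?H = "\<lambda>m. min (z 1 m) (z 3 m) powr (1/4)"
  have "convergent (mart p 2 (\<lambda>m. min (z (2 - 1) m) (z (2 + 1) m) powr (1/4)))"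
    using reg[unfolded regular_def] by blast
  then have "Bseq (mart p 2 ?H)" by (intro convergent_imp_Bseq) simp
  then obtain C where C: "\<And>n. \<bar>mart p 2 ?H n\<bar> \<le> C" by (auto simp: Bseq_def)
  obtain K where K: "0 < K" "\<And>n. z 2 n \<le> K * z 1 n" "\<And>n. z 2 n \<le> K * z 3 n" using z1_z3_compare by blast
  have C0: "0 \<le> C" using C[of 0] by simp
  have "\<bar>mart p 2 (\<lambda>_. 1) N - mart p 2 (\<lambda>_. 1) n\<bar> \<le> (2 * C * K powr (1/4)) * z 2 n powr (- (1/4))" if "n \<le> N" for n N
  proof -
    have "\<bar>mart p 2 (\<lambda>_. 1) N - mart p 2 (\<lambda>_. 1) n\<bar> \<le> 2 * C / ?H n"
    proof (rule weighted_increments_rate[OF _ _ _ C that])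
      fix m
      show "mart p 2 ?H (Suc m) - mart p 2 ?H m = ?H m * (mart p 2 (\<lambda>_. 1) (Suc m) - mart p 2 (\<lambda>_. 1) m)"
        by (simp add: mart_def wsum_Suc algebra_simps)
      show "0 < ?H m" by (simp add: min_def)
      show "?H m \<le> ?H (Suc m)" using z_mono[of m "Suc m" 1] z_mono[of m "Suc m" 3] by (intro powr_mono2 min.mono) auto
    qed
    also have "\<dots> \<le> 2 * C / ((z 2 n / K) powr (1/4))"
    proof (rule divide_left_mono)
      show "(z 2 n / K) powr (1/4) \<le> ?H n"
        using K(1) K(2,3)[of n] by (intro powr_mono2) (auto simp: divide_le_eq mult.commute)
    qed (use C0 K in \<open>auto simp: min_def\<close>)
    also have "\<dots> = (2 * C * K powr (1/4)) * z 2 n powr (- (1/4))"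
      using K(1) by (simp add: powr_divide powr_minus inverse_eq_divide)
    finally show ?thesis .
  qed
  then show ?thesis by blast
qed

lemma five_sites_mirror: "five_sites (mirror p)"
proof -
  have "left_end p" by unfold_locales
  then show ?thesis using mirror_end by (simp add: five_sites_def five_sites_axioms_def)
qed

text \<open>The increments of \<open>ln (z 1 / z 3)\<close> consist of jump sums at \<open>0\<close>
  and \<open>4\<close>, the martingale at \<open>2\<close> and harmonic errors; each is at most a
  negative power of \<open>z 2\<close>.\<close>

lemma y_rate:
  assumes r: "0 < r" "(\<lambda>n. z 1 n / z 3 n) \<longlonglongrightarrow> r"
  shows "\<exists>\<epsilon> C. 0 < \<epsilon> \<and> (\<forall>n. \<bar>z 1 n / z 3 n - r\<bar> \<le> C * z 2 n powr (- \<epsilon>))"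
proof -
  interpret M: five_sites "mirror p" by (rule five_sites_mirror)
  obtain K where K: "0 < K" "\<And>n. z 2 n \<le> K * z 1 n" "\<And>n. z 2 n \<le> K * z 3 n" "\<And>n. z 1 n / z 3 n \<le> K"
    using z1_z3_compare by blast
  obtain \<epsilon>1 C1 where 1: "0 < \<epsilon>1" "\<And>n N. n \<le> N \<Longrightarrow> Asum p 0 N - Asum p 0 n \<le> C1 * z 2 n powr (- \<epsilon>1)"
    using A0_rate by blast
  obtain \<epsilon>2 C2 where 2: "0 < \<epsilon>2" "\<And>n N. n \<le> N \<Longrightarrow> Bsum p 4 N - Bsum p 4 n \<le> C2 * z 2 n powr (- \<epsilon>2)"
    using M.A0_rate by (auto simp: Asum_mirror loc_mirror)
  obtain C3 where 3: "\<And>n N. n \<le> N \<Longrightarrow> \<bar>mart p 2 (\<lambda>_. 1) N - mart p 2 (\<lambda>_. 1) n\<bar> \<le> C3 * z 2 n powr (- (1/4))"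
    using mart_rate by blast
  define \<epsilon> where "\<epsilon> = min (min \<epsilon>1 \<epsilon>2) (1/4)"
  have \<epsilon>: "0 < \<epsilon>" using 1 2 by (simp add: \<epsilon>_def)
  have pw: "D * z 2 n powr (- \<delta>) \<le> \<bar>D\<bar> * z 2 n powr (- \<epsilon>)" if "\<epsilon> \<le> \<delta>" for \<delta> D n
    using that real_loc_ge_1[of p n 2] by (intro mult_mono powr_mono) auto
  define D where "D = \<bar>C1\<bar> + \<bar>C2\<bar> + \<bar>C3\<bar> + 2 * K"
  have le: "\<bar>ln (z 1 N / z 3 N) - ln (z 1 n / z 3 n)\<bar> \<le> D * z 2 n powr (- \<epsilon>)" if n: "n \<le> N" for n N
  proof -
    have split: "(\<Sum>k=loc p 0 j..<loc p N j. 1 / real k) = (\<Sum>k=loc p 0 j..<loc p n j. 1 / real k) + (\<Sum>k=loc p n j..<loc p N j. 1 / real k)" for j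
      by (rule sum.atLeastLessThan_concat[symmetric]) (use n in \<open>auto intro: loc_mono\<close>)
    have h: "(\<Sum>k=loc p n j..<loc p N j. 1 / real k) = (Asum p (j - 1) N - Asum p (j - 1) n) + (Bsum p (j + 1) N - Bsum p (j + 1) n)" for j
      using split[of j] wsum_arrivals[OF unit_steps, of j "\<lambda>k. 1 / real k" n] wsum_arrivals[OF unit_steps, of j "\<lambda>k. 1 / real k" N]
      by (simp add: Asum_def Bsum_def)
    have e: "\<bar>(\<Sum>k=loc p n j..<loc p N j. 1 / real k) - (ln (z j N) - ln (z j n))\<bar> \<le> 1 / z j n" for j
      by (rule harmonic_ln_error) (use n in \<open>auto intro: loc_mono\<close>)
    have m: "mart p 2 (\<lambda>_. 1) k = Asum p 2 k - Bsum p 2 k" for k by (simp add: mart_def Asum_def Bsum_def)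
    have "0 \<le> Asum p 0 N - Asum p 0 n" "0 \<le> Bsum p 4 N - Bsum p 4 n"
      using incseqD[OF incseq_Asum n] incseqD[OF incseq_Bsum n] by simp_all
    moreover have "Asum p 0 N - Asum p 0 n \<le> \<bar>C1\<bar> * z 2 n powr (- \<epsilon>)"
      by (rule order_trans[OF 1(2)[OF n] pw]) (simp add: \<epsilon>_def)
    moreover have "Bsum p 4 N - Bsum p 4 n \<le> \<bar>C2\<bar> * z 2 n powr (- \<epsilon>)"
      by (rule order_trans[OF 2(2)[OF n] pw]) (simp add: \<epsilon>_def)
    moreover have "\<bar>(Asum p 2 N - Bsum p 2 N) - (Asum p 2 n - Bsum p 2 n)\<bar> \<le> \<bar>C3\<bar> * z 2 n powr (- \<epsilon>)"
      unfolding m[symmetric] by (rule order_trans[OF 3[OF n] pw]) (simp add: \<epsilon>_def)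
    moreover have "1 / z j n \<le> K * z 2 n powr (- \<epsilon>)" if "z 2 n \<le> K * z j n" for j
    proof -
      have "1 / z j n \<le> K * z 2 n powr (- 1)" using that by (simp add: powr_minus field_simps)
      also have "\<dots> \<le> \<bar>K\<bar> * z 2 n powr (- \<epsilon>)" by (rule pw) (simp add: \<epsilon>_def min_def)
      finally show ?thesis using K(1) by simp
    qed
    then have "1 / z 1 n \<le> K * z 2 n powr (- \<epsilon>)" "1 / z 3 n \<le> K * z 2 n powr (- \<epsilon>)" using K by auto
    moreover have "ln (z 1 N / z 3 N) - ln (z 1 n / z 3 n) = (ln (z 1 N) - ln (z 1 n)) - (ln (z 3 N) - ln (z 3 n))"
      by (simp add: ln_div)
    moreover have "D * z 2 n powr (- \<epsilon>) = \<bar>C1\<bar> * z 2 n powr (- \<epsilon>) + \<bar>C2\<bar> * z 2 n powr (- \<epsilon>) + \<bar>C3\<bar> * z 2 n powr (- \<epsilon>) + 2 * (K * z 2 n powr (- \<epsilon>))"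
      by (simp add: D_def algebra_simps)
    moreover note e[of 1] e[of 3]
    moreover have "(\<Sum>k=loc p n 1..<loc p N 1. 1 / real k) = (Asum p 0 N - Asum p 0 n) + (Bsum p 2 N - Bsum p 2 n)"
      using h[of 1] by simp
    moreover have "(\<Sum>k=loc p n 3..<loc p N 3. 1 / real k) = (Asum p 2 N - Asum p 2 n) + (Bsum p 4 N - Bsum p 4 n)"
      using h[of 3] by simp
    ultimately show ?thesis unfolding abs_le_iff by linarith
  qed
  have "\<bar>z 1 n / z 3 n - r\<bar> \<le> (max K r * D) * z 2 n powr (- \<epsilon>)" for n
  proof -
    have "(\<lambda>N. \<bar>ln (z 1 N / z 3 N) - ln (z 1 n / z 3 n)\<bar>) \<longlonglongrightarrow> \<bar>ln r - ln (z 1 n / z 3 n)\<bar>"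
      using r by (intro tendsto_intros) auto
    then have "\<bar>ln r - ln (z 1 n / z 3 n)\<bar> \<le> D * z 2 n powr (- \<epsilon>)"
      by (rule LIMSEQ_le_const2) (use le in blast)
    then have le': "\<bar>ln (z 1 n / z 3 n) - ln r\<bar> \<le> D * z 2 n powr (- \<epsilon>)" by (subst abs_minus_commute)
    have "\<bar>z 1 n / z 3 n - r\<bar> \<le> max K r * \<bar>ln (z 1 n / z 3 n) - ln r\<bar>"
      using K(4)[of n] r by (intro abs_diff_le_ln) auto
    also have "\<dots> \<le> max K r * (D * z 2 n powr (- \<epsilon>))"
      using K(1) le' by (intro mult_left_mono) auto
    finally have "\<bar>z 1 n / z 3 n - r\<bar> \<le> max K r * (D * z 2 n powr (- \<epsilon>))" .
    then show ?thesis by (simp add: mult.assoc)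
  qed
  with \<epsilon> show ?thesis by blast
qed

text \<open>Replacing \<open>z 1 / z 3\<close> by its limit costs a multiple of
  \<open>z 2 powr (- (1 + \<epsilon>))\<close> per jump \<open>2 -> 3\<close>, which is summable;
  this is where the rate enters.\<close>

lemma A1_A3:
  assumes r: "0 < r" "(\<lambda>n. z 1 n / z 3 n) \<longlonglongrightarrow> r"
  shows "eqc (Asum p 1) (\<lambda>n. r * Asum p 3 n)"
proof -
  obtain \<epsilon> C where \<epsilon>: "0 < \<epsilon>" "\<And>n. \<bar>z 1 n / z 3 n - r\<bar> \<le> C * z 2 n powr (- \<epsilon>)" using y_rate[OF r] by blast
  obtain S where S: "\<And>n. wsum p 2 1 (\<lambda>m. z 2 m powr (- (1 + \<epsilon>))) n \<le> S" using wsum_powr_bounded[OF unit_steps, of "1 + \<epsilon>" 2] \<epsilon>(1) by auto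
  have "0 \<le> C * z 2 0 powr (- \<epsilon>)" by (rule order_trans[OF abs_ge_zero \<epsilon>(2)])
  moreover have "0 < z 2 0 powr (- \<epsilon>)" by simp
  ultimately have C0: "0 \<le> C" by (simp only: zero_le_mult_iff) linarith
  define f where "f m = (if p m = 2 \<and> p (Suc m) = 3 then (z 1 m / z 3 m - r) / z 2 m else 0)" for m
  have "summable (\<lambda>m. \<bar>f m\<bar>)"
  proof (rule summable_bounded_partial)
    fix n
    have "(\<Sum>m<n. \<bar>f m\<bar>) \<le> wsum p 2 1 (\<lambda>m. C * z 2 m powr (- (1 + \<epsilon>))) n"
      unfolding wsum_def
    proof (rule sum_mono)
      fix m
      have "\<bar>(z 1 m / z 3 m - r) / z 2 m\<bar> \<le> C * z 2 m powr (- \<epsilon>) / z 2 m"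
        using \<epsilon>(2)[of m] by (simp add: divide_right_mono)
      also have "\<dots> = C * z 2 m powr (- (1 + \<epsilon>))" by (simp add: powr_diff powr_minus field_simps)
      finally show "\<bar>f m\<bar> \<le> (if p m = 2 \<and> p (Suc m) = 2 + 1 then C * z 2 m powr (- (1 + \<epsilon>)) else 0)"
        by (simp add: f_def)
    qed
    also have "\<dots> \<le> C * S" unfolding wsum_cmult using S[of n] C0 by (rule mult_left_mono)
    finally show "(\<Sum>m<n. \<bar>f m\<bar>) \<le> C * S" .
  qed simp
  then have "summable f" by (rule summable_rabs_cancel)
  then have "convergent (\<lambda>n. \<Sum>m<n. f m)" by (simp add: summable_iff_convergent)
  moreover have "(\<Sum>m<n. f m) = wsum p 2 1 (\<lambda>m. z 1 m / (z 2 m * z 3 m)) n - r * wsum p 2 1 (\<lambda>m. 1 / z 2 m) n" for n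
    by (induction n) (simp_all add: wsum_Suc f_def diff_divide_distrib algebra_simps)
  ultimately have "eqc (wsum p 2 1 (\<lambda>m. z 1 m / (z 2 m * z 3 m))) (\<lambda>n. r * wsum p 2 1 (\<lambda>m. 1 / z 2 m) n)"
    by (simp add: eqc_def)
  from eqc_trans[OF A1_eqc eqc_trans[OF this eqc_cmult[OF eqc_sym[OF A3_eqc]]]] show ?thesis .
qed

text \<open>Modulo \<open>eqc\<close>, \<open>ln (z 0)\<close> is \<open>Asum p 1\<close> and
  \<open>ln (z 2)\<close> is \<open>Asum p 1\<close> plus \<open>Asum p 3\<close>, in the ratio
  \<open>r\<close> to \<open>1\<close>; hence the exponent \<open>r / (1 + r)\<close>.\<close>

lemma ln_z0:
  assumes r: "0 < r" "(\<lambda>n. z 1 n / z 3 n) \<longlonglongrightarrow> r"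
  shows "eqc (\<lambda>n. ln (z 0 n)) (\<lambda>n. r / (1 + r) * ln (z 2 n))"
proof -
  have "eqc (\<lambda>n. ln (z 0 n)) (\<lambda>n. Asum p (-1) n + Asum p 1 n)" using ln_z[of 0] by simp
  also have "eqc (\<lambda>n. Asum p (-1) n + Asum p 1 n) (\<lambda>n. 0 + Asum p 1 n)"
    using A_minus_1 by (intro eqc_add) (auto simp: eqc_0_iff)
  finally (eqc_trans) have 1: "eqc (\<lambda>n. ln (z 0 n)) (Asum p 1)" by simp
  have "eqc (\<lambda>n. r * Asum p 1 n + Asum p 1 n) (\<lambda>n. r * Asum p 1 n + r * Asum p 3 n)"
    by (rule eqc_add[OF eqc_refl A1_A3[OF r]])
  then have "eqc (\<lambda>n. r * Asum p 1 n + Asum p 1 n) (\<lambda>n. r * (Asum p 1 n + Asum p 3 n))"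
    by (simp add: distrib_left)
  moreover have "eqc (\<lambda>n. r * (Asum p 1 n + Asum p 3 n)) (\<lambda>n. r * ln (z 2 n))"
    using eqc_cmult[OF eqc_sym[OF ln_z[of 2]], of r] by simp
  ultimately have "eqc (\<lambda>n. r * Asum p 1 n + Asum p 1 n) (\<lambda>n. r * ln (z 2 n))" by (rule eqc_trans)
  from eqc_cmult[OF this, of "1 / (1 + r)"]
  have "eqc (\<lambda>n. 1 / (1 + r) * (r * Asum p 1 n + Asum p 1 n)) (\<lambda>n. r / (1 + r) * ln (z 2 n))" by simp
  moreover have "1 / (1 + r) * (r * Asum p 1 n + Asum p 1 n) = Asum p 1 n" for n
  proof -
    have "r * Asum p 1 n + Asum p 1 n = (1 + r) * Asum p 1 n" by (simp add: algebra_simps)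
    then show ?thesis using r(1) by simp
  qed
  ultimately have "eqc (Asum p 1) (\<lambda>n. r / (1 + r) * ln (z 2 n))" by simp
  from eqc_trans[OF 1 this] show ?thesis .
qed

section \<open>Time spent on each of the five sites\<close>

lemma eventually_range: "\<exists>N. \<forall>n\<ge>N. 0 \<le> p n \<and> p n \<le> 4"
proof -
  obtain N1 where N1: "\<And>n. n \<ge> N1 \<Longrightarrow> p n \<noteq> -1" using fin by blast
  obtain N2 where N2: "\<And>n. n \<ge> N2 \<Longrightarrow> p n \<noteq> 5" using R.fin by (auto simp: mirror_def)
  obtain N where N: "N \<ge> max N1 N2" "p N = 0" using inf by blast
  have "0 \<le> p n \<and> p n \<le> 4" if "n \<ge> N" for n
    using that
  proof (induction n rule: dec_induct)
    case (step n)
    have "p (Suc n) \<noteq> -1" "p (Suc n) \<noteq> 5" using N1[of "Suc n"] N2[of "Suc n"] step(1) N(1) by auto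
    then show ?case using step unit_steps_cases[OF unit_steps, of n] by auto
  qed (use N in simp)
  then show ?thesis by blast
qed

text \<open>The walk alternates between even and odd sites, so each class receives half of the time;
  the terms with \<open>odd (p n)\<close> make the identities exact from time \<open>N\<close>
  on.\<close>

lemma parity: "\<exists>N c1 c2. \<forall>n\<ge>N. z 0 n + z 2 n + z 4 n = real n / 2 + c1 - of_bool (odd (p n)) / 2 \<and>
    z 1 n + z 3 n = real n / 2 + c2 + of_bool (odd (p n)) / 2"
proof -
  obtain N where N: "\<And>n. n \<ge> N \<Longrightarrow> 0 \<le> p n \<and> p n \<le> 4" using eventually_range by blast
  define c1 where "c1 = z 0 N + z 2 N + z 4 N - real N / 2 + of_bool (odd (p N)) / 2"
  define c2 where "c2 = z 1 N + z 3 N - real N / 2 - of_bool (odd (p N)) / 2"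
  have "z 0 n + z 2 n + z 4 n = real n / 2 + c1 - of_bool (odd (p n)) / 2 \<and>
    z 1 n + z 3 n = real n / 2 + c2 + of_bool (odd (p n)) / 2" if "n \<ge> N" for n
    using that
  proof (induction n rule: dec_induct)
    case base
    then show ?case by (simp add: c1_def c2_def)
  next
    case (step n)
    have "p (Suc n) \<in> {0, 1, 2, 3, 4}" using N[of "Suc n"] step(1) by auto
    moreover have "odd (p n) \<longleftrightarrow> even (p (Suc n))" using unit_steps_cases[OF unit_steps, of n] by auto
    ultimately show ?case using step.IH by (auto simp: loc_Suc field_simps)
  qed
  then show ?thesis by blast
qed

lemma parity_limits: "(\<lambda>n. (z 0 n + z 2 n + z 4 n) / real n) \<longlonglongrightarrow> 1 / 2" "(\<lambda>n. (z 1 n + z 3 n) / real n) \<longlonglongrightarrow> 1 / 2"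
proof -
  obtain N c1 c2 where N: "\<And>n. n \<ge> N \<Longrightarrow> z 0 n + z 2 n + z 4 n = real n / 2 + c1 - of_bool (odd (p n)) / 2"
    "\<And>n. n \<ge> N \<Longrightarrow> z 1 n + z 3 n = real n / 2 + c2 + of_bool (odd (p n)) / 2" using parity by blast
  have half: "(\<lambda>n. f n / real n) \<longlonglongrightarrow> 1 / 2" if f: "\<And>n. n \<ge> N \<Longrightarrow> \<bar>f n - real n / 2\<bar> \<le> C" for f C
  proof -
    have "(\<lambda>n. f n / real n - 1 / 2) \<longlonglongrightarrow> 0"
    proof (rule Lim_null_comparison)
      show "eventually (\<lambda>n. norm (f n / real n - 1 / 2) \<le> C / real n) sequentially"
      proof (rule eventually_sequentiallyI[of "max N 1"])
        fix n assume n: "max N 1 \<le> n"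
        then have "f n / real n - 1 / 2 = (f n - real n / 2) / real n" by (simp add: diff_divide_distrib)
        then show "norm (f n / real n - 1 / 2) \<le> C / real n" using f[of n] n by (simp add: divide_right_mono)
      qed
      show "(\<lambda>n. C / real n) \<longlonglongrightarrow> 0" by (rule lim_const_over_n)
    qed
    then show ?thesis by (simp add: LIM_zero_iff)
  qed
  show "(\<lambda>n. (z 0 n + z 2 n + z 4 n) / real n) \<longlonglongrightarrow> 1 / 2"
    by (rule half[where C = "\<bar>c1\<bar> + 1"]) (auto simp: N(1) abs_if)
  show "(\<lambda>n. (z 1 n + z 3 n) / real n) \<longlonglongrightarrow> 1 / 2"
    by (rule half[where C = "\<bar>c2\<bar> + 1"]) (auto simp: N(2) abs_if)
qed

lemma z2_limit: "(\<lambda>n. z 2 n / real n) \<longlonglongrightarrow> 1 / 2"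
proof -
  have "(\<lambda>n. z 0 n / z 2 n + 1 + z 4 n / z 2 n) \<longlonglongrightarrow> 0 + 1 + 0" by (intro tendsto_intros z0_z2 z4_z2)
  then have "(\<lambda>n. (z 0 n + z 2 n + z 4 n) / z 2 n) \<longlonglongrightarrow> 1" by (simp add: add_divide_distrib)
  from tendsto_divide[OF parity_limits(1) this]
  have "(\<lambda>n. (z 0 n + z 2 n + z 4 n) / real n / ((z 0 n + z 2 n + z 4 n) / z 2 n)) \<longlonglongrightarrow> 1 / 2" by simp
  moreover have "(z 0 n + z 2 n + z 4 n) / real n / ((z 0 n + z 2 n + z 4 n) / z 2 n) = z 2 n / real n" for n
  proof -
    have "z 0 n + z 2 n + z 4 n \<noteq> 0" using z_pos[of n 0] z_pos[of n 2] z_pos[of n 4] by linarith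
    then show ?thesis by simp
  qed
  ultimately show ?thesis by simp
qed

lemma z1_limit:
  assumes r: "0 < r" "(\<lambda>n. z 1 n / z 3 n) \<longlonglongrightarrow> r"
  shows "(\<lambda>n. z 1 n / real n) \<longlonglongrightarrow> (r / (1 + r)) / 2"
proof -
  have "(\<lambda>n. (z 1 n + z 3 n) / real n * (z 1 n / z 3 n / (1 + z 1 n / z 3 n))) \<longlonglongrightarrow> 1 / 2 * (r / (1 + r))"
    using r by (intro tendsto_intros parity_limits(2)) auto
  moreover have "(z 1 n + z 3 n) / real n * (z 1 n / z 3 n / (1 + z 1 n / z 3 n)) = z 1 n / real n" for n
  proof -
    have "z 1 n + z 3 n \<noteq> 0" using z_pos[of n 1] z_pos[of n 3] by linarith
    moreover have "z 1 n / z 3 n / (1 + z 1 n / z 3 n) = z 1 n / (z 1 n + z 3 n)" by (simp add: field_simps)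
    ultimately show ?thesis by simp
  qed
  ultimately show ?thesis by (simp add: mult.commute)
qed

lemma z0_limit:
  assumes r: "0 < r" "(\<lambda>n. z 1 n / z 3 n) \<longlonglongrightarrow> r"
  shows "\<exists>C>0. (\<lambda>n. z 0 n / real n powr (r / (1 + r))) \<longlonglongrightarrow> C"
proof -
  let ?\<alpha> = "r / (1 + r)"
  obtain L where L: "(\<lambda>n. ln (z 0 n) - ?\<alpha> * ln (z 2 n)) \<longlonglongrightarrow> L"
    using ln_z0[OF r] by (auto simp: eqc_def convergent_def)
  have "(\<lambda>n. (z 2 n / real n) powr ?\<alpha> * exp (ln (z 0 n) - ?\<alpha> * ln (z 2 n))) \<longlonglongrightarrow> (1 / 2) powr ?\<alpha> * exp L"
    by (intro tendsto_intros z2_limit L) auto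
  moreover have "eventually (\<lambda>n. (z 2 n / real n) powr ?\<alpha> * exp (ln (z 0 n) - ?\<alpha> * ln (z 2 n)) = z 0 n / real n powr ?\<alpha>) sequentially"
  proof (rule eventually_sequentiallyI[of 1])
    fix n :: nat assume "1 \<le> n"
    have "exp (ln (z 0 n) - ?\<alpha> * ln (z 2 n)) = z 0 n / z 2 n powr ?\<alpha>" by (simp add: exp_diff powr_def)
    then show "(z 2 n / real n) powr ?\<alpha> * exp (ln (z 0 n) - ?\<alpha> * ln (z 2 n)) = z 0 n / real n powr ?\<alpha>"
      by (simp add: powr_divide)
  qed
  ultimately have "(\<lambda>n. z 0 n / real n powr ?\<alpha>) \<longlonglongrightarrow> (1 / 2) powr ?\<alpha> * exp L"
    by (rule Lim_transform_eventually)
  then show ?thesis by (intro exI[of _ "(1 / 2) powr ?\<alpha> * exp L"]) auto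
qed

end

text \<open>Mirroring replaces \<open>r\<close> by \<open>1 / r\<close>, hence
  \<open>\<alpha>\<close> by \<open>1 - \<alpha>\<close>.\<close>

lemma (in five_sites) limits:
  "\<exists>\<alpha> C1 C2. 0 < \<alpha> \<and> \<alpha> < 1 \<and> 0 < C1 \<and> 0 < C2 \<and>
    (\<lambda>n. z 0 n / real n powr \<alpha>) \<longlonglongrightarrow> C1 \<and> (\<lambda>n. z 4 n / real n powr (1 - \<alpha>)) \<longlonglongrightarrow> C2 \<and>
    (\<lambda>n. z 1 n / real n) \<longlonglongrightarrow> \<alpha> / 2 \<and> (\<lambda>n. z 3 n / real n) \<longlonglongrightarrow> (1 - \<alpha>) / 2 \<and>
    (\<lambda>n. z 2 n / real n) \<longlonglongrightarrow> 1 / 2"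
proof -
  interpret M: five_sites "mirror p" by (rule five_sites_mirror)
  obtain r where r: "0 < r" "(\<lambda>n. z 1 n / z 3 n) \<longlonglongrightarrow> r" using y_limit by blast
  have "(\<lambda>n. 1 / (z 1 n / z 3 n)) \<longlonglongrightarrow> 1 / r" using r by (intro tendsto_divide) auto
  then have r': "0 < 1 / r" "(\<lambda>n. M.z 1 n / M.z 3 n) \<longlonglongrightarrow> 1 / r" using r(1) by (simp_all add: loc_mirror)
  define \<alpha> where "\<alpha> = r / (1 + r)"
  have \<alpha>: "0 < \<alpha>" "\<alpha> < 1" "1 / r / (1 + 1 / r) = 1 - \<alpha>" using r(1) by (simp_all add: \<alpha>_def field_simps)
  obtain C1 where C1: "0 < C1" "(\<lambda>n. z 0 n / real n powr \<alpha>) \<longlonglongrightarrow> C1" using z0_limit[OF r] by (auto simp: \<alpha>_def)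
  obtain C2 where C2: "0 < C2" "(\<lambda>n. z 4 n / real n powr (1 - \<alpha>)) \<longlonglongrightarrow> C2"
    using M.z0_limit[OF r', unfolded \<alpha>(3)] by (auto simp: loc_mirror)
  have "(\<lambda>n. z 1 n / real n) \<longlonglongrightarrow> \<alpha> / 2" unfolding \<alpha>_def by (rule z1_limit[OF r])
  moreover have "(\<lambda>n. z 3 n / real n) \<longlonglongrightarrow> (1 - \<alpha>) / 2"
    using M.z1_limit[OF r', unfolded \<alpha>(3)] by (simp add: loc_mirror)
  ultimately show ?thesis using \<alpha>(1,2) C1 C2 z2_limit by blast
qed

section \<open>Localization on five sites and conclusion\<close>

lemma cnt_unbounded:
  assumes unit_steps: "unit_steps q" and sides: "\<forall>N. \<exists>n\<ge>N. (q n - i) * dir s \<le> 0" "\<forall>N. \<exists>n\<ge>N. 0 < (q n - i) * dir s"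
  shows "\<exists>n. k < cnt q i s n"
proof -
  have step: "\<exists>n. Suc (cnt q i s m) \<le> cnt q i s n" for m
  proof -
    obtain a where a: "m \<le> a" "(q a - i) * dir s \<le> 0" using sides(1) by blast
    obtain b where b: "a \<le> b" "0 < (q b - i) * dir s" using sides(2) by blast
    have "cnt q i s a \<noteq> cnt q i s b" using loc_frozen[OF unit_steps a(2) b(1)] b(2) by auto
    then show ?thesis using cnt_mono[OF a(1), of q i s] cnt_mono[OF b(1), of q i s] by (intro exI[of _ b]) auto
  qed
  show ?thesis
  proof (induction k)
    case 0
    then show ?case using step[of 0] by (auto simp: Suc_le_eq)
  next
    case (Suc k)
    then obtain m where "k < cnt q i s m" by blast
    with step[of m] show ?case by (metis Suc_le_eq Suc_leI le_less_trans)
  qed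
qed

lemma Bsum_shifted: "Bsum (shifted a p) j = Bsum p (j + a)"
  by (rule ext) (simp add: Bsum_def wsum_shifted loc_shifted algebra_simps)

text \<open>The minimum \<open>a\<close> of the infinitely visited sites is a left end. As
  \<open>p\<close> is not critical at \<open>a\<close>, the jump sum at \<open>a + 4\<close> is
  bounded, and infinitely many visits to \<open>a + 5\<close> would make \<open>a + 4\<close>
  explosive. So \<open>a + 4\<close> is a right end.\<close>

lemma localization:
  fixes p :: "nat \<Rightarrow> int"
  assumes reg_p: "regular p" "regular (\<lambda>n. - p n)" and bounded: "\<And>n. A \<le> p n \<and> p n \<le> B"
    and not_explosive: "\<And>x. \<not> explosive x p" and not_critical: "\<And>a. \<not> critical a p"
  shows "\<exists>a. five_sites (shifted a p) \<and> {v. \<exists>\<^sub>\<infinity>n. p n = v} = {a, a + 1, a + 2, a + 3, a + 4}"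
proof -
  define R where "R = {v. \<exists>\<^sub>\<infinity>n. p n = v}"
  have io: "v \<in> R \<longleftrightarrow> (\<forall>N. \<exists>n\<ge>N. p n = v)" for v by (simp add: R_def INFM_nat_le)
  have sub: "R \<subseteq> {A..B}" using bounded io by fastforce
  then have fin: "finite R" by (rule finite_subset) simp
  have "finite (range p)" by (rule finite_subset[of _ "{A..B}"]) (use bounded in auto)
  then obtain n0 where "infinite {n \<in> UNIV. p n = p n0}"
    using pigeonhole_infinite[of "UNIV :: nat set" p] by auto
  then have "R \<noteq> {}" unfolding R_def by (auto simp: frequently_cofinite)
  define a where "a = Min R"
  have a: "a \<in> R" "a - 1 \<notin> R" using Min_in[OF fin \<open>R \<noteq> {}\<close>] Min_le[OF fin, of "a - 1"] by (auto simp: a_def)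
  define q where "q = shifted a p"
  have q: "q n = v \<longleftrightarrow> p n = v + a" for n v by (auto simp: q_def shifted_def)
  interpret left_end q
  proof
    show "regular q" unfolding q_def by (rule regular_shifted[OF reg_p(1)])
    show "\<exists>N. \<forall>n\<ge>N. q n \<noteq> - 1" "\<forall>N. \<exists>n\<ge>N. q n = 0" using a by (auto simp: q io)
  qed
  have A4: "\<exists>k::nat. \<forall>n. Asum q 4 n \<le> k"
    using not_critical[of a] a unfolding critical_def by (auto simp: io q_def Asum_shifted not_less add.commute)
  have not5: "\<exists>N. \<forall>n\<ge>N. q n \<noteq> 5"
  proof (rule ccontr)
    assume "\<not> ?thesis"
    then have inf5: "\<forall>N. \<exists>n\<ge>N. q n = 5" by auto
    have "\<exists>n. k < cnt q 4 s n" for s k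
    proof (cases s)
      case True
      show ?thesis by (rule cnt_unbounded[OF unit_steps]) (use True inf inf5 in \<open>force+\<close>)
    next
      case False
      show ?thesis by (rule cnt_unbounded[OF unit_steps]) (use False inf inf5 in \<open>force+\<close>)
    qed
    then have "\<forall>s k. \<exists>n. k < cnt p (a + 4) s n" by (simp add: q_def cnt_shifted add.commute)
    moreover have "\<exists>C::nat. \<forall>n. wsum p (a + 4) (-1) (\<lambda>m. 1 / loc p m (a + 4 - 1)) n \<le> C"
    proof -
      obtain k :: nat where k: "\<And>n. Asum q 4 n \<le> k" using A4 by blast
      obtain D where D: "\<And>n. \<bar>Asum q 4 n - Bsum q 4 n\<bar> \<le> D" using eqc_bounded[OF AB] by blast
      obtain C :: nat where "real k + D \<le> real C" using real_arch_simple by blast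
      then have "Bsum q 4 n \<le> C" for n using k[of n] D[of n] by linarith
      moreover have "Bsum q 4 = Bsum p (a + 4)" by (simp add: q_def Bsum_shifted add.commute)
      ultimately show ?thesis unfolding Bsum_def by auto
    qed
    ultimately have "explosive (a + 4) p" by (simp add: explosive_def)
    with not_explosive show False by blast
  qed
  have "left_end (mirror q)"
  proof
    have "mirror q = shifted (- a - 4) (\<lambda>n. - p n)" by (rule ext) (simp add: mirror_def q_def shifted_def)
    then show "regular (mirror q)" using regular_shifted[OF reg_p(2)] by simp
    show "\<exists>N. \<forall>n\<ge>N. mirror q n \<noteq> - 1" using not5 by (simp add: mirror_def)
    have "mirror q n = 0 \<longleftrightarrow> q n = 4" for n by (auto simp: mirror_def)
    then show "\<forall>N. \<exists>n\<ge>N. mirror q n = 0" using z4 by (simp add: z_at_top_iff)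
  qed
  moreover have "left_end q" by unfold_locales
  ultimately interpret F: five_sites q by (simp add: five_sites_def five_sites_axioms_def)
  have "R = {a, a + 1, a + 2, a + 3, a + 4}"
  proof (intro equalityI subsetI)
    fix v assume "v \<in> R"
    obtain N where "\<And>n. n \<ge> N \<Longrightarrow> 0 \<le> q n \<and> q n \<le> 4" using F.eventually_range by blast
    moreover obtain n where "n \<ge> N" "p n = v" using \<open>v \<in> R\<close> io by blast
    ultimately have "0 \<le> v - a" "v - a \<le> 4" by (auto simp: q_def shifted_def)
    then show "v \<in> {a, a + 1, a + 2, a + 3, a + 4}" by auto
  next
    fix v assume "v \<in> {a, a + 1, a + 2, a + 3, a + 4}"
    then show "v \<in> R" using a z1 z2 z3 z4 by (auto simp: z_at_top_iff q io add.commute)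
  qed
  then show ?thesis using F.five_sites_axioms unfolding R_def q_def by blast
qed

theorem theorem1p4:
  fixes M :: "'a measure" and X :: "nat \<Rightarrow> 'a \<Rightarrow> int" and v0 :: int
  assumes "vrrw M X v0"
  shows "AE \<omega> in M. \<exists>(k::int) (\<alpha>::real) (C1::real) (C2::real).
    0 < \<alpha> \<and> \<alpha> < 1 \<and> 0 < C1 \<and> 0 < C2 \<and>
    infinitely_visited X \<omega> = {k - 2, k - 1, k, k + 1, k + 2} \<and>
    (\<lambda>n. real (local_time X n (k - 2) \<omega>) / real n powr \<alpha>) \<longlonglongrightarrow> C1 \<and>
    (\<lambda>n. real (local_time X n (k + 2) \<omega>) / real n powr (1 - \<alpha>)) \<longlonglongrightarrow> C2 \<and>
    (\<lambda>n. real (local_time X n (k - 1) \<omega>) / real n) \<longlonglongrightarrow> \<alpha> / 2 \<and>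
    (\<lambda>n. real (local_time X n (k + 1) \<omega>) / real n) \<longlonglongrightarrow> (1 - \<alpha>) / 2 \<and>
    (\<lambda>n. real (local_time X n k \<omega>) / real n) \<longlonglongrightarrow> 1 / 2"
proof -
  interpret vrrw_law M X v0 by (rule vrrw_imp_vrrw_law[OF assms])
  interpret neg: vrrw_law M "\<lambda>n \<omega>. - X n \<omega>" "- v0" by (rule uminus)
  from AE_regular neg.AE_regular AE_bounded AE_not_explosive AE_not_critical show ?thesis
  proof eventually_elim
    case (elim \<omega>)
    obtain A B where AB: "\<And>n. A \<le> X n \<omega> \<and> X n \<omega> \<le> B" using elim(3) by blast
    have "neg.path \<omega> = (\<lambda>n. - path \<omega> n)" by (rule ext) (simp add: path_def neg.path_def)
    with elim(2) have reg: "regular (\<lambda>n. - path \<omega> n)" by simp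
    have "\<exists>a. five_sites (shifted a (path \<omega>)) \<and> {v. \<exists>\<^sub>\<infinity>n. path \<omega> n = v} = {a, a + 1, a + 2, a + 3, a + 4}"
      by (rule localization[OF elim(1) reg, of A B]) (use AB elim(4,5) in \<open>auto simp: path_def\<close>)
    then obtain a where a: "five_sites (shifted a (path \<omega>))"
      "infinitely_visited X \<omega> = {a, a + 1, a + 2, a + 3, a + 4}"
      by (auto simp: infinitely_visited_def path_def)
    have loc: "local_time X n (a + j) \<omega> = loc (shifted a (path \<omega>)) n j" for n j
      by (simp add: local_time_eq_loc loc_shifted path_def add.commute)
    obtain \<alpha> C1 C2 where "0 < \<alpha>" "\<alpha> < 1" "0 < C1" "0 < C2"
      "(\<lambda>n. real (local_time X n (a + 0) \<omega>) / real n powr \<alpha>) \<longlonglongrightarrow> C1"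
      "(\<lambda>n. real (local_time X n (a + 4) \<omega>) / real n powr (1 - \<alpha>)) \<longlonglongrightarrow> C2"
      "(\<lambda>n. real (local_time X n (a + 1) \<omega>) / real n) \<longlonglongrightarrow> \<alpha> / 2"
      "(\<lambda>n. real (local_time X n (a + 3) \<omega>) / real n) \<longlonglongrightarrow> (1 - \<alpha>) / 2"
      "(\<lambda>n. real (local_time X n (a + 2) \<omega>) / real n) \<longlonglongrightarrow> 1 / 2"
      using five_sites.limits[OF a(1)] unfolding loc by blast
    then show ?case
      by (intro exI[of _ "a + 2"] exI[of _ \<alpha>] exI[of _ C1] exI[of _ C2]) (simp add: a(2) add.commute)
  qed
qed

end
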